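(* Let $M$ be the Hardy--Littlewood maximal operator on $\mathbb{R}^n$ and let $T$ be any operator such that, for some $p_0\in(0,\infty)$ and for any $w\in A_\infty$, there is a constant $c$ depending on the $A_\infty$ constant of $w$ such that $$\int_{\mathbb{R}^n}|Tf(x)|^{p_0}\,w(x)\,dx\le c\int_{\mathbb{R}^n}Mf(x)^{p_0}\,w(x)\,dx$$ for any function $f$ such that the left-hand side is finite. Then, if $v\in A_\infty$ and $u\in A_1$, there is a constant $c$ depending on the $A_1$ constant of $u$ and the $A_\infty$ constant of $v$ such that $$\Big\|\frac{T(fv)}{v}\Big\|_{L^{1,\infty}(uv)}\le c\,\|f\|_{L^1(uv)}.$$
   Context: A weight is a non-negative locally integrable function on $\mathbb{R}^n$, positive a.e. $Mf(x)=\sup_{Q\ni x}\frac1{|Q|}\int_Q|f|$, the supremum over cubes $Q$ with sides parallel to the axes. $u\in A_1$ means $[u]_{A_1}=\operatorname{ess\,sup}_x Mu(x)/u(x)<\infty$ (the $A_1$ constant). For $1<p<\infty$, $v\in A_p$ means $[v]_{A_p}=\sup_Q\big(\frac1{|Q|}\int_Q v\big)\big(\frac1{|Q|}\int_Q v^{-1/(p-1)}\big)^{p-1}<\infty$, and $A_\infty=\bigcup_{p>1}A_p$. The $A_\infty$ constant is $[v]_{A_\infty}=\sup_Q \frac{1}{v(Q)}\int_Q M(v\chi_Q)\,dx$, where $v(Q)=\int_Q v\,dx$. The product $uv$ need not be locally integrable; $uv$ also denotes the measure $u(x)v(x)\,dx$, $\|f\|_{L^1(uv)}=\int_{\mathbb{R}^n}|f|\,uv\,dx$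 and $\|h\|_{L^{1,\infty}(uv)}=\sup_{t>0}t\,(uv)(\{x:|h(x)|>t\})$. The operator $T$ maps functions to measurable functions on $\mathbb{R}^n$; the constant in the conclusion may also depend on fixed data such as $n$, $p_0$ and the constants in the hypothesis on $T$.
   Formalization: The conclusion is stated for measurable f for which the left-hand side, the L^{1,∞}(uv) norm of T(fv)/v, is finite; without this proviso the claim fails, for example for Tf = 1 identically and f = 0, since the hypothesis on T is then vacuous. *)

theory Defs
  imports "HOL-Analysis.Analysis" "HOL-Probability.Essential_Supremum"
begin

text \<open>
  All maximal functions, norms and weight constants take values in \<^typ>\<open>ennreal\<close>, so that
  suprema and integrals need no finiteness side conditions. Integration is with respect to
  \<^term>\<open>lebesgue\<close>, and measurable functions are the Lebesgue measurable ones.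
\<close>

definition axis_cube :: "(real ^ 'n) set \<Rightarrow> bool" where
  "axis_cube Q \<longleftrightarrow> (\<exists>a. \<exists>s>0. Q = cbox a (a + (\<chi> i. s)))"

definition average :: "(real ^ 'n) set \<Rightarrow> (real ^ 'n \<Rightarrow> ennreal) \<Rightarrow> ennreal" where
  "average Q g = (\<integral>\<^sup>+y\<in>Q. g y \<partial>lebesgue) / emeasure lebesgue Q"

definition maximal_fun ::
    "(real ^ 'n \<Rightarrow> 'b::real_normed_vector) \<Rightarrow> real ^ 'n \<Rightarrow> ennreal" where
  "maximal_fun f x = (SUP Q\<in>{Q. axis_cube Q \<and> x \<in> Q}. average Q (\<lambda>y. ennreal (norm (f y))))"

text \<open>The power \<open>x\<^sup>p\<close> on the extended half-line, meant for \<open>p > 0\<close>.\<close>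

definition ennreal_powr :: "ennreal \<Rightarrow> real \<Rightarrow> ennreal" where
  "ennreal_powr x p = (if x = top then top else ennreal (enn2real x powr p))"

definition weight :: "(real ^ 'n \<Rightarrow> real) \<Rightarrow> bool" where
  "weight w \<longleftrightarrow> (\<forall>x. 0 \<le> w x) \<and> (AE x in lebesgue. 0 < w x)
     \<and> (\<forall>K. compact K \<longrightarrow> w absolutely_integrable_on K)"

text \<open>
  The values at points where a weight vanishes (such as \<open>0 powr a = 0\<close> for negative \<open>a\<close>) do not
  matter below, since these points form a null set.
\<close>

definition A1_const :: "(real ^ 'n \<Rightarrow> real) \<Rightarrow> ennreal" where
  "A1_const u = esssup lebesgue (\<lambda>x. maximal_fun u x / ennreal (u x))"

definition A1 :: "(real ^ 'n \<Rightarrow> real) \<Rightarrow> bool" where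
  "A1 u \<longleftrightarrow> weight u \<and> A1_const u < top"

definition Ap_const :: "real \<Rightarrow> (real ^ 'n \<Rightarrow> real) \<Rightarrow> ennreal" where
  "Ap_const p v = (SUP Q\<in>Collect axis_cube. average Q (\<lambda>y. ennreal (v y))
     * ennreal_powr (average Q (\<lambda>y. ennreal (v y powr (- 1 / (p - 1))))) (p - 1))"

definition Ap :: "real \<Rightarrow> (real ^ 'n \<Rightarrow> real) \<Rightarrow> bool" where
  "Ap p v \<longleftrightarrow> weight v \<and> Ap_const p v < top"

definition Ainf :: "(real ^ 'n \<Rightarrow> real) \<Rightarrow> bool" where
  "Ainf v \<longleftrightarrow> (\<exists>p>1. Ap p v)"

definition Ainf_const :: "(real ^ 'n \<Rightarrow> real) \<Rightarrow> ennreal" where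
  "Ainf_const v = (SUP Q\<in>Collect axis_cube.
     (\<integral>\<^sup>+x\<in>Q. maximal_fun (\<lambda>y. v y * indicator Q y) x \<partial>lebesgue)
       / (\<integral>\<^sup>+x\<in>Q. ennreal (v x) \<partial>lebesgue))"

text \<open>The measure \<open>u(x) v(x) dx\<close>, which need not be locally finite.\<close>

definition uv_measure ::
    "(real ^ 'n \<Rightarrow> real) \<Rightarrow> (real ^ 'n \<Rightarrow> real) \<Rightarrow> (real ^ 'n) measure" where
  "uv_measure u v = density lebesgue (\<lambda>x. ennreal (u x * v x))"

definition L1_norm :: "'a measure \<Rightarrow> ('a \<Rightarrow> 'b::real_normed_vector) \<Rightarrow> ennreal" where
  "L1_norm \<mu> f = (\<integral>\<^sup>+x. ennreal (norm (f x)) \<partial>\<mu>)"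

definition weak_L1_norm :: "'a measure \<Rightarrow> ('a \<Rightarrow> 'b::real_normed_vector) \<Rightarrow> ennreal" where
  "weak_L1_norm \<mu> h = (SUP t\<in>{0<..}. ennreal t * emeasure \<mu> {x \<in> space \<mu>. t < norm (h x)})"

end

theory Submission
 imports Defs
begin

text \<open>
 Let \<open>E = {|T(fv)| > t v}\<close>. By the reverse Hoelder inequality \<open>u\<^sup>\<rho>\<close> is in \<open>A\<^sub>1\<close> for some \<open>\<rho> > 1\<close>, so
 \<open>U = (M(u\<^sup>\<rho> \<chi>\<^sub>E))\<^sup>1\<^sup>/\<^sup>\<rho>\<close> dominates \<open>u\<close> on \<open>E\<close> and is at most a multiple of \<open>u\<close>. Moreover \<open>uv {U > \<lambda> u}\<close> is at most
 \<open>C \<lambda>\<^sup>-\<^sup>r uv(E)\<close>, and \<open>a = U v\<^sup>\<sigma>\<close> is in \<open>A\<^sub>\<infinity>\<close> for small \<open>\<sigma> > 0\<close>. Put \<open>s = 1 - \<sigma>\<close>. Then \<open>t\<^sup>s uv(E)\<close> is at most the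
 integral of \<open>|T(fv)|\<^sup>s a\<close>, which by an extrapolation argument is bounded by that of \<open>M(fv)\<^sup>s a\<close>. Kolmogorov's
 inequality on the level sets of \<open>U/u\<close> and the mixed weak-type inequality \<open>t uv {M(fv) > t v} \<le> C \<parallel>f\<parallel>\<close> bound the
 latter by a multiple of \<open>uv(E)\<^sup>\<sigma> \<parallel>f\<parallel>\<^sup>s\<close>, where the norm is that of \<open>L\<^sup>1(uv)\<close>.
\<close>

text \<open>The product uv need not be locally integrable, so it cannot serve as a weight in the
  hypothesis on T. The small power \<open>v\<^sup>\<sigma>\<close> cures this, and E is built into U
  so that uv(E) reappears on the right with exactly the power \<sigma>; cancelling it leaves the
  weak-type bound. This needs uv(E) finite, which comes from the finiteness of the weak norm. The
  same finiteness makes the integral of \<open>|T(fv)|\<^sup>s a\<close> finite, so that the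
  absorption in the extrapolation is legitimate.

  The ratio U / u is bounded above but may be arbitrarily small, and uv of the whole space may be
  infinite. The bound \<open>\<lambda>\<^sup>-\<^sup>r\<close> limits how fast the set where U >
  \<lambda> u grows as \<lambda> tends to 0; its layers are summable only if r \<sigma> < 1, which
  is one of the conditions on \<sigma>.

  All constants may depend on the weights only through the A_1 constant of u and the A_inf constant
  of v. For this reason A_inf is handled in a quantitative form with parameters C and d fixed before
  the weights, and the Fujii-Wilson constant is converted into this form and back.\<close>

abbreviation (input) lmeas :: "('a::euclidean_space => 'b::topological_space) => bool" where
 "lmeas f \<equiv> f \<in> borel_measurable lebesgue"

section \<open>Axis-parallel cubes, their volume, and an exhaustion of the space\<close>

definition cub :: "real ^ 'n => real => (real ^ 'n) set" where
 "cub a s = cbox a (a + (\<chi> i. s))"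

lemma mem_cub: "x \<in> cub a s \<longleftrightarrow> (\<forall>i. a $ i <= x $ i \<and> x $ i <= a $ i + s)"
 by (simp add: cub_def mem_box_cart)

lemma axis_cube_iff: "axis_cube Q \<longleftrightarrow> (\<exists>a s. s > 0 \<and> Q = cub a s)"
 by (auto simp: axis_cube_def cub_def)

lemma axis_cube_cub [simp]: "s > 0 ==> axis_cube (cub a s)"
 by (auto simp: axis_cube_iff)

lemma cub_sets [simp, measurable]: "cub a s \<in> sets lebesgue" "cub a s \<in> sets borel"
 by (auto simp: cub_def)

lemma axis_cube_sets: "axis_cube Q ==> Q \<in> sets lebesgue"
 by (auto simp: axis_cube_iff)

lemma emeasure_cub:
 fixes a :: "real ^ 'n"
 assumes "s >= 0"
 shows "emeasure lebesgue (cub a s) = ennreal (s ^ CARD('n))"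
proof -
 have ne: "cbox a (a + (\<chi> i. s)) \<noteq> {}"
  using assms by (auto simp: interval_ne_empty_cart)
 have "measure lebesgue (cub a s) = s ^ CARD('n)"
  unfolding cub_def using content_cbox_cart[OF ne] by (simp add: measure_completion)
 then show ?thesis
  by (metis cub_def emeasure_eq_ennreal_measure emeasure_lborel_cbox_finite fmeasurableD2 lmeasurable_cbox)
qed

lemma measure_cub:
 fixes a :: "real ^ 'n"
 assumes "s >= 0"
 shows "measure lebesgue (cub a s) = s ^ CARD('n)"
 using emeasure_cub[OF assms, of a] assms by (simp add: measure_def)

text \<open>An exhaustion by centred cubes. The side 2 k + 2 makes even \<open>big 0\<close> a
  nondegenerate cube, so that everything known for cubes of positive side applies to each of
  them.\<close>

definition big :: "nat => (real ^ 'n) set" where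
 "big k = cub (\<chi> i. - real k - 1) (2 * real k + 2)"

lemma mem_big: "x \<in> big k \<longleftrightarrow> (\<forall>i. \<bar>x $ i\<bar> <= real k + 1)"
proof -
 have "(- real k - 1 <= y \<and> y <= - real k - 1 + (2 * real k + 2)) = (\<bar>y\<bar> <= real k + 1)" for y :: real
  by linarith
 then show ?thesis by (simp add: big_def mem_cub)
qed

lemma big_mono: "k <= l ==> big k \<subseteq> big l"
 unfolding mem_big subset_iff by (meson add_right_mono of_nat_mono order_trans)

lemma UN_big: "(\<Union>k. big k) = UNIV"
proof -
 have "\<exists>k. x \<in> big k" for x :: "real ^ 'n"
 proof -
  obtain k where k: "norm x <= real k" using real_arch_simple by blast
  have "\<bar>x $ i\<bar> <= real k + 1" for i using component_le_norm_cart[of x i] k by linarith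
  then show ?thesis by (auto simp: mem_big)
 qed
 then show ?thesis by auto
qed

lemma incseq_big: "incseq big" by (auto simp: incseq_def big_mono)

lemma bounded_subset_big:
 fixes S :: "(real ^ 'n) set"
 assumes "bounded S" shows "\<exists>k. S \<subseteq> big k"
proof -
 obtain B where B: "\<And>x. x \<in> S ==> norm x <= B" using assms by (auto simp: bounded_iff)
 obtain k where k: "B <= real k" using real_arch_simple by blast
 have "S \<subseteq> big k"
 proof
  fix x assume "x \<in> S"
  then have "\<bar>x $ i\<bar> <= real k + 1" for i using B[of x] component_le_norm_cart[of x i] k
   by linarith
  then show "x \<in> big k" by (auto simp: mem_big)
 qed
 then show ?thesis by blast
qed

subsection \<open>Dyadic grids\<close>

text \<open>A grid with origin \<open>a\<close> and unit side \<open>s\<close>; the cube with index \<open>(j, m)\<close> has side \<open>s * 2\<^sup>j\<close>,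
 so that larger \<open>j\<close> means larger cubes.\<close>

locale grid =
 fixes a :: "real ^ 'n" and s :: real
 assumes s: "s > 0"
begin

definition sd :: "int => real" where "sd j = s * 2 powi j"

definition ix :: "int => real ^ 'n => int ^ 'n" where
 "ix j x = (\<chi> i. \<lfloor>(x $ i - a $ i) / sd j\<rfloor>)"

definition dq :: "int \<times> (int ^ 'n) => (real ^ 'n) set" where
 "dq p = {x. ix (fst p) x = snd p}"

definition cn :: "int \<times> (int ^ 'n) => real ^ 'n" where
 "cn p = (\<chi> i. a $ i + sd (fst p) * of_int (snd p $ i))"

text \<open>The closed concentric triple of a dyadic cube. Working with triples allows a single grid
  to capture arbitrary cubes, at the price of a doubling constant.\<close>

definition tri :: "int \<times> (int ^ 'n) => (real ^ 'n) set" where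
 "tri p = cub (cn p - (\<chi> i. sd (fst p))) (3 * sd (fst p))"

lemma sd_pos [simp]: "sd j > 0" using s by (simp add: sd_def)
lemma sd_ge0 [simp]: "sd j >= 0" using sd_pos less_imp_le by blast
lemma sd_Suc: "sd (j + 1) = 2 * sd j" by (simp add: sd_def power_int_add)
lemma sd_mono: "j <= j' ==> sd j <= sd j'"
 using s by (auto simp: sd_def intro!: power_int_increasing)
lemma sd_add_nat: "sd (j + int k) = 2 ^ k * sd j"
 by (simp add: sd_def power_int_add)

lemma mem_dq: "x \<in> dq p \<longleftrightarrow> (\<forall>i. cn p $ i <= x $ i \<and> x $ i < cn p $ i + sd (fst p))"
proof -
 have "\<lfloor>(x $ i - a $ i) / sd j\<rfloor> = m \<longleftrightarrow>
   a $ i + sd j * of_int m <= x $ i \<and> x $ i < a $ i + sd j * of_int m + sd j" for i j m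
  using sd_pos[of j] by (simp add: floor_eq_iff field_simps del: sd_pos)
 then show ?thesis by (simp add: dq_def ix_def cn_def vec_eq_iff)
qed

lemma mem_dq_ix [simp]: "x \<in> dq (j, ix j x)" by (simp add: dq_def)
lemma mem_dq_pair: "x \<in> dq (j, m) \<longleftrightarrow> ix j x = m" by (simp add: dq_def)

text \<open>The index at a coarser scale is the integer quotient of the finer index by a power of
  two; this is the nesting property of the grid.\<close>

lemma ix_mono:
 assumes "j <= j'" "ix j x = ix j y" shows "ix j' x = ix j' y"
proof -
 obtain k where k: "j' = j + int k" using assms(1) by (metis zle_iff_zadd)
 have *: "ix j' z $ i = ix j z $ i div 2 ^ k" for z i
 proof -
  have "\<lfloor>(z $ i - a $ i) / sd j'\<rfloor> = \<lfloor>((z $ i - a $ i) / sd j) / of_int (2 ^ k)\<rfloor>"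
   by (simp add: k sd_add_nat field_simps)
  also have "... = \<lfloor>(z $ i - a $ i) / sd j\<rfloor> div 2 ^ k" by (rule floor_divide_real_eq_div) simp
  finally show ?thesis by (simp add: ix_def)
 qed
 show ?thesis using assms(2) by (simp add: vec_eq_iff *)
qed

lemma dq_nested:
 assumes "j <= j'" shows "dq (j, ix j x) \<subseteq> dq (j', ix j' x)"
proof
 fix y assume "y \<in> dq (j, ix j x)"
 then have "ix j y = ix j x" by (simp add: dq_def)
 then have "ix j' y = ix j' x" by (rule ix_mono[OF assms])
 then show "y \<in> dq (j', ix j' x)" by (simp add: dq_def)
qed

lemma dq_subset_or_disjoint:
 assumes "fst p <= fst q" "dq p \<inter> dq q \<noteq> {}" shows "dq p \<subseteq> dq q"
proof -
 obtain x where "x \<in> dq p" "x \<in> dq q" using assms(2) by blast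
 then show ?thesis using dq_nested[OF assms(1), of x] by (simp add: dq_def)
qed

lemma cn_mem_dq: "cn p \<in> dq p" by (simp add: mem_dq)

lemma dq_subset_clo: "dq p \<subseteq> cub (cn p) (sd (fst p))"
proof
 fix x assume x: "x \<in> dq p"
 have "cn p $ i <= x $ i \<and> x $ i <= cn p $ i + sd (fst p)" for i
  using x[unfolded mem_dq, rule_format, of i] by simp
 then show "x \<in> cub (cn p) (sd (fst p))" by (simp add: mem_cub)
qed

lemma box_subset_dq: "box (cn p) (cn p + (\<chi> i. sd (fst p))) \<subseteq> dq p"
 by (auto simp: mem_dq mem_box_cart less_imp_le)

lemma dq_sets [simp, measurable]: "dq p \<in> sets borel" "dq p \<in> sets lebesgue"
proof -
 have "dq p = (\<Inter>i. {x. cn p $ i <= x $ i} \<inter> {x. x $ i < cn p $ i + sd (fst p)})"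
  by (auto simp: mem_dq)
 also have "... \<in> sets borel" by measurable
 finally show "dq p \<in> sets borel" .
 then show "dq p \<in> sets lebesgue" by simp
qed

lemma negligible_clo_dq: "negligible (cub (cn p) (sd (fst p)) - dq p)"
 by (rule negligible_subset[OF negligible_frontier_interval[of "cn p" "cn p + (\<chi> i. sd (fst p))"]])
   (use box_subset_dq[of p] in \<open>auto simp: cub_def\<close>)

lemma bounded_dq: "bounded (dq p)"
 using dq_subset_clo bounded_cbox unfolding cub_def by (rule bounded_subset[rotated])

lemma measure_dq: "emeasure lebesgue (dq p) = ennreal (sd (fst p) ^ CARD('n))"
proof -
 have "emeasure lebesgue (cub (cn p) (sd (fst p))) = emeasure lebesgue (dq p)"
 proof (rule emeasure_eq_AE)
  have "AE x in lebesgue. x \<notin> cub (cn p) (sd (fst p)) - dq p"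
   using negligible_clo_dq[of p] unfolding negligible_iff_null_sets by (rule AE_not_in)
  then show "AE x in lebesgue. (x \<in> cub (cn p) (sd (fst p))) = (x \<in> dq p)"
   by (rule eventually_mono) (use dq_subset_clo[of p] in blast)
 qed auto
 then show ?thesis unfolding emeasure_cub[OF sd_ge0] by (rule sym)
qed

lemma dq_subsetD:
 assumes "dq p \<subseteq> dq q"
 shows "cn q $ i <= cn p $ i" "cn p $ i + sd (fst p) <= cn q $ i + sd (fst q)"
proof -
 show "cn q $ i <= cn p $ i"
  using subsetD[OF assms cn_mem_dq] by (simp add: mem_dq)
 show "cn p $ i + sd (fst p) <= cn q $ i + sd (fst q)"
 proof (rule field_le_epsilon)
  fix e :: real assume e: "e > 0"
  \<comment> \<open>The upper faces do not belong to half-open cubes, so they are approached from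
    inside. The maximum with 0 keeps the test point in the cube when e exceeds the side.\<close>
  let ?y = "\<chi> i. cn p $ i + max 0 (sd (fst p) - e)"
  have "?y \<in> dq p" using e by (simp add: mem_dq)
  then have "?y \<in> dq q" using assms by blast
  then have "cn p $ i + max 0 (sd (fst p) - e) < cn q $ i + sd (fst q)" by (simp add: mem_dq)
  then show "cn p $ i + sd (fst p) <= cn q $ i + sd (fst q) + e" by linarith
 qed
qed

lemma clo_mono:
 assumes "dq p \<subseteq> dq q"
 shows "cub (cn p) (sd (fst p)) \<subseteq> cub (cn q) (sd (fst q))"
proof
 fix x assume x: "x \<in> cub (cn p) (sd (fst p))"
 have "cn q $ i <= x $ i \<and> x $ i <= cn q $ i + sd (fst q)" for i
  using x[unfolded mem_cub, rule_format, of i] dq_subsetD[OF assms, of i] by linarith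
 then show "x \<in> cub (cn q) (sd (fst q))" by (simp add: mem_cub)
qed

lemma tri_mono:
 assumes "fst p <= fst q" "dq p \<subseteq> dq q" shows "tri p \<subseteq> tri q"
proof
 fix x assume x: "x \<in> tri p"
 note 1 = dq_subsetD(1)[OF assms(2)] and 2 = dq_subsetD(2)[OF assms(2)]
 show "x \<in> tri q"
  unfolding tri_def mem_cub
 proof
  fix i
  have "cn p $ i - sd (fst p) <= x $ i" "x $ i <= cn p $ i + 2 * sd (fst p)"
   using x[unfolded tri_def mem_cub, rule_format, of i] by simp_all
  then show "(cn q - (\<chi> i. sd (fst q))) $ i <= x $ i \<and> x $ i <= (cn q - (\<chi> i. sd (fst q))) $ i + 3 * sd (fst q)"
   using 1[of i] 2[of i] sd_mono[OF assms(1)] by auto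
 qed
qed

lemma clo_subset_tri: "cub (cn p) (sd (fst p)) \<subseteq> tri p"
proof
 fix x assume "x \<in> cub (cn p) (sd (fst p))"
 then have "cn p $ i <= x $ i \<and> x $ i <= cn p $ i + sd (fst p)" for i by (simp add: mem_cub)
 then have "cn p $ i - sd (fst p) <= x $ i \<and> x $ i <= cn p $ i - sd (fst p) + 3 * sd (fst p)" for i
  using sd_ge0[of "fst p"] by (smt (verit))
 then show "x \<in> tri p" by (simp add: tri_def mem_cub)
qed

lemma dq_subset_tri: "dq p \<subseteq> tri p" using clo_subset_tri dq_subset_clo by blast

lemma small_dq_in_open:
 assumes "open T" "x \<in> T" shows "\<exists>J. \<forall>j\<le>J. dq (j, ix j x) \<subseteq> T"
proof -
 obtain e where e: "e > 0" "ball x e \<subseteq> T" using assms by (meson openE)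
 define c where "c = e / (s * (real CARD('n) + 1))"
 have c: "c > 0" using e s by (simp add: c_def)
 obtain k where k: "(1/2::real) ^ k < c" using real_arch_pow_inv[OF c, of "1/2"] by auto
 have "dq (j, ix j x) \<subseteq> T" if j: "j <= - int k" for j
 proof
  fix y assume y: "y \<in> dq (j, ix j x)"
  have "sd j <= s * (1/2) ^ k"
   using sd_mono[OF j] by (simp add: sd_def power_int_minus power_one_over inverse_eq_divide)
  also have "... < s * c" using k s by simp
  finally have sdj: "sd j < s * c" .
  have "\<bar>(y - x) $ i\<bar> <= sd j" for i
  proof -
   have "cn (j, ix j x) $ i <= y $ i \<and> y $ i < cn (j, ix j x) $ i + sd j"
    "cn (j, ix j x) $ i <= x $ i \<and> x $ i < cn (j, ix j x) $ i + sd j"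
    using y mem_dq_ix[of x j] by (simp_all only: mem_dq fst_conv) 
   then show ?thesis unfolding vector_minus_component by linarith
  qed
  then have "norm (y - x) <= (\<Sum>i\<in>(UNIV::'n set). sd j)"
   by (intro order_trans[OF norm_le_l1_cart] sum_mono) auto
  also have "... = real CARD('n) * sd j" by simp
  also have "... <= (real CARD('n) + 1) * sd j" by (simp add: mult_right_mono)
  also have "... < (real CARD('n) + 1) * (s * c)" using sdj by (intro mult_strict_left_mono) auto
  also have "(real CARD('n) + 1) * (s * c) = e"
   using s by (simp add: c_def add_nonneg_eq_0_iff)
  finally show "y \<in> T" using e by (auto simp: dist_norm norm_minus_commute)
 qed
 then show ?thesis by blast
qed

text \<open>Maximality is expressed by disjointness from every strictly larger member. For dyadic
  cubes this amounts to not lying in a larger member, and it gives disjointness of the maximal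
  family directly.\<close>

definition maxi :: "(int \<times> (int ^ 'n)) set => (int \<times> (int ^ 'n)) set" where
 "maxi S = {p \<in> S. \<forall>q\<in>S. fst q > fst p --> dq p \<inter> dq q = {}}"

lemma maxi_subset: "maxi S \<subseteq> S" by (auto simp: maxi_def)

lemma maxi_disjoint: "disjoint_family_on dq (maxi S)"
unfolding disjoint_family_on_def
proof (intro ballI impI, rule ccontr)
 fix p q assume pq: "p \<in> maxi S" "q \<in> maxi S" "p \<noteq> q" "dq p \<inter> dq q \<noteq> {}"
 then obtain x where x: "x \<in> dq p" "x \<in> dq q" by blast
 have "\<not> fst p < fst q" "\<not> fst q < fst p" using pq x unfolding maxi_def by blast+
 then have "fst p = fst q" by simp
 then have "p = q" using x by (simp add: dq_def prod_eq_iff)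
 then show False using pq by simp
qed

text \<open>The bound on the generations leaves finitely many members of the family above p that
  contain the corner of p. The largest of these is maximal by nesting.\<close>

lemma maxi_above:
 assumes p: "p \<in> S" and bd: "\<And>q. q \<in> S ==> fst q <= J"
 shows "\<exists>q\<in>maxi S. fst p <= fst q \<and> dq p \<subseteq> dq q"
proof -
 define x where "x = cn p"
 have x: "x \<in> dq p" using cn_mem_dq x_def by simp
 define A where "A = {j. (j, ix j x) \<in> S \<and> fst p <= j}"
 have "(fst p, ix (fst p) x) \<in> S" using p x by (simp add: dq_def)
 then have pA: "fst p \<in> A" by (simp add: A_def)
 have "A \<subseteq> {fst p..J}" using bd by (force simp: A_def)
 then have fin: "finite A" using finite_subset by blast
 define j where "j = Max A"
 have jA: "j \<in> A" using fin pA unfolding j_def by (intro Max_in) auto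
 have jm: "i <= j" if "i \<in> A" for i using fin that by (simp add: j_def)
 let ?q = "(j, ix j x)"
 have "?q \<in> maxi S"
  unfolding maxi_def
 proof (intro CollectI conjI ballI impI)
  show "?q \<in> S" using jA by (simp add: A_def)
  fix q assume q: "q \<in> S" "fst ?q < fst q"
  show "dq ?q \<inter> dq q = {}"
  proof (rule ccontr)
   assume "dq ?q \<inter> dq q \<noteq> {}"
   then obtain y where y: "ix j y = ix j x" "ix (fst q) y = snd q" by (auto simp: dq_def)
   have jq: "j < fst q" using q(2) by simp
   have "ix (fst q) y = ix (fst q) x" using ix_mono[OF less_imp_le[OF jq] y(1)] .
   then have "(fst q, ix (fst q) x) \<in> S" using q(1) y(2) by (metis prod.collapse)
   then have "fst q \<in> A" using jq jA by (simp add: A_def)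
   then have "fst q <= j" by (rule jm)
   then show False using jq by simp
  qed
 qed
 moreover have "dq p \<subseteq> dq ?q"
 proof (rule dq_subset_or_disjoint)
  show "fst p <= fst ?q" using jA by (simp add: A_def)
  show "dq p \<inter> dq ?q \<noteq> {}" using x by auto
 qed
 moreover have "fst p <= fst ?q" using jA by (simp add: A_def)
 ultimately show ?thesis by blast
qed

lemma UN_maxi:
 assumes bd: "\<And>q. q \<in> S ==> fst q <= J"
 shows "(\<Union>p\<in>maxi S. dq p) = (\<Union>p\<in>S. dq p)"
proof
 show "(\<Union>p\<in>maxi S. dq p) \<subseteq> (\<Union>p\<in>S. dq p)" using maxi_subset by blast
 show "(\<Union>p\<in>S. dq p) \<subseteq> (\<Union>p\<in>maxi S. dq p)" using maxi_above[OF _ bd] by blast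
qed

end

section \<open>Comparison of measures through countable families of cubes\<close>

lemma emeasure_UN_disjoint_mono:
 fixes D :: "'i => 'a set"
 assumes "countable I" "disjoint_family_on D I" "\<And>i. i \<in> I ==> D i \<in> sets M" "\<And>i. i \<in> I ==> D i \<in> sets N"
  and "\<And>i. i \<in> I ==> emeasure M (D i) <= emeasure N (D i)"
 shows "emeasure M (\<Union>i\<in>I. D i) <= emeasure N (\<Union>i\<in>I. D i)"
proof -
 have "emeasure M (\<Union>i\<in>I. D i) = (\<integral>\<^sup>+i. emeasure M (D i) \<partial>count_space I)"
  using assms by (intro emeasure_UN_countable) auto
 also have "... <= (\<integral>\<^sup>+i. emeasure N (D i) \<partial>count_space I)"
  using assms by (intro nn_integral_mono) auto
 also have "... = emeasure N (\<Union>i\<in>I. D i)"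
  using assms by (intro emeasure_UN_countable[symmetric]) auto
 finally show ?thesis .
qed

lemma emeasure_UN_le:
 fixes D :: "'i => 'a set"
 assumes "countable I" "\<And>i. i \<in> I ==> D i \<in> sets M"
 shows "emeasure M (\<Union>i\<in>I. D i) <= (\<integral>\<^sup>+i. emeasure M (D i) \<partial>count_space I)"
proof -
 have "(\<Union>i\<in>I. D i) \<in> sets M" using assms by (intro sets.countable_UN') auto
 then have "emeasure M (\<Union>i\<in>I. D i) = (\<integral>\<^sup>+x. indicator (\<Union>i\<in>I. D i) x \<partial>M)" by simp
 also have "... <= (\<integral>\<^sup>+x. \<integral>\<^sup>+i. indicator (D i) x \<partial>count_space I \<partial>M)"
 proof (rule nn_integral_mono)
  fix x
  show "(indicator (\<Union>i\<in>I. D i) x :: ennreal) <= (\<integral>\<^sup>+i. indicator (D i) x \<partial>count_space I)"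
  proof (cases "\<exists>i\<in>I. x \<in> D i")
   case True
   then obtain i where i: "i \<in> I" "x \<in> D i" by blast
   have "1 = (\<integral>\<^sup>+k. indicator {i} k \<partial>count_space I)"
    using i by (subst nn_integral_indicator) (auto simp: emeasure_count_space_finite)
   also have "... <= (\<integral>\<^sup>+k. indicator (D k) x \<partial>count_space I)"
    using i by (intro nn_integral_mono) (auto simp: indicator_def)
   finally show ?thesis using True by (simp add: indicator_def)
  qed (auto simp: indicator_def)
 qed
 also have "... = (\<integral>\<^sup>+i. \<integral>\<^sup>+x. indicator (D i) x \<partial>M \<partial>count_space I)"
  using assms by (intro nn_integral_count_space_nn_integral) auto
 also have "... = (\<integral>\<^sup>+i. emeasure M (D i) \<partial>count_space I)"
  using assms by (intro nn_integral_cong) auto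
 finally show ?thesis .
qed

declare emeasure_completion [simp del] measure_completion [simp del]

lemma big_subset_open: "\<exists>T. open T \<and> big k \<subseteq> T \<and> T \<subseteq> big (Suc k)"
proof -
 define T where "T = box (\<chi> i. - real k - 2) (\<chi> i. real k + 2 :: real ^ 'a)"
 have "big k \<subseteq> T" "T \<subseteq> big (Suc k)"
  by (auto simp: T_def mem_big mem_box_cart abs_le_iff) (smt (verit))+
 then show ?thesis unfolding T_def by (intro exI[of _ T]) (auto simp: T_def)
qed

lemma emeasure_SUP_big:
 assumes "sets \<nu> = sets lebesgue" "H \<in> sets lebesgue"
 shows "(SUP k. emeasure \<nu> (H \<inter> big k)) = emeasure \<nu> H"
proof -
 have "(SUP k. emeasure \<nu> (H \<inter> big k)) = emeasure \<nu> (\<Union>k. H \<inter> big k)"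
  using assms incseq_big
  by (intro SUP_emeasure_incseq) (auto simp: incseq_def big_def)
 then show ?thesis unfolding Int_UN_distrib[symmetric] UN_big by simp
qed

lemma emeasure_null_diff:
 assumes "absolutely_continuous lebesgue \<mu>" "sets \<mu> = sets lebesgue" "H \<subseteq> T" "T \<in> sets lebesgue" "H \<in> sets lebesgue"
  "emeasure lebesgue (T - H) = 0"
 shows "emeasure \<mu> T = emeasure \<mu> H"
proof -
 have "T - H \<in> null_sets \<mu>" using assms by (auto simp: absolutely_continuous_def)
 then have "emeasure \<mu> (H \<union> (T - H)) = emeasure \<mu> H" using assms by (intro emeasure_Un_null_set) auto
 then show ?thesis using assms(3) by (simp add: Un_absorb1)
qed

text \<open>Differentiation of measures in a covering form.\<close>

lemma (in grid) dyadic_compare: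
 assumes sets: "sets \<mu> = sets lebesgue" "sets \<nu> = sets lebesgue"
  and ac: "absolutely_continuous lebesgue \<mu>"
  and fin: "\<And>k. emeasure \<mu> (big k) < \<infinity>"
  and H: "H \<in> sets lebesgue"
  and le: "\<And>x j. x \<in> H ==> j <= J ==> emeasure \<nu> (dq (j, ix j x)) <= emeasure \<mu> (dq (j, ix j x))"
 shows "emeasure \<nu> H <= emeasure \<mu> H"
proof -
 \<comment> \<open>The maximal cubes among those that lie in the open set T and satisfy the
   inequality are disjoint and cover G, so the inequality can be summed over them.\<close>
 have open_case: "emeasure \<nu> G <= emeasure \<mu> T"
  if G: "G \<subseteq> H" and T: "open T" "G \<subseteq> T" for G T
 proof -
  define S where "S = {(j, ix j x) | j x. x \<in> G \<and> j <= J \<and> dq (j, ix j x) \<subseteq> T}"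
  have bd: "q \<in> S ==> fst q <= J" for q by (auto simp: S_def)
  have "G \<subseteq> (\<Union>p\<in>S. dq p)"
  proof
   fix x assume x: "x \<in> G"
   then obtain J' where J': "\<And>j. j <= J' ==> dq (j, ix j x) \<subseteq> T"
    using small_dq_in_open[OF T(1)] T(2) by blast
   have "(min J J', ix (min J J') x) \<in> S" using x J'[of "min J J'"] by (auto simp: S_def)
   then show "x \<in> (\<Union>p\<in>S. dq p)" by (intro UN_I[of "(min J J', ix (min J J') x)"]) auto
  qed
  then have cov: "G \<subseteq> (\<Union>p\<in>maxi S. dq p)" using UN_maxi[of S J] bd by simp
  have S: "emeasure \<nu> (dq p) <= emeasure \<mu> (dq p) \<and> dq p \<subseteq> T" if "p \<in> maxi S" for p
  proof -
   have "p \<in> S" using that maxi_subset by blast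
   then obtain j x where "p = (j, ix j x)" "x \<in> G" "j <= J" "dq (j, ix j x) \<subseteq> T"
    by (auto simp: S_def)
   then show ?thesis using le[of x j] G by auto
  qed
  have "emeasure \<nu> G <= emeasure \<nu> (\<Union>p\<in>maxi S. dq p)"
   using cov sets by (intro emeasure_mono) (auto intro!: sets.countable_UN')
  also have "... <= emeasure \<mu> (\<Union>p\<in>maxi S. dq p)"
   using S sets maxi_disjoint by (intro emeasure_UN_disjoint_mono) auto
  also have "... <= emeasure \<mu> T"
   using S sets T by (intro emeasure_mono) auto
  finally show ?thesis .
 qed
 have bounded_case: "emeasure \<nu> G <= emeasure \<mu> G" if G: "G \<in> sets lebesgue" "G \<subseteq> H" "G \<subseteq> big k" for G k
 proof -
  obtain B :: "(real ^ 'n) set" where B: "open B" "big k \<subseteq> B" "B \<subseteq> big (Suc k)" using big_subset_open by blast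
  have "\<exists>T. open T \<and> G \<subseteq> T \<and> emeasure lebesgue (T - G) < ennreal (1 / real (Suc n))" for n
   by (rule sets_lebesgue_outer_open[OF G(1), of "1 / real (Suc n)"]) (simp, blast)
  then have "\<exists>A. \<forall>n. open (A n) \<and> G \<subseteq> A n \<and> emeasure lebesgue (A n - G) < ennreal (1 / real (Suc n))"
   by (intro choice allI)
  then obtain A where A: "\<And>n. open (A n)" "\<And>n. G \<subseteq> A n"
   "\<And>n. emeasure lebesgue (A n - G) < ennreal (1 / real (Suc n))" by blast
  \<comment> \<open>Outer regularity is available for Lebesgue measure only; absolute continuity
    transfers it to \<mu>. Intersecting with the bounded open set B makes the \<mu>-measures finite,
    as continuity from above requires.\<close>
  define T where "T n = (\<Inter>i\<le>n. A i) \<inter> B" for n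
  have T: "open (T n)" "G \<subseteq> T n" for n using A B G unfolding T_def by auto
  have Tleb: "T n \<in> sets lebesgue" for n using T(1)[of n] by auto
  have dec: "decseq T" by (auto simp: decseq_def T_def)
  have "emeasure \<mu> (T n) <= emeasure \<mu> (big (Suc k))" for n
   using B sets by (intro emeasure_mono) (auto simp: T_def big_def)
  then have Tfin: "emeasure \<mu> (T n) \<noteq> \<infinity>" for n using fin[of "Suc k"] by (metis leD infinity_ennreal_def)
  have "emeasure lebesgue (\<Inter>(range T) - G) <= ennreal (1 / real (Suc n))" for n
  proof -
   have "emeasure lebesgue (\<Inter>(range T) - G) <= emeasure lebesgue (A n - G)"
    using A G Tleb by (intro emeasure_mono) (auto simp: T_def)
   then show ?thesis using A(3)[of n] by simp
  qed
  moreover have "(\<lambda>n. ennreal (1 / real (Suc n))) \<longlonglongrightarrow> ennreal 0"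
   using LIMSEQ_inverse_real_of_nat by (intro tendsto_ennrealI) (simp add: inverse_eq_divide)
  ultimately have "emeasure lebesgue (\<Inter>(range T) - G) <= ennreal 0"
   by (intro LIMSEQ_le_const[of _ "ennreal 0"]) auto
  then have "emeasure \<mu> (\<Inter>(range T)) = emeasure \<mu> G"
   using T Tleb G sets ac by (intro emeasure_null_diff) auto
  moreover have "(INF n. emeasure \<mu> (T n)) = emeasure \<mu> (\<Inter>(range T))"
   using Tleb sets dec Tfin by (intro INF_emeasure_decseq) auto
  moreover have "emeasure \<nu> G <= (INF n. emeasure \<mu> (T n))"
   using open_case[OF G(2)] T by (intro INF_greatest) auto
  ultimately show ?thesis by simp
 qed
 have "emeasure \<nu> H = (SUP k. emeasure \<nu> (H \<inter> big k))"
  using emeasure_SUP_big sets(2) H by metis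
 also have "... <= (SUP k. emeasure \<mu> (H \<inter> big k))"
  using H by (intro SUP_mono') (rule bounded_case, auto simp: big_def)
 also have "... = emeasure \<mu> H" using emeasure_SUP_big sets(1) H by metis
 finally show ?thesis .
qed

subsection \<open>Weights\<close>

definition mw :: "(real ^ 'n => real) => (real ^ 'n) measure" where
 "mw w = density lebesgue (\<lambda>x. ennreal (w x))"

lemma sets_mw [simp, measurable_cong]: "sets (mw w) = sets lebesgue" by (simp add: mw_def)
lemma space_mw [simp]: "space (mw w) = UNIV" by (simp add: mw_def)
lemma mw_one: "mw (\<lambda>_. 1) = lebesgue" by (simp add: mw_def density_1)

text \<open>Positive finite mass on every cube is what averages over cubes require, and it is easy
  to verify for the constructed weights. Positivity almost everywhere is not included; it is
  recovered from the A_inf condition in \<open>ainf_imp_pos\<close>.\<close>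

definition wt :: "(real ^ 'n => real) => bool" where
 "wt w \<longleftrightarrow> w \<in> borel_measurable lebesgue \<and> (\<forall>x. 0 <= w x)
  \<and> (\<forall>a s. s > 0 --> 0 < emeasure (mw w) (cub a s) \<and> emeasure (mw w) (cub a s) < \<infinity>)"

lemma wtD:
 assumes "wt w"
 shows "lmeas w" "0 <= w x"
  "s > 0 ==> 0 < emeasure (mw w) (cub a s)" "s > 0 ==> emeasure (mw w) (cub a s) < \<infinity>"
 using assms by (auto simp: wt_def)

lemma emeasure_mw:
 assumes "lmeas w" "E \<in> sets lebesgue"
 shows "emeasure (mw w) E = (\<integral>\<^sup>+x\<in>E. ennreal (w x) \<partial>lebesgue)"
 using assms by (simp add: mw_def emeasure_density)

lemma nn_integral_mw:
 assumes "lmeas w" "lmeas g"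
 shows "(\<integral>\<^sup>+x. g x \<partial>mw w) = (\<integral>\<^sup>+x. ennreal (w x) * g x \<partial>lebesgue)"
 using assms by (simp add: mw_def nn_integral_density)

lemma mw_ac: "lmeas w ==> absolutely_continuous lebesgue (mw w)"
 unfolding mw_def by (rule absolutely_continuousI_density) simp

lemma AE_mw: "lmeas w ==> AE x in lebesgue. P x ==> AE x in mw w. P x"
 unfolding mw_def by (subst AE_density) (auto elim: eventually_mono)

lemma wt_finite:
 assumes "wt w" "bounded E"
 shows "emeasure (mw w) E < \<infinity>"
proof -
 obtain k where "E \<subseteq> big k" using bounded_subset_big assms(2) by blast
 then have "emeasure (mw w) E <= emeasure (mw w) (big k)" by (intro emeasure_mono) (auto simp: big_def)
 also have "... < \<infinity>" unfolding big_def by (intro wtD assms) auto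
 finally show ?thesis .
qed

lemma bounded_cub [simp]: "bounded (cub a s)" by (simp add: cub_def bounded_cbox)

lemma wt_emeasure_eq:
 assumes "wt w" "bounded E"
 shows "emeasure (mw w) E = ennreal (measure (mw w) E)"
 using wt_finite[OF assms] by (simp add: emeasure_eq_ennreal_measure)

lemma wt_measure_pos:
 assumes "wt w" "s > 0" shows "0 < measure (mw w) (cub a s)"
 using wtD(3)[OF assms, of a] wt_emeasure_eq[OF assms(1) bounded_cub, of a s] by (metis ennreal_0 less_le measure_nonneg)

lemma wt_measure_mono:
 assumes "wt w" "E \<subseteq> F" "bounded F" "F \<in> sets lebesgue"
 shows "measure (mw w) E <= measure (mw w) F"
proof -
 have "bounded E" using assms bounded_subset by blast
 then have "ennreal (measure (mw w) E) <= ennreal (measure (mw w) F)"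
  using assms emeasure_mono[of E F "mw w"] by (simp flip: wt_emeasure_eq)
 then show ?thesis by simp
qed

lemma wt_measure_Diff:
 assumes "wt w" "E \<subseteq> F" "bounded F" "F \<in> sets lebesgue" "E \<in> sets lebesgue"
 shows "measure (mw w) (F - E) = measure (mw w) F - measure (mw w) E"
 using assms wt_finite[OF assms(1,3)] by (intro measure_Diff) auto

lemma wt_measure_Un:
 assumes "wt w" "bounded E" "bounded F" "F \<in> sets lebesgue" "E \<in> sets lebesgue"
 shows "measure (mw w) (E \<union> F) <= measure (mw w) E + measure (mw w) F"
 using assms by (intro measure_Un_le) auto

lemma wt_one: "wt (\<lambda>_. 1)"
proof -
 have "emeasure lebesgue (cub a s) = ennreal (s ^ CARD('a))" "0 < s ^ CARD('a)" if "s > 0" for a :: "real ^ 'a" and s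
  using that emeasure_cub[of s a] by simp_all
 then show ?thesis unfolding wt_def mw_one by (simp del: emeasure_completion)
qed

lemma measure_mw_ge:
 assumes "wt w" "E \<in> sets lebesgue" "bounded E" "c >= 0" "AE x in lebesgue. x \<in> E --> c <= w x"
 shows "c * measure lebesgue E <= measure (mw w) E"
proof -
 have fin: "emeasure lebesgue E = ennreal (measure lebesgue E)"
  using wt_emeasure_eq[OF wt_one assms(3)] by (simp add: mw_one)
 have "ennreal c * emeasure lebesgue E = (\<integral>\<^sup>+x\<in>E. ennreal c \<partial>lebesgue)"
  using assms by (simp add: nn_integral_cmult_indicator)
 also have "... <= (\<integral>\<^sup>+x\<in>E. ennreal (w x) \<partial>lebesgue)"
  using assms(5) by (intro nn_integral_mono_AE) (auto elim!: eventually_mono simp: indicator_def ennreal_leI)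
 also have "... = emeasure (mw w) E" by (rule emeasure_mw[OF wtD(1)[OF assms(1)] assms(2), symmetric])
 finally have "ennreal (c * measure lebesgue E) <= ennreal (measure (mw w) E)"
  using assms fin by (simp add: wt_emeasure_eq ennreal_mult)
 then show ?thesis by simp
qed

lemma measure_mw_le:
 assumes "wt w" "E \<in> sets lebesgue" "bounded E" "c >= 0" "AE x in lebesgue. x \<in> E --> w x <= c"
 shows "measure (mw w) E <= c * measure lebesgue E"
proof -
 have fin: "emeasure lebesgue E = ennreal (measure lebesgue E)"
  using wt_emeasure_eq[OF wt_one assms(3)] by (simp add: mw_one)
 have "emeasure (mw w) E = (\<integral>\<^sup>+x\<in>E. ennreal (w x) \<partial>lebesgue)"
  by (rule emeasure_mw[OF wtD(1)[OF assms(1)] assms(2)])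
 also have "... <= (\<integral>\<^sup>+x\<in>E. ennreal c \<partial>lebesgue)"
  using assms(5) by (intro nn_integral_mono_AE) (auto elim!: eventually_mono simp: indicator_def ennreal_leI)
 also have "... = ennreal c * emeasure lebesgue E"
  using assms by (simp add: nn_integral_cmult_indicator)
 finally have "ennreal (measure (mw w) E) <= ennreal (c * measure lebesgue E)"
  using assms fin by (simp add: wt_emeasure_eq ennreal_mult)
 then show ?thesis using assms by (simp add: ennreal_le_iff)
qed

text \<open>Membership of the measure \<open>w dx\<close> in the class \<open>A\<^sub>\<infinity>\<close> of the measure \<open>u dx\<close>; the second form is
 the one-level condition of Coifman and Fefferman.\<close>

definition ainf :: "real => real => (real ^ 'n => real) => (real ^ 'n => real) => bool" where
 "ainf C d u w \<longleftrightarrow> (\<forall>a s E. s > 0 --> E \<in> sets lebesgue --> E \<subseteq> cub a s -->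
   measure (mw w) E <= C * (measure (mw u) E / measure (mw u) (cub a s)) powr d * measure (mw w) (cub a s))"

definition weak_ainf :: "real => (real ^ 'n => real) => (real ^ 'n => real) => bool" where
 "weak_ainf c u w \<longleftrightarrow> (\<forall>a s E. s > 0 --> E \<in> sets lebesgue --> E \<subseteq> cub a s -->
   measure (mw u) E <= c * measure (mw u) (cub a s) --> measure (mw w) E <= 3/4 * measure (mw w) (cub a s))"

text \<open>Doubling for nested, not necessarily concentric, cubes. The largest ratio of sides that
  occurs is 6, for the triple of a dyadic cube whose side is at most twice that of the given cube;
  16 leaves room.\<close>

definition dbl :: "real => (real ^ 'n => real) => bool" where
 "dbl K w \<longleftrightarrow> (\<forall>a s b t. s > 0 --> t <= 16 * s --> cub a s \<subseteq> cub b t -->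
   measure (mw w) (cub b t) <= K * measure (mw w) (cub a s))"

lemma ainf_imp_weak:
 assumes "C > 0" "d > 0"
 shows "\<exists>c>0. \<forall>u w :: real ^ 'n => real. wt u --> wt w --> ainf C d u w --> weak_ainf c u w"
proof -
 define c where "c = (3 / (4 * C)) powr (1 / d)"
 have c: "c > 0" using assms by (simp add: c_def)
 have cd: "C * c powr d = 3/4" using assms by (simp add: c_def powr_powr)
 have "weak_ainf c u w" if w: "wt u" "wt w" "ainf C d u w" for u w :: "real ^ 'n => real"
  unfolding weak_ainf_def
 proof (intro allI impI)
  fix a s and E :: "(real ^ 'n) set"
  assume E: "s > 0" "E \<in> sets lebesgue" "E \<subseteq> cub a s" "measure (mw u) E <= c * measure (mw u) (cub a s)"
  have "(measure (mw u) E / measure (mw u) (cub a s)) powr d <= c powr d"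
   using E wt_measure_pos[OF w(1) E(1), of a] assms by (intro powr_mono2) (auto simp: field_simps)
  then have "C * (measure (mw u) E / measure (mw u) (cub a s)) powr d <= 3/4"
   using assms unfolding cd[symmetric] by (intro mult_left_mono) auto
  then have "C * (measure (mw u) E / measure (mw u) (cub a s)) powr d * measure (mw w) (cub a s)
    <= 3/4 * measure (mw w) (cub a s)"
   by (rule mult_right_mono) simp
  moreover have "measure (mw w) E <= C * (measure (mw u) E / measure (mw u) (cub a s)) powr d * measure (mw w) (cub a s)"
   using w(3) E unfolding ainf_def by blast
  ultimately show "measure (mw w) E <= 3/4 * measure (mw w) (cub a s)" by linarith
 qed
 then show ?thesis using c by blast
qed

lemma cub_subset_iff:
 assumes "s >= 0"
 shows "cub a s \<subseteq> cub b t \<longleftrightarrow> (\<forall>i. b $ i <= a $ i \<and> a $ i + s <= b $ i + t)"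
proof
 assume "cub a s \<subseteq> cub b t"
 moreover have "a \<in> cub a s" "a + (\<chi> i. s) \<in> cub a s" using assms by (auto simp: mem_cub)
 ultimately have "a \<in> cub b t" "a + (\<chi> i. s) \<in> cub b t" by auto
 then show "\<forall>i. b $ i <= a $ i \<and> a $ i + s <= b $ i + t" by (simp add: mem_cub)
next
 assume *: "\<forall>i. b $ i <= a $ i \<and> a $ i + s <= b $ i + t"
 show "cub a s \<subseteq> cub b t"
 proof
  fix x assume x: "x \<in> cub a s"
  have "b $ i <= x $ i \<and> x $ i <= b $ i + t" for i
   using *[rule_format, of i] x[unfolded mem_cub, rule_format, of i] by linarith
  then show "x \<in> cub b t" by (simp add: mem_cub)
 qed
qed

lemma dbl_one: "dbl (16 ^ CARD('n)) (\<lambda>_ :: real ^ 'n. 1)"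
proof -
 have "t ^ CARD('n) <= 16 ^ CARD('n) * s ^ CARD('n)" if "s > 0" "t <= 16 * s" "t >= 0" for s t :: real
  using that power_mono[of t "16 * s" "CARD('n)"] by (simp add: power_mult_distrib)
 moreover have "t >= 0" if "s > 0" "cub a s \<subseteq> cub b t" for a b :: "real ^ 'n" and s t
 proof -
  have "b $ undefined <= a $ undefined \<and> a $ undefined + s <= b $ undefined + t"
   using that cub_subset_iff[of s a b t] by simp
  then show ?thesis using that by linarith
 qed
 ultimately show ?thesis by (auto simp: dbl_def mw_one measure_cub)
qed

text \<open>Interpolating linearly between two nested cubes gives a chain in which consecutive cubes
 differ by a small proportion; this yields doubling.\<close>

lemma weak_ainf_imp_dbl:
 assumes "c > 0"
 shows "\<exists>K\<ge>1. \<forall>w :: real ^ 'n => real. wt w --> weak_ainf c (\<lambda>_. 1) w --> dbl K w"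
proof -
 define n where "n = CARD('n)"
 have n: "n >= 1" by (simp add: n_def Suc_le_eq)
 \<comment> \<open>In N steps the side grows by at most 15 s, so each step adds at most the
   proportion 15 / N of the new side and, by Bernoulli's inequality, at most 15 n / N \<le> c of the
   new volume. The added shell then carries at most 3/4 of the new mass, and each step costs a
   factor 4. The bound N >= 15 keeps 1 - 15 / N nonnegative.\<close>
 obtain N0 :: nat where N0: "15 * real n / c <= real N0" using real_arch_simple by blast
 define N where "N = max N0 15"
 have N: "15 * real n / c <= real N" "15 <= real N" using N0 by (auto simp: N_def)
 have "dbl (4 ^ N) w" if w: "wt w" "weak_ainf c (\<lambda>_. 1) w" for w :: "real ^ 'n => real"
  unfolding dbl_def
 proof (intro allI impI)
  fix a b :: "real ^ 'n" and s t :: real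
  assume s: "s > 0" and t: "t <= 16 * s" and sub: "cub a s \<subseteq> cub b t"
  have ab: "b $ i <= a $ i \<and> a $ i + s <= b $ i + t" for i
   using sub s by (simp add: cub_subset_iff)
  then have st: "s <= t" using ab[of undefined] by linarith
  define q where "q i = cub (\<chi> k. a $ k + (real i / real N) * (b $ k - a $ k)) (s + (real i / real N) * (t - s))" for i
  define l where "l i = s + (real i / real N) * (t - s)" for i
  have lpos: "l i > 0" for i using s st by (simp add: l_def add_pos_nonneg)
  have lge: "l i >= s" for i using s st by (simp add: l_def)
  have lS: "l (Suc i) = l i + (t - s) / real N" for i
   by (simp add: l_def add_divide_distrib algebra_simps)
  have step: "measure (mw w) (q (Suc i)) <= 4 * measure (mw w) (q i)" for i
  proof -
   have qs: "q i \<subseteq> q (Suc i)"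
    unfolding q_def l_def[symmetric] cub_subset_iff[OF less_imp_le[OF lpos]]
   proof
    fix k
    have e1: "(real (Suc i) / real N) * (b $ k - a $ k) = (real i / real N) * (b $ k - a $ k) + (b $ k - a $ k) / real N"
     by (simp add: add_divide_distrib diff_divide_distrib algebra_simps)
    have e2: "(b $ k - a $ k) / real N <= 0" using ab[of k] by (simp add: divide_nonpos_nonneg)
    have "0 <= (b $ k - a $ k + (t - s)) / real N" using ab[of k] by simp
    then have e3: "0 <= (b $ k - a $ k) / real N + (t - s) / real N" by (simp add: add_divide_distrib)
    show "(\<chi> k. a $ k + real (Suc i) / real N * (b $ k - a $ k)) $ k
       <= (\<chi> k. a $ k + real i / real N * (b $ k - a $ k)) $ k \<and>
       (\<chi> k. a $ k + real i / real N * (b $ k - a $ k)) $ k + l i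
       <= (\<chi> k. a $ k + real (Suc i) / real N * (b $ k - a $ k)) $ k + l (Suc i)"
     using e1 e2 e3 lS[of i] by simp
   qed
   have qsets: "q j \<in> sets lebesgue" "bounded (q j)" for j by (simp_all add: q_def)
   have mq: "measure lebesgue (q j) = l j ^ n" for j
    using lpos[of j] measure_cub[of "l j"] by (simp add: q_def l_def n_def)
   define x where "x = 15 / real N"
   have x: "0 <= x" "x <= 1" using N by (auto simp: x_def)
   have nx: "real n * x <= c" using N assms by (simp add: x_def field_simps)
   have "l (Suc i) * (1 - x) <= l i"
   proof -
    have "(t - s) <= 15 * s" using t by simp
    then have "(t - s) / real N <= x * s" using N by (simp add: x_def divide_right_mono)
    also have "... <= x * l (Suc i)" using x lge by (intro mult_left_mono) auto
    finally have "l (Suc i) - x * l (Suc i) <= l i" using lS[of i] by linarith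
    then show ?thesis by (simp add: algebra_simps)
   qed
   then have "(l (Suc i) * (1 - x)) ^ n <= l i ^ n"
    using x lpos[of "Suc i"] by (intro power_mono) auto
   moreover have "1 - real n * x <= (1 - x) ^ n"
    using Bernoulli_inequality[of "-x" n] x by simp
   ultimately have "l (Suc i) ^ n * (1 - real n * x) <= l i ^ n"
    using lpos[of "Suc i"]
    by (smt (verit, best) mult_left_mono power_mult_distrib zero_less_power)
   then have "l (Suc i) ^ n - l i ^ n <= (real n * x) * l (Suc i) ^ n" by (simp add: algebra_simps)
   also have "... <= c * l (Suc i) ^ n" using nx lpos[of "Suc i"] by (intro mult_right_mono) auto
   finally have "measure lebesgue (q (Suc i) - q i) <= c * measure lebesgue (q (Suc i))"
    using wt_measure_Diff[OF wt_one qs] qsets by (simp add: mw_one mq)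
   then have "measure (mw w) (q (Suc i) - q i) <= 3/4 * measure (mw w) (q (Suc i))"
    using w(2) lpos[of "Suc i"] qsets unfolding weak_ainf_def mw_one q_def l_def by blast
   then show ?thesis
    using wt_measure_Diff[OF w(1) qs] qsets by simp
  qed
  have "measure (mw w) (q i) <= 4 ^ i * measure (mw w) (q 0)" for i
  proof (induction i)
   case (Suc i) then show ?case using step[of i] by simp
  qed simp
  from this[of N] show "measure (mw w) (cub b t) <= 4 ^ N * measure (mw w) (cub a s)"
   using N by (simp add: q_def vec_lambda_eta)
 qed
 then show ?thesis by (intro exI[of _ "4 ^ N"]) auto
qed

section \<open>From the one-level condition to a power estimate\<close>

lemma emeasure_mw_indicator:
 assumes "lmeas w" "E \<in> sets lebesgue" "F \<in> sets lebesgue" "k >= 0"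
 shows "emeasure (mw (\<lambda>x. k * (indicator E x * w x))) F = ennreal k * emeasure (mw w) (E \<inter> F)"
proof -
 have "emeasure (mw (\<lambda>x. k * (indicator E x * w x))) F = (\<integral>\<^sup>+x\<in>F. ennreal (k * (indicator E x * w x)) \<partial>lebesgue)"
  using assms by (intro emeasure_mw) auto
 also have "... = (\<integral>\<^sup>+x. ennreal k * (ennreal (w x) * indicator (E \<inter> F) x) \<partial>lebesgue)"
  using assms(4) by (intro nn_integral_cong) (auto simp: indicator_def ennreal_mult')
 also have "... = ennreal k * (\<integral>\<^sup>+x\<in>E \<inter> F. ennreal (w x) \<partial>lebesgue)"
  using assms by (intro nn_integral_cmult) auto
 also have "... = ennreal k * emeasure (mw w) (E \<inter> F)"
  using assms by (simp add: emeasure_mw)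
 finally show ?thesis .
qed

lemma emeasure_mw_cmult:
 assumes "lmeas w" "F \<in> sets lebesgue" "k >= 0"
 shows "emeasure (mw (\<lambda>x. k * w x)) F = ennreal k * emeasure (mw w) F"
 using emeasure_mw_indicator[of w UNIV F k] assms by simp

lemma (in grid) emeasure_dq_clo:
 assumes "lmeas w" "E \<in> sets lebesgue"
 shows "emeasure (mw w) (E \<inter> cub (cn p) (sd (fst p))) = emeasure (mw w) (E \<inter> dq p)"
proof (rule emeasure_eq_AE)
 have "AE x in lebesgue. x \<notin> cub (cn p) (sd (fst p)) - dq p"
  using negligible_clo_dq[of p] unfolding negligible_iff_null_sets by (rule AE_not_in)
 then have "AE x in lebesgue. (x \<in> E \<inter> cub (cn p) (sd (fst p))) = (x \<in> E \<inter> dq p)"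
  by (rule eventually_mono) (use dq_subset_clo[of p] in blast)
 then show "AE x in mw w. (x \<in> E \<inter> cub (cn p) (sd (fst p))) = (x \<in> E \<inter> dq p)"
  by (rule AE_mw[OF assms(1)])
qed (use assms in auto)

lemma (in grid) measure_dq_clo:
 assumes "wt w"
 shows "measure (mw w) (cub (cn p) (sd (fst p))) = measure (mw w) (dq p)"
 using emeasure_dq_clo[OF wtD(1)[OF assms], of UNIV p] by (simp add: measure_def)

lemma (in grid) dq_zero: "cub (cn (0, 0)) (sd (fst (0, 0 :: int ^ 'n))) = cub a s"
 by (simp add: cn_def sd_def)

text \<open>A stopping-time step. Dyadic cubes are selected where the density of E with respect to u
  first gets high, and E1 is the union of their parents. In a cube where E is dense,
  \<open>weak_ainf\<close> applied to the complement leaves E at least a quarter of the w-mass, and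
  doubling passes to the parent; so w(E1) is controlled by w(E). In the parents E has density at
  most 1 - c, and E lies in E1 up to a u-null set; so E1 is larger than E by the factor 1/(1 - c) in
  u-measure.\<close>

lemma (in grid) density_step:
 fixes u w :: "real ^ 'n => real"
 assumes w: "wt u" "wt w" and wk: "weak_ainf c u w" and db: "dbl K w" and c: "0 < c" "c < 1"
  and E: "E \<in> sets lebesgue" "E \<subseteq> cub a s" "measure (mw u) E < (1 - c) * measure (mw u) (cub a s)"
 shows "\<exists>E1. E1 \<in> sets lebesgue \<and> E1 \<subseteq> cub a s \<and> measure (mw u) E <= (1 - c) * measure (mw u) E1
   \<and> measure (mw w) E1 <= 4 * K * measure (mw w) E"
proof -
 have bE: "bounded E" using E(2) bounded_cub bounded_subset by blast
 have bI: "bounded (E \<inter> X)" "E \<inter> X \<in> sets lebesgue" if "X \<in> sets lebesgue" for X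
  using bE that E bounded_Int by auto
 define dens where "dens p \<longleftrightarrow> (1 - c) * measure (mw u) (dq p) <= measure (mw u) (E \<inter> dq p)" for p
 \<comment> \<open>The members are parents: p has low density and one of its children is dense. The
   parent carries the upper bound for u, the child the lower bound for w, and doubling connects the
   two.\<close>
 define S where "S = {p. \<exists>j x. p = (j + 1, ix (j + 1) x) \<and> j < 0 \<and> x \<in> dq (0, 0) \<and> \<not> dens p \<and> dens (j, ix j x)}"
 have bd: "q \<in> S ==> fst q <= 0" for q by (auto simp: S_def)
 have K: "K >= 0"
  using db[unfolded dbl_def, rule_format, of s s a a] wt_measure_pos[OF w(2) s, of a] s
  by (smt (verit, best) mult_nonneg_nonneg order_refl mult_less_0_iff)
 have P: "dq p \<subseteq> dq (0, 0) \<and> measure (mw u) (E \<inter> dq p) <= (1 - c) * measure (mw u) (dq p)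
   \<and> measure (mw w) (dq p) <= 4 * K * measure (mw w) (E \<inter> dq p)" if "p \<in> S" for p
 proof -
  obtain j x where jx: "p = (j + 1, ix (j + 1) x)" "j < 0" "x \<in> dq (0, 0)" "\<not> dens p" "dens (j, ix j x)"
   using \<open>p \<in> S\<close> by (auto simp: S_def)
  define q where "q = (j, ix j x)"
  have sub: "dq p \<subseteq> dq (0, 0)"
   using jx by (intro dq_subset_or_disjoint) (auto intro!: exI[of _ x] mem_dq_ix)
  have qp: "cub (cn q) (sd (fst q)) \<subseteq> cub (cn p) (sd (fst p))"
   by (rule clo_mono) (unfold q_def jx(1), rule dq_nested, simp)
  have "measure (mw u) (dq q - E) <= c * measure (mw u) (cub (cn q) (sd (fst q)))"
  proof -
   have "measure (mw u) (dq q - E) = measure (mw u) (dq q - E \<inter> dq q)" by (simp add: Diff_Int2 Diff_Int)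
   also have "... = measure (mw u) (dq q) - measure (mw u) (E \<inter> dq q)"
    using bI bounded_dq w by (intro wt_measure_Diff) auto
   finally show ?thesis using jx(5) measure_dq_clo[OF w(1), of q] by (simp add: dens_def q_def algebra_simps)
  qed
  then have "measure (mw w) (dq q - E) <= 3/4 * measure (mw w) (cub (cn q) (sd (fst q)))"
   using wk dq_subset_clo[of q] E unfolding weak_ainf_def by (meson Diff_subset dq_sets(2) order_trans sd_pos sets.Diff)
  moreover have "measure (mw w) (dq q) <= measure (mw w) (dq q - E) + measure (mw w) (E \<inter> dq q)"
  proof -
   have "dq q = (dq q - E) \<union> (E \<inter> dq q)" by blast
   then show ?thesis using wt_measure_Un[OF w(2), of "dq q - E" "E \<inter> dq q"] bI bounded_dq E
    by (metis bounded_diff dq_sets(2) sets.Diff)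
  qed
  ultimately have 1: "measure (mw w) (dq q) <= 4 * measure (mw w) (E \<inter> dq q)"
   using measure_dq_clo[OF w(2), of q] by linarith
  have "measure (mw w) (dq p) <= K * measure (mw w) (dq q)"
  proof -
   have "measure (mw w) (cub (cn p) (sd (fst p))) <= K * measure (mw w) (cub (cn q) (sd (fst q)))"
   proof -
    have "sd (fst p) <= 16 * sd (fst q)" by (simp add: q_def jx(1) sd_Suc)
    then show ?thesis using db qp sd_pos unfolding dbl_def by blast
   qed
   then show ?thesis using measure_dq_clo[OF w(2)] by simp
  qed
  also have "... <= K * (4 * measure (mw w) (E \<inter> dq p))"
  proof (intro mult_left_mono order_trans[OF 1])
   have "dq q \<subseteq> dq p" unfolding q_def jx(1) by (rule dq_nested) simp
   then show "measure (mw w) (E \<inter> dq q) <= measure (mw w) (E \<inter> dq p)"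
    using bI w by (intro wt_measure_mono) auto
  qed (use K in auto)
  finally show ?thesis using sub jx(4) by (simp add: dens_def)
 qed
 define E1 where "E1 = (\<Union>p\<in>maxi S. dq p)"
 have E1: "E1 \<subseteq> dq (0, 0)" "E1 \<in> sets lebesgue"
  using P maxi_subset by (auto simp: E1_def intro!: sets.countable_UN')
 have d0: "dq (0, 0) \<subseteq> cub a s" using dq_subset_clo[of "(0,0)"] dq_zero by simp
 have bE1: "bounded E1" using E1(1) bounded_dq bounded_subset by blast
 have meas: "lmeas u" "lmeas w" using w wtD by auto
 have PS: "p \<in> maxi S ==> p \<in> S" for p using maxi_subset by blast
 have disj: "emeasure M E1 <= emeasure N E1"
  if "sets M = sets lebesgue" "sets N = sets lebesgue" "\<And>p. p \<in> maxi S ==> emeasure M (dq p) <= emeasure N (dq p)" for M N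
  unfolding E1_def using that maxi_disjoint by (intro emeasure_UN_disjoint_mono) auto
 have w1: "measure (mw w) E1 <= 4 * K * measure (mw w) E"
 proof -
  have "emeasure (mw w) E1 <= emeasure (mw (\<lambda>x. 4 * K * (indicator E x * w x))) E1"
  proof (rule disj)
   fix p assume "p \<in> maxi S"
   then have "measure (mw w) (dq p) <= 4 * K * measure (mw w) (E \<inter> dq p)" using P PS by blast
   then show "emeasure (mw w) (dq p) <= emeasure (mw (\<lambda>x. 4 * K * (indicator E x * w x))) (dq p)"
    using meas E K w bI
    by (subst emeasure_mw_indicator) (auto simp: wt_emeasure_eq bounded_dq simp flip: ennreal_mult)
  qed auto
  also have "... = ennreal (4 * K) * emeasure (mw w) (E \<inter> E1)"
   using meas E K E1 by (intro emeasure_mw_indicator) auto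
  also have "... <= ennreal (4 * K) * emeasure (mw w) E"
   using E by (intro mult_left_mono emeasure_mono) auto
  finally show ?thesis using w K bE bE1 by (simp add: wt_emeasure_eq flip: ennreal_mult)
 qed
 have u1: "measure (mw u) (E \<inter> E1) <= (1 - c) * measure (mw u) E1"
 proof -
  have "emeasure (mw (\<lambda>x. 1 * (indicator E x * u x))) E1 <= emeasure (mw (\<lambda>x. (1 - c) * u x)) E1"
  proof (rule disj)
   fix p assume "p \<in> maxi S"
   then have "measure (mw u) (E \<inter> dq p) <= (1 - c) * measure (mw u) (dq p)" using P PS by blast
   then show "emeasure (mw (\<lambda>x. 1 * (indicator E x * u x))) (dq p) <= emeasure (mw (\<lambda>x. (1 - c) * u x)) (dq p)"
    using meas E c w bI
    by (subst emeasure_mw_indicator, simp_all, subst emeasure_mw_cmult)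
     (auto simp: wt_emeasure_eq bounded_dq simp flip: ennreal_mult)
  qed auto
  then have "emeasure (mw u) (E \<inter> E1) <= ennreal (1 - c) * emeasure (mw u) E1"
   using meas E c E1
   by (subst (asm) emeasure_mw_indicator, simp_all, subst (asm) emeasure_mw_cmult) auto
  then show ?thesis using w c bE1 bI E1 by (simp add: wt_emeasure_eq flip: ennreal_mult)
 qed
 define H where "H = E \<inter> dq (0, 0) - E1"
 have H: "H \<in> sets lebesgue" "bounded H" using E E1 bI by (auto simp: H_def intro: bounded_diff)
 have "emeasure (mw (\<lambda>x. 1 * (indicator E x * u x))) H <= emeasure (mw (\<lambda>x. (1 - c) * u x)) H"
 proof (rule dyadic_compare[where J = 0])
  show "emeasure (mw (\<lambda>x. (1 - c) * u x)) (big k) < \<infinity>" for k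
  proof -
   have "emeasure (mw u) (big k) < \<infinity>" using wt_finite[OF w(1)] by (simp add: big_def)
   then show ?thesis using meas c by (subst emeasure_mw_cmult) (auto simp: big_def ennreal_mult_less_top)
  qed
  show "absolutely_continuous lebesgue (mw (\<lambda>x. (1 - c) * u x))" using meas by (intro mw_ac) auto
  fix x and j :: int assume x: "x \<in> H" and j: "j <= 0"
  have xE1: "x \<notin> (\<Union>p\<in>S. dq p)" using x UN_maxi[of S 0] bd by (auto simp: H_def E1_def)
  \<comment> \<open>Descending from level 0, whose cube has low density by assumption: a first dense
    cube around x would put its parent into S, but x lies outside all cubes of S.\<close>
  have "\<not> dens (j, ix j x)" using j
  proof (induction j rule: int_le_induct)
   case base
   have x0: "ix 0 x = 0" using x by (auto simp: H_def dq_def)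
   have "emeasure (mw u) (E \<inter> cub a s) = emeasure (mw u) (E \<inter> dq (0,0))"
    using emeasure_dq_clo[OF meas(1) E(1), of "(0,0)"] dq_zero by simp
   then have "measure (mw u) E = measure (mw u) (E \<inter> dq (0,0))"
    using E(2) by (simp add: measure_def Int_absorb2)
   then show ?case using E(3) measure_dq_clo[OF w(1), of "(0,0)"] dq_zero x0 by (simp add: dens_def)
  next
   case (step i)
   show ?case
   proof
    assume d: "dens (i - 1, ix (i - 1) x)"
    have "(i, ix i x) \<in> S" unfolding S_def
     using step d x by (intro CollectI exI[of _ "i - 1"] exI[of _ x]) (auto simp: H_def)
    then show False using xE1 mem_dq_ix[of x i] by blast
   qed
  qed
  then have "measure (mw u) (E \<inter> dq (j, ix j x)) <= (1 - c) * measure (mw u) (dq (j, ix j x))"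
   by (simp add: dens_def)
  then show "emeasure (mw (\<lambda>x. 1 * (indicator E x * u x))) (dq (j, ix j x)) <= emeasure (mw (\<lambda>x. (1 - c) * u x)) (dq (j, ix j x))"
   using meas E c w bI
   by (subst emeasure_mw_indicator, simp_all, subst emeasure_mw_cmult)
     (auto simp: wt_emeasure_eq bounded_dq simp flip: ennreal_mult)
 qed (use H in auto)
 moreover have "E \<inter> H = H" by (auto simp: H_def)
 ultimately have "emeasure (mw u) H <= ennreal (1 - c) * emeasure (mw u) H"
   using meas E c H
   by (subst (asm) emeasure_mw_indicator, simp_all, subst (asm) emeasure_mw_cmult) auto
 then have "measure (mw u) H <= (1 - c) * measure (mw u) H"
  using w c H by (simp add: wt_emeasure_eq flip: ennreal_mult)
 then have "c * measure (mw u) H <= 0" by (simp add: algebra_simps)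
 then have H0: "measure (mw u) H = 0" using c by (simp add: mult_le_0_iff antisym)
 have "measure (mw u) E = measure (mw u) (E \<inter> dq (0,0))"
  using emeasure_dq_clo[OF meas(1) E(1), of "(0,0)"] dq_zero E(2) by (simp add: measure_def Int_absorb2)
 also have "E \<inter> dq (0,0) = H \<union> (E \<inter> E1)" using E1 by (auto simp: H_def)
 also have "measure (mw u) ... <= measure (mw u) H + measure (mw u) (E \<inter> E1)"
  using H bI E1 E by (intro wt_measure_Un w) auto
 finally have "measure (mw u) E <= (1 - c) * measure (mw u) E1" using H0 u1 by simp
 then show ?thesis using w1 E1 d0 by blast
qed

text \<open>The density step is iterated until the set fills the proportion 1 - c of the cube. Each
  application gains the factor 1/(1 - c) in u-measure and loses at most 4 K in w-measure, so d is
  the quotient of the logarithms of these two numbers. The roles of the weights are exchanged: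
  smallness in u controlling w becomes smallness in w controlling u, and it is w that must be
  doubling.\<close>

lemma weak_ainf_imp_ainf:
 assumes c: "0 < c" "c < 1" and K: "K >= 1"
 shows "\<exists>C>0. \<exists>d>0. \<forall>u w :: real ^ 'n => real. wt u --> wt w --> weak_ainf c u w --> dbl K w --> ainf C d w u"
proof -
 define r where "r = 1 - c"
 have r: "0 < r" "r < 1" using c by (auto simp: r_def)
 define d where "d = ln (1 / r) / ln (4 * K)"
 have lnK: "ln (4 * K) > 0" using K by simp
 have d: "d > 0" using r lnK by (simp add: d_def)
 have rd: "(4 * K) powr d = 1 / r" using r lnK K by (simp add: powr_def d_def)
 have "ainf (4 powr d) d w u" if w: "wt u" "wt w" "weak_ainf c u w" "dbl K w" for u w :: "real ^ 'n => real"
  unfolding ainf_def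
 proof (intro allI impI)
  fix a :: "real ^ 'n" and s E assume s: "s > 0" and E: "E \<in> sets lebesgue" "E \<subseteq> cub a s"
  interpret grid a s using s by unfold_locales
  let ?u = "measure (mw u)" and ?w = "measure (mw w)" and ?Q = "cub a s"
  have upos: "?u ?Q > 0" and wpos: "?w ?Q > 0" using wt_measure_pos w s by auto
  have dense: "?w ?Q <= 4 * ?w E" if "E \<in> sets lebesgue" "E \<subseteq> ?Q" "r * ?u ?Q <= ?u E" for E
  proof -
   have "?u (?Q - E) <= c * ?u ?Q" using that w by (simp add: wt_measure_Diff r_def algebra_simps)
   then have "?w (?Q - E) <= 3/4 * ?w ?Q" using that w(3) s unfolding weak_ainf_def
    by (meson Diff_subset cub_sets(1) sets.Diff)
   then show ?thesis using that w by (simp add: wt_measure_Diff)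
  qed
  have iter: "?w ?Q <= 4 * (4 * K) ^ m * ?w E"
   if "E \<in> sets lebesgue" "E \<subseteq> ?Q" "r ^ Suc m * ?u ?Q <= ?u E" for E m
   using that
  proof (induction m arbitrary: E)
   case 0 then show ?case using dense[of E] by simp
  next
   case (Suc m)
   show ?case
   proof (cases "r * ?u ?Q <= ?u E")
    case True
    have "?w ?Q <= 4 * ?w E" using dense Suc True by blast
    also have "... <= 4 * (4 * K) ^ Suc m * ?w E"
     using K one_le_power[of "4 * K" "Suc m"] by (intro mult_right_mono) (auto simp: mult_ac power_mult_distrib)
    finally show ?thesis .
   next
    case False
    then obtain E1 where E1: "E1 \<in> sets lebesgue" "E1 \<subseteq> ?Q" "?u E <= (1 - c) * ?u E1"
     "?w E1 <= 4 * K * ?w E"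
     using density_step[OF w(1,2,3,4) c Suc.prems(1,2)] by (auto simp: r_def)
    have "r * (r ^ Suc m * ?u ?Q) <= r * ?u E1" using E1(3) Suc.prems(3) by (simp add: r_def)
    then have "r ^ Suc m * ?u ?Q <= ?u E1" using r by simp
    then have "?w ?Q <= 4 * (4 * K) ^ m * ?w E1" using Suc.IH E1 by blast
    also have "... <= 4 * (4 * K) ^ m * (4 * K * ?w E)" using E1 K by (intro mult_left_mono) auto
    finally show ?thesis by (simp add: mult_ac)
   qed
  qed
  define x where "x = ?u E / ?u ?Q"
  have "?u E <= ?u ?Q" using E w by (intro wt_measure_mono) auto
  then have x1: "x <= 1" using upos by (simp add: x_def)
  show "?u E <= 4 powr d * (?w E / ?w ?Q) powr d * ?u ?Q"
  proof (cases "x > 0")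
   case False
   then have "?u E <= 0" using upos by (simp add: x_def field_simps not_less)
   then show ?thesis by (meson measure_nonneg mult_nonneg_nonneg order_trans powr_ge_zero)
  next
   case True
   obtain m where m: "r ^ Suc m <= x" "x <= r ^ m"
   proof -
    obtain k where "r ^ k < x" using real_arch_pow_inv[OF True r(2)] by blast
    then have ex: "\<exists>k. r ^ k <= x" by (meson less_imp_le)
    define k0 where "k0 = (LEAST k. r ^ k <= x)"
    have k0: "r ^ k0 <= x" unfolding k0_def using ex by (rule LeastI_ex)
    show ?thesis
    proof (cases k0)
     case 0 then show ?thesis using that[of 0] x1 k0 r by auto
    next
     case (Suc m)
     then have "\<not> r ^ m <= x" unfolding k0_def by (metis not_less_Least lessI)
     then show ?thesis using that[of m] k0 Suc by simp
    qed
   qed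
   have "r ^ Suc m * ?u ?Q <= ?u E" using m(1) upos by (simp add: x_def pos_le_divide_eq)
   then have it: "?w ?Q <= 4 * (4 * K) ^ m * ?w E" using iter E by blast
   have Km: "(4 * K) ^ m > 0" using K by simp
   have "1 / (4 * (4 * K) ^ m) <= ?w E / ?w ?Q"
    using it wpos K Km by (simp add: field_simps)
   then have "(1 / (4 * (4 * K) ^ m)) powr d <= (?w E / ?w ?Q) powr d"
    using d K by (intro powr_mono2) auto
   then have "4 powr d * (1 / (4 * (4 * K) ^ m)) powr d <= 4 powr d * (?w E / ?w ?Q) powr d" by simp
   moreover have "4 powr d * (1 / (4 * (4 * K) ^ m)) powr d = r ^ m"
   proof -
    have "(y ^ m) powr d = (y powr d) ^ m" if "y > 0" for y :: real
     using that powr_realpow[of y m] powr_realpow[of "y powr d" m] by (metis mult.commute powr_gt_zero powr_powr)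
    from this[of "4 * K"] have "((4 * K) ^ m) powr d = ((4 * K) powr d) ^ m" using K by linarith
    then have "((4 * K) ^ m) powr d = (1 / r) ^ m" using rd by simp
    then show ?thesis using K r by (simp add: powr_divide powr_mult power_one_over)
   qed
   ultimately have "x <= 4 powr d * (?w E / ?w ?Q) powr d" using m(2) by linarith
   then show ?thesis using upos by (simp add: x_def field_simps)
  qed
 qed
 then show ?thesis using d by (intro exI[of _ "4 powr d"] conjI exI[of _ d]) auto
qed

subsection \<open>Powers and geometric sums\<close>

lemma ennreal_powr_ennreal: "0 <= r ==> ennreal_powr (ennreal r) p = ennreal (r powr p)"
 by (simp add: ennreal_powr_def)

lemma ennreal_powr_top [simp]: "ennreal_powr top p = top"
 by (simp add: ennreal_powr_def)

lemma ennreal_powr_mono: "0 <= p ==> x <= y ==> ennreal_powr x p <= ennreal_powr y p"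
 by (cases x; cases y) (auto simp: ennreal_powr_ennreal top_unique intro!: ennreal_leI powr_mono2)

lemma ennreal_powr_measurable [measurable]:
 assumes "f \<in> borel_measurable M" shows "(\<lambda>x. ennreal_powr (f x) p) \<in> borel_measurable M"
 unfolding ennreal_powr_def using assms by measurable

lemma powr_level_lt:
 assumes "B > 1" "y > 0"
 shows "\<exists>i::int. B powr i < y \<and> y <= B powr (real_of_int i + 1)"
proof -
 define i where "i = \<lceil>log B y\<rceil> - 1"
 have "real_of_int i < log B y" "log B y <= real_of_int i + 1" unfolding i_def by linarith+
 then show ?thesis using assms by (intro exI[of _ i]) (simp add: powr_less_iff le_powr_iff)
qed

lemma powr_level_le:
 assumes "B > 1" "y > 0"
 shows "\<exists>i::int. B powr i <= y \<and> y < B powr (real_of_int i + 1)"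
proof -
 define i where "i = \<lfloor>log B y\<rfloor>"
 have "real_of_int i <= log B y" "log B y < real_of_int i + 1" unfolding i_def by linarith+
 then show ?thesis using assms by (intro exI[of _ i]) (simp add: powr_le_iff less_powr_iff)
qed

lemma nn_integral_count_space_infinite:
 assumes "infinite I" "c > 0" "\<And>i. i \<in> I ==> c <= f i" "I \<subseteq> A"
 shows "(\<integral>\<^sup>+i. f i \<partial>count_space A) = (top :: ennreal)"
proof -
 have "top = (\<integral>\<^sup>+i. c * indicator I i \<partial>count_space A)"
  using assms by (subst nn_integral_cmult_indicator) (auto simp: emeasure_count_space ennreal_mult_eq_top_iff)
 also have "... <= (\<integral>\<^sup>+i. f i \<partial>count_space A)"
  using assms by (intro nn_integral_mono) (auto simp: indicator_def)
 finally show ?thesis by (simp add: top_unique)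
qed

lemma borel_measurable_nn_integral_count_space:
 assumes I: "countable I" and f: "\<And>i. i \<in> I ==> f i \<in> borel_measurable M"
 shows "(\<lambda>x. \<integral>\<^sup>+i. (f i x :: ennreal) \<partial>count_space I) \<in> borel_measurable M"
proof -
 define J where "J = to_nat_on I ` I"
 have bij: "bij_betw (from_nat_into I) J I"
  unfolding J_def using I by (intro bij_betwI[where g = "to_nat_on I"]) auto
 have "(\<integral>\<^sup>+i. f i x \<partial>count_space I) = (\<Sum>n. f (from_nat_into I n) x * indicator J n)" for x
 proof -
  have "(\<integral>\<^sup>+i. f i x \<partial>count_space I) = (\<integral>\<^sup>+n. f (from_nat_into I n) x \<partial>count_space J)"
   by (rule nn_integral_bij_count_space[OF bij, symmetric])
  also have "... = (\<integral>\<^sup>+n. f (from_nat_into I n) x * indicator J n \<partial>count_space UNIV)"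
   by (rule nn_integral_count_space_indicator) simp
  finally show ?thesis by (simp add: nn_integral_count_space_nat)
 qed
 moreover have "(\<lambda>x. f (from_nat_into I n) x * indicator J n) \<in> borel_measurable M" for n
 proof (cases "n \<in> J")
  case True
  then have "from_nat_into I n \<in> I" using bij by (auto simp: bij_betw_def)
  then show ?thesis using f by simp
 qed simp
 ultimately show ?thesis by simp
qed

text \<open>The single term of the level just below y already dominates. If y is infinite, the terms
  with nonnegative index are bounded below by a positive number and the sum diverges.\<close>

lemma powr_le_level_sum:
 fixes y :: ennreal
 assumes p: "p > 0" and T: "T > 0"
 shows "ennreal_powr y p <= (\<integral>\<^sup>+i. (if ennreal (T * 2 powr i) < y then ennreal ((T * 2 powr (real_of_int i + 1)) powr p) else 0) \<partial>count_space (UNIV :: int set))"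
  (is "_ <= (\<integral>\<^sup>+i. ?f i \<partial>_)")
proof (cases y)
 case (real r)
 show ?thesis
 proof (cases "r > 0")
  case True
  then obtain i :: int where i: "2 powr i < r / T" "r / T <= 2 powr (real_of_int i + 1)"
   using powr_level_lt[of 2 "r / T"] T by auto
  have "r <= T * 2 powr (real_of_int i + 1)" using i T by (simp add: field_simps)
  then have "r powr p <= (T * 2 powr (real_of_int i + 1)) powr p" using p True by (intro powr_mono2) auto
  then have "ennreal_powr y p <= ?f i" using real True i T p
   by (auto simp: ennreal_powr_ennreal field_simps intro!: ennreal_leI ennreal_lessI)
  also have "... <= (\<integral>\<^sup>+i. ?f i \<partial>count_space UNIV)" by (rule nn_integral_ge_point) simp
  finally show ?thesis .
 qed (use real in \<open>auto simp: ennreal_powr_def\<close>)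
next
 case top
 have "(\<integral>\<^sup>+i. ?f i \<partial>count_space UNIV) = top"
 proof (rule nn_integral_count_space_infinite[of "{0::int..}" "ennreal (T powr p)"])
  fix i :: int assume "i \<in> {0..}"
  then have "T * 1 <= T * 2 powr (real_of_int i + 1)" using T by (intro mult_left_mono ge_one_powr_ge_zero) auto
  then show "ennreal (T powr p) <= ?f i" using top T p by (auto intro!: ennreal_leI powr_mono2)
 qed (use T in \<open>auto simp: infinite_Ici\<close>)
 then show ?thesis by simp
qed

lemma powr_le_level_sum_nat:
 fixes y :: ennreal
 assumes p: "p > 0" and T: "T > 0"
 shows "ennreal_powr y p <= ennreal (T powr p) +
  (\<integral>\<^sup>+i. (if ennreal (T * 2 ^ i) < y then ennreal ((T * 2 ^ Suc i) powr p) else 0) \<partial>count_space (UNIV :: nat set))"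
  (is "_ <= _ + (\<integral>\<^sup>+i. ?f i \<partial>_)")
proof (cases y)
 case (real r)
 show ?thesis
 proof (cases "r > T")
  case True
  then obtain i :: int where i: "2 powr i < r / T" "r / T <= 2 powr (real_of_int i + 1)"
   using powr_level_lt[of 2 "r / T"] T by auto
  have "1 < 2 powr (real_of_int i + 1)" using i(2) True T by (smt (verit, best) divide_less_eq_1_pos less_divide_eq_1_pos)
  then have "0 < real_of_int i + 1" using powr_less_cancel_iff[of 2 0 "real_of_int i + 1"] by simp
  then obtain k :: nat where k: "i = int k" by (metis add.commute int_one_le_iff_zero_less linorder_not_less nonneg_int_cases of_int_1 of_int_add of_int_le_0_iff zle_add1_eq_le zless_add1_eq)
  have k1: "2 powr i = (2::real) ^ k" "2 powr (real_of_int i + 1) = (2::real) ^ Suc k"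
   by (simp_all add: k powr_realpow powr_add)
  have "r <= T * 2 ^ Suc k" using i T unfolding k1 by (simp add: field_simps)
  then have "r powr p <= (T * 2 ^ Suc k) powr p" using p True T by (intro powr_mono2) auto
  then have "ennreal_powr y p <= ?f k" using real True i T p unfolding k1
   by (auto simp: ennreal_powr_ennreal field_simps intro!: ennreal_leI ennreal_lessI)
  also have "... <= (\<integral>\<^sup>+i. ?f i \<partial>count_space UNIV)" by (rule nn_integral_ge_point) simp
  also have "... <= ennreal (T powr p) + ..." by simp
  finally show ?thesis .
 next
  case False
  then have "ennreal_powr y p <= ennreal (T powr p)" using real p
   by (auto simp: ennreal_powr_ennreal intro!: ennreal_leI powr_mono2)
  then show ?thesis by (simp add: add_increasing2)
 qed
next
 case top
 have "(\<integral>\<^sup>+i. ?f i \<partial>count_space UNIV) = top"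
 proof (rule nn_integral_count_space_infinite[of "UNIV" "ennreal (T powr p)"])
  fix i :: nat
  have "T * 1 <= T * 2 ^ Suc i" using T by (intro mult_left_mono one_le_power) auto
  then show "ennreal (T powr p) <= ?f i" using top T p by (auto intro!: ennreal_leI powr_mono2)
 qed (use T in auto)
 then show ?thesis by simp
qed

lemma nn_integral_geometric_nat:
 assumes "0 <= c" "0 <= q" "q < 1"
 shows "(\<integral>\<^sup>+k. ennreal (c * q ^ k) \<partial>count_space (UNIV :: nat set)) = ennreal (c / (1 - q))"
proof -
 have "(\<integral>\<^sup>+k. ennreal (c * q ^ k) \<partial>count_space (UNIV :: nat set)) = (\<Sum>k. ennreal (c * q ^ k))"
  by (rule nn_integral_count_space_nat)
 also have "... = ennreal (\<Sum>k. c * q ^ k)"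
  using assms by (intro suminf_ennreal2 summable_mult summable_geometric) auto
 also have "(\<Sum>k. c * q ^ k) = c / (1 - q)"
  using assms by (subst suminf_mult) (auto simp: suminf_geometric summable_geometric)
 finally show ?thesis .
qed

lemma geometric_sum_le:
 assumes B: "B > 1" and e: "e > 0" and y: "y >= 0"
 shows "(\<integral>\<^sup>+i. (if B powr i <= y then ennreal (B powr (real_of_int i * e)) else 0) \<partial>count_space (UNIV :: int set))
  <= ennreal (y powr e / (1 - B powr (- e)))"
proof (cases "y > 0")
 case False
 then have "y = 0" using y by simp
 then have "\<not> B powr i <= y" for i :: int using B by (simp add: not_le)
 then show ?thesis by simp
next
 case True
 obtain i0 :: int where i0: "B powr i0 <= y" "y < B powr (real_of_int i0 + 1)"
  using powr_level_le[OF B True] by blast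
 have le: "i <= i0" if "B powr i <= y" for i :: int
 proof -
  have "B powr i < B powr (real_of_int i0 + 1)" using that i0 by linarith
  then have "real_of_int i < real_of_int i0 + 1" using B by simp
  then show ?thesis by linarith
 qed
 have bij: "bij_betw (\<lambda>k::nat. i0 - int k) UNIV {..i0}"
  by (rule bij_betwI[where g = "\<lambda>i. nat (i0 - i)"]) auto
 have "(\<integral>\<^sup>+i. (if B powr i <= y then ennreal (B powr (real_of_int i * e)) else 0) \<partial>count_space (UNIV :: int set))
   <= (\<integral>\<^sup>+i. ennreal (B powr (real_of_int i * e)) * indicator {..i0} i \<partial>count_space (UNIV :: int set))"
  using le by (intro nn_integral_mono) (auto simp: indicator_def)
 also have "... = (\<integral>\<^sup>+i. ennreal (B powr (real_of_int i * e)) \<partial>count_space {..i0})"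
  by (simp add: nn_integral_count_space_indicator)
 also have "... = (\<integral>\<^sup>+k. ennreal (B powr (real_of_int (i0 - int k) * e)) \<partial>count_space (UNIV :: nat set))"
  by (rule nn_integral_bij_count_space[OF bij, symmetric])
 also have "... = (\<integral>\<^sup>+k. ennreal (B powr (i0 * e) * (B powr (- e)) ^ k) \<partial>count_space (UNIV :: nat set))"
 proof (rule nn_integral_cong)
  fix k :: nat
  have "(B powr (- e)) ^ k = B powr (- e * k)" using B by (simp add: powr_powr flip: powr_realpow)
  then show "ennreal (B powr (real_of_int (i0 - int k) * e)) = ennreal (B powr (i0 * e) * (B powr (- e)) ^ k)"
   by (simp add: algebra_simps flip: powr_add)
 qed
 also have "... = ennreal (B powr (i0 * e) / (1 - B powr (- e)))"
  using B e by (intro nn_integral_geometric_nat) (use powr_less_mono[of "-e" 0 B] in auto)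
 also have "... <= ennreal (y powr e / (1 - B powr (- e)))"
 proof -
  have "B powr (i0 * e) <= y powr e"
   using i0(1) e B by (metis less_imp_le powr_ge_zero powr_mono2 powr_powr)
  moreover have "1 - B powr (- e) > 0" using B e by (simp add: powr_less_one)
  ultimately show ?thesis by (intro ennreal_leI divide_right_mono) auto
 qed
 finally show ?thesis .
qed

lemma geometric_sum_abs:
 assumes B: "B > 1" and e: "e > 0"
 shows "(\<integral>\<^sup>+i. ennreal (B powr (- e * \<bar>real_of_int i\<bar>)) \<partial>count_space (UNIV :: int set)) <= ennreal (2 / (1 - B powr (- e)))"
proof -
 let ?f = "\<lambda>i::int. if B powr i <= 1 then ennreal (B powr (real_of_int i * e)) else 0"
 have f: "(\<integral>\<^sup>+i. ?f i \<partial>count_space UNIV) <= ennreal (1 / (1 - B powr (- e)))"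
  using geometric_sum_le[OF B e, of 1] by simp
 have bij: "bij_betw (\<lambda>k::int. - k) UNIV UNIV" by (rule bij_betwI[where g = uminus]) auto
 have "(\<integral>\<^sup>+i. ennreal (B powr (- e * \<bar>real_of_int i\<bar>)) \<partial>count_space (UNIV :: int set))
   <= (\<integral>\<^sup>+i. ?f i + ?f (- i) \<partial>count_space (UNIV :: int set))"
 proof (intro nn_integral_mono)
  fix i :: int
  have "B powr i <= 1" if "i <= 0" using B that powr_mono[of "real_of_int i" 0 B] by simp
  moreover have "B powr (- real_of_int i) <= 1" if "\<not> i <= 0" using B that powr_mono[of "- real_of_int i" 0 B] by simp
  ultimately show "ennreal (B powr (- e * \<bar>real_of_int i\<bar>)) <= ?f i + ?f (- i)"
   by (cases "i <= 0") (auto simp: mult.commute intro: add_increasing add_increasing2)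
 qed
 also have "... = (\<integral>\<^sup>+i. ?f i \<partial>count_space UNIV) + (\<integral>\<^sup>+i. ?f (- i) \<partial>count_space UNIV)"
  by (rule nn_integral_add) auto
 also have "(\<integral>\<^sup>+i. ?f (- i) \<partial>count_space UNIV) = (\<integral>\<^sup>+i. ?f i \<partial>count_space UNIV)"
  by (rule nn_integral_bij_count_space[OF bij])
 also have "(\<integral>\<^sup>+i. ?f i \<partial>count_space UNIV) + (\<integral>\<^sup>+i. ?f i \<partial>count_space UNIV)
  <= ennreal (1 / (1 - B powr (- e))) + ennreal (1 / (1 - B powr (- e)))" using f by (intro add_mono)
 also have "... = ennreal (2 / (1 - B powr (- e)))"
 proof -
  have "1 - B powr (- e) > 0" using B e by (simp add: powr_less_one)
  then show ?thesis by (simp flip: ennreal_plus add_divide_distrib)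
 qed
 finally show ?thesis .
qed

text \<open>The constant in Kolmogorov's inequality: 1 for the part where f is at most the cut, and
  a geometric series with ratio \<open>2 powr (d - 1)\<close> for the dyadic levels above
  it.\<close>

definition kolC :: "real => real" where "kolC d = 1 + 2 powr d / (1 - 2 powr (d - 1))"

lemma kolC_ge1: "d < 1 ==> kolC d >= 1"
 by (auto simp: kolC_def powr_less_one less_imp_le)

text \<open>The integral is cut at the height L / m, where the trivial bound by the measure of A and
  the weak-type bound agree. Above the cut the weak-type bound at dyadic heights gives a geometric
  series, convergent because d < 1.\<close>

lemma kolmogorov:
 assumes d: "0 < d" "d < 1" and f: "f \<in> borel_measurable M" and A: "A \<in> sets M"
  and m: "0 <= m" and L: "0 <= L" and mA: "emeasure M A <= ennreal m"
  and wk: "\<And>t. t > 0 ==> ennreal t * emeasure M {x\<in>A. ennreal t < f x} <= ennreal L"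
 shows "(\<integral>\<^sup>+x\<in>A. ennreal_powr (f x) d \<partial>M) <= ennreal (kolC d * m powr (1 - d) * L powr d)"
proof -
 define q :: real where "q = 2 powr (d - 1)"
 have q: "0 < q" "q < 1" using d by (auto simp: q_def powr_less_one)
 define C where "C = 1 + 2 powr d / (1 - q)"
 have C: "C >= 1" using q by (simp add: C_def)
 have main: "(\<integral>\<^sup>+x\<in>A. ennreal_powr (f x) d \<partial>M) <= ennreal (C * m powr (1 - d) * L powr d)"
  if m: "0 < m" and L: "0 < L"
  and mA: "emeasure M A <= ennreal m"
  and wk: "\<And>t. t > 0 ==> ennreal t * emeasure M {x\<in>A. ennreal t < f x} <= ennreal L"
  for m L
 proof -
  define T where "T = L / m"
  have T: "T > 0" using m L by (simp add: T_def)
  define X where "X i = {x\<in>A. ennreal (T * 2 ^ i) < f x}" for i :: nat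
  have X: "X i \<in> sets M" for i unfolding X_def using f A by measurable
  have EX: "ennreal ((T * 2 ^ Suc i) powr d) * emeasure M (X i) <= ennreal (T powr d * m * 2 powr d * q ^ i)" for i
  proof -
   have pos: "T * 2 ^ i > 0" using T by simp
   have "emeasure M (X i) <= ennreal (L / (T * 2 ^ i))"
   proof -
    have "ennreal (T * 2 ^ i) * emeasure M (X i) <= ennreal (T * 2 ^ i) * ennreal (L / (T * 2 ^ i))"
     using wk[OF pos] pos L unfolding X_def by (simp flip: ennreal_mult)
    then show ?thesis using pos by (subst (asm) ennreal_mult_le_mult_iff) auto
   qed
   then have "ennreal ((T * 2 ^ Suc i) powr d) * emeasure M (X i) <= ennreal ((T * 2 ^ Suc i) powr d) * ennreal (L / (T * 2 ^ i))"
    by (rule mult_left_mono) simp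
   also have "... = ennreal ((T * 2 ^ Suc i) powr d * (L / (T * 2 ^ i)))" using pos L by (simp flip: ennreal_mult)
   also have "(T * 2 ^ Suc i) powr d * (L / (T * 2 ^ i)) = T powr d * m * 2 powr d * q ^ i"
   proof -
    have "(2 ^ i) powr d = (2 powr d) ^ i" using powr_realpow[of 2 i] powr_realpow[of "2 powr d" i]
     by (metis mult.commute powr_gt_zero powr_powr zero_less_numeral)
    moreover have "2 powr d = q * 2" by (simp add: q_def powr_diff)
    ultimately have "(T * 2 ^ Suc i) powr d = T powr d * 2 powr d * (q ^ i * 2 ^ i)"
     using T by (simp only: power_Suc powr_mult power_mult_distrib[symmetric] mult.assoc)
    moreover have "L / (T * 2 ^ i) = m / 2 ^ i" using m L by (simp add: T_def)
    ultimately show ?thesis by simp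
   qed
   finally show ?thesis .
  qed
  have "(\<integral>\<^sup>+x\<in>A. ennreal_powr (f x) d \<partial>M) <= (\<integral>\<^sup>+x. ennreal (T powr d) * indicator A x +
    (\<integral>\<^sup>+i. ennreal ((T * 2 ^ Suc i) powr d) * indicator (X i) x \<partial>count_space UNIV) \<partial>M)"
  proof (intro nn_integral_mono)
   fix x
   show "ennreal_powr (f x) d * indicator A x <= ennreal (T powr d) * indicator A x +
    (\<integral>\<^sup>+i. ennreal ((T * 2 ^ Suc i) powr d) * indicator (X i) x \<partial>count_space UNIV)"
   proof (cases "x \<in> A")
    case True
    have "(\<integral>\<^sup>+i. (if ennreal (T * 2 ^ i) < f x then ennreal ((T * 2 ^ Suc i) powr d) else 0) \<partial>count_space (UNIV :: nat set))
     = (\<integral>\<^sup>+i. ennreal ((T * 2 ^ Suc i) powr d) * indicator (X i) x \<partial>count_space UNIV)"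
     using True by (intro nn_integral_cong) (auto simp: X_def indicator_def)
    then show ?thesis using powr_le_level_sum_nat[OF d(1) T, of "f x"] True by simp
   qed simp
  qed
  also have "... = ennreal (T powr d) * emeasure M A +
    (\<integral>\<^sup>+x. (\<integral>\<^sup>+i. ennreal ((T * 2 ^ Suc i) powr d) * indicator (X i) x \<partial>count_space UNIV) \<partial>M)"
   using A X by (subst nn_integral_add) (auto simp: nn_integral_cmult_indicator intro!: borel_measurable_nn_integral_count_space)
  also have "(\<integral>\<^sup>+x. (\<integral>\<^sup>+i. ennreal ((T * 2 ^ Suc i) powr d) * indicator (X i) x \<partial>count_space UNIV) \<partial>M)
    = (\<integral>\<^sup>+i. (\<integral>\<^sup>+x. ennreal ((T * 2 ^ Suc i) powr d) * indicator (X i) x \<partial>M) \<partial>count_space UNIV)"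
   using X by (intro nn_integral_count_space_nn_integral) auto
  also have "... = (\<integral>\<^sup>+i. ennreal ((T * 2 ^ Suc i) powr d) * emeasure M (X i) \<partial>count_space UNIV)"
   using X by (simp add: nn_integral_cmult_indicator)
  also have "... <= (\<integral>\<^sup>+i. ennreal (T powr d * m * 2 powr d * q ^ i) \<partial>count_space UNIV)"
   by (intro nn_integral_mono EX)
  also have "... = ennreal (T powr d * m * 2 powr d / (1 - q))"
   using m q by (intro nn_integral_geometric_nat) auto
  also have "ennreal (T powr d) * emeasure M A <= ennreal (T powr d) * ennreal m"
   using mA by (intro mult_left_mono) auto
  also have "ennreal (T powr d) * ennreal m + ennreal (T powr d * m * 2 powr d / (1 - q)) = ennreal (C * (T powr d * m))"
   using m q by (simp add: C_def algebra_simps add_divide_distrib flip: ennreal_mult ennreal_plus)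
  also have "T powr d * m = m powr (1 - d) * L powr d"
   using m L by (simp add: T_def powr_divide powr_diff)
  finally show ?thesis by (simp add: mult.assoc add_right_mono)
 qed
 have "(\<integral>\<^sup>+x\<in>A. ennreal_powr (f x) d \<partial>M) <= ennreal (C * (m + 1 / real (Suc n)) powr (1 - d) * (L + 1 / real (Suc n)) powr d)" for n
  \<comment> \<open>The cut L / m requires both numbers to be positive; they are enlarged by 1/(n +
    1) and the bound passes to the limit.\<close>
  proof (rule main)
   show "0 < m + 1 / real (Suc n)" "0 < L + 1 / real (Suc n)" using m L by (simp_all add: add_nonneg_pos)
   show "emeasure M A <= ennreal (m + 1 / real (Suc n))"
    using mA by (rule order_trans) (auto intro!: ennreal_leI)
   show "ennreal t * emeasure M {x\<in>A. ennreal t < f x} <= ennreal (L + 1 / real (Suc n))" if "t > 0" for t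
    using wk[OF that] by (rule order_trans) (auto intro!: ennreal_leI)
  qed
  moreover have "(\<lambda>n. ennreal (C * (m + 1 / real (Suc n)) powr (1 - d) * (L + 1 / real (Suc n)) powr d))
   \<longlonglongrightarrow> ennreal (C * (m + 0) powr (1 - d) * (L + 0) powr d)"
  proof -
   have *: "(\<lambda>n. 1 / real (Suc n)) \<longlonglongrightarrow> 0" using LIMSEQ_inverse_real_of_nat by (simp add: inverse_eq_divide)
   have "(\<lambda>n. (z + 1 / real (Suc n)) powr e) \<longlonglongrightarrow> (z + 0) powr e" if "z >= 0" "e > 0" for z e :: real
    using that by (intro tendsto_powr' tendsto_intros *) (auto simp: add_nonneg_nonneg)
   then show ?thesis using m L d by (intro tendsto_ennrealI tendsto_mult tendsto_const) auto
  qed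
  ultimately have "(\<integral>\<^sup>+x\<in>A. ennreal_powr (f x) d \<partial>M) <= ennreal (C * m powr (1 - d) * L powr d)"
   by (intro LIMSEQ_le_const[of _ "ennreal (C * m powr (1 - d) * L powr d)"]) auto
 then show ?thesis by (simp add: kolC_def C_def q_def)
qed

subsection \<open>Weighted maximal functions\<close>

definition avg :: "(real ^ 'n => real) => (real ^ 'n) set => (real ^ 'n => ennreal) => ennreal" where
 "avg a Q g = (\<integral>\<^sup>+y\<in>Q. g y \<partial>mw a) / emeasure (mw a) Q"

text \<open>The maximal operator of the measure a dx. The weight 1 gives the Hardy-Littlewood
  operator; the extrapolation uses a general doubling weight, for which this operator is bounded on
  L^p(a dx) for every p > 1 without an A_p condition.\<close>

definition Mx :: "(real ^ 'n => real) => (real ^ 'n => ennreal) => real ^ 'n => ennreal" where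
 "Mx a g x = (SUP Q\<in>{Q. axis_cube Q \<and> x \<in> Q}. avg a Q g)"

abbreviation (input) HL :: "(real ^ 'n => ennreal) => real ^ 'n => ennreal" where
 "HL \<equiv> Mx (\<lambda>_. 1)"

lemma maximal_fun_eq_Mx: "maximal_fun f x = HL (\<lambda>y. ennreal (norm (f y))) x"
 by (simp add: maximal_fun_def Mx_def average_def avg_def mw_one)

lemma ennreal_divide_le_iff:
 assumes "0 < b" "b < (top::ennreal)" shows "a / b <= c \<longleftrightarrow> a <= c * b"
proof
 assume "a / b <= c"
 then have "a / b * b <= c * b" by (rule mult_right_mono) simp
 then show "a <= c * b" using assms by (simp add: ennreal_divide_times)
next
 assume "a <= c * b" then show "a / b <= c" using assms by (intro divide_le_posI_ennreal) (auto simp: mult.commute)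
qed

lemma avg_le_iff:
 assumes "wt a" "s > 0"
 shows "avg a (cub c s) g <= t \<longleftrightarrow> (\<integral>\<^sup>+y\<in>cub c s. g y \<partial>mw a) <= t * emeasure (mw a) (cub c s)"
 using wtD(3,4)[OF assms, of c] unfolding avg_def by (intro ennreal_divide_le_iff) auto

lemma Mx_greater: "t < Mx a g x \<longleftrightarrow> (\<exists>c s. s > 0 \<and> x \<in> cub c s \<and> t < avg a (cub c s) g)"
 by (auto simp: Mx_def less_SUP_iff axis_cube_iff)

lemma avg_le_Mx: "s > 0 ==> x \<in> cub c s ==> avg a (cub c s) g <= Mx a g x"
 unfolding Mx_def by (rule SUP_upper) simp

lemma Mx_le: "(\<And>c s. s > 0 ==> x \<in> cub c s ==> avg a (cub c s) g <= t) ==> Mx a g x <= t"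
 unfolding Mx_def by (rule SUP_least) (auto simp: axis_cube_iff)

lemma avg_mono_AE:
 assumes "AE x in mw a. g x <= h x" shows "avg a Q g <= avg a Q h"
 unfolding avg_def using assms
 by (intro divide_right_mono_ennreal nn_integral_mono_AE) (auto elim!: eventually_mono simp: indicator_def)

lemma Mx_mono_AE:
 assumes "AE x in mw a. g x <= h x" shows "Mx a g x <= Mx a h x"
 by (intro Mx_le order_trans[OF avg_mono_AE[OF assms] avg_le_Mx])

lemma avg_add:
 assumes "lmeas g" "lmeas h" "Q \<in> sets lebesgue"
 shows "avg a Q (\<lambda>x. g x + h x) = avg a Q g + avg a Q h"
 using assms by (simp add: avg_def distrib_right nn_integral_add add_divide_distrib_ennreal)

lemma avg_const:
 assumes "wt a" "s > 0" shows "avg a (cub c s) (\<lambda>_. k) = k"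
 using wtD(3,4)[OF assms, of c] by (simp add: avg_def nn_integral_cmult_indicator ennreal_mult_divide_eq)

text \<open>Since cubes are closed, a cube with average above t is enlarged slightly. Continuity
  from above of its mass keeps the average above t, and the enlarged cube contains a ball around
  x.\<close>

lemma open_Mx:
 assumes "wt a" shows "open {x. t < Mx a g x}"
proof (rule openI)
 fix x assume "x \<in> {x. t < Mx a g x}"
 then obtain c s where c: "s > 0" "x \<in> cub c s" "t < avg a (cub c s) g" by (auto simp: Mx_greater)
 define Q where "Q k = cub (c - (\<chi> i. 1 / real (Suc k))) (s + 2 / real (Suc k))" for k
 define I where "I = (\<integral>\<^sup>+y\<in>cub c s. g y \<partial>mw a)"
 have spos: "s + 2 / real (Suc k) > 0" for k using c by (simp add: add_pos_nonneg)
 have Qsub: "cub c s \<subseteq> Q k" for k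
 proof -
  have "2 / real (Suc k) = 1 / real (Suc k) + 1 / real (Suc k)" by (simp flip: add_divide_distrib)
  moreover have "1 / real (Suc k) >= 0" by simp
  ultimately show ?thesis unfolding Q_def using c
   by (subst cub_subset_iff) (auto simp del: of_nat_Suc)
 qed
 have dec: "decseq Q"
  unfolding decseq_def
 proof (intro allI impI)
  fix k l :: nat assume "k <= l"
  then have "1 / real (Suc l) <= 1 / real (Suc k)" by (simp add: frac_le)
  moreover have "2 / real (Suc i) = 1 / real (Suc i) + 1 / real (Suc i)" for i by (simp flip: add_divide_distrib)
  ultimately show "Q l \<subseteq> Q k" unfolding Q_def using spos[of l]
   by (subst cub_subset_iff) (auto simp del: of_nat_Suc)
 qed
 have INT: "(\<Inter>k. Q k) = cub c s"
 proof (intro equalityI subsetI)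
  fix y assume y: "y \<in> (\<Inter>k. Q k)"
  have "c $ i <= y $ i \<and> y $ i <= c $ i + s" for i
  proof -
   have "c $ i - 1 / real (Suc k) <= y $ i \<and> y $ i <= c $ i + s + 1 / real (Suc k)" for k
   proof -
    have "y \<in> Q k" using y by blast
    then have "c $ i - 1 / real (Suc k) <= y $ i \<and> y $ i <= c $ i - 1 / real (Suc k) + (s + 2 / real (Suc k))"
     by (simp add: Q_def mem_cub)
    moreover have "2 / real (Suc k) = 1 / real (Suc k) + 1 / real (Suc k)" by (simp flip: add_divide_distrib)
    ultimately show ?thesis by linarith
   qed
   then have *: "c $ i - inverse (real (Suc k)) <= y $ i" "y $ i - (c $ i + s) <= inverse (real (Suc k))" for k
    by (simp_all add: inverse_eq_divide algebra_simps)
   have "c $ i - 0 <= y $ i"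
    by (rule LIMSEQ_le_const2[OF tendsto_diff[OF tendsto_const LIMSEQ_inverse_real_of_nat]]) (use * in auto)
   moreover have "y $ i - (c $ i + s) <= 0"
    by (rule LIMSEQ_le_const[OF LIMSEQ_inverse_real_of_nat]) (use * in auto)
   ultimately show ?thesis by simp
  qed
  then show "y \<in> cub c s" by (simp add: mem_cub)
 qed (use Qsub in auto)
 have fin: "emeasure (mw a) (Q k) \<noteq> \<infinity>" for k
  unfolding Q_def using wtD(4)[OF assms spos] by (metis infinity_ennreal_def less_irrefl)
 have Qs: "range Q \<subseteq> sets (mw a)" by (auto simp: Q_def)
 have lim: "(\<lambda>k. emeasure (mw a) (Q k)) \<longlonglongrightarrow> emeasure (mw a) (cub c s)"
  unfolding INT[symmetric] by (rule Lim_emeasure_decseq) (use dec fin Qs in auto)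
 have "t < top" using c(3) by (meson order_less_le_trans top_greatest)
 then have lim2: "(\<lambda>k. t * emeasure (mw a) (Q k)) \<longlonglongrightarrow> t * emeasure (mw a) (cub c s)"
  by (intro ennreal_tendsto_cmult lim) 
 have "\<exists>k. t * emeasure (mw a) (Q k) < I"
 proof (rule ccontr)
  assume "\<nexists>k. t * emeasure (mw a) (Q k) < I"
  then have "I <= t * emeasure (mw a) (cub c s)" using lim2 by (intro LIMSEQ_le_const) (auto simp: not_less)
  then show False using c avg_le_iff[OF assms c(1), of c g t] by (simp add: I_def not_le[symmetric])
 qed
 then obtain k where k: "t * emeasure (mw a) (Q k) < I" by blast
 have "I <= (\<integral>\<^sup>+y\<in>Q k. g y \<partial>mw a)"
  unfolding I_def using Qsub[of k] by (intro nn_integral_mono) (auto simp: indicator_def)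
 then have tk: "t < avg a (Q k) g"
  using k avg_le_iff[OF assms spos, of "c - (\<chi> i. 1 / real (Suc k))" k g t] by (auto simp: Q_def not_le[symmetric])
 have "ball x (1 / real (Suc k)) \<subseteq> {x. t < Mx a g x}"
 proof
  fix y assume y: "y \<in> ball x (1 / real (Suc k))"
  have "\<bar>(y - x) $ i\<bar> < 1 / real (Suc k)" for i
   using y component_le_norm_cart[of "y - x" i] by (simp add: dist_norm norm_minus_commute)
  then have yx: "\<bar>y $ i - x $ i\<bar> < 1 / real (Suc k)" for i by simp
  have "c $ i - 1 / real (Suc k) <= y $ i \<and> y $ i <= c $ i - 1 / real (Suc k) + (s + 2 / real (Suc k))" for i
  proof -
   have "2 / real (Suc k) = 1 / real (Suc k) + 1 / real (Suc k)" by (simp flip: add_divide_distrib)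
   then show ?thesis using yx[of i] c(2)[unfolded mem_cub, rule_format, of i] by linarith
  qed
  then have "y \<in> Q k" by (simp add: Q_def mem_cub)
  then show "y \<in> {x. t < Mx a g x}"
   unfolding mem_Collect_eq Mx_greater using tk spos[of k] unfolding Q_def by blast
 qed
 then show "\<exists>e>0. ball x e \<subseteq> {x. t < Mx a g x}" by (intro exI[of _ "1 / real (Suc k)"]) auto
qed

lemma Mx_measurable [measurable]: "wt a ==> Mx a g \<in> borel_measurable lebesgue"
proof (rule borel_measurableI_greater)
 fix t assume "wt a"
 from open_Mx[OF this] have "{x. t < Mx a g x} \<in> sets borel" by simp
 then show "{x \<in> space lebesgue. t < Mx a g x} \<in> sets lebesgue" by simp
qed

section \<open>Weak-type and strong-type bounds for maximal functions of doubling weights\<close>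

interpretation G: grid "0 :: real ^ 'n" 1 by unfold_locales simp

lemma dblD: "dbl K w ==> s > 0 ==> t <= 16 * s ==> cub a s \<subseteq> cub b t ==>
  measure (mw w) (cub b t) <= K * measure (mw w) (cub a s)"
 by (auto simp: dbl_def)

lemma dblD_emeasure:
 assumes "wt w" "dbl K w" "K >= 0" "s > 0" "t <= 16 * s" "cub a s \<subseteq> cub b t"
 shows "emeasure (mw w) (cub b t) <= ennreal K * emeasure (mw w) (cub a s)"
 using dblD[OF assms(2,4,5,6)] assms by (simp add: wt_emeasure_eq flip: ennreal_mult)

lemma (in grid) emeasure_tri_le:
 assumes "wt w" "dbl K w" "K >= 0"
 shows "emeasure (mw w) (tri p) <= ennreal K * emeasure (mw w) (dq p)"
proof -
 have "emeasure (mw w) (tri p) <= ennreal K * emeasure (mw w) (cub (cn p) (sd (fst p)))"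
  unfolding tri_def using clo_subset_tri[of p] sd_pos[of "fst p"]
  by (intro dblD_emeasure assms) (auto simp: tri_def)
 then show ?thesis using emeasure_dq_clo[of w UNIV p] wtD(1)[OF assms(1)] by simp
qed

text \<open>The given cube is covered by the neighbours of the dyadic cube of comparable side around
  x, and all of them lie in the triple of that cube. If each neighbour had average at most \<tau>,
  summation and doubling for the triple would bound the average over the given cube by K \<tau>. The
  triple of each neighbour contains x.\<close>

lemma (in grid) dyadic_catch:
 assumes a: "wt a'" "dbl K a'" "K >= 1" and g: "lmeas g"
  and t: "t > 0" and x: "x \<in> cub c t" and big: "ennreal (K * \<tau>) < avg a' (cub c t) g" and tau: "\<tau> >= 0"
 shows "\<exists>p. t <= sd (fst p) \<and> sd (fst p) <= 2 * t \<and> x \<in> tri p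
  \<and> ennreal \<tau> * emeasure (mw a') (dq p) < (\<integral>\<^sup>+y\<in>dq p. g y \<partial>mw a')"
proof -
 obtain j0 :: int where "2 powr j0 <= t / s" "t / s < 2 powr (real_of_int j0 + 1)"
  using powr_level_le[of 2 "t / s"] t s by auto
 then have "s * 2 powi j0 <= t" "t < s * 2 powi (j0 + 1)"
  using s powr_real_of_int'[of 2 j0] powr_real_of_int'[of 2 "j0 + 1"] by (simp_all add: field_simps)
 then obtain j where j: "t <= sd j" "sd j <= 2 * t"
  using sd_Suc[of j0] unfolding sd_def[symmetric] by (intro that[of "j0 + 1"]) auto
 define N where "N = {m. \<forall>i. \<bar>m $ i - ix j x $ i\<bar> <= 1}"
 define P where "P = Pair j ` N"
 have trix: "x \<in> tri p" "dq p \<subseteq> tri (j, ix j x)" "fst p = j" if "p \<in> P" for p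
 proof -
  obtain m where m: "p = (j, m)" "\<And>i. \<bar>m $ i - ix j x $ i\<bar> <= 1" using \<open>p \<in> P\<close> by (auto simp: P_def N_def)
  show "fst p = j" using m by simp
  have near: "cn p $ i <= cn (j, ix j x) $ i + sd j" "cn (j, ix j x) $ i <= cn p $ i + sd j" for i
  proof -
   have "real_of_int (m $ i) <= real_of_int (ix j x $ i + 1)" "real_of_int (ix j x $ i) <= real_of_int (m $ i + 1)"
    using m(2)[of i] by (simp_all only: of_int_le_iff)
   then have "sd j * real_of_int (m $ i) <= sd j * real_of_int (ix j x $ i + 1)" 
    "sd j * real_of_int (ix j x $ i) <= sd j * real_of_int (m $ i + 1)" by (auto intro!: mult_left_mono)
   then show "cn p $ i <= cn (j, ix j x) $ i + sd j" "cn (j, ix j x) $ i <= cn p $ i + sd j"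
    by (simp_all add: cn_def m(1) distrib_left)
  qed
  have xd: "cn (j, ix j x) $ i <= x $ i \<and> x $ i < cn (j, ix j x) $ i + sd j" for i
   using mem_dq_ix[of x j] by (simp add: mem_dq)
  have "cn p $ i - sd j <= x $ i \<and> x $ i <= cn p $ i - sd j + 3 * sd j" for i
   using xd[of i] near[of i] by linarith
  then show "x \<in> tri p" by (simp add: tri_def mem_cub m(1))
  show "dq p \<subseteq> tri (j, ix j x)"
  proof
   fix y assume "y \<in> dq p"
   then have yd: "cn p $ i <= y $ i \<and> y $ i < cn p $ i + sd j" for i by (simp add: mem_dq m(1))
   have "cn (j, ix j x) $ i - sd j <= y $ i \<and> y $ i <= cn (j, ix j x) $ i - sd j + 3 * sd j" for i
    using yd[of i] near[of i] by linarith
   then show "y \<in> tri (j, ix j x)" by (simp add: tri_def mem_cub)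
  qed
 qed
 have cov: "cub c t \<subseteq> (\<Union>p\<in>P. dq p)"
 proof
  fix y assume y: "y \<in> cub c t"
  have "\<bar>ix j y $ i - ix j x $ i\<bar> <= 1" for i
  proof -
   have "\<bar>y $ i - x $ i\<bar> <= sd j"
    using y[unfolded mem_cub, rule_format, of i] x[unfolded mem_cub, rule_format, of i] j by linarith
   then have "\<bar>(y $ i - a $ i) / sd j - (x $ i - a $ i) / sd j\<bar> <= 1"
    using sd_pos[of j] by (simp add: abs_divide flip: diff_divide_distrib)
   then show ?thesis by (simp add: ix_def) linarith
  qed
  then have "(j, ix j y) \<in> P" by (auto simp: P_def N_def)
  then show "y \<in> (\<Union>p\<in>P. dq p)" using mem_dq_ix by blast
 qed
 have sub: "(\<Union>p\<in>P. dq p) \<subseteq> tri (j, ix j x)" using trix by blast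
 have disj: "disjoint_family_on dq P"
  by (auto simp: disjoint_family_on_def P_def mem_dq_pair)
 have sub2: "cub c t \<subseteq> tri (j, ix j x)" using cov sub by blast
 show ?thesis
 proof (rule ccontr)
  assume neg: "\<not> ?thesis"
  have le: "(\<integral>\<^sup>+y\<in>dq p. g y \<partial>mw a') <= ennreal \<tau> * emeasure (mw a') (dq p)" if "p \<in> P" for p
  proof (rule ccontr)
   assume "\<not> ?thesis"
   then have "ennreal \<tau> * emeasure (mw a') (dq p) < (\<integral>\<^sup>+y\<in>dq p. g y \<partial>mw a')" by simp
   moreover have "t <= sd (fst p)" "sd (fst p) <= 2 * t" using j trix(3)[OF that] by simp_all
   ultimately show False using neg trix(1)[OF that] by blast
  qed
  define \<nu> where "\<nu> = density (mw a') g"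
  define \<mu> where "\<mu> = density (mw a') (\<lambda>_. ennreal \<tau>)"
  have sets: "sets \<nu> = sets lebesgue" "sets \<mu> = sets lebesgue" by (simp_all add: \<nu>_def \<mu>_def)
  have nu: "emeasure \<nu> X = (\<integral>\<^sup>+y\<in>X. g y \<partial>mw a')" if "X \<in> sets lebesgue" for X
   using that g by (simp add: \<nu>_def emeasure_density)
  have mu: "emeasure \<mu> X = ennreal \<tau> * emeasure (mw a') X" if "X \<in> sets lebesgue" for X
   using that by (simp add: \<mu>_def emeasure_density_const)
  have "(\<integral>\<^sup>+y\<in>cub c t. g y \<partial>mw a') <= emeasure \<nu> (\<Union>p\<in>P. dq p)"
   using cov by (subst nu[symmetric]) (auto intro!: emeasure_mono sets.countable_UN' simp: sets)
  also have "... <= emeasure \<mu> (\<Union>p\<in>P. dq p)"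
   using disj le by (intro emeasure_UN_disjoint_mono) (auto simp: sets nu mu)
  also have "... <= emeasure \<mu> (tri (j, ix j x))"
   using sub by (intro emeasure_mono) (auto simp: sets tri_def)
  also have "... = ennreal \<tau> * emeasure (mw a') (tri (j, ix j x))" by (rule mu) (simp add: tri_def)
  also have "... <= ennreal \<tau> * (ennreal K * emeasure (mw a') (cub c t))"
   using sub2 j a t unfolding tri_def by (intro mult_left_mono dblD_emeasure) (auto simp: tri_def)
  also have "... = ennreal (K * \<tau>) * emeasure (mw a') (cub c t)"
   using a tau by (simp add: ennreal_mult mult_ac)
  finally have "avg a' (cub c t) g <= ennreal (K * \<tau>)" using avg_le_iff[OF a(1) t] by simp
  then show False using big by simp
 qed
qed

text \<open>Covering by triples of maximal cubes, first for cubes of bounded size and then in the limit.\<close>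

lemma (in grid) cover_bound:
 assumes sets: "sets M = sets lebesgue" "sets N = sets lebesgue" and X: "X \<in> sets lebesgue"
  and le: "\<And>p. p \<in> S ==> emeasure M (X \<inter> tri p) <= emeasure N (dq p)"
 shows "emeasure M (X \<inter> (\<Union>p\<in>S. tri p)) <= emeasure N (\<Union>p\<in>S. dq p)"
proof -
 define S' where "S' R = {p\<in>S. fst p <= int R}" for R :: nat
 have "(\<Union>R. X \<inter> (\<Union>p\<in>S' R. tri p)) = X \<inter> (\<Union>p\<in>S. tri p)"
 proof -
  have "(\<Union>R. S' R) = S"
  proof (intro equalityI subsetI)
   fix p assume "p \<in> S" then have "p \<in> S' (nat (fst p))" by (simp add: S'_def)
   then show "p \<in> (\<Union>R. S' R)" by blast
  qed (auto simp: S'_def)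
  then show ?thesis by blast
 qed
 moreover have "incseq (\<lambda>R. X \<inter> (\<Union>p\<in>S' R. tri p))"
  by (force simp: incseq_def S'_def)
 moreover have trisets: "tri p \<in> sets lebesgue" for p by (simp add: tri_def)
 have UNsets: "(\<Union>p\<in>A. tri p) \<in> sets lebesgue" "(\<Union>p\<in>A. dq p) \<in> sets lebesgue" for A
  using trisets by (auto intro!: sets.countable_UN')
 ultimately have eq: "(SUP R. emeasure M (X \<inter> (\<Union>p\<in>S' R. tri p))) = emeasure M (X \<inter> (\<Union>p\<in>S. tri p))"
  using X sets UNsets by (subst SUP_emeasure_incseq) auto
 have "emeasure M (X \<inter> (\<Union>p\<in>S' R. tri p)) <= emeasure N (\<Union>p\<in>S. dq p)" for R
 proof -
  have bd: "\<And>q. q \<in> S' R ==> fst q <= int R" by (simp add: S'_def)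
  have mS: "p \<in> S" if "p \<in> maxi (S' R)" for p using that maxi_subset by (auto simp: S'_def)
  have sub: "X \<inter> (\<Union>p\<in>S' R. tri p) \<subseteq> (\<Union>p\<in>maxi (S' R). X \<inter> tri p)"
  proof
   fix x assume "x \<in> X \<inter> (\<Union>p\<in>S' R. tri p)"
   then obtain p where p: "x \<in> X" "p \<in> S' R" "x \<in> tri p" by blast
   obtain q where "q \<in> maxi (S' R)" "fst p <= fst q" "dq p \<subseteq> dq q" using maxi_above[OF p(2) bd] by blast
   then show "x \<in> (\<Union>p\<in>maxi (S' R). X \<inter> tri p)" using tri_mono p by blast
  qed
  have "emeasure M (X \<inter> (\<Union>p\<in>S' R. tri p)) <= emeasure M (\<Union>p\<in>maxi (S' R). X \<inter> tri p)"
   using sub X sets trisets by (intro emeasure_mono) (auto intro!: sets.countable_UN')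
  also have "... <= (\<integral>\<^sup>+p. emeasure M (X \<inter> tri p) \<partial>count_space (maxi (S' R)))"
   using X sets trisets by (intro emeasure_UN_le) auto
  also have "... <= (\<integral>\<^sup>+p. emeasure N (dq p) \<partial>count_space (maxi (S' R)))"
   using le mS by (intro nn_integral_mono) auto
  also have "... = emeasure N (\<Union>p\<in>maxi (S' R). dq p)"
   using sets maxi_disjoint by (intro emeasure_UN_countable[symmetric]) auto
  also have "... <= emeasure N (\<Union>p\<in>S. dq p)"
   using mS sets UNsets by (intro emeasure_mono) auto
  finally show ?thesis .
 qed
 then show ?thesis unfolding eq[symmetric] by (intro SUP_least) auto
qed

text \<open>One factor K is lost in replacing an arbitrary cube by a dyadic one, the other in
  returning from triples to the dyadic cubes themselves.\<close>

lemma Mx_weak_type: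
 fixes a :: "real ^ 'n => real"
 assumes a: "wt a" "dbl K a" "K >= 1" and g: "lmeas g" and t: "\<tau> > 0"
 shows "ennreal \<tau> * emeasure (mw a) {x. ennreal (K * \<tau>) < Mx a g x} <= ennreal K * (\<integral>\<^sup>+x. g x \<partial>mw a)"
proof -
 define S where "S = {p. ennreal \<tau> * emeasure (mw a) (G.dq p) < (\<integral>\<^sup>+y\<in>G.dq p. g y \<partial>mw a)}"
 define M where "M = density (mw a) (\<lambda>_. ennreal \<tau>)"
 define N where "N = density (mw a) (\<lambda>x. ennreal K * g x)"
 have sets: "sets M = sets lebesgue" "sets N = sets lebesgue" by (simp_all add: M_def N_def)
 have M: "emeasure M X = ennreal \<tau> * emeasure (mw a) X" if "X \<in> sets lebesgue" for X
  using that by (simp add: M_def emeasure_density_const)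
 have N: "emeasure N X = ennreal K * (\<integral>\<^sup>+y\<in>X. g y \<partial>mw a)" if "X \<in> sets lebesgue" for X
  using that g by (simp add: N_def emeasure_density nn_integral_cmult mult.assoc)
 have sub: "{x. ennreal (K * \<tau>) < Mx a g x} \<subseteq> UNIV \<inter> (\<Union>p\<in>S. G.tri p)"
 proof
  fix x assume "x \<in> {x. ennreal (K * \<tau>) < Mx a g x}"
  then obtain c s where "s > 0" "x \<in> cub c s" "ennreal (K * \<tau>) < avg a (cub c s) g" by (auto simp: Mx_greater)
  from G.dyadic_catch[OF a g this less_imp_le[OF t]] show "x \<in> UNIV \<inter> (\<Union>p\<in>S. G.tri p)" by (auto simp: S_def)
 qed
 have trisets: "(\<Union>p\<in>S. G.tri p) \<in> sets lebesgue" "(\<Union>p\<in>S. G.dq p) \<in> sets lebesgue"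
  by (auto intro!: sets.countable_UN' simp: G.tri_def)
 have Mset: "{x. ennreal (K * \<tau>) < Mx a g x} \<in> sets lebesgue"
  using open_Mx[OF a(1)] by simp
 have "ennreal \<tau> * emeasure (mw a) {x. ennreal (K * \<tau>) < Mx a g x} = emeasure M {x. ennreal (K * \<tau>) < Mx a g x}"
  using Mset by (rule M[symmetric])
 also have "... <= emeasure M (UNIV \<inter> (\<Union>p\<in>S. G.tri p))"
  using sub trisets sets by (intro emeasure_mono) auto
 also have "... <= emeasure N (\<Union>p\<in>S. G.dq p)"
 proof (rule G.cover_bound)
  fix p assume "p \<in> S"
  have "emeasure M (UNIV \<inter> G.tri p) = ennreal \<tau> * emeasure (mw a) (G.tri p)" by (simp add: M G.tri_def)
  also have "... <= ennreal \<tau> * (ennreal K * emeasure (mw a) (G.dq p))"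
   using a by (intro mult_left_mono G.emeasure_tri_le) auto
  also have "... = ennreal K * (ennreal \<tau> * emeasure (mw a) (G.dq p))" by (simp add: mult_ac)
  also have "... <= ennreal K * (\<integral>\<^sup>+y\<in>G.dq p. g y \<partial>mw a)"
   using \<open>p \<in> S\<close> by (intro mult_left_mono) (auto simp: S_def)
  also have "... = emeasure N (G.dq p)" by (simp add: N)
  finally show "emeasure M (UNIV \<inter> G.tri p) <= emeasure N (G.dq p)" .
 qed (use sets in auto)
 also have "... = ennreal K * (\<integral>\<^sup>+y\<in>(\<Union>p\<in>S. G.dq p). g y \<partial>mw a)" by (rule N[OF trisets(2)])
 also have "... <= ennreal K * (\<integral>\<^sup>+y. g y \<partial>mw a)"
  by (intro mult_left_mono nn_integral_mono) (auto simp: indicator_def)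
 finally show ?thesis .
qed

text \<open>On the set where Mx \<le> q < r < g every dyadic average of g around a point is at most
  q, so the covering form of differentiation bounds the integral of g over it by q times its mass.
  As g > r there, the bounded pieces of the set are null. Rational q and r exhaust the exceptional
  set.\<close>

lemma Mx_ge_AE:
 fixes a :: "real ^ 'n => real"
 assumes a: "wt a" and g: "lmeas g"
 shows "AE x in mw a. g x <= Mx a g x"
proof -
 have null: "AE x in mw a. \<not> (Mx a g x <= ennreal q \<and> ennreal r < g x)"
  if "0 <= q" "q < r" for q r :: real
 proof -
  define H where "H k = {x. Mx a g x <= ennreal q \<and> ennreal r < g x} \<inter> big k" for k
  have "{x \<in> space lebesgue. Mx a g x <= ennreal q \<and> ennreal r < g x} \<in> sets lebesgue"
   using Mx_measurable[OF a, of g] g by measurable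
  then have H: "H k \<in> sets lebesgue" for k by (auto simp: H_def big_def)
  have "emeasure (mw a) (H k) = 0" for k
  proof -
   have "emeasure (density (mw a) g) (H k) <= emeasure (density (mw a) (\<lambda>_. ennreal q)) (H k)"
   proof (rule G.dyadic_compare[where J = 0])
    have bm: "lmeas a" using wtD a by blast
    have "density (mw a) (\<lambda>_. ennreal q) = density lebesgue (\<lambda>x. ennreal (a x) * ennreal q)"
     unfolding mw_def using bm by (subst density_density_eq) auto
    then show "absolutely_continuous lebesgue (density (mw a) (\<lambda>_. ennreal q))"
     using bm by (auto intro!: absolutely_continuousI_density)
    show "emeasure (density (mw a) (\<lambda>_. ennreal q)) (big k) < \<infinity>" for k
     using wt_finite[OF a, of "big k"] by (simp add: emeasure_density_const ennreal_mult_less_top big_def)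
    fix x and j :: int assume x: "x \<in> H k"
    let ?p = "(j, G.ix j x)"
    have "avg a (cub (G.cn ?p) (G.sd j)) g <= Mx a g x"
     using G.dq_subset_clo[of ?p] G.mem_dq_ix[of x j] by (intro avg_le_Mx) auto
    also have "... <= ennreal q" using x by (simp add: H_def)
    finally have "(\<integral>\<^sup>+y\<in>cub (G.cn ?p) (G.sd j). g y \<partial>mw a) <= ennreal q * emeasure (mw a) (cub (G.cn ?p) (G.sd j))"
     using avg_le_iff[OF a G.sd_pos] by simp
    moreover have "(\<integral>\<^sup>+y\<in>G.dq ?p. g y \<partial>mw a) <= (\<integral>\<^sup>+y\<in>cub (G.cn ?p) (G.sd j). g y \<partial>mw a)"
     using G.dq_subset_clo[of ?p] by (intro nn_integral_mono) (auto simp: indicator_def)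
    moreover have "emeasure (mw a) (cub (G.cn ?p) (G.sd j)) = emeasure (mw a) (G.dq ?p)"
     using G.emeasure_dq_clo[of a UNIV ?p] bm by simp
    ultimately show "emeasure (density (mw a) g) (G.dq ?p) <= emeasure (density (mw a) (\<lambda>_. ennreal q)) (G.dq ?p)"
     using g by (simp add: emeasure_density emeasure_density_const nn_integral_cmult_indicator)
   qed (use H in auto)
   then have "(\<integral>\<^sup>+y\<in>H k. g y \<partial>mw a) <= ennreal q * emeasure (mw a) (H k)"
    using g H by (simp add: emeasure_density emeasure_density_const nn_integral_cmult_indicator)
   moreover have "ennreal r * emeasure (mw a) (H k) <= (\<integral>\<^sup>+y\<in>H k. g y \<partial>mw a)"
   proof -
    have "ennreal r * emeasure (mw a) (H k) = (\<integral>\<^sup>+y\<in>H k. ennreal r \<partial>mw a)"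
     using H by (simp add: nn_integral_cmult_indicator)
    also have "... <= (\<integral>\<^sup>+y\<in>H k. g y \<partial>mw a)"
     by (intro nn_integral_mono) (auto simp: indicator_def H_def)
    finally show ?thesis .
   qed
   ultimately have "ennreal r * emeasure (mw a) (H k) <= ennreal q * emeasure (mw a) (H k)" by order
   moreover have "emeasure (mw a) (H k) = ennreal (measure (mw a) (H k))"
    by (rule wt_emeasure_eq[OF a]) (auto simp: H_def big_def intro: bounded_subset[OF bounded_cub])
   ultimately have "r * measure (mw a) (H k) <= q * measure (mw a) (H k)"
    using that by (simp flip: ennreal_mult)
   then have "(r - q) * measure (mw a) (H k) <= 0" by (simp add: algebra_simps)
   then have "measure (mw a) (H k) = 0" using that by (simp add: mult_le_0_iff antisym)
   then show ?thesis using \<open>emeasure (mw a) (H k) = ennreal (measure (mw a) (H k))\<close> by simp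
  qed
  then have "AE x in mw a. x \<notin> H k" for k using H by (intro AE_not_in) (auto simp: null_sets_def)
  then have "AE x in mw a. \<forall>k. x \<notin> H k" by (simp add: AE_all_countable)
  then show ?thesis
   by (rule eventually_mono) (use UN_big in \<open>force simp: H_def\<close>)
 qed
 have "AE x in mw a. \<forall>qr\<in>{(q, r) \<in> \<rat> \<times> \<rat>. 0 <= q \<and> q < r}. \<not> (Mx a g x <= ennreal (fst qr) \<and> ennreal (snd qr) < g x)"
 proof (subst AE_ball_countable)
  show "countable {(q, r) \<in> \<rat> \<times> \<rat>. 0 <= q \<and> (q::real) < r}"
   by (rule countable_subset[of _ "\<rat> \<times> \<rat>"]) (auto intro: countable_rat)
 qed (use null in auto)
 then show ?thesis
 proof (rule eventually_mono)
  fix x assume *: "\<forall>qr\<in>{(q, r) \<in> \<rat> \<times> \<rat>. 0 <= q \<and> q < r}. \<not> (Mx a g x <= ennreal (fst qr) \<and> ennreal (snd qr) < g x)"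
  show "g x <= Mx a g x"
  proof (rule ccontr)
   assume "\<not> g x <= Mx a g x"
   then have lt: "Mx a g x < g x" by simp
   obtain z where z: "Mx a g x < z" "z < g x" using dense[OF lt] by blast
   obtain m where m: "Mx a g x = ennreal m" "m >= 0" using z by (cases "Mx a g x") auto
   obtain z' where z': "z = ennreal z'" "z' >= 0" using z by (cases z) auto
   have "m < z'" using z m z' by (simp add: ennreal_less_iff)
   obtain q where q: "q \<in> \<rat>" "m < q" "q < z'" using Rats_dense_in_real[OF \<open>m < z'\<close>] by blast
   obtain r where r: "r \<in> \<rat>" "q < r" "r < z'" using Rats_dense_in_real[OF q(3)] by blast
   have "Mx a g x <= ennreal q" using m q by (simp add: ennreal_leI)
   moreover have "ennreal r < g x" using z z' r by (meson ennreal_leI less_imp_le order_le_less_trans)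
   ultimately show False using *[rule_format, of "(q, r)"] q r m by auto
  qed
 qed
qed

lemma Mx_set [simp]: "wt a ==> {x. t < Mx a g x} \<in> sets lebesgue"
 using borel_open[OF open_Mx, of a t g] by simp

lemma lebesgue_Collect: "Measurable.pred lebesgue P ==> {x. P x} \<in> sets lebesgue"
 by (simp add: pred_def)

text \<open>Discarding the values of g up to \<tau> changes every average by at most \<tau> \<le> K
  \<tau>. Only the large values of g remain on the right, which is what makes the summation over
  levels converge.\<close>

lemma Mx_level:
 fixes a :: "real ^ 'n => real"
 assumes a: "wt a" "dbl K a" "K >= 1" and g: "lmeas g" and t: "\<tau> > 0"
 shows "ennreal \<tau> * emeasure (mw a) {x. ennreal (2 * K * \<tau>) < Mx a g x}
  <= ennreal K * (\<integral>\<^sup>+x\<in>{x. ennreal \<tau> < g x}. g x \<partial>mw a)"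
proof -
 define g1 where "g1 x = g x * indicator {x. ennreal \<tau> < g x} x" for x
 have "{x \<in> space lebesgue. ennreal \<tau> < g x} \<in> sets lebesgue" using g by measurable
 then have g1: "lmeas g1" using g unfolding g1_def[abs_def] by simp
 have "{x. ennreal (2 * K * \<tau>) < Mx a g x} \<subseteq> {x. ennreal (K * \<tau>) < Mx a g1 x}"
 proof
  fix x assume "x \<in> {x. ennreal (2 * K * \<tau>) < Mx a g x}"
  then obtain c s where c: "s > 0" "x \<in> cub c s" "ennreal (2 * K * \<tau>) < avg a (cub c s) g"
   by (auto simp: Mx_greater)
  have "avg a (cub c s) g <= avg a (cub c s) (\<lambda>x. g1 x + ennreal \<tau>)"
   by (intro avg_mono_AE AE_I2) (auto simp: g1_def indicator_def not_less)
  also have "... = avg a (cub c s) g1 + ennreal \<tau>"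
   using g1 by (simp add: avg_add avg_const[OF a(1) c(1)])
  finally have *: "avg a (cub c s) g <= avg a (cub c s) g1 + ennreal \<tau>" .
  have "ennreal (K * \<tau>) < avg a (cub c s) g1"
  proof (rule ccontr)
   assume "\<not> ?thesis"
   then have "avg a (cub c s) g <= ennreal (K * \<tau>) + ennreal \<tau>" using * by (meson add_right_mono not_less order_trans)
   also have "... = ennreal (K * \<tau> + \<tau>)" using a t by (simp add: ennreal_plus)
   also have "... <= ennreal (2 * K * \<tau>)"
   proof (rule ennreal_leI)
    have "1 * \<tau> <= K * \<tau>" using a(3) t by (intro mult_right_mono) auto
    then show "K * \<tau> + \<tau> <= 2 * K * \<tau>" by simp
   qed
   finally show False using c(3) by simp
  qed
  then show "x \<in> {x. ennreal (K * \<tau>) < Mx a g1 x}" using c Mx_greater by blast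
 qed
 then have "ennreal \<tau> * emeasure (mw a) {x. ennreal (2 * K * \<tau>) < Mx a g x}
   <= ennreal \<tau> * emeasure (mw a) {x. ennreal (K * \<tau>) < Mx a g1 x}"
  using Mx_set[OF a(1)] by (intro mult_left_mono emeasure_mono) auto
 also have "... <= ennreal K * (\<integral>\<^sup>+x. g1 x \<partial>mw a)" using Mx_weak_type[OF a g1 t] .
 finally show ?thesis by (simp add: g1_def)
qed

text \<open>Marcinkiewicz interpolation on dyadic levels. After exchanging the sum over levels with
  the integral, the sum of \<open>2 powr (i * (p - 1))\<close> over the levels below g x is
  comparable to its largest term because p > 1.\<close>

lemma Mx_strong_type:
 assumes p: "p > 1" and K: "K >= 1"
 shows "\<exists>C\<ge>0. \<forall>(a :: real ^ 'n => real) g. wt a --> dbl K a --> lmeas g --> (\<forall>x. 0 <= g x) -->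
  (\<integral>\<^sup>+x. ennreal_powr (Mx a (\<lambda>x. ennreal (g x)) x) p \<partial>mw a) <= ennreal C * (\<integral>\<^sup>+x. ennreal (g x powr p) \<partial>mw a)"
proof -
 define q :: real where "q = 2 powr (- (p - 1))"
 have q: "0 < q" "q < 1" using p by (auto simp: q_def powr_less_one)
 define C where "C = (4 * K) powr p * K / (1 - q)"
 have C: "C >= 0" using q K by (simp add: C_def)
 have main: "(\<integral>\<^sup>+x. ennreal_powr (Mx a (\<lambda>x. ennreal (g x)) x) p \<partial>mw a) <= ennreal C * (\<integral>\<^sup>+x. ennreal (g x powr p) \<partial>mw a)"
  if a: "wt a" "dbl K a" and g: "lmeas g" "\<And>x. 0 <= g x" for a :: "real ^ 'n => real" and g
 proof -
  let ?M = "\<lambda>x. Mx a (\<lambda>x. ennreal (g x)) x"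
  define X where "X i = {x. ennreal (2 * K * 2 powr real_of_int i) < ?M x}" for i :: int
  define Y where "Y i = {x. ennreal (2 powr real_of_int i) < ennreal (g x)}" for i :: int
  have X: "X i \<in> sets lebesgue" for i unfolding X_def by (rule Mx_set[OF a(1)])
  have Y: "Y i \<in> sets lebesgue" for i unfolding Y_def using g by (intro lebesgue_Collect) measurable
  have lev: "ennreal ((2 * K * 2 powr (real_of_int i + 1)) powr p) * emeasure (mw a) (X i)
    <= ennreal ((4 * K) powr p * K) * (\<integral>\<^sup>+x. ennreal (2 powr (i * (p - 1))) * (ennreal (g x) * indicator (Y i) x) \<partial>mw a)" for i
  proof -
   have "ennreal ((2 * K * 2 powr (real_of_int i + 1)) powr p) = ennreal ((4 * K) powr p * 2 powr (i * (p - 1))) * ennreal (2 powr i)"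
   proof -
    have "(2 * K * 2 powr (real_of_int i + 1)) powr p = ((4 * K) * 2 powr i) powr p"
     by (simp add: powr_add mult_ac)
    also have "... = (4 * K) powr p * 2 powr (i * (p - 1)) * 2 powr i"
     using K by (simp add: powr_mult powr_powr right_diff_distrib flip: powr_add)
    finally show ?thesis by (simp flip: ennreal_mult)
   qed
   then have "ennreal ((2 * K * 2 powr (real_of_int i + 1)) powr p) * emeasure (mw a) (X i)
    = ennreal ((4 * K) powr p * 2 powr (i * (p - 1))) * (ennreal (2 powr i) * emeasure (mw a) (X i))"
    by (simp add: mult.assoc)
   also have "... <= ennreal ((4 * K) powr p * 2 powr (i * (p - 1))) * (ennreal K * (\<integral>\<^sup>+x\<in>Y i. ennreal (g x) \<partial>mw a))"
    using Mx_level[OF a K, of "\<lambda>x. ennreal (g x)" "2 powr i"] g unfolding X_def Y_def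
    by (intro mult_left_mono) auto
   also have "... = ennreal ((4 * K) powr p * K) * (ennreal (2 powr (i * (p - 1))) * (\<integral>\<^sup>+x\<in>Y i. ennreal (g x) \<partial>mw a))"
    using K by (simp add: ennreal_mult mult_ac)
   finally show ?thesis using g Y by (simp add: nn_integral_cmult)
  qed
  have "(\<integral>\<^sup>+x. ennreal_powr (?M x) p \<partial>mw a) \<le>
    (\<integral>\<^sup>+x. \<integral>\<^sup>+i. ennreal ((2 * K * 2 powr (real_of_int i + 1)) powr p) * indicator (X i) x \<partial>count_space UNIV \<partial>mw a)"
  proof (rule nn_integral_mono)
   fix x
   have "(\<integral>\<^sup>+i. (if ennreal (2 * K * 2 powr real_of_int i) < ?M x then ennreal ((2 * K * 2 powr (real_of_int i + 1)) powr p) else 0) \<partial>count_space UNIV)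
    = (\<integral>\<^sup>+i. ennreal ((2 * K * 2 powr (real_of_int i + 1)) powr p) * indicator (X i) x \<partial>count_space UNIV)"
    by (intro nn_integral_cong) (auto simp: X_def indicator_def)
   then show "ennreal_powr (?M x) p <= (\<integral>\<^sup>+i. ennreal ((2 * K * 2 powr (real_of_int i + 1)) powr p) * indicator (X i) x \<partial>count_space UNIV)"
    using powr_le_level_sum[of p "2 * K" "?M x"] p K by simp
  qed
  also have "... = (\<integral>\<^sup>+i. ennreal ((2 * K * 2 powr (real_of_int i + 1)) powr p) * emeasure (mw a) (X i) \<partial>count_space UNIV)"
   using X by (subst nn_integral_count_space_nn_integral) (auto simp: nn_integral_cmult_indicator)
  also have "... <= (\<integral>\<^sup>+i. ennreal ((4 * K) powr p * K) * (\<integral>\<^sup>+x. ennreal (2 powr (i * (p - 1))) * (ennreal (g x) * indicator (Y i) x) \<partial>mw a) \<partial>count_space UNIV)"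
   by (intro nn_integral_mono lev)
  also have "... = ennreal ((4 * K) powr p * K) * (\<integral>\<^sup>+i. (\<integral>\<^sup>+x. ennreal (2 powr (i * (p - 1))) * (ennreal (g x) * indicator (Y i) x) \<partial>mw a) \<partial>count_space UNIV)"
   by (rule nn_integral_cmult) simp
  also have "(\<integral>\<^sup>+i. (\<integral>\<^sup>+x. ennreal (2 powr (i * (p - 1))) * (ennreal (g x) * indicator (Y i) x) \<partial>mw a) \<partial>count_space UNIV)
    = (\<integral>\<^sup>+x. \<integral>\<^sup>+i. ennreal (2 powr (i * (p - 1))) * (ennreal (g x) * indicator (Y i) x) \<partial>count_space UNIV \<partial>mw a)"
   using g Y by (intro nn_integral_count_space_nn_integral[symmetric]) auto
  also have "... <= (\<integral>\<^sup>+x. ennreal (g x powr p) * ennreal (1 / (1 - q)) \<partial>mw a)"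
  proof (rule nn_integral_mono)
   fix x
   have "(\<integral>\<^sup>+i. ennreal (2 powr (i * (p - 1))) * (ennreal (g x) * indicator (Y i) x) \<partial>count_space UNIV)
    <= (\<integral>\<^sup>+i. ennreal (g x) * (if 2 powr real_of_int i <= g x then ennreal (2 powr (i * (p - 1))) else 0) \<partial>count_space UNIV)"
    using g(2) by (intro nn_integral_mono) (auto simp: Y_def indicator_def mult.commute ennreal_less_iff)
   also have "... = ennreal (g x) * (\<integral>\<^sup>+i. (if 2 powr real_of_int i <= g x then ennreal (2 powr (i * (p - 1))) else 0) \<partial>count_space UNIV)"
    by (rule nn_integral_cmult) simp
   also have "... <= ennreal (g x) * ennreal (g x powr (p - 1) / (1 - q))"
    unfolding q_def using geometric_sum_le[of 2 "p - 1" "g x"] p g(2) by (intro mult_left_mono) auto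
   also have "... = ennreal (g x powr p) * ennreal (1 / (1 - q))"
   proof -
    have "g x * g x powr (p - 1) = g x powr p" using g(2)[of x] by (simp add: powr_mult_base)
    then show ?thesis using q g(2) by (simp flip: ennreal_mult)
   qed
   finally show "(\<integral>\<^sup>+i. ennreal (2 powr (i * (p - 1))) * (ennreal (g x) * indicator (Y i) x) \<partial>count_space UNIV)
    <= ennreal (g x powr p) * ennreal (1 / (1 - q))" .
  qed
  also have "... = (\<integral>\<^sup>+x. ennreal (g x powr p) \<partial>mw a) * ennreal (1 / (1 - q))"
   using g by (intro nn_integral_multc) auto
  finally have "(\<integral>\<^sup>+x. ennreal_powr (?M x) p \<partial>mw a)
    <= ennreal ((4 * K) powr p * K) * ((\<integral>\<^sup>+x. ennreal (g x powr p) \<partial>mw a) * ennreal (1 / (1 - q)))"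
   by (simp add: mult_left_mono)
  also have "... = ennreal C * (\<integral>\<^sup>+x. ennreal (g x powr p) \<partial>mw a)"
  proof -
   have "ennreal C = ennreal ((4 * K) powr p * K) * ennreal (1 / (1 - q))"
    using q K by (simp add: C_def flip: ennreal_mult)
   then show ?thesis by (simp add: mult_ac)
  qed
  finally show ?thesis .
 qed
 show ?thesis using C main by blast
qed

lemma ennreal_powr_add_le:
 assumes "p >= 0"
 shows "ennreal_powr (x + y) p <= ennreal (2 powr p) * (ennreal_powr x p + ennreal_powr y p)"
proof (cases "x = top \<or> y = top")
 case True
 then show ?thesis by (auto simp: ennreal_mult_top ennreal_top_mult)
next
 case False
 then obtain r t where r: "x = ennreal r" "y = ennreal t" "0 <= r" "0 <= t" by (cases x; cases y) auto
 have "(r + t) powr p <= (2 * max r t) powr p" using r assms by (intro powr_mono2) auto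
 also have "... = 2 powr p * max r t powr p" using r by (simp add: powr_mult)
 also have "... <= 2 powr p * (r powr p + t powr p)" by (intro mult_left_mono) (auto simp: max_def)
 finally show ?thesis using r by (simp add: ennreal_powr_ennreal ennreal_leI flip: ennreal_plus ennreal_mult)
qed

text \<open>The part of the function supported far from the cube has an essentially constant maximal function there.\<close>

lemma coifman_rochberg:
 assumes d: "0 < d" "d < 1" and K: "K >= 1"
 shows "\<exists>C\<ge>1. \<forall>(a :: real ^ 'n => real) g c s x. wt a --> dbl K a --> lmeas g -->
  s > 0 --> x \<in> cub c s -->
  (\<integral>\<^sup>+y\<in>cub c s. ennreal_powr (Mx a g y) d \<partial>mw a) <= ennreal C * ennreal_powr (Mx a g x) d * emeasure (mw a) (cub c s)"
proof -
 define Ck where "Ck = kolC d"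
 have Ck: "Ck >= 0" using kolC_ge1[of d] d by (simp add: Ck_def)
 note kol = kolmogorov[OF d, folded Ck_def]
 define C where "C = 2 powr d * (Ck * (K ^ 3) powr d + K powr d) + 1"
 have C: "C >= 1" using Ck by (simp add: C_def)
 have main: "(\<integral>\<^sup>+y\<in>cub c s. ennreal_powr (Mx a g y) d \<partial>mw a) <= ennreal C * ennreal_powr (Mx a g x) d * emeasure (mw a) (cub c s)"
  if a: "wt a" "dbl K a" and g: "lmeas g" and s: "s > 0" and x: "x \<in> cub c s"
  for a :: "real ^ 'n => real" and g c s x
 proof (cases "Mx a g x = top")
  case True
  then show ?thesis using wtD(3)[OF a(1) s, of c] C by (simp add: ennreal_mult_top ennreal_top_mult)
 next
  case False
  then obtain b where b: "Mx a g x = ennreal b" "b >= 0" by (cases "Mx a g x") auto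
  define Q where "Q = cub c s"
  define m where "m = measure (mw a) Q"
  have mQ: "emeasure (mw a) Q = ennreal m" unfolding m_def Q_def by (rule wt_emeasure_eq[OF a(1)]) simp
  define R where "R = cub (c - (\<chi> i. s)) (3 * s)"
  have QR: "Q \<subseteq> R" unfolding Q_def R_def using s by (subst cub_subset_iff) auto
  define g1 where "g1 y = g y * indicator R y" for y
  define g2 where "g2 y = g y * indicator (- R) y" for y
  have gm: "lmeas g1" "lmeas g2"
   unfolding g1_def[abs_def] g2_def[abs_def] R_def using g by measurable
  have far: "Mx a g2 y <= ennreal (K * b)" if y: "y \<in> Q" for y
  proof (rule Mx_le)
   fix e r assume r: "r > 0" "y \<in> cub e r"
   show "avg a (cub e r) g2 <= ennreal (K * b)"
   \<comment> \<open>A cube through y of side at most s stays in R, where g2 vanishes. The triple of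
     a larger cube contains x, so the average of g over that triple is at most b and doubling
     finishes.\<close>
   proof (cases "r <= s")
    case True
    have "cub e r \<subseteq> R"
    proof
     fix z assume z: "z \<in> cub e r"
     have "c $ i - s <= z $ i \<and> z $ i <= c $ i - s + 3 * s" for i
      using z[unfolded mem_cub, rule_format, of i] r(2)[unfolded mem_cub, rule_format, of i]
       y[unfolded Q_def mem_cub, rule_format, of i] True by linarith
     then show "z \<in> R" by (simp add: R_def mem_cub)
    qed
    then have "(\<integral>\<^sup>+y\<in>cub e r. g2 y \<partial>mw a) = (\<integral>\<^sup>+y. 0 \<partial>mw a)"
     by (intro nn_integral_cong) (auto simp: g2_def indicator_def)
    then show ?thesis by (simp add: avg_def)
   next
    case False
    define R' where "R' = cub (e - (\<chi> i. r)) (3 * r)"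
    have sub: "cub e r \<subseteq> R'" unfolding R'_def using r by (subst cub_subset_iff) auto
    have xR: "x \<in> R'"
    proof -
     have "e $ i - r <= x $ i \<and> x $ i <= e $ i - r + 3 * r" for i
      using x[unfolded mem_cub, rule_format, of i] r(2)[unfolded mem_cub, rule_format, of i]
       y[unfolded Q_def mem_cub, rule_format, of i] False by linarith
     then show ?thesis by (simp add: R'_def mem_cub)
    qed
    have "avg a R' g <= ennreal b" unfolding b(1)[symmetric] R'_def
     using r xR by (intro avg_le_Mx) (auto simp: R'_def)
    then have "(\<integral>\<^sup>+y\<in>R'. g y \<partial>mw a) <= ennreal b * emeasure (mw a) R'"
     using avg_le_iff[OF a(1), of "3 * r" "e - (\<chi> i. r)" g "ennreal b"] r by (simp add: R'_def)
    also have "... <= ennreal b * (ennreal K * emeasure (mw a) (cub e r))"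
     unfolding R'_def using r K sub by (intro mult_left_mono dblD_emeasure a) (auto simp: R'_def)
    finally have "(\<integral>\<^sup>+y\<in>R'. g y \<partial>mw a) <= ennreal (K * b) * emeasure (mw a) (cub e r)"
     using K b by (simp add: ennreal_mult mult_ac)
    moreover have "(\<integral>\<^sup>+y\<in>cub e r. g2 y \<partial>mw a) <= (\<integral>\<^sup>+y\<in>R'. g y \<partial>mw a)"
     using sub by (intro nn_integral_mono) (auto simp: g2_def indicator_def)
    ultimately show ?thesis using avg_le_iff[OF a(1) r(1)] by (meson order_trans)
   qed
  qed
  have intg1: "(\<integral>\<^sup>+y. g1 y \<partial>mw a) <= ennreal (K * b * m)"
  proof -
   have "avg a R g <= ennreal b" unfolding b(1)[symmetric] R_def
    using s x QR by (intro avg_le_Mx) (auto simp: R_def Q_def)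
   then have "(\<integral>\<^sup>+y\<in>R. g y \<partial>mw a) <= ennreal b * emeasure (mw a) R"
    using avg_le_iff[OF a(1), of "3 * s" "c - (\<chi> i. s)" g "ennreal b"] s by (simp add: R_def)
   also have "... <= ennreal b * (ennreal K * emeasure (mw a) Q)"
    unfolding R_def Q_def using s K QR by (intro mult_left_mono dblD_emeasure a) (auto simp: R_def Q_def)
   also have "... = ennreal (K * b * m)" using K b mQ by (simp add: mult_ac m_def flip: ennreal_mult)
   finally show ?thesis by (simp add: g1_def)
  qed
  have m0: "m > 0" unfolding m_def Q_def by (rule wt_measure_pos[OF a(1) s])
  \<comment> \<open>Kolmogorov's inequality on Q for the local part. The three factors K come from
    rescaling the height, from the weak-type bound, and from the mass of g1.\<close>
  have near: "(\<integral>\<^sup>+y\<in>Q. ennreal_powr (Mx a g1 y) d \<partial>mw a) <= ennreal (Ck * m powr (1 - d) * (K ^ 3 * b * m) powr d)"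
  proof (rule kol)
   show "Mx a g1 \<in> borel_measurable (mw a)" using Mx_measurable[OF a(1)] by measurable
   fix t :: real assume t: "t > 0"
    have "ennreal t * emeasure (mw a) {x \<in> Q. ennreal t < Mx a g1 x} <= ennreal t * emeasure (mw a) {x. ennreal (K * (t / K)) < Mx a g1 x}"
     using K Mx_set[OF a(1)] by (intro mult_left_mono emeasure_mono) auto
    also have "... = ennreal K * (ennreal (t / K) * emeasure (mw a) {x. ennreal (K * (t / K)) < Mx a g1 x})"
     using K t by (simp add: mult.assoc[symmetric] flip: ennreal_mult)
    also have "... <= ennreal K * (ennreal K * (\<integral>\<^sup>+x. g1 x \<partial>mw a))"
     using K t by (intro mult_left_mono Mx_weak_type[OF a K gm(1)]) auto
    also have "... <= ennreal K * (ennreal K * ennreal (K * b * m))"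
     by (intro mult_left_mono intg1) auto
    also have "... = ennreal (K ^ 3 * b * m)"
     using K b m0 by (simp add: power3_eq_cube mult_ac flip: ennreal_mult)
    finally show "ennreal t * emeasure (mw a) {x \<in> Q. ennreal t < Mx a g1 x} <= ennreal (K ^ 3 * b * m)" .
  qed (use m0 K b mQ in \<open>auto simp: Q_def\<close>)
  also have "Ck * m powr (1 - d) * (K ^ 3 * b * m) powr d = Ck * (K ^ 3) powr d * b powr d * m"
   using K b m0 by (simp add: powr_mult powr_diff field_simps)
  finally have near: "(\<integral>\<^sup>+y\<in>Q. ennreal_powr (Mx a g1 y) d \<partial>mw a) <= ennreal (Ck * (K ^ 3) powr d * b powr d * m)" .
  have pw: "ennreal_powr (Mx a g y) d <= ennreal (2 powr d) * (ennreal_powr (Mx a g1 y) d + ennreal (K powr d * b powr d))"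
   if y: "y \<in> Q" for y
  proof -
   have "Mx a g y <= Mx a g1 y + Mx a g2 y"
   proof (rule Mx_le)
    fix e r assume r: "r > 0" "y \<in> cub e r"
    have "avg a (cub e r) g = avg a (cub e r) (\<lambda>x. g1 x + g2 x)"
     unfolding avg_def by (intro arg_cong2[where f = "(/)"] nn_integral_cong) (auto simp: g1_def g2_def indicator_def)
    also have "... = avg a (cub e r) g1 + avg a (cub e r) g2" using gm by (intro avg_add) auto
    also have "... <= Mx a g1 y + Mx a g2 y" using r by (intro add_mono avg_le_Mx)
    finally show "avg a (cub e r) g <= Mx a g1 y + Mx a g2 y" .
   qed
   also have "... <= Mx a g1 y + ennreal (K * b)" using far[OF y] by (intro add_left_mono)
   finally have "ennreal_powr (Mx a g y) d <= ennreal_powr (Mx a g1 y + ennreal (K * b)) d"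
    using d by (intro ennreal_powr_mono) auto
   also have "... <= ennreal (2 powr d) * (ennreal_powr (Mx a g1 y) d + ennreal_powr (ennreal (K * b)) d)"
    using d by (intro ennreal_powr_add_le) auto
   finally show ?thesis using K b by (simp add: ennreal_powr_ennreal powr_mult)
  qed
  have M1: "(\<lambda>y. ennreal_powr (Mx a g1 y) d) \<in> borel_measurable lebesgue" using Mx_measurable[OF a(1)] by measurable
  have "(\<integral>\<^sup>+y\<in>Q. ennreal_powr (Mx a g y) d \<partial>mw a)
    <= (\<integral>\<^sup>+y. ennreal (2 powr d) * (ennreal_powr (Mx a g1 y) d * indicator Q y + ennreal (K powr d * b powr d) * indicator Q y) \<partial>mw a)"
   using pw by (intro nn_integral_mono) (auto simp: indicator_def)
  also have "... = ennreal (2 powr d) * ((\<integral>\<^sup>+y\<in>Q. ennreal_powr (Mx a g1 y) d \<partial>mw a) + ennreal (K powr d * b powr d) * ennreal m)"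
   using M1 mQ by (subst nn_integral_cmult, (simp add: Q_def)) (subst nn_integral_add, auto simp: Q_def nn_integral_cmult_indicator)
  also have "... <= ennreal (2 powr d) * (ennreal (Ck * (K ^ 3) powr d * b powr d * m) + ennreal (K powr d * b powr d) * ennreal m)"
   by (intro mult_left_mono add_right_mono near) auto
  also have "... = ennreal (2 powr d * (Ck * (K ^ 3) powr d + K powr d) * b powr d * m)"
   using Ck m0 by (simp add: algebra_simps flip: ennreal_mult ennreal_plus)
  also have "... <= ennreal (C * b powr d * m)"
   using m0 by (intro ennreal_leI mult_right_mono) (auto simp: C_def)
  also have "... = ennreal C * ennreal_powr (Mx a g x) d * emeasure (mw a) (cub c s)"
   using b C m0 mQ by (simp add: ennreal_powr_ennreal ennreal_mult Q_def)
  finally show ?thesis by (simp add: Q_def)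
 qed
 show ?thesis using C main by blast
qed

section \<open>Powers of maximal functions as weights\<close>

lemma emeasure_mw_mult:
 assumes "lmeas a" "lmeas h" "E \<in> sets lebesgue" "\<And>x. 0 <= a x" "\<And>x. 0 <= h x"
 shows "emeasure (mw (\<lambda>x. a x * h x)) E = (\<integral>\<^sup>+x\<in>E. ennreal (h x) \<partial>mw a)"
proof -
 have "emeasure (mw (\<lambda>x. a x * h x)) E = (\<integral>\<^sup>+x\<in>E. ennreal (a x * h x) \<partial>lebesgue)"
  using assms by (intro emeasure_mw) auto
 also have "... = (\<integral>\<^sup>+x. ennreal (a x) * (ennreal (h x) * indicator E x) \<partial>lebesgue)"
  using assms by (intro nn_integral_cong) (simp add: ennreal_mult mult.assoc)
 also have "... = (\<integral>\<^sup>+x\<in>E. ennreal (h x) \<partial>mw a)"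
  using assms by (intro nn_integral_mw[symmetric]) auto
 finally show ?thesis .
qed

lemma measure_leI: "emeasure M E <= ennreal X ==> 0 <= X ==> measure M E <= X"
 by (simp add: measure_def enn2real_leI)

text \<open>What remains of the A_inf property of \<open>\<beta> powr \<theta>\<close> once the
  geometry is removed: \<beta> is bounded below by j / 2 and its power \<delta> > \<theta> has
  average at most a multiple of \<open>j powr \<delta>\<close>. For \<theta> \<le> 0 the weight is
  bounded above by the lower bound on \<beta>, and bounded below on half of Q by Chebyshev's
  inequality. For \<theta> > 0 the lower bound is immediate, and splitting at a height T replaces
  Hoelder's inequality with the exponents \<delta> / \<theta> and its conjugate.\<close>

lemma powr_weight_core:
 assumes th: "\<theta> < 1" and C1: "C1 >= (1::real)"
 defines "\<delta> \<equiv> (if \<theta> <= 0 then 1/2 else (1 + \<theta>) / 2)"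
 shows "\<exists>C>0. \<exists>d>0. \<forall>(M :: 'a measure) Q m \<beta> j. Q \<in> sets M --> emeasure M Q = ennreal m --> 0 < m --> \<beta> \<in> borel_measurable M -->
  (0::real) < j --> (AE y in M. y \<in> Q --> j / 2 <= \<beta> y) --> (\<integral>\<^sup>+y\<in>Q. ennreal (\<beta> y powr \<delta>) \<partial>M) <= ennreal (C1 * j powr \<delta> * m) -->
  (\<exists>L>0. ennreal L <= (\<integral>\<^sup>+y\<in>Q. ennreal (\<beta> y powr \<theta>) \<partial>M) \<and>
   (\<forall>E. E \<in> sets M --> E \<subseteq> Q --> (\<integral>\<^sup>+y\<in>E. ennreal (\<beta> y powr \<theta>) \<partial>M) <= ennreal (C * (measure M E / m) powr d * L)))"
proof (cases "\<theta> <= 0")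
 case True
 have \<delta>: "\<delta> = 1/2" using True by (simp add: \<delta>_def)
 \<comment> \<open>With \<delta> = 1/2 this gives \<open>l powr \<delta> = 2 * C1\<close>, so by
   Chebyshev's inequality \<beta> exceeds l j on at most half of Q.\<close>
 define l where "l = (2 * C1) ^ 2"
 have l: "l > 0" "l powr \<delta> = 2 * C1" using C1 by (simp_all add: l_def \<delta> powr_half_sqrt real_sqrt_mult)
 define C where "C = 2 * (2 * l) powr (- \<theta>)"
 have C: "C > 0" using l by (simp add: C_def)
 have "\<exists>L>0. ennreal L <= (\<integral>\<^sup>+y\<in>Q. ennreal (\<beta> y powr \<theta>) \<partial>M) \<and>
   (\<forall>E. E \<in> sets M --> E \<subseteq> Q --> (\<integral>\<^sup>+y\<in>E. ennreal (\<beta> y powr \<theta>) \<partial>M) <= ennreal (C * (measure M E / m) powr 1 * L))"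
  if Q: "Q \<in> sets M" "emeasure M Q = ennreal m" "0 < m" and b: "\<beta> \<in> borel_measurable M" and j: "(0::real) < j"
  and lo: "AE y in M. y \<in> Q --> j / 2 <= \<beta> y" and up: "(\<integral>\<^sup>+y\<in>Q. ennreal (\<beta> y powr \<delta>) \<partial>M) <= ennreal (C1 * j powr \<delta> * m)"
  for M :: "'a measure" and Q m \<beta> j
 proof -
  define L where "L = (l * j) powr \<theta> * (m / 2)"
  have L: "L > 0" using l j Q by (simp add: L_def)
  define A where "A = {y \<in> Q. l * j < \<beta> y}"
  have A: "A \<in> sets M" unfolding A_def using Q b by measurable
  have fin: "emeasure M X = ennreal (measure M X)" if "X \<in> sets M" "X \<subseteq> Q" for X
   using emeasure_mono[OF that(2) Q(1)] Q(2) by (intro emeasure_eq_ennreal_measure) (auto simp: top_unique)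
  have "ennreal ((l * j) powr \<delta>) * emeasure M A = (\<integral>\<^sup>+y\<in>A. ennreal ((l * j) powr \<delta>) \<partial>M)"
   using A by (simp add: nn_integral_cmult_indicator)
  also have "... <= (\<integral>\<^sup>+y\<in>Q. ennreal (\<beta> y powr \<delta>) \<partial>M)"
   using l j by (intro nn_integral_mono) (auto simp: indicator_def A_def \<delta> intro!: ennreal_leI powr_mono2)
  also note up
  finally have "(l * j) powr \<delta> * measure M A <= C1 * j powr \<delta> * m"
   using fin[OF A] C1 Q by (simp add: A_def flip: ennreal_mult)
  then have "2 * C1 * (j powr \<delta> * measure M A) <= C1 * (j powr \<delta> * m)"
   using l j by (simp add: powr_mult mult_ac)
  then have "j powr \<delta> * (2 * measure M A) <= j powr \<delta> * m" using C1 by simp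
  then have mA: "measure M A <= m / 2" using j by simp
  have "measure M (Q - A) = m - measure M A"
   using Q A fin[OF A] by (subst measure_Diff) (auto simp: A_def measure_def)
  then have "ennreal (m / 2) <= emeasure M (Q - A)" using mA fin[of "Q - A"] A Q by (auto intro!: ennreal_leI)
  then have "ennreal L <= ennreal ((l * j) powr \<theta>) * emeasure M (Q - A)"
   unfolding L_def using Q by (subst ennreal_mult) (auto intro!: mult_left_mono)
  also have "... = (\<integral>\<^sup>+y\<in>Q - A. ennreal ((l * j) powr \<theta>) \<partial>M)"
   using A Q by (simp add: nn_integral_cmult_indicator)
  also have "... <= (\<integral>\<^sup>+y\<in>Q. ennreal (\<beta> y powr \<theta>) \<partial>M)"
   using lo
  proof (intro nn_integral_mono_AE, elim eventually_mono)
   fix y assume y: "y \<in> Q --> j / 2 <= \<beta> y"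
   show "ennreal ((l * j) powr \<theta>) * indicator (Q - A) y <= ennreal (\<beta> y powr \<theta>) * indicator Q y"
    using y j True by (auto simp: indicator_def A_def not_less intro!: ennreal_leI powr_mono2')
  qed
  finally have 1: "ennreal L <= (\<integral>\<^sup>+y\<in>Q. ennreal (\<beta> y powr \<theta>) \<partial>M)" .
  have "(\<integral>\<^sup>+y\<in>E. ennreal (\<beta> y powr \<theta>) \<partial>M) <= ennreal (C * (measure M E / m) powr 1 * L)" if E: "E \<in> sets M" "E \<subseteq> Q" for E
  proof -
   have "(\<integral>\<^sup>+y\<in>E. ennreal (\<beta> y powr \<theta>) \<partial>M) <= (\<integral>\<^sup>+y\<in>E. ennreal ((j / 2) powr \<theta>) \<partial>M)"
    using lo
   proof (intro nn_integral_mono_AE, elim eventually_mono)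
    fix y assume y: "y \<in> Q --> j / 2 <= \<beta> y"
    show "ennreal (\<beta> y powr \<theta>) * indicator E y <= ennreal ((j / 2) powr \<theta>) * indicator E y"
     using y j True E by (auto simp: indicator_def intro!: ennreal_leI powr_mono2')
   qed
   also have "... = ennreal ((j / 2) powr \<theta> * measure M E)"
    using E fin[OF E] by (simp add: nn_integral_cmult_indicator ennreal_mult)
   also have "(j / 2) powr \<theta> * measure M E = C * (measure M E / m) powr 1 * L"
   proof -
    have "(j / 2) powr \<theta> = (2 * l) powr (- \<theta>) * (l * j) powr \<theta>"
     using l j by (simp add: powr_minus powr_mult powr_divide field_simps)
    then show ?thesis using Q by (simp add: C_def L_def)
   qed
   finally show ?thesis .
  qed
  then show ?thesis using 1 L by blast
 qed
 then show ?thesis using C by (intro exI[of _ C] conjI exI[of _ 1]) auto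
next
 case False
 then have th0: "\<theta> > 0" by simp
 have \<delta>: "\<delta> = (1 + \<theta>) / 2" using False by (simp add: \<delta>_def)
 have d\<theta>: "\<theta> < \<delta>" "\<delta> > 0" using th th0 by (simp_all add: \<delta>)
 define d where "d = 1 - \<theta> / \<delta>"
 have d: "d > 0" using d\<theta> by (simp add: d_def)
 define C where "C = (1 + C1) * 2 powr \<theta>"
 have C: "C > 0" using C1 by (simp add: C_def)
 have "\<exists>L>0. ennreal L <= (\<integral>\<^sup>+y\<in>Q. ennreal (\<beta> y powr \<theta>) \<partial>M) \<and>
   (\<forall>E. E \<in> sets M --> E \<subseteq> Q --> (\<integral>\<^sup>+y\<in>E. ennreal (\<beta> y powr \<theta>) \<partial>M) <= ennreal (C * (measure M E / m) powr d * L))"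
  if Q: "Q \<in> sets M" "emeasure M Q = ennreal m" "0 < m" and b: "\<beta> \<in> borel_measurable M" and j: "(0::real) < j"
  and lo: "AE y in M. y \<in> Q --> j / 2 <= \<beta> y" and up: "(\<integral>\<^sup>+y\<in>Q. ennreal (\<beta> y powr \<delta>) \<partial>M) <= ennreal (C1 * j powr \<delta> * m)"
  for M :: "'a measure" and Q m \<beta> j
 proof -
  define L where "L = (j / 2) powr \<theta> * m"
  have L: "L > 0" using j Q by (simp add: L_def)
  have fin: "emeasure M X = ennreal (measure M X)" if "X \<in> sets M" "X \<subseteq> Q" for X
   using emeasure_mono[OF that(2) Q(1)] Q(2) by (intro emeasure_eq_ennreal_measure) (auto simp: top_unique)
  have "ennreal L = (\<integral>\<^sup>+y\<in>Q. ennreal ((j / 2) powr \<theta>) \<partial>M)"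
   using Q by (simp add: nn_integral_cmult_indicator L_def ennreal_mult)
  also have "... <= (\<integral>\<^sup>+y\<in>Q. ennreal (\<beta> y powr \<theta>) \<partial>M)"
   using lo
  proof (intro nn_integral_mono_AE, elim eventually_mono)
   fix y assume y: "y \<in> Q --> j / 2 <= \<beta> y"
   show "ennreal ((j / 2) powr \<theta>) * indicator Q y <= ennreal (\<beta> y powr \<theta>) * indicator Q y"
    using y j th0 by (auto simp: indicator_def intro!: ennreal_leI powr_mono2)
  qed
  finally have 1: "ennreal L <= (\<integral>\<^sup>+y\<in>Q. ennreal (\<beta> y powr \<theta>) \<partial>M)" .
  have "(\<integral>\<^sup>+y\<in>E. ennreal (\<beta> y powr \<theta>) \<partial>M) <= ennreal (C * (measure M E / m) powr d * L)" if E: "E \<in> sets M" "E \<subseteq> Q" for E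
  proof (cases "measure M E = 0")
   case True
   then have "emeasure M E = 0" using fin[OF E] by simp
   then have "AE y in M. y \<notin> E" using E by (intro AE_not_in) auto
   then have "(\<integral>\<^sup>+y\<in>E. ennreal (\<beta> y powr \<theta>) \<partial>M) = (\<integral>\<^sup>+y. 0 \<partial>M)"
    by (intro nn_integral_cong_AE) (auto elim!: eventually_mono)
   then show ?thesis by simp
  next
   case False
   define e where "e = measure M E"
   have e: "e > 0" using False by (simp add: e_def less_le)
   \<comment> \<open>This height makes \<open>T powr \<delta> * e\<close> equal to
     \<open>j powr \<delta> * m\<close>, which balances the contributions from below and from above
     T.\<close>
   define T where "T = j * (m / e) powr (1 / \<delta>)"
   have T: "T > 0" using j e Q by (simp add: T_def)
   have bd: "AE y in M. y \<in> E --> \<beta> y powr \<theta> <= T powr \<theta> + T powr (\<theta> - \<delta>) * \<beta> y powr \<delta>"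
    using lo
   proof (rule eventually_mono, intro impI)
    fix y assume "y \<in> Q --> j / 2 <= \<beta> y" "y \<in> E"
    then have bpos: "\<beta> y > 0" using E j by force
    show "\<beta> y powr \<theta> <= T powr \<theta> + T powr (\<theta> - \<delta>) * \<beta> y powr \<delta>"
    proof (cases "\<beta> y <= T")
     case True
     then have "\<beta> y powr \<theta> <= T powr \<theta>" using bpos th0 by (intro powr_mono2) auto
     then show ?thesis by (simp add: add_increasing2)
    next
     case False
     have "\<beta> y powr \<theta> = \<beta> y powr (\<theta> - \<delta>) * \<beta> y powr \<delta>" by (simp flip: powr_add)
     also have "... <= T powr (\<theta> - \<delta>) * \<beta> y powr \<delta>"
      using False d\<theta> T by (intro mult_right_mono powr_mono2') auto
     also have "... <= T powr \<theta> + ..." by simp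
     finally show ?thesis .
    qed
   qed
   have bm: "(\<lambda>y. ennreal (\<beta> y powr \<delta>) * indicator E y) \<in> borel_measurable M" using b E by measurable
   have "(\<integral>\<^sup>+y\<in>E. ennreal (\<beta> y powr \<theta>) \<partial>M) \<le>
     (\<integral>\<^sup>+y. ennreal (T powr \<theta>) * indicator E y + ennreal (T powr (\<theta> - \<delta>)) * (ennreal (\<beta> y powr \<delta>) * indicator E y) \<partial>M)"
    using bd by (intro nn_integral_mono_AE) (auto elim!: eventually_mono simp: indicator_def ennreal_leI simp flip: ennreal_mult ennreal_plus)
   also have "... = ennreal (T powr \<theta>) * emeasure M E + ennreal (T powr (\<theta> - \<delta>)) * (\<integral>\<^sup>+y\<in>E. ennreal (\<beta> y powr \<delta>) \<partial>M)"
    using E bm by (subst nn_integral_add) (auto simp: nn_integral_cmult_indicator nn_integral_cmult)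
   also have "... <= ennreal (T powr \<theta>) * ennreal e + ennreal (T powr (\<theta> - \<delta>)) * ennreal (C1 * j powr \<delta> * m)"
   proof (intro add_mono mult_left_mono)
    have "(\<integral>\<^sup>+y\<in>E. ennreal (\<beta> y powr \<delta>) \<partial>M) <= (\<integral>\<^sup>+y\<in>Q. ennreal (\<beta> y powr \<delta>) \<partial>M)"
     using E by (intro nn_integral_mono) (auto simp: indicator_def)
    then show "(\<integral>\<^sup>+y\<in>E. ennreal (\<beta> y powr \<delta>) \<partial>M) <= ennreal (C1 * j powr \<delta> * m)" using up by (rule order_trans)
   qed (use fin[OF E] in \<open>auto simp: e_def\<close>)
   also have "... = ennreal (T powr \<theta> * e + T powr (\<theta> - \<delta>) * (C1 * j powr \<delta> * m))"
    using e C1 Q by (simp flip: ennreal_mult ennreal_plus)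
   also have "T powr \<theta> * e + T powr (\<theta> - \<delta>) * (C1 * j powr \<delta> * m) = (1 + C1) * (T powr \<theta> * e)"
   proof -
    have "T powr \<delta> = j powr \<delta> * (m / e)" using j e Q d\<theta> by (simp add: T_def powr_mult powr_powr)
    then have "j powr \<delta> * m = T powr \<delta> * e" using e by simp
    then have "T powr (\<theta> - \<delta>) * (C1 * j powr \<delta> * m) = C1 * (T powr (\<theta> - \<delta>) * T powr \<delta>) * e" by (simp add: mult_ac)
    also have "T powr (\<theta> - \<delta>) * T powr \<delta> = T powr \<theta>" by (simp flip: powr_add)
    finally show ?thesis by (simp add: algebra_simps)
   qed
   also have "(1 + C1) * (T powr \<theta> * e) = C * (e / m) powr d * L"
   proof -
    have "T powr \<theta> = j powr \<theta> * (m / e) powr (\<theta> / \<delta>)" using j e Q by (simp add: T_def powr_mult powr_powr)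
    moreover have "(e / m) powr d = (e / m) * (m / e) powr (\<theta> / \<delta>)"
    proof -
     have "(m / e) powr (\<theta> / \<delta>) = (e / m) powr (- (\<theta> / \<delta>))"
      using e Q by (simp add: powr_minus powr_divide)
     moreover have "(e / m) powr d = (e / m) powr 1 * (e / m) powr (- (\<theta> / \<delta>))" 
      unfolding d_def powr_add[symmetric] by simp
     ultimately show ?thesis using e Q by simp
    qed
    moreover have "(j / 2) powr \<theta> = j powr \<theta> / 2 powr \<theta>" using j by (simp add: powr_divide)
    moreover have "(1 + C1) * (jt * Z * e) = (1 + C1) * t * (e / m * Z) * (jt / t * m)" if "t > 0" for jt Z t :: real
     using that Q by simp
    ultimately show ?thesis unfolding C_def L_def by simp
   qed
   finally show ?thesis by (simp add: e_def)
  qed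
  then show ?thesis using 1 L by blast
 qed
 then show ?thesis using C d by blast
qed

text \<open>The level j is the value at a point of the cube where the maximal function is less than
  twice its infimum. The choice gives the lower bound j / 2, and the Coifman-Rochberg estimate at
  that same point gives the upper bound.\<close>

lemma Mx_cube_level:
 assumes \<delta>: "0 < \<delta>" "\<delta> < 1" and K: "K >= 1"
 shows "\<exists>C1\<ge>1. \<forall>(a :: real ^ 'n => real) g c s. wt a --> dbl K a --> lmeas g -->
  (\<forall>x. 0 < Mx a g x) --> (AE x in mw a. Mx a g x < top) --> s > 0 -->
  (\<exists>j>0. (AE y in mw a. y \<in> cub c s --> j / 2 <= enn2real (Mx a g y)) \<and>
   (\<integral>\<^sup>+y\<in>cub c s. ennreal (enn2real (Mx a g y) powr \<delta>) \<partial>mw a) <= ennreal (C1 * j powr \<delta> * measure (mw a) (cub c s)))"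
proof -
 obtain C1 where C1: "C1 >= 1" and CR: "\<forall>(a :: real ^ 'n => real) g c s x. wt a --> dbl K a --> lmeas g -->
  s > 0 --> x \<in> cub c s -->
  (\<integral>\<^sup>+y\<in>cub c s. ennreal_powr (Mx a g y) \<delta> \<partial>mw a) <= ennreal C1 * ennreal_powr (Mx a g x) \<delta> * emeasure (mw a) (cub c s)"
  using coifman_rochberg[OF \<delta> K, where 'n = 'n] by blast
 have main: "\<exists>j>0. (AE y in mw a. y \<in> cub c s --> j / 2 <= enn2real (Mx a g y)) \<and>
   (\<integral>\<^sup>+y\<in>cub c s. ennreal (enn2real (Mx a g y) powr \<delta>) \<partial>mw a) <= ennreal (C1 * j powr \<delta> * measure (mw a) (cub c s))"
  if a: "wt a" "dbl K a" and g: "lmeas g" and pos: "\<And>x. 0 < Mx a g x" and fin: "AE x in mw a. Mx a g x < top" and s: "s > 0"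
  for a :: "real ^ 'n => real" and g c s
 proof -
  define \<beta> where "\<beta> x = enn2real (Mx a g x)" for x
   define Q where "Q = cub c s"
   have Qs: "Q \<in> sets lebesgue" by (simp add: Q_def)
   define m where "m = measure (mw a) Q"
   have m: "emeasure (mw a) Q = ennreal m" "m > 0"
    using wt_emeasure_eq[OF a(1), of Q] wt_measure_pos[OF a(1) s] by (simp_all add: m_def Q_def)
   have cQ: "c \<in> Q" using s by (simp add: Q_def mem_cub)
   define I where "I = (INF x\<in>Q. Mx a g x)"
   have I0: "I > 0"
   proof -
    obtain e r where r: "r > 0" "c \<in> cub e r" "0 < avg a (cub e r) g"
     using pos[of c] unfolding Mx_greater by blast
    \<comment> \<open>A cube containing both Q and a cube with positive average bounds the maximal
      function below uniformly on Q, so the infimum is positive.\<close>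
    define R where "R = cub (c - (\<chi> i. r + s)) (2 * r + 2 * s)"
    have "cub e r \<subseteq> R"
    proof
     fix z assume z: "z \<in> cub e r"
     have "c $ i - (r + s) <= z $ i \<and> z $ i <= c $ i - (r + s) + (2 * r + 2 * s)" for i
      using z[unfolded mem_cub, rule_format, of i] r(2)[unfolded mem_cub, rule_format, of i] s r(1) by linarith
     then show "z \<in> R" by (simp add: R_def mem_cub)
    qed
    then have "(\<integral>\<^sup>+y\<in>cub e r. g y \<partial>mw a) <= (\<integral>\<^sup>+y\<in>R. g y \<partial>mw a)"
     by (intro nn_integral_mono) (auto simp: indicator_def)
    moreover have "0 < (\<integral>\<^sup>+y\<in>cub e r. g y \<partial>mw a)" using r(3) by (simp add: avg_def ennreal_zero_less_divide)
    ultimately have "0 < avg a R g"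
     using wtD(4)[OF a(1), of "2 * r + 2 * s"] r s by (auto simp: avg_def ennreal_zero_less_divide R_def)
    moreover have "avg a R g <= I"
     unfolding I_def
    proof (rule INF_greatest)
     fix z assume z: "z \<in> Q"
     have "c $ i - (r + s) <= z $ i \<and> z $ i <= c $ i - (r + s) + (2 * r + 2 * s)" for i
      using z[unfolded Q_def mem_cub, rule_format, of i] s r by linarith
     then have "z \<in> R" by (simp add: R_def mem_cub)
     then show "avg a R g <= Mx a g z" unfolding R_def using r s by (intro avg_le_Mx) auto
    qed
    ultimately show ?thesis by simp
   qed
   have "\<exists>x\<in>Q. Mx a g x < top"
   proof (rule ccontr)
    assume "\<not> ?thesis"
    then have "AE x in mw a. x \<notin> Q" using fin by (auto elim!: eventually_mono)
    then have "emeasure (mw a) Q = 0" using Qs by (subst (asm) AE_iff_measurable[of Q]) auto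
    then show False using m by simp
   qed
   then have Ifin: "I < top" by (auto simp: I_def INF_less_iff)
   then have "I < 2 * I" using I0 by (cases I) (auto simp flip: ennreal_numeral ennreal_mult simp: ennreal_less_iff)
   then obtain x0 where x0: "x0 \<in> Q" "Mx a g x0 < 2 * I" unfolding I_def INF_less_iff by blast
   have "Mx a g x0 < top" by (rule order_less_le_trans[OF x0(2) top_greatest])
   then obtain j where j: "Mx a g x0 = ennreal j" "j > 0" using pos[of x0] by (cases "Mx a g x0") auto
   have lo: "AE y in mw a. y \<in> Q --> j / 2 <= \<beta> y"
    using fin
   proof (rule eventually_mono, intro impI)
    fix y assume y: "Mx a g y < top" "y \<in> Q"
    have "I <= Mx a g y" unfolding I_def using y(2) by (rule INF_lower)
    then have "2 * I <= 2 * Mx a g y" by (rule mult_left_mono) simp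
    then have "ennreal j <= 2 * Mx a g y" using x0(2) unfolding j(1) by simp
    moreover have "Mx a g y = ennreal (\<beta> y)" using y by (simp add: \<beta>_def)
    moreover have "2 * ennreal (\<beta> y) = ennreal (2 * \<beta> y)" by (simp add: ennreal_mult \<beta>_def)
    ultimately have "ennreal j <= ennreal (2 * \<beta> y)" by (simp only:)
    then show "j / 2 <= \<beta> y" by (simp add: \<beta>_def)
   qed
   have "(\<integral>\<^sup>+y\<in>Q. ennreal (\<beta> y powr \<delta>) \<partial>mw a) <= (\<integral>\<^sup>+y\<in>Q. ennreal_powr (Mx a g y) \<delta> \<partial>mw a)"
    by (intro nn_integral_mono mult_right_mono) (auto simp: \<beta>_def ennreal_powr_def)
   also have "... <= ennreal C1 * ennreal_powr (Mx a g x0) \<delta> * emeasure (mw a) Q"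
    using CR a g s x0 unfolding Q_def by blast
   also have "... = ennreal (C1 * j powr \<delta> * m)"
    using j C1 m by (simp add: ennreal_powr_ennreal ennreal_mult)
   finally have up: "(\<integral>\<^sup>+y\<in>Q. ennreal (\<beta> y powr \<delta>) \<partial>mw a) <= ennreal (C1 * j powr \<delta> * m)" .
   show ?thesis using j lo up unfolding Q_def m_def \<beta>_def by blast
 qed
 show ?thesis using C1 main by blast
qed

text \<open>All exponents below 1 are covered, negative ones included: the extrapolation uses
  \<theta> = (s - p0) / \<gamma>, which is negative when s < p0.\<close>

lemma ainf_Mx_powr:
 assumes th: "\<theta> < 1" and K: "K >= 1"
 shows "\<exists>C>0. \<exists>d>0. \<forall>(a :: real ^ 'n => real) g. wt a --> dbl K a --> lmeas g -->
  (\<forall>x. 0 < Mx a g x) --> (AE x in mw a. Mx a g x < top) -->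
  wt (\<lambda>x. a x * enn2real (Mx a g x) powr \<theta>) \<and> ainf C d a (\<lambda>x. a x * enn2real (Mx a g x) powr \<theta>)"
proof -
 define \<delta> where "\<delta> = (if \<theta> <= 0 then 1/2 else (1 + \<theta>) / 2)"
 have \<delta>: "0 < \<delta>" "\<delta> < 1" using th by (auto simp: \<delta>_def)
 obtain C1 where C1: "C1 >= 1" and CL: "\<forall>(a :: real ^ 'n => real) g c s. wt a --> dbl K a --> lmeas g -->
  (\<forall>x. 0 < Mx a g x) --> (AE x in mw a. Mx a g x < top) --> s > 0 -->
  (\<exists>j>0. (AE y in mw a. y \<in> cub c s --> j / 2 <= enn2real (Mx a g y)) \<and>
   (\<integral>\<^sup>+y\<in>cub c s. ennreal (enn2real (Mx a g y) powr \<delta>) \<partial>mw a) <= ennreal (C1 * j powr \<delta> * measure (mw a) (cub c s)))"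
  using Mx_cube_level[OF \<delta> K, where 'n = 'n] by blast
 obtain C d where Cd: "C > 0" "d > 0" and core: "\<forall>(M :: (real ^ 'n) measure) Q m \<beta> j. Q \<in> sets M --> emeasure M Q = ennreal m --> 0 < m --> \<beta> \<in> borel_measurable M -->
  (0::real) < j --> (AE y in M. y \<in> Q --> j / 2 <= \<beta> y) --> (\<integral>\<^sup>+y\<in>Q. ennreal (\<beta> y powr \<delta>) \<partial>M) <= ennreal (C1 * j powr \<delta> * m) -->
  (\<exists>L>0. ennreal L <= (\<integral>\<^sup>+y\<in>Q. ennreal (\<beta> y powr \<theta>) \<partial>M) \<and>
   (\<forall>E. E \<in> sets M --> E \<subseteq> Q --> (\<integral>\<^sup>+y\<in>E. ennreal (\<beta> y powr \<theta>) \<partial>M) <= ennreal (C * (measure M E / m) powr d * L)))"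
  using powr_weight_core[OF th C1, where 'a = "real ^ 'n", folded \<delta>_def] by blast
 have main: "wt (\<lambda>x. a x * enn2real (Mx a g x) powr \<theta>) \<and> ainf C d a (\<lambda>x. a x * enn2real (Mx a g x) powr \<theta>)"
  if a: "wt a" "dbl K a" and g: "lmeas g" and pos: "\<And>x. 0 < Mx a g x" and fin: "AE x in mw a. Mx a g x < top"
  for a :: "real ^ 'n => real" and g
 proof -
  define \<beta> where "\<beta> x = enn2real (Mx a g x)" for x
  define w where "w x = a x * \<beta> x powr \<theta>" for x
  have bm: "lmeas \<beta>" unfolding \<beta>_def[abs_def] using Mx_measurable[OF a(1)] by measurable
  have am: "lmeas a" "\<And>x. 0 <= a x" using wtD a by auto
  have wm: "lmeas w" unfolding w_def[abs_def] using bm am by measurable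
  have wE: "emeasure (mw w) E = (\<integral>\<^sup>+y\<in>E. ennreal (\<beta> y powr \<theta>) \<partial>mw a)" if "E \<in> sets lebesgue" for E
   unfolding w_def using bm am that by (intro emeasure_mw_mult) auto
  have cube: "\<exists>L>0. ennreal L <= emeasure (mw w) (cub c s) \<and>
   (\<forall>E. E \<in> sets lebesgue --> E \<subseteq> cub c s --> emeasure (mw w) E <= ennreal (C * (measure (mw a) E / measure (mw a) (cub c s)) powr d * L))"
   if s: "s > 0" for c s
  proof -
   define Q where "Q = cub c s"
   have Qs: "Q \<in> sets lebesgue" by (simp add: Q_def)
   define m where "m = measure (mw a) Q"
   have m: "emeasure (mw a) Q = ennreal m" "m > 0"
    using wt_emeasure_eq[OF a(1), of Q] wt_measure_pos[OF a(1) s] by (simp_all add: m_def Q_def)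
   obtain j where j: "j > 0" and lo: "AE y in mw a. y \<in> Q --> j / 2 <= \<beta> y"
    and up: "(\<integral>\<^sup>+y\<in>Q. ennreal (\<beta> y powr \<delta>) \<partial>mw a) <= ennreal (C1 * j powr \<delta> * m)"
    using CL[rule_format, OF a g pos fin s, of c] unfolding Q_def m_def \<beta>_def by blast
   have "\<exists>L>0. ennreal L <= (\<integral>\<^sup>+y\<in>Q. ennreal (\<beta> y powr \<theta>) \<partial>mw a) \<and>
    (\<forall>E. E \<in> sets (mw a) --> E \<subseteq> Q --> (\<integral>\<^sup>+y\<in>E. ennreal (\<beta> y powr \<theta>) \<partial>mw a) <= ennreal (C * (measure (mw a) E / m) powr d * L))"
    using core[rule_format, of Q "mw a" m \<beta> j] Qs m bm j lo up by simp
   then show ?thesis unfolding Q_def[symmetric] m_def[symmetric] using wE Qs by simp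
  qed
  have "wt w"
   unfolding wt_def
  proof (intro conjI allI impI)
   fix c :: "real ^ 'n" and s :: real assume s: "s > 0"
   from cube[OF s, of c] obtain L where L: "L > 0" "ennreal L <= emeasure (mw w) (cub c s)"
    "\<And>E. E \<in> sets lebesgue ==> E \<subseteq> cub c s ==> emeasure (mw w) E <= ennreal (C * (measure (mw a) E / measure (mw a) (cub c s)) powr d * L)" by blast
   show "0 < emeasure (mw w) (cub c s)" using L(1,2) by (meson ennreal_less_zero_iff order_less_le_trans)
   show "emeasure (mw w) (cub c s) < \<infinity>" using L(3)[of "cub c s"] by (simp add: order_le_less_trans[OF _ ennreal_less_top])
  qed (use wm am in \<open>auto simp: w_def\<close>)
  moreover have "ainf C d a w"
   unfolding ainf_def
  proof (intro allI impI)
   fix c :: "real ^ 'n" and s :: real and E assume s: "s > 0" and E: "E \<in> sets lebesgue" "E \<subseteq> cub c s"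
   from cube[OF s, of c] obtain L where L: "L > 0" "ennreal L <= emeasure (mw w) (cub c s)"
    "\<And>E. E \<in> sets lebesgue ==> E \<subseteq> cub c s ==> emeasure (mw w) E <= ennreal (C * (measure (mw a) E / measure (mw a) (cub c s)) powr d * L)" by blast
   have "measure (mw w) E <= C * (measure (mw a) E / measure (mw a) (cub c s)) powr d * L"
    using L(3)[OF E] Cd L by (intro measure_leI) auto
   also have "... <= C * (measure (mw a) E / measure (mw a) (cub c s)) powr d * measure (mw w) (cub c s)"
    using L(2) wt_emeasure_eq[OF \<open>wt w\<close>, of "cub c s"] Cd by (intro mult_left_mono) auto
   finally show "measure (mw w) E <= C * (measure (mw a) E / measure (mw a) (cub c s)) powr d * measure (mw w) (cub c s)" .
  qed
  ultimately show ?thesis unfolding w_def \<beta>_def by blast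
 qed
 show ?thesis using Cd main by blast
qed

lemma ainf_trans:
 assumes w: "wt u" "wt v" "wt w" and ab: "ainf C d u v" "ainf C' d' v w" and p: "C > 0" "d > 0" "C' > 0" "d' > 0"
 shows "ainf (C' * C powr d') (d * d') u w"
 unfolding ainf_def
proof (intro allI impI)
 fix c :: "real ^ 'a" and s :: real and E assume s: "s > 0" and E: "E \<in> sets lebesgue" "E \<subseteq> cub c s"
 let ?Q = "cub c s"
 have "measure (mw v) E / measure (mw v) ?Q <= C * (measure (mw u) E / measure (mw u) ?Q) powr d"
  using ab(1) s E wt_measure_pos[OF w(2) s, of c] unfolding ainf_def by (simp add: pos_divide_le_eq)
 then have "(measure (mw v) E / measure (mw v) ?Q) powr d' <= (C * (measure (mw u) E / measure (mw u) ?Q) powr d) powr d'"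
  using p by (intro powr_mono2) auto
 also have "... = C powr d' * (measure (mw u) E / measure (mw u) ?Q) powr (d * d')"
  using p by (simp add: powr_mult powr_powr)
 finally have "C' * (measure (mw v) E / measure (mw v) ?Q) powr d' * measure (mw w) ?Q
   <= C' * (C powr d' * (measure (mw u) E / measure (mw u) ?Q) powr (d * d')) * measure (mw w) ?Q"
  using p by (intro mult_right_mono mult_left_mono) auto
 moreover have "measure (mw w) E <= C' * (measure (mw v) E / measure (mw v) ?Q) powr d' * measure (mw w) ?Q"
  using ab(2) s E unfolding ainf_def by blast
 ultimately show "measure (mw w) E <= C' * C powr d' * (measure (mw u) E / measure (mw u) ?Q) powr (d * d') * measure (mw w) ?Q"
  by (simp add: mult_ac)
qed

lemma ainf_mono:
 assumes "wt u" "ainf C d u w" "C <= C'" "d' <= d" "0 < d'" "0 < C"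
 shows "ainf C' d' u w"
 unfolding ainf_def
proof (intro allI impI)
 fix c :: "real ^ 'a" and s :: real and E assume s: "s > 0" and E: "E \<in> sets lebesgue" "E \<subseteq> cub c s"
 let ?Q = "cub c s"
 have "measure (mw u) E <= measure (mw u) ?Q" using assms E by (intro wt_measure_mono) auto
 then have "measure (mw u) E / measure (mw u) ?Q <= 1" using wt_measure_pos[OF assms(1) s, of c] by simp
 then have "(measure (mw u) E / measure (mw u) ?Q) powr d <= (measure (mw u) E / measure (mw u) ?Q) powr d'"
  using assms by (intro powr_mono') auto
 then have "C * (measure (mw u) E / measure (mw u) ?Q) powr d * measure (mw w) ?Q <= C' * (measure (mw u) E / measure (mw u) ?Q) powr d' * measure (mw w) ?Q"
  using assms by (intro mult_right_mono mult_mono) auto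
 moreover have "measure (mw w) E <= C * (measure (mw u) E / measure (mw u) ?Q) powr d * measure (mw w) ?Q"
  using assms(2) s E unfolding ainf_def by blast
 ultimately show "measure (mw w) E <= C' * (measure (mw u) E / measure (mw u) ?Q) powr d' * measure (mw w) ?Q" by linarith
qed

subsection \<open>The Fujii-Wilson constant\<close>

definition fw :: "real => (real ^ 'n => real) => bool" where
 "fw b w \<longleftrightarrow> (\<forall>c s. s > 0 -->
  (\<integral>\<^sup>+x\<in>cub c s. HL (\<lambda>y. ennreal (w y) * indicator (cub c s) y) x \<partial>lebesgue)
   <= ennreal b * emeasure (mw w) (cub c s))"

lemma Ainf_const_le_iff_fw:
 assumes "wt w" "b >= 0"
 shows "Ainf_const w <= ennreal b \<longleftrightarrow> fw b w"
proof -
 have "maximal_fun (\<lambda>y. w y * indicator Q y) x = HL (\<lambda>y. ennreal (w y) * indicator Q y) x" for Q x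
 proof -
  have "ennreal (norm (w y * indicator Q y)) = ennreal (w y) * indicator Q y" for y
   using wtD(2)[OF assms(1), of y] by (auto simp: indicator_def)
  then show ?thesis by (simp add: maximal_fun_eq_Mx)
 qed
 moreover have "(\<integral>\<^sup>+x\<in>Q. ennreal (w x) \<partial>lebesgue) = emeasure (mw w) Q" if "axis_cube Q" for Q
  by (rule emeasure_mw[symmetric]) (use wtD assms axis_cube_sets that in auto)
 ultimately have "Ainf_const w <= ennreal b \<longleftrightarrow> (\<forall>Q. axis_cube Q -->
   (\<integral>\<^sup>+x\<in>Q. HL (\<lambda>y. ennreal (w y) * indicator Q y) x \<partial>lebesgue) / emeasure (mw w) Q <= ennreal b)"
  by (simp add: Ainf_const_def SUP_le_iff)
 also have "... \<longleftrightarrow> fw b w"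
 proof -
  have "((\<integral>\<^sup>+x\<in>cub c s. HL (\<lambda>y. ennreal (w y) * indicator (cub c s) y) x \<partial>lebesgue) / emeasure (mw w) (cub c s) <= ennreal b)
   = ((\<integral>\<^sup>+x\<in>cub c s. HL (\<lambda>y. ennreal (w y) * indicator (cub c s) y) x \<partial>lebesgue) <= ennreal b * emeasure (mw w) (cub c s))"
   if "s > 0" for c s
   using wtD(3,4)[OF assms(1) that, of c] by (intro ennreal_divide_le_iff) auto
  then show ?thesis unfolding fw_def axis_cube_iff by blast
 qed
 finally show ?thesis .
qed

lemma sum_levels_le:
 fixes y :: ennreal and V :: real
 assumes "V > 0"
 shows "(\<Sum>i=1..N. if ennreal (2 ^ i * V) < y then ennreal (2 ^ i * V) else 0) <= 2 * y"
proof (induction N)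
 case (Suc N)
 show ?case
 proof (cases "ennreal (2 ^ Suc N * V) < y")
  case True
  have "(\<Sum>i=1..Suc N. if ennreal (2 ^ i * V) < y then ennreal (2 ^ i * V) else 0) <= (\<Sum>i=1..Suc N. ennreal (2 ^ i * V))"
   by (intro sum_mono) auto
  also have "... = ennreal (\<Sum>i=1..Suc N. 2 ^ i * V)" using assms by (intro sum_ennreal) auto
  also have "(\<Sum>i=1..Suc N. 2 ^ i * V) <= 2 * (2 ^ Suc N * V)"
   using assms by (induction N) (auto simp: algebra_simps)
  also have "ennreal (2 * (2 ^ Suc N * V)) = 2 * ennreal (2 ^ Suc N * V)"
   using assms by (subst ennreal_mult) auto
  also have "... <= 2 * y" using True by (intro mult_left_mono) auto
  finally show ?thesis by (auto simp: ennreal_leI)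
 next
  case False
  then show ?thesis using Suc by simp
 qed
qed simp

text \<open>Uses the maximal dyadic subcubes of the cube on which the average exceeds \<open>l\<close>.\<close>

lemma reverse_weak_type:
 fixes w :: "real ^ 'n => real"
 assumes w: "wt w" and s: "s > 0" and l: "l > 0" "measure (mw w) (cub c s) <= l * s ^ CARD('n)"
 shows "emeasure (mw w) {x \<in> cub c s. l < w x} <= ennreal (2 ^ CARD('n) * l) *
  emeasure lebesgue {x \<in> cub c s. ennreal l < HL (\<lambda>y. ennreal (w y) * indicator (cub c s) y) x}"
proof -
 interpret grid c s using s by unfold_locales
 define Q where "Q = cub c s"
 define g where "g y = ennreal (w y) * indicator Q y" for y
 have wm: "lmeas w" "\<And>x. 0 <= w x" using wtD w by auto
 have Qs: "Q \<in> sets lebesgue" by (simp add: Q_def)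
 have gm: "lmeas g" unfolding g_def[abs_def] using wm Qs by measurable
 have gX: "(\<integral>\<^sup>+y\<in>X. g y \<partial>lebesgue) = emeasure (mw w) (Q \<inter> X)" if "X \<in> sets lebesgue" for X
  using that wm Qs by (subst emeasure_mw) (auto simp: g_def indicator_def intro!: nn_integral_cong)
 define n where "n = CARD('n)"
 define S where "S = {p. ennreal l * emeasure lebesgue (dq p) < emeasure (mw w) (Q \<inter> dq p)}"
 have mdq: "emeasure lebesgue (dq p) = ennreal (sd (fst p) ^ n)" for p by (simp add: measure_dq n_def)
 \<comment> \<open>A grid cube of level above 0 has at least the volume of Q, so the mass of w on
   its intersection with Q is at most l times its volume and it is not selected.\<close>
 have bd: "fst q <= 0" if "q \<in> S" for q
 proof (rule ccontr)
  assume "\<not> fst q <= 0"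
  then have "s <= sd (fst q)" using sd_mono[of 0 "fst q"] by (simp add: sd_def)
  then have "s ^ n <= sd (fst q) ^ n" using s by (intro power_mono) auto
  then have "l * s ^ n <= l * sd (fst q) ^ n" using l by (intro mult_left_mono) auto
  have "emeasure (mw w) (Q \<inter> dq q) <= emeasure (mw w) Q" using Qs by (intro emeasure_mono) auto
  also have "... = ennreal (measure (mw w) Q)" unfolding Q_def by (rule wt_emeasure_eq[OF w]) simp
  also have "... <= ennreal (l * sd (fst q) ^ n)"
   using l(2) \<open>l * s ^ n <= l * sd (fst q) ^ n\<close> unfolding Q_def n_def by (intro ennreal_leI) linarith
  also have "... = ennreal l * emeasure lebesgue (dq q)" using l by (simp add: mdq ennreal_mult)
  finally show False using that by (simp add: S_def)
 qed
 define A where "A = {x \<in> Q. ennreal l < HL g x}"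
 have A: "A \<in> sets lebesgue" using Mx_set[OF wt_one, of "ennreal l" g] Qs unfolding A_def
  by (simp add: Collect_conj_eq)
 have P: "dq p \<subseteq> A \<and> emeasure (mw w) (dq p) <= ennreal (2 ^ n * l) * emeasure lebesgue (dq p)" if p: "p \<in> maxi S" for p
 proof -
  have pS: "p \<in> S" using p maxi_subset by blast
  have "emeasure (mw w) (Q \<inter> dq p) = emeasure (mw w) (dq p \<inter> dq (0,0))"
   using emeasure_dq_clo[OF wm(1), of "dq p" "(0,0)"] dq_zero by (simp add: Q_def Int_commute)
  moreover have "0 < emeasure (mw w) (Q \<inter> dq p)" using pS by (auto simp: S_def intro: order_le_less_trans[OF zero_le])
  ultimately have "dq p \<inter> dq (0,0) \<noteq> {}" by auto
  then have "dq p \<subseteq> dq (0,0)" using bd[OF pS] by (intro dq_subset_or_disjoint) auto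
  then have pQ: "dq p \<subseteq> Q" using dq_subset_clo[of "(0,0)"] dq_zero by (auto simp: Q_def)
  have "dq p \<subseteq> A"
  proof
   fix x assume x: "x \<in> dq p"
   let ?R = "cub (cn p) (sd (fst p))"
   have "ennreal l * emeasure lebesgue ?R = ennreal l * emeasure lebesgue (dq p)"
    by (simp add: mdq emeasure_cub n_def)
   also have "... < (\<integral>\<^sup>+y\<in>dq p. g y \<partial>lebesgue)" using pS by (simp add: S_def gX)
   also have "... <= (\<integral>\<^sup>+y\<in>?R. g y \<partial>lebesgue)"
    using dq_subset_clo[of p] by (intro nn_integral_mono) (auto simp: indicator_def)
   finally have "ennreal l < avg (\<lambda>_. 1) ?R g"
    using avg_le_iff[OF wt_one sd_pos, of "cn p" "fst p" g "ennreal l"] by (simp add: mw_one not_le[symmetric])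
   also have "... <= HL g x" using x dq_subset_clo[of p] by (intro avg_le_Mx) auto
   finally show "x \<in> A" using x pQ by (auto simp: A_def)
  qed
  moreover have "emeasure (mw w) (dq p) <= ennreal (2 ^ n * l) * emeasure lebesgue (dq p)"
  proof -
   \<comment> \<open>The parent of a maximal cube is not selected, hence the mass of w on p is at
     most l times the volume of the parent. This is the origin of the factor 2^n.\<close>
   define q where "q = (fst p + 1, ix (fst p + 1) (cn p))"
   have ixp: "p = (fst p, ix (fst p) (cn p))" using cn_mem_dq[of p] by (simp add: dq_def prod_eq_iff)
   have "dq (fst p, ix (fst p) (cn p)) \<subseteq> dq (fst p + 1, ix (fst p + 1) (cn p))" by (rule dq_nested) simp
   then have pq: "dq p \<subseteq> dq q" unfolding q_def using ixp by simp
   have "q \<notin> S"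
   proof
    assume "q \<in> S"
    then have "dq p \<inter> dq q = {}" using p unfolding maxi_def by (auto simp: q_def)
    then show False using pq cn_mem_dq[of p] by blast
   qed
   have "emeasure (mw w) (dq p) <= emeasure (mw w) (Q \<inter> dq q)" using pq pQ Qs by (intro emeasure_mono) auto
   also have "... <= ennreal l * emeasure lebesgue (dq q)" using \<open>q \<notin> S\<close> by (simp add: S_def)
   also have "... = ennreal (2 ^ n * l) * emeasure lebesgue (dq p)"
    using l by (simp add: mdq q_def sd_Suc power_mult_distrib mult_ac flip: ennreal_mult)
   finally show ?thesis .
  qed
  ultimately show ?thesis by simp
 qed
 define O' where "O' = (\<Union>p\<in>maxi S. dq p)"
 have O': "O' \<in> sets lebesgue" "O' \<subseteq> A" using P by (auto simp: O'_def intro!: sets.countable_UN')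
 have wO: "emeasure (mw w) O' <= ennreal (2 ^ n * l) * emeasure lebesgue O'"
 proof -
  have "emeasure (mw w) O' <= emeasure (density lebesgue (\<lambda>_. ennreal (2 ^ n * l))) O'"
   unfolding O'_def using P maxi_disjoint by (intro emeasure_UN_disjoint_mono) (auto simp: emeasure_density_const)
  then show ?thesis using O' by (simp add: emeasure_density_const)
 qed
 \<comment> \<open>Off the selected cubes the density of w on every dyadic cube up to level 0 is at
   most l, so differentiation gives w(H) \<le> l |H|. Up to a null set H lies in A, because the
   maximal function dominates w almost everywhere on Q.\<close>
 define H where "H = {x \<in> Q. l < w x} - O'"
 note [measurable] = wm(1) Qs
 have L: "{x \<in> Q. l < w x} \<in> sets lebesgue" by (intro lebesgue_Collect) measurable
 then have H: "H \<in> sets lebesgue" using O' by (simp add: H_def)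
 have wH: "emeasure (mw w) H <= ennreal l * emeasure lebesgue H"
 proof -
  have "emeasure (mw (\<lambda>x. 1 * (indicator Q x * w x))) H <= emeasure (density lebesgue (\<lambda>_. ennreal l)) H"
  proof (rule dyadic_compare[where J = 0])
   show "emeasure (density lebesgue (\<lambda>_. ennreal l)) (big k :: (real ^ 'n) set) < \<infinity>" for k
    using wt_finite[OF wt_one, of "big k :: (real ^ 'n) set"] by (simp add: emeasure_density_const mw_one ennreal_mult_less_top big_def)
   fix x and j :: int assume x: "x \<in> H"
   then have "(j, ix j x) \<notin> S"
    using UN_maxi[of S 0] bd mem_dq_ix[of x j] by (auto simp: H_def O'_def)
   then show "emeasure (mw (\<lambda>x. 1 * (indicator Q x * w x))) (dq (j, ix j x)) <= emeasure (density lebesgue (\<lambda>_. ennreal l)) (dq (j, ix j x))"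
    using wm Qs by (subst emeasure_mw_indicator) (auto simp: S_def emeasure_density_const)
  qed (use H in \<open>auto intro!: absolutely_continuousI_density\<close>)
  moreover have "Q \<inter> H = H" by (auto simp: H_def)
  ultimately show ?thesis using wm Qs H by (subst (asm) emeasure_mw_indicator) (auto simp: emeasure_density_const)
 qed
 have HA: "emeasure lebesgue (O' \<union> H) <= emeasure lebesgue A"
 proof (rule emeasure_mono_AE)
  have "AE x in lebesgue. g x <= HL g x" using Mx_ge_AE[OF wt_one gm] unfolding mw_one .
  then show "AE x in lebesgue. x \<in> O' \<union> H --> x \<in> A"
  proof (rule eventually_mono, intro impI)
   fix x assume x: "g x <= HL g x" "x \<in> O' \<union> H"
   show "x \<in> A"
   proof (cases "x \<in> O'")
    case False
    then have "x \<in> Q" "l < w x" using x by (auto simp: H_def)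
    then have "ennreal l < g x" using l by (simp add: g_def ennreal_less_iff)
    then show ?thesis using x \<open>x \<in> Q\<close> by (auto simp: A_def)
   qed (use O' in auto)
  qed
 qed (use A in auto)
 have "emeasure (mw w) {x \<in> Q. l < w x} <= emeasure (mw w) (O' \<union> H)"
  using O' H by (intro emeasure_mono) (auto simp: H_def)
 also have "... <= emeasure (mw w) O' + emeasure (mw w) H" using O' H by (intro emeasure_subadditive) auto
 also have "... <= ennreal (2 ^ n * l) * emeasure lebesgue O' + ennreal (2 ^ n * l) * emeasure lebesgue H"
 proof (intro add_mono wO order_trans[OF wH] mult_right_mono ennreal_leI)
  have "1 * l <= 2 ^ n * l" using l by (intro mult_right_mono) auto
  then show "l <= 2 ^ n * l" by simp
 qed auto
 also have "... = ennreal (2 ^ n * l) * emeasure lebesgue (O' \<union> H)"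
  using O' H by (subst plus_emeasure[symmetric]) (auto simp: H_def distrib_left)
 also have "... <= ennreal (2 ^ n * l) * emeasure lebesgue A" using HA by (rule mult_left_mono) simp
 finally show ?thesis by (simp add: A_def Q_def n_def g_def[abs_def])
qed

text \<open>Let V be the average of w over the cube and X the part where w > 2^N V. The reverse
  weak-type inequality at each of the levels 2^i V with i = 1, ..., N bounds the mass of X. The
  right-hand sides add up to at most 2^(n + 1) times the integral of the localized maximal function,
  since dyadic levels below a number add up to at most twice that number. Hence N w(X) is at most
  2^(n + 1) b w(Q), and N is chosen to make w(X) at most a quarter of w(Q).\<close>

lemma fw_imp_weak:
 "\<exists>c. 0 < c \<and> c < 1 \<and> (\<forall>w :: real ^ 'n => real. wt w --> fw b w --> weak_ainf c (\<lambda>_. 1) w)"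
proof -
 define n where "n = CARD('n)"
 obtain N0 :: nat where N0: "2 ^ (n + 3) * \<bar>b\<bar> <= real N0" using real_arch_simple by blast
 define N where "N = max N0 1"
 have N: "2 ^ (n + 3) * \<bar>b\<bar> <= real N" "N >= 1" using N0 by (auto simp: N_def)
 \<comment> \<open>Off X the weight is at most 2^N V, so a set of volume at most c |Q| has at most
   half of the mass there. Together with the quarter from X this gives 3/4.\<close>
 define c :: real where "c = 1 / 2 ^ Suc N"
 have "(1::real) < 2 ^ Suc N" by (rule one_less_power) auto
 then have c: "0 < c" "c < 1" by (simp_all add: c_def)
 have "weak_ainf c (\<lambda>_. 1) w" if w: "wt w" "fw b w" for w :: "real ^ 'n => real"
  unfolding weak_ainf_def
 proof (intro allI impI)
  fix a :: "real ^ 'n" and s :: real and E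
  assume s: "s > 0" and E: "E \<in> sets lebesgue" "E \<subseteq> cub a s"
   "measure (mw (\<lambda>_. 1)) E <= c * measure (mw (\<lambda>_ :: real ^ 'n. 1)) (cub a s)"
  define Q where "Q = cub a s"
  define W where "W = measure (mw w) Q"
  have W: "W > 0" "emeasure (mw w) Q = ennreal W"
   unfolding W_def Q_def using wt_measure_pos[OF w(1) s] wt_emeasure_eq[OF w(1)] by simp_all
  define V where "V = W / s ^ n"
  have V: "V > 0" "V * s ^ n = W" using W s by (simp_all add: V_def)
  define g where "g y = ennreal (w y) * indicator Q y" for y
  define A where "A i = {x \<in> Q. ennreal (2 ^ i * V) < HL g x}" for i :: nat
  have A: "A i \<in> sets lebesgue" for i
   using Mx_set[OF wt_one, of "ennreal (2 ^ i * V)" g] by (simp add: A_def Q_def Collect_conj_eq)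
  define X where "X = {x \<in> Q. 2 ^ N * V < w x}"
  have [measurable]: "lmeas w" using wtD w by auto
  have XI: "{x \<in> Q. r < w x} \<in> sets lebesgue" for r unfolding Q_def by (intro lebesgue_Collect) measurable
  have X: "X \<in> sets lebesgue" unfolding X_def by (rule XI)
  have lev: "emeasure (mw w) X <= ennreal (2 ^ n) * (ennreal (2 ^ i * V) * emeasure lebesgue (A i))" if i: "i \<in> {1..N}" for i
  proof -
   have "(2::real) ^ i <= 2 ^ N" using i by (intro power_increasing) auto
   then have le: "2 ^ i * V <= 2 ^ N * V" using V by simp
   have "emeasure (mw w) X <= emeasure (mw w) {x \<in> Q. 2 ^ i * V < w x}"
    unfolding X_def using le XI[of "2 ^ i * V"] by (intro emeasure_mono) auto
   also have "... <= ennreal (2 ^ CARD('n) * (2 ^ i * V)) * emeasure lebesgue {x \<in> cub a s. ennreal (2 ^ i * V) < HL (\<lambda>y. ennreal (w y) * indicator (cub a s) y) x}"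
    unfolding Q_def
   proof (rule reverse_weak_type[OF w(1) s])
    have "1 * W <= 2 ^ i * W" using W by (intro mult_right_mono) auto
    then show "measure (mw w) (cub a s) <= 2 ^ i * V * s ^ CARD('n)" using V unfolding n_def W_def Q_def by (simp add: mult.assoc)
   qed (use V in auto)
   also have "... = ennreal (2 ^ n) * (ennreal (2 ^ i * V) * emeasure lebesgue (A i))"
    using V by (simp add: A_def Q_def g_def[abs_def] n_def ennreal_mult mult.assoc)
   finally show ?thesis .
  qed
  have "ennreal (real N) * emeasure (mw w) X = (\<Sum>i=1..N. emeasure (mw w) X)"
   by (simp add: ennreal_of_nat_eq_real_of_nat)
  also have "... <= (\<Sum>i=1..N. ennreal (2 ^ n) * (ennreal (2 ^ i * V) * emeasure lebesgue (A i)))"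
   by (intro sum_mono lev)
  also have "... = ennreal (2 ^ n) * (\<Sum>i=1..N. \<integral>\<^sup>+x. ennreal (2 ^ i * V) * indicator (A i) x \<partial>lebesgue)"
   using A by (simp add: sum_distrib_left nn_integral_cmult_indicator)
  also have "... = ennreal (2 ^ n) * (\<integral>\<^sup>+x. (\<Sum>i=1..N. ennreal (2 ^ i * V) * indicator (A i) x) \<partial>lebesgue)"
   using A by (subst nn_integral_sum) auto
  also have "... <= ennreal (2 ^ n) * (\<integral>\<^sup>+x. 2 * (HL g x * indicator Q x) \<partial>lebesgue)"
  proof (intro mult_left_mono nn_integral_mono)
   fix x
   have "(\<Sum>i=1..N. ennreal (2 ^ i * V) * indicator (A i) x) = (\<Sum>i=1..N. if ennreal (2 ^ i * V) < HL g x then ennreal (2 ^ i * V) else 0) * indicator Q x"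
   proof -
    have "ennreal (2 ^ i * V) * indicator (A i) x = (if ennreal (2 ^ i * V) < HL g x then ennreal (2 ^ i * V) else 0) * indicator Q x" for i
     by (auto simp: A_def indicator_def)
    then show ?thesis by (simp only: sum_distrib_right)
   qed
   also have "... <= (2 * HL g x) * indicator Q x"
    by (intro mult_right_mono sum_levels_le V) auto
   finally show "(\<Sum>i=1..N. ennreal (2 ^ i * V) * indicator (A i) x) <= 2 * (HL g x * indicator Q x)"
    by (simp add: mult.assoc)
  qed auto
  also have "... = ennreal (2 ^ n) * (2 * (\<integral>\<^sup>+x\<in>Q. HL g x \<partial>lebesgue))"
   using Mx_measurable[OF wt_one, of g] by (subst nn_integral_cmult) (auto simp: Q_def)
  also have "... <= ennreal (2 ^ n) * (2 * (ennreal b * emeasure (mw w) Q))"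
   using w(2) s unfolding fw_def g_def[abs_def] Q_def by (intro mult_left_mono) auto
  also have "... <= ennreal (2 ^ n) * (2 * (ennreal \<bar>b\<bar> * ennreal W))"
   by (intro mult_left_mono mult_mono ennreal_leI) (auto simp: W)
  also have "... = ennreal (2 ^ Suc n * \<bar>b\<bar> * W)"
  proof -
   have two: "(2 :: ennreal) = ennreal 2" by simp
   show ?thesis unfolding two using W by (simp add: mult_ac del: ennreal_numeral flip: ennreal_mult)
  qed
  finally have "ennreal (real N) * emeasure (mw w) X <= ennreal (2 ^ Suc n * \<bar>b\<bar> * W)" .
  moreover have "emeasure (mw w) X = ennreal (measure (mw w) X)"
   by (rule wt_emeasure_eq[OF w(1)]) (auto simp: X_def Q_def intro: bounded_subset[OF bounded_cub])
  ultimately have "real N * measure (mw w) X <= 2 ^ Suc n * \<bar>b\<bar> * W"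
   using W by (simp flip: ennreal_mult)
  also have "... <= real N / 4 * W"
   using N W by (intro mult_right_mono) (auto simp: power_add)
  finally have mX: "measure (mw w) X <= W / 4" using N by simp
  have bE: "bounded E" using E bounded_cub bounded_subset by blast
  have "measure (mw w) (E - X) <= 2 ^ N * V * measure lebesgue (E - X)"
   using w(1) E X bE V by (intro measure_mw_le) (auto simp: X_def Q_def intro: bounded_diff)
  also have "... <= 2 ^ N * V * measure lebesgue E"
   using wt_measure_mono[OF wt_one, of "E - X" E] bE E V by (intro mult_left_mono) (auto simp: mw_one)
  also have "... <= 2 ^ N * V * (c * s ^ n)"
   using E(3) V s by (intro mult_left_mono) (auto simp: mw_one measure_cub n_def)
  also have "... = 2 ^ N * c * W" using V by simp
  also have "... = W / 2" by (simp add: c_def)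
  finally have "measure (mw w) (E - X) <= W / 2" .
  moreover have "measure (mw w) E <= measure (mw w) ((E - X) \<union> X)"
   using w(1) E X bE by (intro wt_measure_mono) (auto simp: X_def Q_def intro!: bounded_diff bounded_subset[OF bounded_cub])
  moreover have "measure (mw w) ((E - X) \<union> X) <= measure (mw w) (E - X) + measure (mw w) X"
   using w(1) E X bE by (intro wt_measure_Un) (auto simp: X_def Q_def intro!: bounded_diff bounded_subset[OF bounded_cub])
  ultimately show "measure (mw w) E <= 3/4 * measure (mw w) (cub a s)" using mX by (simp add: W_def Q_def)
 qed
 then show ?thesis using c by blast
qed

lemma weak_ainf_mono:
 assumes "weak_ainf c u w" "c' <= c" shows "weak_ainf c' u w"
 unfolding weak_ainf_def
proof (intro allI impI)
 fix a :: "real ^ 'a" and s :: real and E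
 assume E: "s > 0" "E \<in> sets lebesgue" "E \<subseteq> cub a s" "measure (mw u) E <= c' * measure (mw u) (cub a s)"
 have "c' * measure (mw u) (cub a s) <= c * measure (mw u) (cub a s)" using assms(2) by (intro mult_right_mono) auto
 then show "measure (mw w) E <= 3/4 * measure (mw w) (cub a s)"
  using assms(1)[unfolded weak_ainf_def, rule_format, OF E(1,2,3)] E(4) by linarith
qed

text \<open>The exchange of roles in \<open>weak_ainf_imp_ainf\<close> is used twice. With w
  doubling it bounds Lebesgue measure in terms of w; weakened to one level and applied again, now
  with Lebesgue measure as the doubling measure, it bounds w in terms of Lebesgue measure.\<close>

lemma weak_one_imp_ainf:
 assumes c: "0 < c" "c < 1"
 shows "\<exists>C\<ge>1. \<exists>d. 0 < d \<and> d < 1 \<and> (\<exists>K\<ge>1. \<forall>w :: real ^ 'n => real. wt w --> weak_ainf c (\<lambda>_. 1) w -->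
  ainf C d (\<lambda>_. 1) w \<and> ainf C d w (\<lambda>_. 1) \<and> dbl K w)"
proof -
 obtain K where K: "K >= 1" "\<forall>w :: real ^ 'n => real. wt w --> weak_ainf c (\<lambda>_. 1) w --> dbl K w"
  using weak_ainf_imp_dbl[OF c(1), where 'n = 'n] by blast
 obtain C1 d1 where 1: "C1 > 0" "d1 > 0" "\<forall>u w :: real ^ 'n => real. wt u --> wt w --> weak_ainf c u w --> dbl K w --> ainf C1 d1 w u"
  using weak_ainf_imp_ainf[OF c K(1), where 'n = 'n] by blast
 obtain c2 where 2: "c2 > 0" "\<forall>u w :: real ^ 'n => real. wt u --> wt w --> ainf C1 d1 u w --> weak_ainf c2 u w"
  using ainf_imp_weak[OF 1(1,2), where 'n = 'n] by blast
 define c3 where "c3 = min c2 (1/2)"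
 have c3: "0 < c3" "c3 < 1" using 2 by (auto simp: c3_def)
 have K1: "(16::real) ^ CARD('n) >= 1" by simp
 obtain C3 d3 where 3: "C3 > 0" "d3 > 0" "\<forall>u w :: real ^ 'n => real. wt u --> wt w --> weak_ainf c3 u w --> dbl (16 ^ CARD('n)) w --> ainf C3 d3 w u"
  using weak_ainf_imp_ainf[OF c3 K1, where 'n = 'n] by blast
 define C where "C = max 1 (max C1 C3)"
 define d where "d = min (1/2) (min d1 d3)"
 have d: "0 < d" "d < 1" using 1 3 by (auto simp: d_def)
 have "ainf C d (\<lambda>_. 1) w \<and> ainf C d w (\<lambda>_. 1) \<and> dbl K w" if w: "wt w" "weak_ainf c (\<lambda>_. 1) w" for w :: "real ^ 'n => real"
 proof -
  have dw: "dbl K w" using K(2)[rule_format, OF w] .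
  have a1: "ainf C1 d1 w (\<lambda>_. 1)" using 1(3)[rule_format, OF wt_one w(1) w(2) dw] .
  then have "weak_ainf c2 w (\<lambda>_. 1)" by (intro 2(2)[rule_format] w wt_one)
  then have "weak_ainf c3 w (\<lambda>_. 1)" by (rule weak_ainf_mono) (simp add: c3_def)
  then have a3: "ainf C3 d3 (\<lambda>_. 1) w" using 3(3)[rule_format, OF w(1) wt_one _ dbl_one] by simp
  have "ainf C d (\<lambda>_. 1) w" using d 3 by (intro ainf_mono[OF wt_one a3]) (auto simp: C_def d_def)
  moreover have "ainf C d w (\<lambda>_. 1)" using d 1 by (intro ainf_mono[OF w(1) a1]) (auto simp: C_def d_def)
  ultimately show ?thesis using dw by blast
 qed
 then show ?thesis using d K by (intro exI[of _ C] conjI exI[of _ d] exI[of _ K]) (auto simp: C_def)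
qed

lemma ainf_imp_weak_one:
 assumes "C > 0" "d > 0"
 shows "\<exists>c. 0 < c \<and> c < 1 \<and> (\<forall>w :: real ^ 'n => real. wt w --> ainf C d (\<lambda>_. 1) w --> weak_ainf c (\<lambda>_. 1) w)"
proof -
 obtain c where c: "c > 0" "\<forall>u w :: real ^ 'n => real. wt u --> wt w --> ainf C d u w --> weak_ainf c u w"
  using ainf_imp_weak[OF assms, where 'n = 'n] by blast
 have "weak_ainf (min c (1/2)) (\<lambda>_. 1) w" if "wt w" "ainf C d (\<lambda>_. 1) w" for w :: "real ^ 'n => real"
 proof -
  have "weak_ainf c (\<lambda>_. 1) w" using c(2)[rule_format, OF wt_one that] .
  then show ?thesis by (rule weak_ainf_mono) simp
 qed
 then show ?thesis using c(1) by (intro exI[of _ "min c (1/2)"]) auto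
qed

subsection \<open>Distribution of a weight on a cube\<close>

lemma self_improve:
 fixes X :: real
 assumes "X >= 0" "W > 0" "z > 0" "C > 0" "0 < d" "d < 1" "X <= C * (X * z) powr d * W"
 shows "X <= (C * W) powr (1 / (1 - d)) * z powr (d / (1 - d))"
proof (cases "X = 0")
 case False
 then have X: "X > 0" using assms by simp
 have "X powr (1 - d) * X powr d <= C * W * z powr d * X powr d"
  using assms X by (simp add: powr_mult mult_ac flip: powr_add)
 then have "X powr (1 - d) <= C * W * z powr d" using X by simp
 then have "(X powr (1 - d)) powr (1 / (1 - d)) <= (C * W * z powr d) powr (1 / (1 - d))"
  using assms by (intro powr_mono2) auto
 then show ?thesis using assms X by (simp add: powr_powr powr_mult)
qed simp

text \<open>Chebyshev's inequality bounds |E| by X / l, where X is the w-mass of E. Inserted into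
  the A_inf inequality for E, this bounds X by its own power d < 1, and absorption leaves polynomial
  decay in l with the exponent d / (1 - d). This gain is the source of all higher integrability
  below.\<close>

lemma tail_upper:
 fixes w :: "real ^ 'n => real" and c :: "real ^ 'n"
 assumes w: "wt w" "ainf C d (\<lambda>_. 1) w" and C: "C > 0" "0 < d" "d < 1" and s: "s > 0" and l: "l > 0"
 defines "W \<equiv> measure (mw w) (cub c s)"
 shows "measure (mw w) {x \<in> cub c s. l < w x} <= C powr (1 / (1 - d)) * W * (W / (l * s ^ CARD('n))) powr (d / (1 - d))"
proof -
 define E where "E = {x \<in> cub c s. l < w x}"
 have [measurable]: "lmeas w" using wtD w by auto
 have E: "E \<in> sets lebesgue" "E \<subseteq> cub c s" "bounded E"
  unfolding E_def by (intro lebesgue_Collect, measurable, auto intro: bounded_subset[OF bounded_cub])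
 have W: "W > 0" unfolding W_def by (rule wt_measure_pos[OF w(1) s])
 define X where "X = measure (mw w) E"
 have "l * measure lebesgue E <= X" unfolding X_def
  using E l by (intro measure_mw_ge[OF w(1)]) (auto simp: E_def)
 then have "measure lebesgue E <= X / l" using l by (simp add: field_simps)
 then have "measure lebesgue E / s ^ CARD('n) <= X / l / s ^ CARD('n)" using s by (intro divide_right_mono) auto
 then have "measure lebesgue E / s ^ CARD('n) <= X * (1 / (l * s ^ CARD('n)))" by simp
 then have "(measure lebesgue E / s ^ CARD('n)) powr d <= (X * (1 / (l * s ^ CARD('n)))) powr d"
  using C s by (intro powr_mono2) auto
 then have "C * (measure lebesgue E / s ^ CARD('n)) powr d * W <= C * (X * (1 / (l * s ^ CARD('n)))) powr d * W"
  using C W by (intro mult_right_mono mult_left_mono) auto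
 moreover have "X <= C * (measure lebesgue E / s ^ CARD('n)) powr d * W"
  using w(2) s E unfolding ainf_def X_def W_def mw_one by (metis less_imp_le measure_cub)
 ultimately have "X <= C * (X * (1 / (l * s ^ CARD('n)))) powr d * W" by linarith
 then have "X <= (C * W) powr (1 / (1 - d)) * (1 / (l * s ^ CARD('n))) powr (d / (1 - d))"
  using C W l s by (intro self_improve) (auto simp: X_def)
 also have "... = C powr (1 / (1 - d)) * W * (W / (l * s ^ CARD('n))) powr (d / (1 - d))"
 proof -
  have "1 / (1 - d) = 1 + d / (1 - d)" using C by (simp add: field_simps)
  then have "W powr (1 / (1 - d)) = W * W powr (d / (1 - d))" using W by (simp add: powr_add)
  then show ?thesis using C W l s by (simp add: powr_mult powr_divide)
 qed
 finally show ?thesis by (simp add: X_def E_def)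
qed

text \<open>The same absorption with the two measures exchanged, using w(E) \<le> l |E| on the set
  of small values.\<close>

lemma tail_lower:
 fixes w :: "real ^ 'n => real" and c :: "real ^ 'n"
 assumes w: "wt w" "ainf C d w (\<lambda>_. 1)" and C: "C > 0" "0 < d" "d < 1" and s: "s > 0" and l: "l > 0"
 defines "W \<equiv> measure (mw w) (cub c s)"
 shows "measure lebesgue {x \<in> cub c s. w x <= l} <= C powr (1 / (1 - d)) * s ^ CARD('n) * (l * s ^ CARD('n) / W) powr (d / (1 - d))"
proof -
 define E where "E = {x \<in> cub c s. w x <= l}"
 have [measurable]: "lmeas w" using wtD w by auto
 have E: "E \<in> sets lebesgue" "E \<subseteq> cub c s" "bounded E"
  unfolding E_def by (intro lebesgue_Collect, measurable, auto intro: bounded_subset[OF bounded_cub])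
 have W: "W > 0" unfolding W_def by (rule wt_measure_pos[OF w(1) s])
 define X where "X = measure lebesgue E"
 define Y where "Y = s ^ CARD('n)"
 have Y: "Y > 0" using s by (simp add: Y_def)
 have "measure (mw w) E <= l * X" unfolding X_def
  using E l by (intro measure_mw_le[OF w(1)]) (auto simp: E_def)
 then have "measure (mw w) E / W <= l * X / W" using W by (intro divide_right_mono) auto
 then have "measure (mw w) E / W <= X * (l / W)" by (simp add: mult.commute)
 then have "(measure (mw w) E / W) powr d <= (X * (l / W)) powr d"
  using C W by (intro powr_mono2) auto
 then have "C * (measure (mw w) E / W) powr d * Y <= C * (X * (l / W)) powr d * Y"
  using C Y by (intro mult_right_mono mult_left_mono) auto
 moreover have "X <= C * (measure (mw w) E / W) powr d * Y"
  using w(2) s E unfolding ainf_def X_def W_def mw_one Y_def by (metis less_imp_le measure_cub)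
 ultimately have "X <= C * (X * (l / W)) powr d * Y" by linarith
 then have "X <= (C * Y) powr (1 / (1 - d)) * (l / W) powr (d / (1 - d))"
  using C W l Y by (intro self_improve) (auto simp: X_def)
 also have "... = C powr (1 / (1 - d)) * Y * (l * Y / W) powr (d / (1 - d))"
 proof -
  have "1 / (1 - d) = 1 + d / (1 - d)" using C by (simp add: field_simps)
  then have "Y powr (1 / (1 - d)) = Y * Y powr (d / (1 - d))" using Y by (simp add: powr_add)
  then show ?thesis using C W l Y by (simp add: powr_mult powr_divide)
 qed
 finally show ?thesis by (simp add: X_def E_def Y_def)
qed

lemma ennreal_powr_powr: "0 < p ==> 0 < q ==> ennreal_powr (ennreal_powr x p) q = ennreal_powr x (p * q)"
 by (cases x) (auto simp: ennreal_powr_ennreal powr_powr)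

lemma ennreal_powr_one [simp]: "ennreal_powr x 1 = x"
 by (cases x) (auto simp: ennreal_powr_ennreal)

lemma ennreal_less_powrD:
 assumes "ennreal t < ennreal_powr y p" "t > 0" "p > 0"
 shows "ennreal (t powr (1 / p)) < y"
proof (rule ccontr)
 assume "\<not> ?thesis"
 then have "ennreal_powr y p <= ennreal_powr (ennreal (t powr (1 / p))) p"
  using assms by (intro ennreal_powr_mono) auto
 also have "... = ennreal t" using assms by (simp add: ennreal_powr_ennreal powr_powr)
 finally show False using assms by simp
qed

text \<open>The tail of w decays like \<tau> to the power -\<eta>, so the level sets of the
  localized maximal function decay with exponent 1 + \<eta>. This is a weak-type bound for its power
  1 + \<eta>, and Kolmogorov's inequality with exponent 1 - d = 1 / (1 + \<eta>) returns the first
  power.\<close>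

lemma ainf_imp_fw:
 assumes C: "C > 0" "0 < d" "d < 1"
 shows "\<exists>b\<ge>0. \<forall>w :: real ^ 'n => real. wt w --> ainf C d (\<lambda>_. 1) w --> fw b w"
proof -
 define \<eta> where "\<eta> = d / (1 - d)"
 have eta: "\<eta> > 0" "1 + \<eta> = 1 / (1 - d)" using C by (auto simp: \<eta>_def field_simps)
 define K where "K = (16::real) ^ CARD('n)"
 have K: "K >= 1" by (simp add: K_def)
 define C0 where "C0 = K * C powr (1 / (1 - d)) * (2 * K) powr (1 + \<eta>)"
 have C0: "C0 > 0" using C K by (simp add: C0_def)
 define b where "b = kolC (1 - d) * C0 powr (1 - d)"
 have kc: "kolC (1 - d) >= 1" using C by (intro kolC_ge1) auto
 have b: "b >= 0" using kc by (simp add: b_def)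
 have "fw b w" if w: "wt w" "ainf C d (\<lambda>_. 1) w" for w :: "real ^ 'n => real"
  unfolding fw_def
 proof (intro allI impI)
  fix c :: "real ^ 'n" and s :: real assume s: "s > 0"
  define Q where "Q = cub c s"
  define W where "W = measure (mw w) Q"
  have W: "W > 0" "emeasure (mw w) Q = ennreal W"
   unfolding W_def Q_def using wt_measure_pos[OF w(1) s] wt_emeasure_eq[OF w(1)] by simp_all
  define Y where "Y = s ^ CARD('n)"
  have Y: "Y > 0" using s by (simp add: Y_def)
  have wm[measurable]: "lmeas w" using wtD w by auto
  have Qs[measurable]: "Q \<in> sets lebesgue" by (simp add: Q_def)
  define g where "g y = ennreal (w y) * indicator Q y" for y
  have gm[measurable]: "lmeas g" unfolding g_def[abs_def] by measurable
  have MX[measurable]: "HL g \<in> borel_measurable lebesgue" by (rule Mx_measurable[OF wt_one])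
  define L where "L = C0 * W * (W / Y) powr \<eta>"
  have L: "L > 0" using C0 W Y by (simp add: L_def)
  have "(\<integral>\<^sup>+x\<in>Q. ennreal_powr (ennreal_powr (HL g x) (1 + \<eta>)) (1 - d) \<partial>lebesgue)
    <= ennreal (kolC (1 - d) * Y powr (1 - (1 - d)) * L powr (1 - d))"
  proof (rule kolmogorov)
   show "emeasure lebesgue Q <= ennreal Y" using s by (simp add: Q_def Y_def emeasure_cub)
   fix t :: real assume t: "t > 0"
   define \<tau> where "\<tau> = t powr (1 / (1 + \<eta>)) / (2 * K)"
   have tau: "\<tau> > 0" "2 * K * \<tau> = t powr (1 / (1 + \<eta>))" using t K by (simp_all add: \<tau>_def)
   define X where "X = {x. ennreal (2 * K * \<tau>) < HL g x}"
   have Xs: "X \<in> sets lebesgue" unfolding X_def by (rule Mx_set[OF wt_one])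
   have sub: "{x \<in> Q. ennreal t < ennreal_powr (HL g x) (1 + \<eta>)} \<subseteq> X"
   proof
    fix x assume "x \<in> {x \<in> Q. ennreal t < ennreal_powr (HL g x) (1 + \<eta>)}"
    then have "ennreal t < ennreal_powr (HL g x) (1 + \<eta>)" by simp
    from ennreal_less_powrD[OF this t] show "x \<in> X" unfolding X_def tau(2) using eta(1) by simp
   qed
   have T: "{x \<in> Q. \<tau> < w x} \<in> sets lebesgue" by (intro lebesgue_Collect) measurable
   have "ennreal \<tau> * emeasure lebesgue X <= ennreal K * (\<integral>\<^sup>+x\<in>{x. ennreal \<tau> < g x}. g x \<partial>lebesgue)"
    using Mx_level[OF wt_one dbl_one _ gm tau(1)] unfolding X_def mw_one K_def by simp
   also have "(\<integral>\<^sup>+x\<in>{x. ennreal \<tau> < g x}. g x \<partial>lebesgue) = emeasure (mw w) {x \<in> Q. \<tau> < w x}"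
    using tau(1) by (subst emeasure_mw[OF wm T]) (auto intro!: nn_integral_cong simp: g_def indicator_def ennreal_less_iff)
   also have "... = ennreal (measure (mw w) {x \<in> Q. \<tau> < w x})"
    by (rule wt_emeasure_eq[OF w(1)]) (auto simp: Q_def intro: bounded_subset[OF bounded_cub])
   also have "... <= ennreal (C powr (1 / (1 - d)) * W * (W / (\<tau> * Y)) powr \<eta>)"
    unfolding W_def Q_def Y_def \<eta>_def by (intro ennreal_leI tail_upper w C s tau)
   finally have "ennreal \<tau> * emeasure lebesgue X <= ennreal (K * (C powr (1 / (1 - d)) * W * (W / (\<tau> * Y)) powr \<eta>))"
    using K W by (simp add: mult_left_mono flip: ennreal_mult)
   then have 1: "ennreal (t / \<tau>) * (ennreal \<tau> * emeasure lebesgue X) <= ennreal (t / \<tau>) * ennreal (K * (C powr (1 / (1 - d)) * W * (W / (\<tau> * Y)) powr \<eta>))"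
    by (intro mult_left_mono) auto
   have 2: "t / \<tau> * (K * (C powr (1 / (1 - d)) * W * (W / (\<tau> * Y)) powr \<eta>)) = L"
   proof -
    have "(2 * K) powr (1 + \<eta>) * \<tau> powr (1 + \<eta>) = (t powr (1 / (1 + \<eta>))) powr (1 + \<eta>)"
     unfolding tau(2)[symmetric] using tau(1) K by (simp add: powr_mult)
    also have "... = t" using t eta(1) by (simp add: powr_powr)
    finally have "(2 * K) powr (1 + \<eta>) * \<tau> powr (1 + \<eta>) = t" .
    then have "t / \<tau> = (2 * K) powr (1 + \<eta>) * \<tau> powr \<eta>" using tau by (simp add: powr_add field_simps)
    moreover have "(W / (\<tau> * Y)) powr \<eta> = (W / Y) powr \<eta> / \<tau> powr \<eta>"
     using W Y tau by (simp add: powr_divide powr_mult)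
    ultimately show ?thesis using tau by (simp add: L_def C0_def)
   qed
   have "ennreal t * emeasure lebesgue X = ennreal (t / \<tau>) * (ennreal \<tau> * emeasure lebesgue X)"
    using t tau by (simp add: mult.assoc[symmetric] flip: ennreal_mult)
   also have "... <= ennreal (t / \<tau> * (K * (C powr (1 / (1 - d)) * W * (W / (\<tau> * Y)) powr \<eta>)))"
    using 1 t tau K W by (subst ennreal_mult) auto
   finally have "ennreal t * emeasure lebesgue X <= ennreal L" unfolding 2 .
   moreover have "ennreal t * emeasure lebesgue {x \<in> Q. ennreal t < ennreal_powr (HL g x) (1 + \<eta>)} <= ennreal t * emeasure lebesgue X"
    using sub Xs by (intro mult_left_mono emeasure_mono) auto
   ultimately show "ennreal t * emeasure lebesgue {x \<in> Q. ennreal t < ennreal_powr (HL g x) (1 + \<eta>)} <= ennreal L"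
    by (rule order_trans[rotated])
  qed (use C Y L in auto)
  also have "kolC (1 - d) * Y powr (1 - (1 - d)) * L powr (1 - d) = b * W"
  proof -
   have "((W / Y) powr \<eta>) powr (1 - d) = (W / Y) powr d" using C by (simp add: powr_powr \<eta>_def)
   then have "L powr (1 - d) = C0 powr (1 - d) * W powr (1 - d) * (W / Y) powr d"
    using C0 W Y by (simp add: L_def powr_mult)
   moreover have "Y powr d * (W powr (1 - d) * (W / Y) powr d) = W"
    using W Y by (simp add: powr_divide flip: powr_add)
   ultimately show ?thesis by (simp add: b_def mult_ac)
  qed
  also have "ennreal (b * W) = ennreal b * emeasure (mw w) Q" using b W by (simp add: ennreal_mult)
  finally have "(\<integral>\<^sup>+x\<in>Q. ennreal_powr (ennreal_powr (HL g x) (1 + \<eta>)) (1 - d) \<partial>lebesgue) <= ennreal b * emeasure (mw w) Q" .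
  moreover have "ennreal_powr (ennreal_powr y (1 + \<eta>)) (1 - d) = y" for y
   using C eta by (simp add: ennreal_powr_powr)
  ultimately show "(\<integral>\<^sup>+x\<in>cub c s. HL (\<lambda>y. ennreal (w y) * indicator (cub c s) y) x \<partial>lebesgue)
    <= ennreal b * emeasure (mw w) (cub c s)"
   by (simp add: Q_def g_def[abs_def])
 qed
 then show ?thesis using b by blast
qed

text \<open>The tail bound is a weak-type inequality for \<open>w powr \<eta>\<close> with respect
  to the measure w dx. Kolmogorov's inequality with exponent 1/2 makes
  \<open>w powr (\<eta> / 2)\<close> integrable for w dx, hence the exponent 1 + \<eta> / 2 for
  dx.\<close>

lemma reverse_holder:
 assumes C: "C > 0" "0 < d" "d < 1"
 defines "\<eta> \<equiv> d / (1 - d)"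
 shows "\<exists>C'\<ge>0. \<forall>(w :: real ^ 'n => real) c s. wt w --> ainf C d (\<lambda>_. 1) w --> s > 0 -->
  (\<integral>\<^sup>+x\<in>cub c s. ennreal (w x powr (1 + \<eta> / 2)) \<partial>lebesgue)
   <= ennreal (C' * s ^ CARD('n) * (measure (mw w) (cub c s) / s ^ CARD('n)) powr (1 + \<eta> / 2))"
proof -
 have eta: "\<eta> > 0" using C by (auto simp: \<eta>_def)
 define C0 where "C0 = C powr (1 / (1 - d))"
 have C0: "C0 > 0" using C by (simp add: C0_def)
 define C' where "C' = kolC (1/2) * C0 powr (1/2)"
 have kc: "kolC (1/2) >= 1" by (intro kolC_ge1) auto
 have C': "C' >= 0" using kc by (simp add: C'_def)
 have "(\<integral>\<^sup>+x\<in>cub c s. ennreal (w x powr (1 + \<eta> / 2)) \<partial>lebesgue)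
   <= ennreal (C' * s ^ CARD('n) * (measure (mw w) (cub c s) / s ^ CARD('n)) powr (1 + \<eta> / 2))"
  if w: "wt w" "ainf C d (\<lambda>_. 1) w" and s: "s > 0" for w :: "real ^ 'n => real" and c s
 proof -
  define Q where "Q = cub c s"
  define W where "W = measure (mw w) Q"
  have W: "W > 0" "emeasure (mw w) Q = ennreal W"
   unfolding W_def Q_def using wt_measure_pos[OF w(1) s] wt_emeasure_eq[OF w(1)] by simp_all
  define Y where "Y = s ^ CARD('n)"
  have Y: "Y > 0" using s by (simp add: Y_def)
  have wm[measurable]: "lmeas w" and w0: "\<And>x. 0 <= w x" using wtD w by auto
  have Qs[measurable]: "Q \<in> sets lebesgue" by (simp add: Q_def)
  define L where "L = C0 * W * (W / Y) powr \<eta>"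
  have L: "L > 0" using C0 W Y by (simp add: L_def)
  have "(\<integral>\<^sup>+x\<in>Q. ennreal_powr (ennreal (w x powr \<eta>)) (1/2) \<partial>mw w)
    <= ennreal (kolC (1/2) * W powr (1 - 1/2) * L powr (1/2))"
  proof (rule kolmogorov)
   fix t :: real assume t: "t > 0"
   define r where "r = t powr (1 / \<eta>)"
   have r: "r > 0" "r powr \<eta> = t" using t eta by (simp_all add: r_def powr_powr)
   have sub: "{x \<in> Q. ennreal t < ennreal (w x powr \<eta>)} \<subseteq> {x \<in> Q. r < w x}"
   proof safe
    fix x assume "ennreal t < ennreal (w x powr \<eta>)"
    then have lt: "t < w x powr \<eta>" using t by (simp add: ennreal_less_iff)
    show "r < w x"
    proof (rule ccontr)
     assume "\<not> r < w x"
     then have "w x powr \<eta> <= r powr \<eta>" using w0 eta by (intro powr_mono2) auto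
     then show False using lt r by simp
    qed
   qed
   have R: "{x \<in> Q. r < w x} \<in> sets lebesgue" by (intro lebesgue_Collect) measurable
   have "emeasure (mw w) {x \<in> Q. ennreal t < ennreal (w x powr \<eta>)} <= emeasure (mw w) {x \<in> Q. r < w x}"
    using sub R by (intro emeasure_mono) auto
   also have "... = ennreal (measure (mw w) {x \<in> Q. r < w x})"
    by (rule wt_emeasure_eq[OF w(1)]) (auto simp: Q_def intro: bounded_subset[OF bounded_cub])
   also have "... <= ennreal (C0 * W * (W / (r * Y)) powr \<eta>)"
    unfolding W_def Q_def Y_def \<eta>_def C0_def by (intro ennreal_leI tail_upper w C s r)
   also have "C0 * W * (W / (r * Y)) powr \<eta> = L / t"
    using W Y r by (simp add: L_def powr_divide powr_mult)
   finally have "ennreal t * emeasure (mw w) {x \<in> Q. ennreal t < ennreal (w x powr \<eta>)} <= ennreal t * ennreal (L / t)"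
    by (rule mult_left_mono) simp
   also have "... = ennreal L" using t L by (simp flip: ennreal_mult)
   finally show "ennreal t * emeasure (mw w) {x \<in> Q. ennreal t < ennreal (w x powr \<eta>)} <= ennreal L" .
  qed (use C W L in auto)
  also have "kolC (1/2) * W powr (1 - 1/2) * L powr (1/2) = C' * Y * (W / Y) powr (1 + \<eta> / 2)"
  proof -
   have "L powr (1/2) = C0 powr (1/2) * W powr (1/2) * (W / Y) powr (\<eta> / 2)"
    using C0 W Y by (simp add: L_def powr_mult powr_powr)
   moreover have "W powr (1 - 1/2) * W powr (1/2) = W" using W by (simp flip: powr_add)
   moreover have "Y * (W / Y) powr (1 + \<eta> / 2) = W * (W / Y) powr (\<eta> / 2)" using W Y by (simp add: powr_add)
   ultimately show ?thesis by (simp add: C'_def mult_ac)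
  qed
  finally have 1: "(\<integral>\<^sup>+x\<in>Q. ennreal (w x powr (\<eta> / 2)) \<partial>mw w) <= ennreal (C' * Y * (W / Y) powr (1 + \<eta> / 2))"
   by (simp add: ennreal_powr_ennreal powr_powr)
  have "(\<integral>\<^sup>+x\<in>Q. ennreal (w x powr (1 + \<eta> / 2)) \<partial>lebesgue) = (\<integral>\<^sup>+x\<in>Q. ennreal (w x * w x powr (\<eta> / 2)) \<partial>lebesgue)"
   using w0 by (simp add: powr_add)
  also have "... = emeasure (mw (\<lambda>x. w x * w x powr (\<eta> / 2))) Q" by (rule emeasure_mw[symmetric]) auto
  also have "... = (\<integral>\<^sup>+x\<in>Q. ennreal (w x powr (\<eta> / 2)) \<partial>mw w)" using w0 by (intro emeasure_mw_mult) auto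
  finally show ?thesis using 1 unfolding Q_def W_def Y_def by simp
 qed
 then show ?thesis using C' by (intro exI[of _ C']) auto
qed

section \<open>The weights and the class A_inf of the statement versus their quantitative
  forms\<close>

lemma wt_imp_weight:
 assumes w: "wt w" and pos: "AE x in lebesgue. 0 < w x"
 shows "weight w"
 unfolding weight_def
proof (intro conjI allI impI)
 fix K :: "(real ^ 'a) set" assume K: "compact K"
 have wm[measurable]: "lmeas w" and w0: "\<And>x. 0 <= w x" using wtD w by auto
 have Ks[measurable]: "K \<in> sets lebesgue" using K by (simp add: lmeasurable_compact fmeasurableD)
 have "emeasure (mw w) K < \<infinity>" using K compact_imp_bounded by (intro wt_finite[OF w]) auto
 then have fin: "(\<integral>\<^sup>+x\<in>K. ennreal (w x) \<partial>lebesgue) < \<infinity>" by (simp add: emeasure_mw)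
 show "w absolutely_integrable_on K"
  unfolding set_integrable_def
 proof (rule integrableI_bounded)
  have "(\<integral>\<^sup>+x. ennreal (norm (indicat_real K x *\<^sub>R w x)) \<partial>lebesgue) = (\<integral>\<^sup>+x\<in>K. ennreal (w x) \<partial>lebesgue)"
   using w0 by (intro nn_integral_cong) (auto simp: indicator_def)
  then show "(\<integral>\<^sup>+x. ennreal (norm (indicat_real K x *\<^sub>R w x)) \<partial>lebesgue) < \<infinity>" using fin by simp
 qed simp
qed (use assms wtD in auto)

lemma weight_imp_wt:
 fixes w :: "real ^ 'n => real"
 assumes "weight w"
 shows "wt w" "AE x in lebesgue. 0 < w x"
proof -
 have w0: "\<And>x. 0 <= w x" and pos: "AE x in lebesgue. 0 < w x" and int: "\<And>K. compact K ==> w absolutely_integrable_on K"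
  using assms by (auto simp: weight_def)
 have comp: "compact (cub c s)" for c :: "real ^ 'n" and s by (simp add: cub_def compact_cbox)
 \<comment> \<open>Absolute integrability yields measurability only for restrictions to compact
   sets; w is their pointwise limit.\<close>
 have lim: "(\<lambda>k. indicat_real (big k) x *\<^sub>R w x) \<longlonglongrightarrow> w x" for x
 proof -
  obtain k where "x \<in> big k" using UN_big by blast
  then have "\<forall>\<^sub>F l in sequentially. indicat_real (big l) x *\<^sub>R w x = w x"
   using big_mono by (intro eventually_sequentiallyI[of k]) (auto simp: indicator_def)
  then show ?thesis by (rule tendsto_eventually)
 qed
 have "(\<lambda>x. indicat_real (big k) x *\<^sub>R w x) \<in> borel_measurable lebesgue" for k
  using int[OF comp] unfolding set_integrable_def big_def by (intro borel_measurable_integrable)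
 then have wm[measurable]: "lmeas w"
  by (rule borel_measurable_LIMSEQ_real[OF lim])
 show "wt w"
  unfolding wt_def
 proof (intro conjI allI impI wm w0)
  fix c :: "real ^ 'n" and s :: real assume s: "s > 0"
  have "(\<integral>\<^sup>+x. ennreal (norm (indicat_real (cub c s) x *\<^sub>R w x)) \<partial>lebesgue) < \<infinity>"
   using int[OF comp, of c s] unfolding set_integrable_def integrable_iff_bounded by auto
  also have "(\<integral>\<^sup>+x. ennreal (norm (indicat_real (cub c s) x *\<^sub>R w x)) \<partial>lebesgue) = emeasure (mw w) (cub c s)"
   using w0 by (subst emeasure_mw) (auto intro!: nn_integral_cong simp: indicator_def)
  finally show "emeasure (mw w) (cub c s) < \<infinity>" .
  show "0 < emeasure (mw w) (cub c s)"
  proof (rule ccontr)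
   assume "\<not> ?thesis"
   then have "(\<integral>\<^sup>+x\<in>cub c s. ennreal (w x) \<partial>lebesgue) = 0" by (simp add: emeasure_mw)
   then have "AE x in lebesgue. ennreal (w x) * indicator (cub c s) x = 0" by (subst (asm) nn_integral_0_iff_AE) auto
   then have "AE x in lebesgue. x \<notin> cub c s" using pos by eventually_elim (auto simp: indicator_def split: if_splits)
   then have "emeasure lebesgue (cub c s) = 0" by (subst (asm) AE_iff_measurable[of "cub c s"]) auto
   then show False using s by (simp add: emeasure_cub)
  qed
 qed
 show "AE x in lebesgue. 0 < w x" by (rule pos)
qed

lemma ainf_imp_pos:
 fixes w :: "real ^ 'n => real"
 assumes w: "wt w" "ainf C d w (\<lambda>_. 1)"
 shows "AE x in lebesgue. 0 < w x"
proof -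
 have wm[measurable]: "lmeas w" and w0: "\<And>x. 0 <= w x" using wtD w by auto
 define E where "E k = {x \<in> big k. w x <= 0}" for k
 have bk[measurable]: "big k \<in> sets lebesgue" for k by (simp add: big_def)
 have E1: "E k \<in> sets lebesgue" for k unfolding E_def by (intro lebesgue_Collect) measurable
 have E2: "E k \<subseteq> big k" for k by (auto simp: E_def)
 note E = E1 E2
 have bE: "bounded (E k)" for k using E(2) bounded_subset[OF bounded_cub] unfolding big_def by blast
 have "emeasure lebesgue (E k) = 0" for k
 proof -
  have "measure (mw w) (E k) <= 0 * measure lebesgue (E k)"
   using E bE by (intro measure_mw_le[OF w(1)]) (auto simp: E_def)
  then have "measure (mw w) (E k) = 0" by (simp add: antisym)
  moreover have "measure (mw (\<lambda>_. 1)) (E k) <= C * (measure (mw w) (E k) / measure (mw w) (big k)) powr d * measure (mw (\<lambda>_. 1)) (big k :: (real ^ 'n) set)"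
   using E unfolding big_def by (intro w(2)[unfolded ainf_def, rule_format]) auto
  ultimately have "measure lebesgue (E k) = 0" unfolding mw_one by (simp add: antisym)
  then show ?thesis using wt_emeasure_eq[OF wt_one bE[of k]] by (simp add: mw_one)
 qed
 then have "AE x in lebesgue. x \<notin> E k" for k using E by (intro AE_not_in) auto
 then have "AE x in lebesgue. \<forall>k. x \<notin> E k" by (simp add: AE_all_countable)
 then show ?thesis
 proof (rule eventually_mono)
  fix x assume *: "\<forall>k. x \<notin> E k"
  obtain k where "x \<in> big k" using UN_big by blast
  then show "0 < w x" using * by (force simp: E_def)
 qed
qed

text \<open>Brings the constructed weights into the union of the classes A_p, for which the operator
  hypothesis is stated. The bound for small values of w is a weak-type inequality for
  \<open>w powr (- \<eta>)\<close>, and Kolmogorov's inequality with exponent 1/2 controls the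
  average of \<open>w powr (- \<eta> / 2)\<close>; p is determined by 1 / (p - 1) = \<eta> /
  2.\<close>

lemma ainf_imp_Ainf:
 fixes w :: "real ^ 'n => real"
 assumes w: "wt w" "ainf C d w (\<lambda>_. 1)" and C: "C > 0" "0 < d" "d < 1"
 shows "Ainf w"
proof -
 have pos: "AE x in lebesgue. 0 < w x" by (rule ainf_imp_pos[OF w])
 have wm[measurable]: "lmeas w" and w0: "\<And>x. 0 <= w x" using wtD w by auto
 define \<eta> where "\<eta> = d / (1 - d)"
 have eta: "\<eta> > 0" using C by (auto simp: \<eta>_def)
 define C0 where "C0 = C powr (1 / (1 - d))"
 have C0: "C0 > 0" using C by (simp add: C0_def)
 define C' where "C' = kolC (1/2) * C0 powr (1/2)"
 have kc: "kolC (1/2) >= 1" by (intro kolC_ge1) auto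
 have C': "C' >= 0" using kc by (simp add: C'_def)
 define p where "p = 1 + 2 / \<eta>"
 have p: "p > 1" "- 1 / (p - 1) = - \<eta> / 2" "p - 1 = 2 / \<eta>" using eta by (simp_all add: p_def)
 have cube: "average (cub c s) (\<lambda>y. ennreal (w y)) * ennreal_powr (average (cub c s) (\<lambda>y. ennreal (w y powr (- 1 / (p - 1))))) (p - 1)
   <= ennreal (C' powr (p - 1))" if s: "s > 0" for c s
 proof -
  define Q where "Q = cub c s"
  define W where "W = measure (mw w) Q"
  have W: "W > 0" "emeasure (mw w) Q = ennreal W"
   unfolding W_def Q_def using wt_measure_pos[OF w(1) s] wt_emeasure_eq[OF w(1)] by simp_all
  define Y where "Y = s ^ CARD('n)"
  have Y: "Y > 0" "emeasure lebesgue Q = ennreal Y" using s by (simp_all add: Y_def Q_def emeasure_cub)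
  have Qs[measurable]: "Q \<in> sets lebesgue" by (simp add: Q_def)
  define L where "L = C0 * Y * (Y / W) powr \<eta>"
  have L: "L > 0" using C0 W Y by (simp add: L_def)
  have "(\<integral>\<^sup>+x\<in>Q. ennreal_powr (ennreal (w x powr (-\<eta>))) (1/2) \<partial>lebesgue)
    <= ennreal (kolC (1/2) * Y powr (1 - 1/2) * L powr (1/2))"
  proof (rule kolmogorov)
   fix t :: real assume t: "t > 0"
   define r where "r = t powr (- 1 / \<eta>)"
   have r: "r > 0" "r powr (-\<eta>) = t" using t eta by (simp_all add: r_def powr_powr)
   have sub: "{x \<in> Q. ennreal t < ennreal (w x powr (-\<eta>))} \<subseteq> {x \<in> Q. w x <= r}"
   proof safe
    fix x assume "ennreal t < ennreal (w x powr (-\<eta>))"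
    then have lt: "t < w x powr (-\<eta>)" using t by (simp add: ennreal_less_iff)
    show "w x <= r"
    proof (rule ccontr)
     assume "\<not> w x <= r"
     then have "w x powr (-\<eta>) <= r powr (-\<eta>)" using r eta by (intro powr_mono2') auto
     then show False using lt r by simp
    qed
   qed
   have R: "{x \<in> Q. w x <= r} \<in> sets lebesgue" by (intro lebesgue_Collect) measurable
   have "emeasure lebesgue {x \<in> Q. ennreal t < ennreal (w x powr (-\<eta>))} <= emeasure lebesgue {x \<in> Q. w x <= r}"
    using sub R by (intro emeasure_mono) auto
   also have "... = ennreal (measure lebesgue {x \<in> Q. w x <= r})"
    unfolding mw_one[symmetric] by (rule wt_emeasure_eq[OF wt_one]) (auto simp: Q_def intro: bounded_subset[OF bounded_cub])
   also have "... <= ennreal (C0 * Y * (r * Y / W) powr \<eta>)"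
    unfolding W_def Q_def Y_def \<eta>_def C0_def by (intro ennreal_leI tail_lower w C s r)
   also have "C0 * Y * (r * Y / W) powr \<eta> = L / t"
   proof -
    have "r powr \<eta> = 1 / t" using r t by (simp add: powr_minus field_simps)
    then show ?thesis using W Y r by (simp add: L_def powr_divide powr_mult)
   qed
   finally have "ennreal t * emeasure lebesgue {x \<in> Q. ennreal t < ennreal (w x powr (-\<eta>))} <= ennreal t * ennreal (L / t)"
    by (rule mult_left_mono) simp
   also have "... = ennreal L" using t L by (simp flip: ennreal_mult)
   finally show "ennreal t * emeasure lebesgue {x \<in> Q. ennreal t < ennreal (w x powr (-\<eta>))} <= ennreal L" .
  qed (use C Y L in auto)
  also have "kolC (1/2) * Y powr (1 - 1/2) * L powr (1/2) = C' * (Y / W) powr (\<eta> / 2) * Y"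
  proof -
   have "L powr (1/2) = C0 powr (1/2) * Y powr (1/2) * (Y / W) powr (\<eta> / 2)"
    using C0 W Y by (simp add: L_def powr_mult powr_powr)
   moreover have "Y powr (1 - 1/2) * Y powr (1/2) = Y" using Y by (simp flip: powr_add)
   ultimately show ?thesis by (simp add: C'_def mult_ac)
  qed
  finally have "(\<integral>\<^sup>+x\<in>Q. ennreal (w x powr (- 1 / (p - 1))) \<partial>lebesgue) <= ennreal (C' * (Y / W) powr (\<eta> / 2) * Y)"
   unfolding p by (simp add: ennreal_powr_ennreal powr_powr)
  then have "average Q (\<lambda>y. ennreal (w y powr (- 1 / (p - 1)))) <= ennreal (C' * (Y / W) powr (\<eta> / 2))"
   unfolding average_def Y(2) using Y C' by (subst ennreal_divide_le_iff) (auto simp: ennreal_mult)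
  then have "ennreal_powr (average Q (\<lambda>y. ennreal (w y powr (- 1 / (p - 1))))) (p - 1) <= ennreal_powr (ennreal (C' * (Y / W) powr (\<eta> / 2))) (p - 1)"
   using p(1) by (intro ennreal_powr_mono) auto
  also have "... = ennreal (C' powr (p - 1) * (Y / W))"
   using C' W Y eta by (simp add: ennreal_powr_ennreal powr_mult powr_powr p(3))
  finally have 1: "ennreal_powr (average Q (\<lambda>y. ennreal (w y powr (- 1 / (p - 1))))) (p - 1) <= ennreal (C' powr (p - 1) * (Y / W))" .
  have "average Q (\<lambda>y. ennreal (w y)) = ennreal (W / Y)"
   unfolding average_def Y(2) using W Y by (subst emeasure_mw[symmetric]) (auto simp: divide_ennreal)
  then have "average Q (\<lambda>y. ennreal (w y)) * ennreal_powr (average Q (\<lambda>y. ennreal (w y powr (- 1 / (p - 1))))) (p - 1)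
    <= ennreal (W / Y) * ennreal (C' powr (p - 1) * (Y / W))" using 1 by (simp add: mult_left_mono)
  also have "... = ennreal (C' powr (p - 1))" using W Y by (simp flip: ennreal_mult)
  finally show ?thesis by (simp add: Q_def)
 qed
 have "Ap_const p w <= ennreal (C' powr (p - 1))"
  unfolding Ap_const_def using cube by (intro SUP_least) (auto simp: axis_cube_iff)
 then have "Ap_const p w < top" by (simp add: order_le_less_trans[OF _ ennreal_less_top])
 then show ?thesis unfolding Ainf_def Ap_def using p wt_imp_weight[OF w(1) pos] by blast
qed

text \<open>By the A_p condition the set B where v is at most \<kappa> times its average V fills at
  most half of the cube. A set F with more than 3/4 of the volume keeps a quarter of it outside B,
  so its v-mass is at least \<kappa> / 4 of the total, which exceeds the allowed \<kappa> /
  5.\<close>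

lemma Ap_imp_weak:
 fixes v :: "real ^ 'n => real"
 assumes v: "Ap p v" and p: "p > 1"
 shows "\<exists>c. 0 < c \<and> c < 1 \<and> weak_ainf c v (\<lambda>_. 1)"
proof -
 have wv: "wt v" "AE x in lebesgue. 0 < v x" using weight_imp_wt v by (auto simp: Ap_def)
 have wm[measurable]: "lmeas v" and w0: "\<And>x. 0 <= v x" using wtD wv by auto
 obtain A where A: "Ap_const p v = ennreal A" "A >= 0" using v by (cases "Ap_const p v") (auto simp: Ap_def)
 \<comment> \<open>Makes \<kappa> (A + 1) equal to the power p - 1 of 1/2, which is what gives |B|
   \<le> |Q| / 2. Using A + 1 in place of A avoids a division by zero.\<close>
 define \<kappa> where "\<kappa> = 1 / (2 powr (p - 1) * (A + 1))"
 have kap: "\<kappa> > 0" using A by (simp add: \<kappa>_def)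
 have kap1: "\<kappa> <= 1"
 proof -
  have "1 * 1 <= 2 powr (p - 1) * (A + 1)" using p A by (intro mult_mono ge_one_powr_ge_zero) auto
  then show ?thesis by (simp add: \<kappa>_def)
 qed
 have "weak_ainf (\<kappa> / 5) v (\<lambda>_. 1)"
  unfolding weak_ainf_def mw_one
 proof (intro allI impI)
  fix c :: "real ^ 'n" and s :: real and F
  assume s: "s > 0" and F: "F \<in> sets lebesgue" "F \<subseteq> cub c s" "measure (mw v) F <= \<kappa> / 5 * measure (mw v) (cub c s)"
  define Q where "Q = cub c s"
  define W where "W = measure (mw v) Q"
  have W: "W > 0" "emeasure (mw v) Q = ennreal W"
   unfolding W_def Q_def using wt_measure_pos[OF wv(1) s] wt_emeasure_eq[OF wv(1)] by simp_all
  define Y where "Y = s ^ CARD('n)"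
  have Y: "Y > 0" "emeasure lebesgue Q = ennreal Y" "measure lebesgue Q = Y"
   using s by (simp_all add: Y_def Q_def emeasure_cub measure_cub)
  have Qs[measurable]: "Q \<in> sets lebesgue" by (simp add: Q_def)
  define V where "V = W / Y"
  have V: "V > 0" "V * Y = W" using W Y by (simp_all add: V_def)
  have avV: "average Q (\<lambda>y. ennreal (v y)) = ennreal V"
   unfolding average_def Y(2) using W Y by (subst emeasure_mw[symmetric]) (auto simp: divide_ennreal V_def)
  define I where "I = average Q (\<lambda>y. ennreal (v y powr (- 1 / (p - 1))))"
  have "ennreal V * ennreal_powr I (p - 1) <= ennreal A"
   unfolding A(1)[symmetric] Ap_const_def I_def avV[symmetric] using s by (intro SUP_upper) (auto simp: Q_def)
  moreover have "I \<noteq> top"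
  proof
   assume "I = top"
   then show False using calculation V by (simp add: ennreal_mult_top top_unique)
  qed
  then obtain S where S: "I = ennreal S" "S >= 0" by (cases I) auto
  ultimately have VS: "V * S powr (p - 1) <= A"
   using V A by (simp add: ennreal_powr_ennreal flip: ennreal_mult)
  define B where "B = {x \<in> Q. v x <= \<kappa> * V}"
  have B: "B \<in> sets lebesgue" "B \<subseteq> Q" "bounded B" unfolding B_def Q_def
   by (intro lebesgue_Collect, measurable, auto intro: bounded_subset[OF bounded_cub])
  define bb where "bb = measure lebesgue B"
  have bb: "emeasure lebesgue B = ennreal bb" unfolding bb_def mw_one[symmetric] by (rule wt_emeasure_eq[OF wt_one B(3)])
  have "ennreal ((\<kappa> * V) powr (- 1 / (p - 1))) * emeasure lebesgue B = (\<integral>\<^sup>+y\<in>B. ennreal ((\<kappa> * V) powr (- 1 / (p - 1))) \<partial>lebesgue)"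
   using B by (simp add: nn_integral_cmult_indicator)
  also have "... <= (\<integral>\<^sup>+y\<in>Q. ennreal (v y powr (- 1 / (p - 1))) \<partial>lebesgue)"
   using wv(2) p by (intro nn_integral_mono_AE, elim eventually_mono)
    (auto simp: B_def indicator_def intro!: ennreal_leI powr_mono2')
  also have "... <= ennreal S * emeasure lebesgue Q"
   using S(1) unfolding I_def average_def Y(2) using Y by (subst ennreal_divide_le_iff[symmetric]) auto
  finally have "(\<kappa> * V) powr (- 1 / (p - 1)) * bb <= S * Y"
   using Y S bb by (simp add: bb_def flip: ennreal_mult)
  then have "((\<kappa> * V) powr (- 1 / (p - 1)) * bb) powr (p - 1) <= (S * Y) powr (p - 1)"
   using p kap V by (intro powr_mono2) (auto simp: bb_def)
  moreover have "((\<kappa> * V) powr (- 1 / (p - 1)) * bb) powr (p - 1) = bb powr (p - 1) / (\<kappa> * V)"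
  proof -
   have "(z powr (- 1 / (p - 1)) * bb) powr (p - 1) = bb powr (p - 1) / z" if "z > 0" for z
   proof -
    have "- 1 / (p - 1) * (p - 1) = - 1" using p by simp
    then have "(z powr (- 1 / (p - 1))) powr (p - 1) = 1 / z"
     using that by (simp only: powr_powr powr_minus_divide powr_one)
    then show ?thesis using that by (subst powr_mult) (simp_all add: bb_def)
   qed
   then show ?thesis using kap V by simp
  qed
  moreover have "(S * Y) powr (p - 1) = S powr (p - 1) * Y powr (p - 1)" using S Y by (simp add: powr_mult)
  ultimately have "bb powr (p - 1) / (\<kappa> * V) <= S powr (p - 1) * Y powr (p - 1)" by simp
  then have "bb powr (p - 1) <= \<kappa> * (V * S powr (p - 1)) * Y powr (p - 1)"
   using kap V by (simp add: field_simps)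
  also have "... <= \<kappa> * (A + 1) * Y powr (p - 1)" using VS kap by (intro mult_right_mono mult_left_mono) auto
  also have "... = (Y / 2) powr (p - 1)" using A Y by (simp add: \<kappa>_def powr_divide)
  finally have "bb <= Y / 2" using p Y
   by (metis bb_def divide_pos_pos less_eq_real_def linorder_not_less measure_nonneg powr_less_mono2 zero_less_numeral diff_gt_0_iff_gt)
  have bF: "bounded F" using F bounded_subset[OF bounded_cub] by blast
  show "measure lebesgue F <= 3/4 * measure lebesgue (cub c s)"
  proof (rule ccontr)
   assume "\<not> ?thesis"
   then have mF: "measure lebesgue F > 3/4 * Y" using Y by (simp add: Q_def)
   have "measure lebesgue F <= measure lebesgue ((F - B) \<union> B)"
    using wt_measure_mono[OF wt_one, of F "(F - B) \<union> B"] F B bF by (auto simp: mw_one intro: bounded_diff)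
   also have "... <= measure lebesgue (F - B) + measure lebesgue B"
    using wt_measure_Un[OF wt_one, of "F - B" B] F B bF by (auto simp: mw_one intro: bounded_diff)
   finally have "Y / 4 <= measure lebesgue (F - B)" using mF \<open>bb <= Y / 2\<close> by (simp add: bb_def)
   then have "\<kappa> * V * (Y / 4) <= \<kappa> * V * measure lebesgue (F - B)" using kap V by (intro mult_left_mono) auto
   also have "... <= measure (mw v) (F - B)"
    using F B bF kap V by (intro measure_mw_ge[OF wv(1)]) (auto simp: B_def Q_def intro: bounded_diff)
   also have "... <= measure (mw v) F" using F bF by (intro wt_measure_mono wv) auto
   also have "... <= \<kappa> / 5 * W" using F(3) by (simp add: W_def Q_def)
   finally have "\<kappa> * (V * Y) / 4 <= \<kappa> * W / 5" by (simp add: mult.assoc)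
   then have "\<kappa> * W <= 0" unfolding V(2) by (simp add: mult.commute)
   then show False using kap W by (simp add: mult_le_0_iff)
  qed
 qed
 then show ?thesis using kap kap1 by (intro exI[of _ "\<kappa> / 5"]) auto
qed

text \<open>Membership in some A_p does not give a finite Fujii-Wilson constant by definition. It
  gives a one-level bound of Lebesgue measure in terms of v; exchanging roles, with Lebesgue measure
  doubling, gives the A_inf inequality for v and so the finiteness. The bound obtained depends on p,
  but only finiteness is kept.\<close>

lemma Ainf_const_finite:
 fixes v :: "real ^ 'n => real"
 assumes "Ainf v"
 shows "\<exists>b\<ge>0. Ainf_const v = ennreal b \<and> wt v \<and> fw b v"
proof -
 obtain p where p: "p > 1" "Ap p v" using assms by (auto simp: Ainf_def)
 have wv: "wt v" using weight_imp_wt p by (auto simp: Ap_def)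
 obtain c where c: "0 < c" "c < 1" "weak_ainf c v (\<lambda>_. 1)" using Ap_imp_weak p by blast
 have K1: "(16::real) ^ CARD('n) >= 1" by simp
 obtain C d where 1: "C > 0" "d > 0" "\<forall>u w :: real ^ 'n => real. wt u --> wt w --> weak_ainf c u w --> dbl (16 ^ CARD('n)) w --> ainf C d w u"
  using weak_ainf_imp_ainf[OF c(1,2) K1, where 'n = 'n] by blast
 have a1: "ainf C d (\<lambda>_. 1) v" by (rule 1(3)[rule_format, OF wv wt_one c(3) dbl_one])
 have a2: "ainf C (min d (1/2)) (\<lambda>_. 1) v" using 1 by (intro ainf_mono[OF wt_one a1]) auto
 have d2: "0 < min d (1/2)" "min d (1/2) < 1" using 1 by auto
 obtain b where b: "b >= 0" "\<forall>w :: real ^ 'n => real. wt w --> ainf C (min d (1/2)) (\<lambda>_. 1) w --> fw b w"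
  using ainf_imp_fw[OF 1(1) d2, where 'n = 'n] by blast
 have "fw b v" by (rule b(2)[rule_format, OF wv a2])
 then have "Ainf_const v <= ennreal b" using Ainf_const_le_iff_fw[OF wv b(1)] by simp
 then obtain b' where b': "Ainf_const v = ennreal b'" "b' >= 0" by (cases "Ainf_const v") (auto simp: top_unique)
 then show ?thesis using Ainf_const_le_iff_fw[OF wv b'(2)] wv by auto
qed

section \<open>The A_1 condition in multiplied-out form\<close>

definition A1w :: "real => (real ^ 'n => real) => bool" where
 "A1w A u \<longleftrightarrow> wt u \<and> (AE x in lebesgue. HL (\<lambda>y. ennreal (u y)) x <= ennreal (A * u x))"

lemma A1_imp_A1w:
 fixes u :: "real ^ 'n => real"
 assumes "A1 u"
 shows "\<exists>A\<ge>0. A1_const u = ennreal A \<and> A1w A u"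
proof -
 have wu: "wt u" "AE x in lebesgue. 0 < u x" using weight_imp_wt assms by (auto simp: A1_def)
 have u0: "\<And>x. 0 <= u x" using wtD wu by auto
 have [measurable]: "lmeas u" using wtD wu by auto
 obtain A where A: "A1_const u = ennreal A" "A >= 0" using assms by (cases "A1_const u") (auto simp: A1_def)
 have mf: "maximal_fun u x = HL (\<lambda>y. ennreal (u y)) x" for x
  using u0 by (simp add: maximal_fun_eq_Mx)
 have "AE x in lebesgue. HL (\<lambda>y. ennreal (u y)) x / ennreal (u x) <= ennreal A"
 proof -
  have "esssup lebesgue (\<lambda>x. maximal_fun u x / ennreal (u x)) = ennreal A" using A(1) by (simp add: A1_const_def)
  then show ?thesis using esssup_AE[of "\<lambda>x. maximal_fun u x / ennreal (u x)" lebesgue] by (simp only: mf)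
 qed
 then have "AE x in lebesgue. HL (\<lambda>y. ennreal (u y)) x <= ennreal (A * u x)"
  using wu(2)
 proof eventually_elim
  case (elim x)
  then have "HL (\<lambda>y. ennreal (u y)) x <= ennreal A * ennreal (u x)"
   by (subst (asm) ennreal_divide_le_iff) auto
  then show ?case using A u0 by (simp add: ennreal_mult)
 qed
 then show ?thesis using A wu by (auto simp: A1w_def)
qed

text \<open>The supremum over cubes sits inside the maximal function, so one null set serves all
  cubes at once.\<close>

lemma A1w_cube:
 fixes u :: "real ^ 'n => real"
 assumes u: "A1w A u" and A: "A >= 0"
 shows "AE x in lebesgue. \<forall>c s. s > 0 --> x \<in> cub c s --> measure (mw u) (cub c s) <= A * u x * s ^ CARD('n)"
proof -
 have wu: "wt u" and ae: "AE x in lebesgue. HL (\<lambda>y. ennreal (u y)) x <= ennreal (A * u x)"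
  using u by (auto simp: A1w_def)
 have u0: "\<And>x. 0 <= u x" and um: "lmeas u" using wtD wu by auto
 show ?thesis using ae
 proof (rule eventually_mono, intro allI impI)
  fix x c and s :: real assume x: "HL (\<lambda>y. ennreal (u y)) x <= ennreal (A * u x)" "s > 0" "x \<in> cub c s"
  then have "avg (\<lambda>_. 1) (cub c s) (\<lambda>y. ennreal (u y)) <= ennreal (A * u x)" using avg_le_Mx by (meson order_trans)
  then have "emeasure (mw u) (cub c s) <= ennreal (A * u x) * ennreal (s ^ CARD('n))"
   using x um unfolding avg_le_iff[OF wt_one x(2)] by (simp add: mw_one emeasure_mw emeasure_cub)
  then show "measure (mw u) (cub c s) <= A * u x * s ^ CARD('n)"
   using x A u0 by (intro measure_leI) (auto simp: ennreal_mult)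
 qed
qed

lemma A1w_pos:
 fixes u :: "real ^ 'a => real"
 assumes u: "A1w A u" and A: "A >= 0"
 shows "AE x in lebesgue. 0 < u x"
 using A1w_cube[OF u A]
proof (rule eventually_mono)
 fix x assume *: "\<forall>c s. s > 0 --> x \<in> cub c s --> measure (mw u) (cub c s) <= A * u x * s ^ CARD('a)"
 have wu: "wt u" using u by (simp add: A1w_def)
 have "x \<in> cub x 1" by (simp add: mem_cub)
 then have "measure (mw u) (cub x 1) <= A * u x" using *[rule_format, of 1 x] by simp
 moreover have "0 < measure (mw u) (cub x 1)" by (rule wt_measure_pos[OF wu]) simp
 ultimately have "u x \<noteq> 0" by auto
 then show "0 < u x" using wtD(2)[OF wu, of x] by linarith
qed

lemma A1w_imp_fw:
 assumes u: "A1w A u" and A: "A >= 0"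
 shows "fw A u"
 unfolding fw_def
proof (intro allI impI)
 fix c and s :: real assume s: "s > 0"
 have wu: "wt u" and ae: "AE x in lebesgue. HL (\<lambda>y. ennreal (u y)) x <= ennreal (A * u x)"
  using u by (auto simp: A1w_def)
 have u0: "\<And>x. 0 <= u x" and um[measurable]: "lmeas u" using wtD wu by auto
 have "(\<integral>\<^sup>+x\<in>cub c s. HL (\<lambda>y. ennreal (u y) * indicator (cub c s) y) x \<partial>lebesgue)
   <= (\<integral>\<^sup>+x. ennreal A * (ennreal (u x) * indicator (cub c s) x) \<partial>lebesgue)"
  using ae
 proof (intro nn_integral_mono_AE, elim eventually_mono)
  fix x assume x: "HL (\<lambda>y. ennreal (u y)) x <= ennreal (A * u x)"
  have "HL (\<lambda>y. ennreal (u y) * indicator (cub c s) y) x <= HL (\<lambda>y. ennreal (u y)) x"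
   by (intro Mx_mono_AE AE_I2) (auto simp: indicator_def)
  also note x
  finally show "HL (\<lambda>y. ennreal (u y) * indicator (cub c s) y) x * indicator (cub c s) x <= ennreal A * (ennreal (u x) * indicator (cub c s) x)"
   using A u0 by (auto simp: indicator_def ennreal_mult)
 qed
 also have "... = ennreal A * emeasure (mw u) (cub c s)"
  by (subst nn_integral_cmult) (auto simp: emeasure_mw)
 finally show "(\<integral>\<^sup>+x\<in>cub c s. HL (\<lambda>y. ennreal (u y) * indicator (cub c s) y) x \<partial>lebesgue)
   <= ennreal A * emeasure (mw u) (cub c s)" .
qed

subsection \<open>Mixed weak-type estimates for the maximal function\<close>

text \<open>The A_inf inequality solved for v(E) / v(Q): a subset with a fixed proportion of the
  w-mass carries a fixed proportion of the v-mass.\<close>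

lemma ainf_lower:
 assumes w: "wt v" "wt w" "ainf C d v w" and C: "C > 0" "d > 0" and s: "s > 0" and E: "E \<in> sets lebesgue" "E \<subseteq> cub c s"
  and r: "r > 0" "r * measure (mw w) (cub c s) <= measure (mw w) E"
 shows "measure (mw v) (cub c s) <= (C / r) powr (1 / d) * measure (mw v) E"
proof -
 let ?Q = "cub c s"
 have p: "measure (mw v) ?Q > 0" "measure (mw w) ?Q > 0" using wt_measure_pos w s by auto
 define x where "x = measure (mw v) E / measure (mw v) ?Q"
 have x0: "x >= 0" using p by (simp add: x_def)
 have "measure (mw w) E <= C * x powr d * measure (mw w) ?Q"
  using w(3) s E unfolding ainf_def x_def by blast
 then have "r * measure (mw w) ?Q <= C * x powr d * measure (mw w) ?Q" using r by linarith
 then have "r <= C * x powr d" using p by simp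
 then have "r / C <= x powr d" using C by (simp add: field_simps)
 then have "(r / C) powr (1 / d) <= (x powr d) powr (1 / d)" using r C by (intro powr_mono2) auto
 also have "... = x" using C x0 by (simp add: powr_powr)
 finally have "1 <= (C / r) powr (1 / d) * x"
  using r C by (simp add: powr_divide field_simps)
 then show ?thesis using p by (simp add: x_def field_simps)
qed

lemma (in grid) measure_tri: "measure lebesgue (tri p) = 3 ^ CARD('n) * sd (fst p) ^ CARD('n)"
 by (simp add: tri_def measure_cub power_mult_distrib)

lemma (in grid) tri_sets [simp, measurable]: "tri p \<in> sets lebesgue" by (simp add: tri_def)

lemma (in grid) bounded_tri [simp]: "bounded (tri p)" by (simp add: tri_def)

lemma (in grid) measure_tri_le:
 assumes "wt w" "dbl K w" "K >= 0"
 shows "measure (mw w) (tri p) <= K * measure (mw w) (dq p)"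
 using emeasure_tri_le[OF assms, of p] assms
 by (simp add: wt_emeasure_eq bounded_dq flip: ennreal_mult)

text \<open>Intended for u^\<rho> in place of u and \<theta> = 1/\<rho>, so that the measure is the
  original uv. On the set X k, where u is about 2^k, the points in question lie in triples of dyadic
  cubes on which the average of u \<chi>_E exceeds a multiple of \<Lambda> 2^k. By A_1 the average
  of u over such a cube is at most a multiple of 2^k, so E carries a proportion of order \<Lambda>
  of its u-mass. The A_inf inequalities for u and then for v turn this into a bound of the v-mass of
  the cube by \<Lambda> to the power -1/d^2 times that of its intersection with E. Summation over k
  restores \<open>u powr \<theta>\<close> and contributes the further power
  \<Lambda>^(-\<theta>).\<close>

lemma restricted_decay:
 assumes A: "A >= 1" and C: "C >= 1" "0 < d" "d < 1" and K: "K >= 1" and th: "\<theta> > 0"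
 shows "\<exists>D>0. \<exists>\<kappa>>0. \<forall>(u :: real ^ 'n => real) v E \<Lambda>. A1w A u --> ainf C d (\<lambda>_. 1) u --> wt v --> ainf C d v (\<lambda>_. 1) -->
  dbl K v --> E \<in> sets lebesgue --> \<Lambda> > 0 -->
  emeasure (mw (\<lambda>x. u x powr \<theta> * v x)) {x. ennreal (\<Lambda> * u x) < HL (\<lambda>y. ennreal (u y) * indicator E y) x}
   <= ennreal (D * \<Lambda> powr (- \<kappa>)) * emeasure (mw (\<lambda>x. u x powr \<theta> * v x)) E"
proof -
 define n where "n = CARD('n)"
 define K1 where "K1 = (16::real) ^ CARD('n)"
 have K1: "K1 >= 1" by (simp add: K1_def)
 have dK1: "dbl K1 (\<lambda>_ :: real ^ 'n. 1)" unfolding K1_def by (rule dbl_one)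
 \<comment> \<open>The factor \<open>2 * 3 ^ n * A\<close> comes from A_1 on the triple at a point
   where u \<le> 2^(k + 1); K1 is the loss in passing to dyadic cubes.\<close>
 define c2 where "c2 = 1 / (2 * 3 ^ n * A * K1)"
 have c2: "c2 > 0" using A K1 by (simp add: c2_def)
 define c3 where "c3 = (C / (c2 / C) powr (1 / d)) powr (1 / d)"
 have c3: "c3 > 0" using C c2 by (simp add: c3_def)
 define q :: real where "q = 2 powr (- \<theta>)"
 have q: "0 < q" "q < 1" using th by (auto simp: q_def powr_less_one)
 define k2 where "k2 = 1 / d * (1 / d)"
 have k2: "k2 > 0" using C by (simp add: k2_def)
 define D where "D = K * c3 * 2 powr \<theta> * ((A * K1) powr \<theta> / (1 - q))"
 have D: "D > 0" using K c3 A K1 q by (simp add: D_def)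
 have "emeasure (mw (\<lambda>x. u x powr \<theta> * v x)) {x. ennreal (\<Lambda> * u x) < HL (\<lambda>y. ennreal (u y) * indicator E y) x}
   <= ennreal (D * \<Lambda> powr (- (k2 + \<theta>))) * emeasure (mw (\<lambda>x. u x powr \<theta> * v x)) E"
  if u: "A1w A u" "ainf C d (\<lambda>_. 1) u" and v: "wt v" "ainf C d v (\<lambda>_. 1)" "dbl K v" and Es[measurable]: "E \<in> sets lebesgue" and L: "\<Lambda> > 0"
  for u v :: "real ^ 'n => real" and E \<Lambda>
 proof -
  have wu: "wt u" using u by (simp add: A1w_def)
  have um[measurable]: "lmeas u" and u0: "\<And>x. 0 <= u x" using wtD wu by auto
  have vm[measurable]: "lmeas v" and v0: "\<And>x. 0 <= v x" using wtD v by auto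
  define M where "M = mw (\<lambda>x. u x powr \<theta> * v x)"
  have setsM: "sets M = sets lebesgue" by (simp add: M_def)
  have uvm[measurable]: "(\<lambda>x. u x powr \<theta> * v x) \<in> borel_measurable lebesgue" by measurable
  define g where "g y = ennreal (u y) * indicator E y" for y
  have gm[measurable]: "lmeas g" unfolding g_def[abs_def] by measurable
  have gX: "(\<integral>\<^sup>+y\<in>X. g y \<partial>lebesgue) = emeasure (mw u) (E \<inter> X)" if "X \<in> sets lebesgue" for X
   using that by (subst emeasure_mw) (auto simp: g_def indicator_def intro!: nn_integral_cong)
  define X where "X k = {x. 2 powr real_of_int k < u x \<and> u x <= 2 powr (real_of_int k + 1)}" for k :: int
  have Xs[measurable]: "X k \<in> sets lebesgue" for k unfolding X_def by (intro lebesgue_Collect) measurable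
  define S where "S k = {p. ennreal (\<Lambda> * 2 powr real_of_int k / K1) * emeasure lebesgue (G.dq p) < emeasure (mw u) (E \<inter> G.dq p)}" for k :: int
  define good where "good x \<longleftrightarrow> (\<forall>c s. s > 0 --> x \<in> cub c s --> measure (mw u) (cub c s) <= A * u x * s ^ CARD('n))" for x
  have good: "AE x in lebesgue. good x" unfolding good_def using A1w_cube[OF u(1)] A by simp
  have Sm: "\<Lambda> * 2 powr real_of_int k / K1 * G.sd (fst p) ^ n < measure (mw u) (E \<inter> G.dq p)" if "p \<in> S k" for p k
  proof -
   have "emeasure (mw u) (E \<inter> G.dq p) = ennreal (measure (mw u) (E \<inter> G.dq p))"
    by (rule wt_emeasure_eq[OF wu]) (simp add: G.bounded_dq bounded_Int)
   then have "ennreal (\<Lambda> * 2 powr real_of_int k / K1 * G.sd (fst p) ^ n) < ennreal (measure (mw u) (E \<inter> G.dq p))"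
    using that L K1 by (simp add: S_def G.measure_dq n_def flip: ennreal_mult)
   then show ?thesis using L K1 by (subst (asm) ennreal_less_iff) auto
  qed
  define N where "N k = mw (\<lambda>x. (K * c3 * \<Lambda> powr (- k2) * 2 powr ((real_of_int k + 1) * \<theta>)) * (indicator E x * v x))" for k :: int
  have N: "emeasure (N k) Y = ennreal (K * c3 * \<Lambda> powr (- k2) * 2 powr ((real_of_int k + 1) * \<theta>)) * emeasure (mw v) (E \<inter> Y)"
   if "Y \<in> sets lebesgue" for k Y unfolding N_def using that K c3 by (intro emeasure_mw_indicator) auto
  have step: "emeasure M (X k \<inter> G.tri p) <= emeasure (N k) (G.dq p)" if p: "p \<in> S k" for k p
  proof (cases "emeasure lebesgue (X k \<inter> G.tri p) = 0")
   case True
   then have "X k \<inter> G.tri p \<in> null_sets lebesgue" by (auto simp: null_sets_def)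
   then have "emeasure M (X k \<inter> G.tri p) = 0" using mw_ac[OF uvm] unfolding M_def absolutely_continuous_def by blast
   then show ?thesis by simp
  next
   case False
   \<comment> \<open>The A_1 bound holds only at almost every point; since the intersection is not
     null, it contains a point where the bound is available.\<close>
   have "\<exists>x\<in>X k \<inter> G.tri p. good x"
   proof (rule ccontr)
    assume "\<not> ?thesis"
    then have "AE x in lebesgue. x \<notin> X k \<inter> G.tri p" using good by (auto elim!: eventually_mono)
    then have "emeasure lebesgue (X k \<inter> G.tri p) = 0" by (subst (asm) AE_iff_measurable[of "X k \<inter> G.tri p"]) auto
    then show False using False by simp
   qed
   then obtain x where x: "x \<in> X k" "x \<in> G.tri p" "good x" by blast
   let ?Q = "cub (G.cn p) (G.sd (fst p))"
   have "measure (mw u) ?Q <= measure (mw u) (G.tri p)"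
    using wu by (intro wt_measure_mono G.clo_subset_tri) auto
   also have "... <= A * u x * (3 * G.sd (fst p)) ^ n"
    using x(2) x(3)[unfolded good_def, rule_format, of "3 * G.sd (fst p)" "G.cn p - (\<chi> i. G.sd (fst p))"]
    unfolding G.tri_def n_def by simp
   also have "... <= A * 2 powr (real_of_int k + 1) * (3 * G.sd (fst p)) ^ n"
    using x A by (intro mult_right_mono mult_left_mono) (auto simp: X_def)
   finally have uQ: "measure (mw u) ?Q <= A * (2 * 2 powr real_of_int k) * (3 ^ n * G.sd (fst p) ^ n)"
    by (simp add: powr_add power_mult_distrib mult_ac)
   have EQ: "measure (mw w) (E \<inter> ?Q) = measure (mw w) (E \<inter> G.dq p)" if "lmeas w" for w
    using G.emeasure_dq_clo[OF that Es] by (simp add: measure_def)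
   have uE: "c2 * \<Lambda> * measure (mw u) ?Q <= measure (mw u) (E \<inter> ?Q)"
   proof -
    have "c2 * \<Lambda> * measure (mw u) ?Q <= c2 * \<Lambda> * (A * (2 * 2 powr real_of_int k) * (3 ^ n * G.sd (fst p) ^ n))"
     using uQ c2 L by (intro mult_left_mono) auto
    also have "... = \<Lambda> * 2 powr real_of_int k / K1 * G.sd (fst p) ^ n"
     using A K1 by (simp add: c2_def)
    also have "... <= measure (mw u) (E \<inter> ?Q)" using Sm[OF p] EQ[OF um] by simp
    finally show ?thesis .
   qed
   have EQsets: "E \<inter> ?Q \<in> sets lebesgue" "E \<inter> ?Q \<subseteq> ?Q" by auto
   have Qpos: "measure lebesgue ?Q > 0" by (simp add: measure_cub)
   define r where "r = measure lebesgue (E \<inter> ?Q) / measure lebesgue ?Q"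
   have "measure (mw u) (E \<inter> ?Q) <= C * r powr d * measure (mw u) ?Q"
    using u(2) EQsets G.sd_pos unfolding ainf_def r_def mw_one by blast
   then have "c2 * \<Lambda> * measure (mw u) ?Q <= C * r powr d * measure (mw u) ?Q" using uE by linarith
   then have "c2 * \<Lambda> <= C * r powr d" using wt_measure_pos[OF wu G.sd_pos] by simp
   then have "c2 / C * \<Lambda> <= r powr d" using C by (simp add: field_simps)
   then have "(c2 / C * \<Lambda>) powr (1 / d) <= (r powr d) powr (1 / d)" using c2 C L by (intro powr_mono2) auto
   also have "... = r" using C by (simp add: powr_powr r_def)
   finally have rr: "(c2 / C * \<Lambda>) powr (1 / d) * measure (mw (\<lambda>_. 1)) ?Q <= measure (mw (\<lambda>_. 1)) (E \<inter> ?Q)"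
    using Qpos by (simp add: r_def mw_one pos_le_divide_eq)
   have "measure (mw v) ?Q <= (C / (c2 / C * \<Lambda>) powr (1 / d)) powr (1 / d) * measure (mw v) (E \<inter> ?Q)"
    using c2 C L by (intro ainf_lower[OF v(1) wt_one v(2) _ _ G.sd_pos EQsets _ rr]) auto
   also have "(C / (c2 / C * \<Lambda>) powr (1 / d)) powr (1 / d) = c3 * \<Lambda> powr (- k2)"
   proof -
    have "(C / (c2 / C * \<Lambda>) powr (1 / d)) = (C / (c2 / C) powr (1 / d)) * \<Lambda> powr (- (1 / d))"
     using c2 C L by (subst powr_mult) (auto simp: powr_minus field_simps)
    then have "(C / (c2 / C * \<Lambda>) powr (1 / d)) powr (1 / d) = c3 * (\<Lambda> powr (- (1 / d))) powr (1 / d)"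
     unfolding c3_def using c2 C L by (subst powr_mult[symmetric]) auto
    then show ?thesis by (simp add: powr_powr k2_def)
   qed
   finally have vE: "measure (mw v) (G.dq p) <= c3 * \<Lambda> powr (- k2) * measure (mw v) (E \<inter> G.dq p)"
    using G.measure_dq_clo[OF v(1)] EQ[OF vm] by simp
   have "emeasure M (X k \<inter> G.tri p) <= ennreal (2 powr ((real_of_int k + 1) * \<theta>)) * emeasure (mw v) (G.tri p)"
   proof -
    have "emeasure M (X k \<inter> G.tri p) = (\<integral>\<^sup>+x\<in>X k \<inter> G.tri p. ennreal (u x powr \<theta> * v x) \<partial>lebesgue)"
     unfolding M_def by (rule emeasure_mw) auto
    also have "... <= (\<integral>\<^sup>+x. ennreal (2 powr ((real_of_int k + 1) * \<theta>)) * (ennreal (v x) * indicator (G.tri p) x) \<partial>lebesgue)"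
    proof (rule nn_integral_mono)
     fix x
     show "ennreal (u x powr \<theta> * v x) * indicator (X k \<inter> G.tri p) x <= ennreal (2 powr ((real_of_int k + 1) * \<theta>)) * (ennreal (v x) * indicator (G.tri p) x)"
     proof (cases "x \<in> X k \<inter> G.tri p")
      case True
      then have "u x powr \<theta> <= (2 powr (real_of_int k + 1)) powr \<theta>" using th u0 by (intro powr_mono2) (auto simp: X_def)
      then have "u x powr \<theta> * v x <= 2 powr ((real_of_int k + 1) * \<theta>) * v x"
       using v0 by (intro mult_right_mono) (auto simp: powr_powr)
      then show ?thesis using True v0 by (simp add: ennreal_leI flip: ennreal_mult)
     qed simp
    qed
    also have "... = ennreal (2 powr ((real_of_int k + 1) * \<theta>)) * emeasure (mw v) (G.tri p)"
     by (subst nn_integral_cmult) (auto simp: emeasure_mw)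
    finally show ?thesis .
   qed
   also have "... = ennreal (2 powr ((real_of_int k + 1) * \<theta>) * measure (mw v) (G.tri p))"
    using v(1) by (simp add: wt_emeasure_eq ennreal_mult)
   also have "... <= ennreal (2 powr ((real_of_int k + 1) * \<theta>) * (K * (c3 * \<Lambda> powr (- k2) * measure (mw v) (E \<inter> G.dq p))))"
   proof (intro ennreal_leI mult_left_mono)
    have "measure (mw v) (G.tri p) <= K * measure (mw v) (G.dq p)" using K by (intro G.measure_tri_le v) auto
    also have "... <= K * (c3 * \<Lambda> powr (- k2) * measure (mw v) (E \<inter> G.dq p))" using vE K by (intro mult_left_mono) auto
    finally show "measure (mw v) (G.tri p) <= K * (c3 * \<Lambda> powr (- k2) * measure (mw v) (E \<inter> G.dq p))" .
   qed auto
   also have "... = ennreal ((K * c3 * \<Lambda> powr (- k2) * 2 powr ((real_of_int k + 1) * \<theta>)) * measure (mw v) (E \<inter> G.dq p))"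
    by (simp add: mult_ac)
   also have "... = emeasure (N k) (G.dq p)"
    using K c3 wt_emeasure_eq[OF v(1), of "E \<inter> G.dq p"] by (simp add: N G.bounded_dq bounded_Int ennreal_mult)
   finally show ?thesis .
  qed
  define O' where "O' k = (\<Union>p\<in>S k. G.dq p)" for k
  have Os[measurable]: "O' k \<in> sets lebesgue" for k by (auto simp: O'_def intro!: sets.countable_UN')
  have cov: "emeasure M (X k \<inter> (\<Union>p\<in>S k. G.tri p)) <= emeasure (N k) (O' k)" for k
   unfolding O'_def using step setsM by (intro G.cover_bound) (auto simp: N_def)
  define Z where "Z = {x. ennreal (\<Lambda> * u x) < HL g x}"
  have MX[measurable]: "HL g \<in> borel_measurable lebesgue" by (rule Mx_measurable[OF wt_one])
  have Zs[measurable]: "Z \<in> sets lebesgue" unfolding Z_def by (intro lebesgue_Collect) measurable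
  have ZX: "Z \<inter> X k \<subseteq> X k \<inter> (\<Union>p\<in>S k. G.tri p)" for k
  proof
   fix x assume x: "x \<in> Z \<inter> X k"
   have "ennreal (\<Lambda> * 2 powr real_of_int k) <= ennreal (\<Lambda> * u x)" using x L by (intro ennreal_leI mult_left_mono) (auto simp: X_def)
   also have "... < HL g x" using x by (simp add: Z_def)
   finally obtain c s where cs: "s > 0" "x \<in> cub c s" "ennreal (\<Lambda> * 2 powr real_of_int k) < avg (\<lambda>_. 1) (cub c s) g"
    unfolding Mx_greater by blast
   have "\<exists>p. s <= G.sd (fst p) \<and> G.sd (fst p) <= 2 * s \<and> x \<in> G.tri p
    \<and> ennreal (\<Lambda> * 2 powr real_of_int k / K1) * emeasure (mw (\<lambda>_. 1)) (G.dq p) < (\<integral>\<^sup>+y\<in>G.dq p. g y \<partial>mw (\<lambda>_. 1))"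
    using cs K1 L by (intro G.dyadic_catch[OF wt_one dK1 K1 gm]) auto
   then obtain p where "x \<in> G.tri p" "p \<in> S k" by (auto simp: mw_one gX S_def)
   then show "x \<in> X k \<inter> (\<Union>p\<in>S k. G.tri p)" using x by blast
  qed
  have "AE x in lebesgue. 0 < u x" using A1w_pos[OF u(1)] A by simp
  then have "AE x in M. 0 < u x" unfolding M_def by (rule AE_mw[OF uvm])
  then have "AE x in M. x \<in> Z --> x \<in> (\<Union>k. Z \<inter> X k)"
  proof (rule eventually_mono, intro impI)
   fix x assume "0 < u x" "x \<in> Z"
   then show "x \<in> (\<Union>k. Z \<inter> X k)" using powr_level_lt[of 2 "u x"] by (auto simp: X_def)
  qed
  then have "emeasure M Z <= emeasure M (\<Union>k. Z \<inter> X k)"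
   using setsM by (intro emeasure_mono_AE) (auto intro!: sets.countable_UN')
  also have "... <= (\<integral>\<^sup>+k. emeasure M (Z \<inter> X k) \<partial>count_space UNIV)"
   using setsM by (intro emeasure_UN_le) auto
  also have "... <= (\<integral>\<^sup>+k. emeasure (N k) (O' k) \<partial>count_space UNIV)"
  proof (intro nn_integral_mono)
   fix k
   have "emeasure M (Z \<inter> X k) <= emeasure M (X k \<inter> (\<Union>p\<in>S k. G.tri p))"
    using ZX setsM by (intro emeasure_mono) (auto intro!: sets.countable_UN' sets.Int)
   also note cov
   finally show "emeasure M (Z \<inter> X k) <= emeasure (N k) (O' k)" .
  qed
  also have "... = (\<integral>\<^sup>+k. (\<integral>\<^sup>+x. ennreal (K * c3 * \<Lambda> powr (- k2) * 2 powr ((real_of_int k + 1) * \<theta>)) * (ennreal (v x) * indicator (E \<inter> O' k) x) \<partial>lebesgue) \<partial>count_space UNIV)"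
   by (intro nn_integral_cong) (simp add: N emeasure_mw nn_integral_cmult)
  also have "... = (\<integral>\<^sup>+x. (\<integral>\<^sup>+k. ennreal (K * c3 * \<Lambda> powr (- k2) * 2 powr ((real_of_int k + 1) * \<theta>)) * (ennreal (v x) * indicator (E \<inter> O' k) x) \<partial>count_space UNIV) \<partial>lebesgue)"
   by (intro nn_integral_count_space_nn_integral[symmetric]) auto
  also have "... <= (\<integral>\<^sup>+x. ennreal (D * \<Lambda> powr (- (k2 + \<theta>))) * (ennreal (u x powr \<theta> * v x) * indicator E x) \<partial>lebesgue)"
   using good
  proof (intro nn_integral_mono_AE, elim eventually_mono)
   fix x assume gx: "good x"
   define z where "z = A * K1 * u x / \<Lambda>"
   have z0: "z >= 0" using A K1 u0 L by (simp add: z_def)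
   \<comment> \<open>A selected cube through x has average of u at most A u(x) by A_1 at x, so only
     levels with 2^k \<le> z occur and the sum over k is geometric.\<close>
   have zk: "2 powr real_of_int k <= z" if xO: "x \<in> O' k" for k
   proof -
    obtain p where p: "p \<in> S k" "x \<in> G.dq p" using xO unfolding O'_def by blast
    have "\<Lambda> * 2 powr real_of_int k / K1 * G.sd (fst p) ^ n < measure (mw u) (E \<inter> G.dq p)" by (rule Sm[OF p(1)])
    also have "... <= measure (mw u) (cub (G.cn p) (G.sd (fst p)))"
     using wu G.dq_subset_clo[of p] by (intro wt_measure_mono) auto
    also have "... <= A * u x * G.sd (fst p) ^ n"
     using subsetD[OF G.dq_subset_clo p(2)] gx[unfolded good_def, rule_format, of "G.sd (fst p)" "G.cn p"] unfolding n_def by simp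
    finally have "\<Lambda> * 2 powr real_of_int k / K1 < A * u x" by (rule mult_right_less_imp_less) simp
    then show ?thesis using K1 L by (simp add: z_def field_simps)
   qed
   have "(\<integral>\<^sup>+k. ennreal (K * c3 * \<Lambda> powr (- k2) * 2 powr ((real_of_int k + 1) * \<theta>)) * (ennreal (v x) * indicator (E \<inter> O' k) x) \<partial>count_space UNIV)
    <= (\<integral>\<^sup>+k. (ennreal (K * c3 * \<Lambda> powr (- k2) * 2 powr \<theta> * v x) * indicator E x) * (if 2 powr real_of_int k <= z then ennreal (2 powr (real_of_int k * \<theta>)) else 0) \<partial>count_space UNIV)"
   proof (intro nn_integral_mono)
    fix k :: int
    show "ennreal (K * c3 * \<Lambda> powr (- k2) * 2 powr ((real_of_int k + 1) * \<theta>)) * (ennreal (v x) * indicator (E \<inter> O' k) x)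
     <= (ennreal (K * c3 * \<Lambda> powr (- k2) * 2 powr \<theta> * v x) * indicator E x) * (if 2 powr real_of_int k <= z then ennreal (2 powr (real_of_int k * \<theta>)) else 0)"
    proof (cases "x \<in> E \<inter> O' k")
     case True
     have "2 powr ((real_of_int k + 1) * \<theta>) = 2 powr \<theta> * 2 powr (real_of_int k * \<theta>)" by (simp add: distrib_right powr_add)
     then show ?thesis using True zk[of k] K c3 v0 by (simp add: mult_ac flip: ennreal_mult)
    qed simp
   qed
   also have "... = (ennreal (K * c3 * \<Lambda> powr (- k2) * 2 powr \<theta> * v x) * indicator E x) * (\<integral>\<^sup>+k. (if 2 powr real_of_int k <= z then ennreal (2 powr (real_of_int k * \<theta>)) else 0) \<partial>count_space UNIV)"
    by (rule nn_integral_cmult) simp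
   also have "... <= (ennreal (K * c3 * \<Lambda> powr (- k2) * 2 powr \<theta> * v x) * indicator E x) * ennreal (z powr \<theta> / (1 - q))"
    unfolding q_def using th z0 by (intro mult_left_mono geometric_sum_le) auto
   also have "... = ennreal (K * c3 * \<Lambda> powr (- k2) * 2 powr \<theta> * v x * (z powr \<theta> / (1 - q))) * indicator E x"
    using K c3 v0 q by (cases "x \<in> E") (simp_all add: mult_ac flip: ennreal_mult)
   also have "K * c3 * \<Lambda> powr (- k2) * 2 powr \<theta> * v x * (z powr \<theta> / (1 - q)) = D * \<Lambda> powr (- (k2 + \<theta>)) * (u x powr \<theta> * v x)"
   proof -
    have "z powr \<theta> = (A * K1) powr \<theta> * u x powr \<theta> * \<Lambda> powr (- \<theta>)"
     using A K1 u0 L by (simp add: z_def powr_mult powr_divide powr_minus field_simps)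
    moreover have "\<Lambda> powr (- (k2 + \<theta>)) = \<Lambda> powr (- k2) * \<Lambda> powr (- \<theta>)" by (simp flip: powr_add)
    ultimately show ?thesis by (simp add: D_def)
   qed
   also have "ennreal (D * \<Lambda> powr (- (k2 + \<theta>)) * (u x powr \<theta> * v x)) * indicator E x = ennreal (D * \<Lambda> powr (- (k2 + \<theta>))) * (ennreal (u x powr \<theta> * v x) * indicator E x)"
    using D v0 by (cases "x \<in> E") (simp_all add: mult_ac flip: ennreal_mult)
   finally show "(\<integral>\<^sup>+k. ennreal (K * c3 * \<Lambda> powr (- k2) * 2 powr ((real_of_int k + 1) * \<theta>)) * (ennreal (v x) * indicator (E \<inter> O' k) x) \<partial>count_space UNIV)
     <= ennreal (D * \<Lambda> powr (- (k2 + \<theta>))) * (ennreal (u x powr \<theta> * v x) * indicator E x)" .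
  qed
  also have "... = ennreal (D * \<Lambda> powr (- (k2 + \<theta>))) * emeasure M E"
   unfolding M_def by (subst nn_integral_cmult) (auto simp: emeasure_mw)
  finally show ?thesis by (simp add: M_def Z_def g_def[abs_def])
 qed
 then show ?thesis using D k2 th by (intro exI[of _ D] conjI exI[of _ "k2 + \<theta>"]) auto
qed

text \<open>On F the weight v is about B^k, while its average over the cube is about B^(k + l). If l
  >= 0, F has a small share of the v-mass and the A_inf inequality makes |F| small. If l < 0, v on F
  is far above its average and Chebyshev's inequality makes |F| small. The A_inf inequality for u
  transfers the smallness, which turns the rate d into d^2.\<close>

lemma level_decay:
 assumes A: "wt u" "ainf C d (\<lambda>_. 1) u" and v: "wt v" "ainf C d v (\<lambda>_. 1)" and C: "C >= 1" "0 < d" "d < 1" and B: "B > 1" and s: "s > 0"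
  and F: "F \<in> sets lebesgue" "F \<subseteq> cub c s" "\<And>x. x \<in> F ==> B powr real_of_int k <= v x \<and> v x <= B powr (real_of_int k + 1)"
  and V: "B powr (real_of_int k + real_of_int l) * measure lebesgue (cub c s) <= measure (mw v) (cub c s)"
   "measure (mw v) (cub c s) <= B powr (real_of_int k + real_of_int l + 1) * measure lebesgue (cub c s)"
 shows "measure (mw u) F <= C * (C * B) powr d * B powr (- (d * d) * \<bar>real_of_int l\<bar>) * measure (mw u) (cub c s)"
proof -
 let ?Q = "cub c s"
 have bF: "bounded F" using F bounded_subset[OF bounded_cub] by blast
 have Q: "measure lebesgue ?Q > 0" "measure (mw v) ?Q > 0" using wt_measure_pos[OF wt_one s] wt_measure_pos[OF v(1) s] by (auto simp: mw_one)
 define f where "f = measure lebesgue F"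
 have fQ: "f <= measure lebesgue ?Q" using wt_measure_mono[OF wt_one, of F ?Q] F by (simp add: f_def mw_one)
 have f0: "f >= 0" by (simp add: f_def)
 have CB: "C * B >= B" using C B by simp
 have Badd: "B powr (1 + y) = B * B powr y" for y using B by (simp add: powr_add)
 have key: "f / measure lebesgue ?Q <= C * B * B powr (- d * \<bar>real_of_int l\<bar>)"
 proof (cases "l >= 0")
  case True
  have "measure (mw v) F <= B powr (real_of_int k + 1) * f"
   unfolding f_def using F bF by (intro measure_mw_le v) auto
  also have "... <= B powr (real_of_int k + 1) * measure lebesgue ?Q" using fQ by (intro mult_left_mono) auto
  also have "... = B powr (1 - real_of_int l) * (B powr (real_of_int k + real_of_int l) * measure lebesgue ?Q)"
   by (simp add: add.commute flip: powr_add mult.assoc)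
  also have "... <= B powr (1 - real_of_int l) * measure (mw v) ?Q" using V(1) by (intro mult_left_mono) auto
  finally have "measure (mw v) F / measure (mw v) ?Q <= B powr (1 - real_of_int l)" using Q by (simp add: field_simps)
  then have "(measure (mw v) F / measure (mw v) ?Q) powr d <= (B powr (1 - real_of_int l)) powr d"
   using C by (intro powr_mono2) auto
  also have "... = B powr (d + (- d * \<bar>real_of_int l\<bar>))" using True by (simp add: powr_powr algebra_simps)
  also have "... <= B powr (1 + (- d * \<bar>real_of_int l\<bar>))" using B C by (intro powr_mono) auto
  also have "... = B * B powr (- d * \<bar>real_of_int l\<bar>)" by (rule Badd)
  finally have "C * (measure (mw v) F / measure (mw v) ?Q) powr d * measure lebesgue ?Q <= C * (B * B powr (- d * \<bar>real_of_int l\<bar>)) * measure lebesgue ?Q"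
   using C by (intro mult_right_mono mult_left_mono) auto
  moreover have "f <= C * (measure (mw v) F / measure (mw v) ?Q) powr d * measure lebesgue ?Q"
   using v(2) s F unfolding ainf_def f_def mw_one by blast
  ultimately show ?thesis using Q by (simp add: pos_divide_le_eq mult.assoc)
 next
  case False
  have "B powr real_of_int k * f <= measure (mw v) F"
   unfolding f_def using F bF by (intro measure_mw_ge v) auto
  also have "... <= measure (mw v) ?Q" using F by (intro wt_measure_mono v) auto
  also have "... <= B powr (real_of_int k + real_of_int l + 1) * measure lebesgue ?Q" by (rule V)
  also have "... = B powr real_of_int k * (B powr (real_of_int l + 1) * measure lebesgue ?Q)" by (simp flip: powr_add mult.assoc add: add.assoc)
  finally have "f <= B powr (real_of_int l + 1) * measure lebesgue ?Q" using B by simp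
  then have "f / measure lebesgue ?Q <= B powr (real_of_int l + 1)" using Q by (simp add: field_simps)
  also have "... <= B powr (1 + (- d * \<bar>real_of_int l\<bar>))"
  proof (intro powr_mono)
   have "d * \<bar>real_of_int l\<bar> <= 1 * \<bar>real_of_int l\<bar>" using C by (intro mult_right_mono) auto
   then show "real_of_int l + 1 <= 1 + (- d * \<bar>real_of_int l\<bar>)" using False by simp
  qed (use B in auto)
  also have "... = B * B powr (- d * \<bar>real_of_int l\<bar>)" by (rule Badd)
  also have "... <= C * B * B powr (- d * \<bar>real_of_int l\<bar>)" using CB by (intro mult_right_mono) auto
  finally show ?thesis .
 qed
 then have "(f / measure lebesgue ?Q) powr d <= (C * B * B powr (- d * \<bar>real_of_int l\<bar>)) powr d"
  using C Q f0 by (intro powr_mono2) auto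
 also have "... = (C * B) powr d * B powr (- (d * d) * \<bar>real_of_int l\<bar>)"
  using C B by (simp add: powr_mult powr_powr mult_ac)
 finally have "C * (f / measure lebesgue ?Q) powr d * measure (mw u) ?Q <= C * ((C * B) powr d * B powr (- (d * d) * \<bar>real_of_int l\<bar>)) * measure (mw u) ?Q"
  using C by (intro mult_right_mono mult_left_mono) auto
 moreover have "measure (mw u) F <= C * (f / measure lebesgue ?Q) powr d * measure (mw u) ?Q"
  using A(2) s F unfolding ainf_def f_def mw_one by blast
 ultimately show ?thesis by (simp add: mult.assoc)
qed

text \<open>The maximal dyadic cubes at the levels \<open>B\<^sup>k\<close> are grouped according to how the averages of \<open>v\<close>
 and \<open>u\<close> on their triples compare with \<open>B\<^sup>k\<close> and with powers of two. In each group the cubes are sparse,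
 and the contributions decay geometrically in the deviation of the average of \<open>v\<close> from \<open>B\<^sup>k\<close>.\<close>

lemma mixed_weak_type_integrable:
 assumes A: "A >= 1" and C: "C >= 1" "0 < d" "d < 1"
 shows "\<exists>D>0. \<forall>(u :: real ^ 'n => real) v g. A1w A u --> ainf C d (\<lambda>_. 1) u --> wt v --> ainf C d v (\<lambda>_. 1) -->
  lmeas g --> (\<integral>\<^sup>+x. g x \<partial>lebesgue) < \<infinity> -->
  emeasure (mw (\<lambda>x. u x * v x)) {x. ennreal (v x) < HL g x} <= ennreal D * (\<integral>\<^sup>+x. g x * ennreal (u x) \<partial>lebesgue)"
proof -
 define n where "n = CARD('n)"
 \<comment> \<open>Twice the factor 2^n by which the average over a maximal cube can exceed the
   level: the cubes of the next level then fill at most half of each maximal cube.\<close>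
 define B where "B = (2::real) ^ Suc n"
 have "(1::real) < 2 ^ Suc n" by (rule one_less_power) auto
 then have B: "B > 1" by (simp add: B_def)
 define K1 where "K1 = (16::real) ^ CARD('n)"
 have K1: "K1 >= 1" by (simp add: K1_def)
 have dK1: "dbl K1 (\<lambda>_ :: real ^ 'n. 1)" unfolding K1_def by (rule dbl_one)
 define C2 where "C2 = (C / (1 / (2 * 3 ^ n))) powr (1 / d)"
 have C2: "C2 > 0" using C by (simp add: C2_def)
 define c1 where "c1 = 2 * B * (C * (C * B) powr d) * C2"
 have c1: "c1 > 0" using C B C2 by (simp add: c1_def)
 define c2 where "c2 = B * 3 ^ n * K1"
 have c2: "c2 > 0" using B K1 by (simp add: c2_def)
 define \<kappa> where "\<kappa> = d * d"
 have kap: "\<kappa> > 0" using C by (simp add: \<kappa>_def)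
 have q: "1 - B powr (- \<kappa>) > 0" using B kap by (simp add: powr_less_one)
 define D where "D = c1 * c2 * (2 * A) * (2 / (1 - B powr (- \<kappa>)))"
 have D: "D > 0" using c1 c2 A q by (simp add: D_def)
 have "emeasure (mw (\<lambda>x. u x * v x)) {x. ennreal (v x) < HL g x} <= ennreal D * (\<integral>\<^sup>+x. g x * ennreal (u x) \<partial>lebesgue)"
  if u: "A1w A u" "ainf C d (\<lambda>_. 1) u" and v: "wt v" "ainf C d v (\<lambda>_. 1)" and gm[measurable]: "lmeas g"
   and gfin: "(\<integral>\<^sup>+x. g x \<partial>lebesgue) < \<infinity>"
  for u v :: "real ^ 'n => real" and g
 proof -
  have wu: "wt u" using u by (simp add: A1w_def)
  have um[measurable]: "lmeas u" and u0: "\<And>x. 0 <= u x" using wtD wu by auto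
  have vm[measurable]: "lmeas v" and v0: "\<And>x. 0 <= v x" using wtD v by auto
  have uvm[measurable]: "(\<lambda>x. u x * v x) \<in> borel_measurable lebesgue" by measurable
  define M where "M = mw (\<lambda>x. u x * v x)"
  have setsM: "sets M = sets lebesgue" by (simp add: M_def)
  define \<nu> where "\<nu> = density lebesgue g"
  have sets\<nu>: "sets \<nu> = sets lebesgue" by (simp add: \<nu>_def)
  have \<nu>E: "emeasure \<nu> X = (\<integral>\<^sup>+y\<in>X. g y \<partial>lebesgue)" if "X \<in> sets lebesgue" for X
   using that by (simp add: \<nu>_def emeasure_density)
  have \<nu>fin: "emeasure \<nu> X < \<infinity>" if "X \<in> sets lebesgue" for X
  proof -
   have "emeasure \<nu> X <= (\<integral>\<^sup>+x. g x \<partial>lebesgue)" unfolding \<nu>E[OF that] by (intro nn_integral_mono) (auto simp: indicator_def)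
   then show ?thesis using gfin by (rule order_le_less_trans)
  qed
  have \<nu>eq: "emeasure \<nu> X = ennreal (measure \<nu> X)" if "X \<in> sets lebesgue" for X
   using \<nu>fin[OF that] by (simp add: emeasure_eq_ennreal_measure)
  define \<tau> where "\<tau> k = B powr real_of_int k / K1" for k :: int
  have tau: "\<tau> k > 0" for k using B K1 by (simp add: \<tau>_def)
  have tauS: "\<tau> (k + 1) = B * \<tau> k" for k using B by (simp add: \<tau>_def powr_add)
  define S where "S k = {p. \<tau> k * G.sd (fst p) ^ n < measure \<nu> (G.dq p)}" for k
  have tau_mono: "\<tau> k <= \<tau> k'" if "k <= k'" for k k'
   unfolding \<tau>_def using that B K1 by (intro divide_right_mono powr_mono) auto
  have Smono: "S k' \<subseteq> S k" if "k <= k'" for k k'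
  proof
   fix p assume p: "p \<in> S k'"
   have "\<tau> k * G.sd (fst p) ^ n <= \<tau> k' * G.sd (fst p) ^ n" using tau_mono[OF that] by (intro mult_right_mono) auto
   also have "... < measure \<nu> (G.dq p)" using p by (simp add: S_def)
   finally show "p \<in> S k" by (simp add: S_def)
  qed
  \<comment> \<open>Uses the integrability of g: a cube on which the average exceeds \<tau> k has
    bounded volume, so maximal cubes exist.\<close>
  have bdS: "\<exists>J. \<forall>p\<in>S k. fst p <= J" for k
  proof -
   define R where "R = measure \<nu> UNIV / \<tau> k"
   obtain J :: nat where J: "R < 2 ^ J" using real_arch_pow[of 2 R] by auto
   have "fst p <= int J" if p: "p \<in> S k" for p
   proof (rule ccontr)
    assume "\<not> fst p <= int J"
    then have "G.sd (int J) <= G.sd (fst p)" by (intro G.sd_mono) auto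
    then have "2 ^ J <= G.sd (fst p)" by (simp add: G.sd_def)
    moreover have "(1::real) <= 2 ^ J" by simp
    ultimately have "2 ^ J <= G.sd (fst p) ^ 1" "1 <= G.sd (fst p)" by (simp, linarith)
    then have "2 ^ J <= G.sd (fst p) ^ n" using power_increasing[of 1 n "G.sd (fst p)"] by (simp add: n_def Suc_le_eq)
    then have "R * \<tau> k < G.sd (fst p) ^ n * \<tau> k" using J tau by (intro mult_strict_right_mono) auto
    also have "... < measure \<nu> (G.dq p)" using p by (simp add: S_def mult.commute)
    also have "... <= measure \<nu> UNIV"
    proof -
     have "emeasure \<nu> (G.dq p) <= emeasure \<nu> UNIV" by (intro emeasure_mono) (auto simp: sets\<nu>)
     then show ?thesis using \<nu>eq[of UNIV] \<nu>eq[of "G.dq p"] by simp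
    qed
    finally show False using tau[of k] by (simp add: R_def)
   qed
   then show ?thesis by blast
  qed
  define O' where "O' k = (\<Union>p\<in>S k. G.dq p)" for k
  have Os[measurable]: "O' k \<in> sets lebesgue" for k by (auto simp: O'_def intro!: sets.countable_UN')
  have Omax: "O' k = (\<Union>p\<in>G.maxi (S k). G.dq p)" for k
  proof -
   obtain J where "\<forall>p\<in>S k. fst p <= J" using bdS by blast
   then show ?thesis unfolding O'_def using G.UN_maxi[of "S k" J] by simp
  qed
  \<comment> \<open>The part of a cube not covered by the next level. It keeps at least half of the
    volume, and for maximal cubes these parts are disjoint across all levels.\<close>
  define E where "E k p = G.dq p - O' (k + 1)" for k p
  have Es[measurable]: "E k p \<in> sets lebesgue" for k p by (simp add: E_def)
  have mdq: "measure lebesgue (G.dq p) = G.sd (fst p) ^ n" for p :: "int \<times> (int ^ 'n)"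
   by (simp add: measure_def G.measure_dq n_def)
  have half: "1 / 2 * G.sd (fst p) ^ n <= measure lebesgue (E k p)" if p: "p \<in> G.maxi (S k)" for k p
  proof -
   define q where "q = (fst p + 1, G.ix (fst p + 1) (G.cn p))"
   have ixp: "p = (fst p, G.ix (fst p) (G.cn p))" using G.cn_mem_dq[of p] by (simp add: G.dq_def prod_eq_iff)
   have "G.dq (fst p, G.ix (fst p) (G.cn p)) \<subseteq> G.dq (fst p + 1, G.ix (fst p + 1) (G.cn p))" by (rule G.dq_nested) simp
   then have pq: "G.dq p \<subseteq> G.dq q" unfolding q_def using ixp by simp
   have "q \<notin> S k"
   proof
    assume "q \<in> S k"
    then have "G.dq p \<inter> G.dq q = {}" using p unfolding G.maxi_def by (auto simp: q_def)
    then show False using pq G.cn_mem_dq[of p] by blast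
   qed
   have "emeasure \<nu> (G.dq p) <= emeasure \<nu> (G.dq q)" using pq by (intro emeasure_mono) (auto simp: sets\<nu>)
   then have "measure \<nu> (G.dq p) <= measure \<nu> (G.dq q)" by (simp add: \<nu>eq)
   also have "... <= \<tau> k * (2 ^ n * G.sd (fst p) ^ n)"
    using \<open>q \<notin> S k\<close> by (simp add: S_def q_def G.sd_Suc power_mult_distrib)
   finally have up: "measure \<nu> (G.dq p) <= \<tau> k * (2 ^ n * G.sd (fst p) ^ n)" .
   define R where "R = {q \<in> G.maxi (S (k + 1)). G.dq q \<inter> G.dq p \<noteq> {}}"
   have RS: "q \<in> S (k + 1)" if "q \<in> R" for q using that G.maxi_subset by (auto simp: R_def)
   have Rsub: "G.dq q \<subseteq> G.dq p" if q: "q \<in> R" for q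
   proof -
    have "q \<in> S k" using RS[OF q] Smono[of k "k + 1"] by auto
    then have "\<not> fst q > fst p" using p q unfolding G.maxi_def R_def by blast
    then show ?thesis using q by (intro G.dq_subset_or_disjoint) (auto simp: R_def)
   qed
   define X where "X = (\<Union>q\<in>R. G.dq q)"
   have X: "X \<in> sets lebesgue" "X \<subseteq> G.dq p" using Rsub by (auto simp: X_def intro!: sets.countable_UN')
   have "emeasure (density lebesgue (\<lambda>_. ennreal (\<tau> (k + 1)))) X <= emeasure \<nu> X"
    unfolding X_def
   proof (rule emeasure_UN_disjoint_mono)
    show "disjoint_family_on G.dq R" using G.maxi_disjoint[of "S (k + 1)"] by (rule disjoint_family_on_mono[rotated]) (auto simp: R_def)
    fix q assume "q \<in> R"
    from RS[OF this] have "\<tau> (k + 1) * G.sd (fst q) ^ n <= measure \<nu> (G.dq q)" by (simp add: S_def)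
    then show "emeasure (density lebesgue (\<lambda>_. ennreal (\<tau> (k + 1)))) (G.dq q) <= emeasure \<nu> (G.dq q)"
     using tau[of "k + 1"] by (simp add: emeasure_density_const \<nu>eq G.measure_dq n_def[symmetric] flip: ennreal_mult)
   qed (auto simp: sets\<nu>)
   also have "... <= emeasure \<nu> (G.dq p)" using X by (intro emeasure_mono) (auto simp: sets\<nu>)
   finally have "ennreal (\<tau> (k + 1)) * emeasure lebesgue X <= ennreal (measure \<nu> (G.dq p))"
    using X by (simp add: emeasure_density_const \<nu>eq)
   moreover have bX: "bounded X" using X(2) G.bounded_dq bounded_subset by blast
   ultimately have "\<tau> (k + 1) * measure lebesgue X <= measure \<nu> (G.dq p)"
    using tau[of "k + 1"] wt_emeasure_eq[OF wt_one bX] by (simp add: mw_one flip: ennreal_mult)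
   also note up
   finally have "\<tau> k * (B * measure lebesgue X) <= \<tau> k * (2 ^ n * G.sd (fst p) ^ n)" by (simp add: tauS mult_ac)
   then have "B * measure lebesgue X <= 2 ^ n * G.sd (fst p) ^ n" using tau[of k] by simp
   then have mX: "measure lebesgue X <= 1 / 2 * G.sd (fst p) ^ n" by (simp add: B_def)
   have "E k p = G.dq p - X"
    unfolding E_def Omax X_def R_def by blast
   then have "measure lebesgue (E k p) = measure lebesgue (G.dq p) - measure lebesgue X"
    using wt_measure_Diff[OF wt_one X(2) G.bounded_dq _ X(1)] by (simp add: mw_one)
   then show ?thesis using mX mdq[of p] by simp
  qed
  have mtri: "measure lebesgue (G.tri p) = 3 ^ n * G.sd (fst p) ^ n" for p :: "int \<times> (int ^ 'n)" by (simp add: G.measure_tri n_def)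
  have vE: "measure (mw v) (G.tri p) <= C2 * measure (mw v) (E k p)" if p: "p \<in> G.maxi (S k)" for k p
   unfolding C2_def G.tri_def
  proof (rule ainf_lower[OF v(1) wt_one v(2)])
   show "E k p \<subseteq> cub (G.cn p - (\<chi> i. G.sd (fst p))) (3 * G.sd (fst p))"
    using G.dq_subset_tri[of p] by (auto simp: E_def G.tri_def)
   show "1 / (2 * 3 ^ n) * measure (mw (\<lambda>_. 1)) (cub (G.cn p - (\<chi> i. G.sd (fst p))) (3 * G.sd (fst p))) <= measure (mw (\<lambda>_. 1)) (E k p)"
    using half[OF p] mtri[of p] unfolding mw_one G.tri_def by simp
  qed (use C in auto)
  define Ek where "Ek k = {x. B powr real_of_int k < v x \<and> v x <= B powr (real_of_int k + 1) \<and> ennreal (v x) < HL g x}" for k :: int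
  have MX[measurable]: "HL g \<in> borel_measurable lebesgue" by (rule Mx_measurable[OF wt_one])
  have Eks[measurable]: "Ek k \<in> sets lebesgue" for k unfolding Ek_def by (intro lebesgue_Collect) measurable
  have Ekcov: "Ek k \<subseteq> (\<Union>p\<in>G.maxi (S k). G.tri p)" for k
  proof
   fix x assume x: "x \<in> Ek k"
   have "ennreal (K1 * \<tau> k) <= ennreal (v x)" using x K1 by (intro ennreal_leI) (simp add: Ek_def \<tau>_def)
   also have "... < HL g x" using x by (simp add: Ek_def)
   finally obtain c s where cs: "s > 0" "x \<in> cub c s" "ennreal (K1 * \<tau> k) < avg (\<lambda>_. 1) (cub c s) g"
    unfolding Mx_greater by blast
   obtain p where p: "x \<in> G.tri p" "ennreal (\<tau> k) * emeasure lebesgue (G.dq p) < (\<integral>\<^sup>+y\<in>G.dq p. g y \<partial>lebesgue)"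
    using G.dyadic_catch[OF wt_one dK1 K1 gm cs less_imp_le[OF tau]] unfolding mw_one by blast
   have "ennreal (\<tau> k * G.sd (fst p) ^ n) < ennreal (measure \<nu> (G.dq p))"
    using p(2) tau[of k] by (simp add: \<nu>E[symmetric] \<nu>eq G.measure_dq n_def[symmetric] ennreal_mult)
   then have "p \<in> S k" using tau[of k] by (simp add: S_def ennreal_less_iff)
   obtain J where J: "\<forall>p\<in>S k. fst p <= J" using bdS by blast
   obtain q where "q \<in> G.maxi (S k)" "fst p <= fst q" "G.dq p \<subseteq> G.dq q" using G.maxi_above[OF \<open>p \<in> S k\<close>, of J] J by blast
   then show "x \<in> (\<Union>p\<in>G.maxi (S k). G.tri p)" using G.tri_mono p(1) by blast
  qed
  define vt where "vt p = measure (mw v) (G.tri p) / measure lebesgue (G.tri p)" for p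
  define ut where "ut p = measure (mw u) (G.tri p) / measure lebesgue (G.tri p)" for p
  have tripos: "measure lebesgue (G.tri p) > 0" "measure (mw v) (G.tri p) > 0" "measure (mw u) (G.tri p) > 0" for p :: "int \<times> (int ^ 'n)"
   using wt_measure_pos[OF wu, of "3 * G.sd (fst p)"] wt_measure_pos[OF v(1), of "3 * G.sd (fst p)"] mtri[of p]
   by (simp_all add: G.tri_def)
  have tpos: "vt p > 0" "ut p > 0" for p using tripos[of p] by (simp_all add: vt_def ut_def)
  \<comment> \<open>The restriction k >= - N keeps the sizes of all cubes in a group bounded, so
    that maximal ones exist when levels are mixed below; N tends to infinity at the end. The index l
    compares the average of v on the triple with B^k, and m records the dyadic size of the average
    of u.\<close>
  define T where "T N l m = {(k, p). - int N <= k \<and> p \<in> G.maxi (S k) \<and> B powr (real_of_int k + real_of_int l) <= vt p \<and> vt p < B powr (real_of_int k + real_of_int l + 1)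
    \<and> 2 powr real_of_int m <= ut p \<and> ut p < 2 powr (real_of_int m + 1)}" for N :: nat and l m :: int
  define Z where "Z N l m = (\<Union>kp\<in>T N l m. G.dq (snd kp))" for N l m
  have cT: "countable (T N l m)" for N l m by (rule countableI_type)
  have Zs[measurable]: "Z N l m \<in> sets lebesgue" for N l m using cT by (auto simp: Z_def intro!: sets.countable_UN')
  \<comment> \<open>On the set, v is about B^k, and \<open>level_decay\<close> gives the geometric
    factor in |l|. The mean of u over the triple contributes 2^m, and B^k |tri p| is at most B^(-l)
    v(tri p), whose v-mass returns to the sparse part E k p.\<close>
  have step1: "emeasure M (Ek k \<inter> G.tri p) <= ennreal (c1 * B powr (- \<kappa> * \<bar>real_of_int l\<bar>) * 2 powr real_of_int m * B powr (- real_of_int l)) * emeasure (mw v) (E k p)"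
   if kp: "(k, p) \<in> T N l m" for k p N l m
  proof -
   have p: "p \<in> G.maxi (S k)" and V: "B powr (real_of_int k + real_of_int l) <= vt p" "vt p < B powr (real_of_int k + real_of_int l + 1)"
    and U: "ut p < 2 powr (real_of_int m + 1)" using kp by (auto simp: T_def)
   define F where "F = Ek k \<inter> G.tri p"
   have F: "F \<in> sets lebesgue" "F \<subseteq> G.tri p" "bounded F" using bounded_subset[OF G.bounded_tri] by (auto simp: F_def)
   have uF: "measure (mw u) F <= C * (C * B) powr d * B powr (- (d * d) * \<bar>real_of_int l\<bar>) * measure (mw u) (G.tri p)"
    unfolding G.tri_def
   proof (rule level_decay[OF wu u(2) v C B, where k = k])
    show "F \<subseteq> cub (G.cn p - (\<chi> i. G.sd (fst p))) (3 * G.sd (fst p))" using F by (simp add: G.tri_def)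
    show "B powr (real_of_int k + real_of_int l) * measure lebesgue (cub (G.cn p - (\<chi> i. G.sd (fst p))) (3 * G.sd (fst p)))
     <= measure (mw v) (cub (G.cn p - (\<chi> i. G.sd (fst p))) (3 * G.sd (fst p)))"
     using V(1) tripos(1)[of p] unfolding G.tri_def[symmetric] vt_def by (simp add: pos_le_divide_eq)
    show "measure (mw v) (cub (G.cn p - (\<chi> i. G.sd (fst p))) (3 * G.sd (fst p)))
     <= B powr (real_of_int k + real_of_int l + 1) * measure lebesgue (cub (G.cn p - (\<chi> i. G.sd (fst p))) (3 * G.sd (fst p)))"
     using V(2) tripos(1)[of p] unfolding G.tri_def[symmetric] vt_def by (simp add: pos_divide_less_eq)
    show "0 < 3 * G.sd (fst p)" by simp
    show "F \<in> sets lebesgue" by (rule F)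
    show "B powr real_of_int k <= v x \<and> v x <= B powr (real_of_int k + 1)" if "x \<in> F" for x
     using that by (simp add: F_def Ek_def)
   qed
   have ut1: "measure (mw u) (G.tri p) <= 2 * 2 powr real_of_int m * measure lebesgue (G.tri p)"
    using U tripos(1)[of p] unfolding ut_def by (simp add: pos_divide_less_eq powr_add)
   have vt1: "B powr real_of_int k * measure lebesgue (G.tri p) <= B powr (- real_of_int l) * measure (mw v) (G.tri p)"
   proof -
    have "B powr (real_of_int k + real_of_int l) * measure lebesgue (G.tri p) <= measure (mw v) (G.tri p)"
     using V(1) tripos(1)[of p] unfolding vt_def by (simp add: pos_le_divide_eq)
    then have "B powr (- real_of_int l) * (B powr (real_of_int k + real_of_int l) * measure lebesgue (G.tri p)) <= B powr (- real_of_int l) * measure (mw v) (G.tri p)"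
     by (intro mult_left_mono) auto
    then show ?thesis by (simp flip: mult.assoc powr_add)
   qed
   have "emeasure M F <= ennreal (B * B powr real_of_int k) * emeasure (mw u) F"
   proof -
    have "emeasure M F = (\<integral>\<^sup>+x\<in>F. ennreal (u x * v x) \<partial>lebesgue)"
     unfolding M_def using F by (intro emeasure_mw) auto
    also have "... <= (\<integral>\<^sup>+x. ennreal (B * B powr real_of_int k) * (ennreal (u x) * indicator F x) \<partial>lebesgue)"
    proof (rule nn_integral_mono)
     fix x
     show "ennreal (u x * v x) * indicator F x <= ennreal (B * B powr real_of_int k) * (ennreal (u x) * indicator F x)"
     proof (cases "x \<in> F")
      case True
      then have "v x <= B * B powr real_of_int k" using B by (simp add: F_def Ek_def powr_add mult.commute)
      then have "u x * v x <= B * B powr real_of_int k * u x" using u0[of x] by (subst mult.commute) (rule mult_right_mono)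
      then show ?thesis using True u0 B by (simp add: ennreal_leI flip: ennreal_mult)
     qed simp
    qed
    also have "... = ennreal (B * B powr real_of_int k) * emeasure (mw u) F"
     using F by (subst nn_integral_cmult) (auto simp: emeasure_mw)
    finally show ?thesis .
   qed
   also have "... = ennreal (B * B powr real_of_int k * measure (mw u) F)"
    using wt_emeasure_eq[OF wu F(3)] B by (simp add: ennreal_mult)
   also have "... <= ennreal (c1 * B powr (- \<kappa> * \<bar>real_of_int l\<bar>) * 2 powr real_of_int m * B powr (- real_of_int l) * measure (mw v) (E k p))"
   proof (rule ennreal_leI)
    define H where "H = C * (C * B) powr d * B powr (- \<kappa> * \<bar>real_of_int l\<bar>)"
    have H: "H >= 0" using C B by (simp add: H_def)
    have "B * B powr real_of_int k * measure (mw u) F <= B * B powr real_of_int k * (H * measure (mw u) (G.tri p))"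
     using uF B unfolding H_def \<kappa>_def by (intro mult_left_mono) auto
    also have "... <= B * B powr real_of_int k * (H * (2 * 2 powr real_of_int m * measure lebesgue (G.tri p)))"
     using ut1 B H by (intro mult_left_mono) auto
    also have "... = B * H * (2 * 2 powr real_of_int m) * (B powr real_of_int k * measure lebesgue (G.tri p))" by simp
    also have "... <= B * H * (2 * 2 powr real_of_int m) * (B powr (- real_of_int l) * measure (mw v) (G.tri p))"
     using vt1 B H by (intro mult_left_mono) auto
    also have "... <= B * H * (2 * 2 powr real_of_int m) * (B powr (- real_of_int l) * (C2 * measure (mw v) (E k p)))"
     using vE[OF p] B H by (intro mult_left_mono) auto
    also have "... = c1 * B powr (- \<kappa> * \<bar>real_of_int l\<bar>) * 2 powr real_of_int m * B powr (- real_of_int l) * measure (mw v) (E k p)"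
     by (simp add: c1_def H_def)
    finally show "B * B powr real_of_int k * measure (mw u) F <= c1 * B powr (- \<kappa> * \<bar>real_of_int l\<bar>) * 2 powr real_of_int m * B powr (- real_of_int l) * measure (mw v) (E k p)" .
   qed
   also have "... = ennreal (c1 * B powr (- \<kappa> * \<bar>real_of_int l\<bar>) * 2 powr real_of_int m * B powr (- real_of_int l)) * emeasure (mw v) (E k p)"
   proof -
    have "bounded (E k p)" unfolding E_def by (intro bounded_diff G.bounded_dq)
    then show ?thesis using wt_emeasure_eq[OF v(1)] c1 by (simp add: ennreal_mult)
   qed
   finally show ?thesis by (simp add: F_def)
  qed
  \<comment> \<open>On a cube of the group the average of v is at most a multiple of B^(k + l) and
    that of g exceeds \<tau> k, of order B^k. Summing over the maximal cubes of the group bounds the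
    v-mass by a multiple of B^l times the integral of g; B^l cancels the factor B^(-l) of the
    preceding estimate.\<close>
  have step2: "emeasure (mw v) (Z N l m) <= ennreal (c2 * B powr real_of_int l) * emeasure \<nu> (Z N l m)" for N l m
  proof -
   define P where "P = snd ` T N l m"
   obtain J where J: "\<forall>p\<in>S (- int N). fst p <= J" using bdS by blast
   have PS: "p \<in> S (- int N)" if "p \<in> P" for p
    
  proof -
   obtain k where k: "(k, p) \<in> T N l m" using \<open>p \<in> P\<close> by (auto simp: P_def)
   then have "p \<in> S k" "- int N <= k" using G.maxi_subset by (auto simp: T_def)
   then show ?thesis using Smono by blast
  qed
   have ZP: "Z N l m = (\<Union>p\<in>G.maxi P. G.dq p)"
   proof -
    have "(\<Union>p\<in>G.maxi P. G.dq p) = (\<Union>p\<in>P. G.dq p)" by (rule G.UN_maxi) (use J PS in blast)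
    then show ?thesis by (simp add: Z_def P_def)
   qed
   have "emeasure (mw v) (Z N l m) <= emeasure (density \<nu> (\<lambda>_. ennreal (c2 * B powr real_of_int l))) (Z N l m)"
    unfolding ZP
   proof (rule emeasure_UN_disjoint_mono)
    fix p assume "p \<in> G.maxi P"
    then have "p \<in> P" using G.maxi_subset by blast
    then obtain k where k: "(k, p) \<in> T N l m" by (auto simp: P_def)
    then have p: "p \<in> S k" and V: "vt p < B powr (real_of_int k + real_of_int l + 1)" using G.maxi_subset by (auto simp: T_def)
    have "measure (mw v) (G.dq p) <= measure (mw v) (G.tri p)" by (intro wt_measure_mono v G.dq_subset_tri) auto
    also have "... <= B powr (real_of_int k + real_of_int l + 1) * (3 ^ n * G.sd (fst p) ^ n)"
     using V tripos(1)[of p] unfolding vt_def mtri by (simp add: pos_divide_less_eq)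
    also have "... = c2 * B powr real_of_int l * (\<tau> k * G.sd (fst p) ^ n)"
     using B K1 by (simp add: \<tau>_def c2_def powr_add)
    also have "... <= c2 * B powr real_of_int l * measure \<nu> (G.dq p)"
     using p c2 by (intro mult_left_mono) (auto simp: S_def)
    finally have "measure (mw v) (G.dq p) <= c2 * B powr real_of_int l * measure \<nu> (G.dq p)" .
    then show "emeasure (mw v) (G.dq p) <= emeasure (density \<nu> (\<lambda>_. ennreal (c2 * B powr real_of_int l))) (G.dq p)"
     using c2 by (simp add: wt_emeasure_eq[OF v(1) G.bounded_dq] emeasure_density_const sets\<nu> \<nu>eq flip: ennreal_mult)
   qed (auto simp: G.maxi_disjoint sets\<nu>)
   then show ?thesis by (simp add: emeasure_density_const sets\<nu>)
  qed
  have disjE: "disjoint_family_on (\<lambda>kp. E (fst kp) (snd kp)) (T N l m)" for N l m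
   unfolding disjoint_family_on_def
  proof (intro ballI impI)
   fix x y assume xy: "x \<in> T N l m" "y \<in> T N l m" "x \<noteq> y"
   have less: "E k p \<inter> E k' p' = {}" if "k < k'" "p' \<in> G.maxi (S k')" for k k' p p'
   proof -
    have "p' \<in> S k'" using that(2) G.maxi_subset by blast
    then have "p' \<in> S (k + 1)" using Smono[of "k + 1" k'] that(1) by auto
    then show ?thesis by (auto simp: E_def O'_def)
   qed
   have mx: "snd x \<in> G.maxi (S (fst x))" "snd y \<in> G.maxi (S (fst y))" using xy by (auto simp: T_def)
   consider "fst x < fst y" | "fst y < fst x" | "fst x = fst y" by linarith
   then show "E (fst x) (snd x) \<inter> E (fst y) (snd y) = {}"
   proof cases
    case 1 then show ?thesis using less mx by blast
   next
    case 2 then show ?thesis using less mx by blast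
   next
    case 3
    then have "snd x \<noteq> snd y" using xy by (simp add: prod_eq_iff)
    then have "G.dq (snd x) \<inter> G.dq (snd y) = {}" using mx 3 G.maxi_disjoint[of "S (fst y)"] unfolding disjoint_family_on_def by simp
    then show ?thesis by (auto simp: E_def)
   qed
  qed
  have step3: "emeasure M (\<Union>kp\<in>T N l m. Ek (fst kp) \<inter> G.tri (snd kp)) <= ennreal (c1 * c2 * B powr (- \<kappa> * \<bar>real_of_int l\<bar>)) * (ennreal (2 powr real_of_int m) * emeasure \<nu> (Z N l m))" for N l m
  proof -
   define e where "e = c1 * B powr (- \<kappa> * \<bar>real_of_int l\<bar>) * 2 powr real_of_int m * B powr (- real_of_int l)"
   have e: "e >= 0" using c1 by (simp add: e_def)
   have "emeasure M (\<Union>kp\<in>T N l m. Ek (fst kp) \<inter> G.tri (snd kp)) <= (\<integral>\<^sup>+kp. emeasure M (Ek (fst kp) \<inter> G.tri (snd kp)) \<partial>count_space (T N l m))"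
    using cT by (intro emeasure_UN_le) (auto simp: setsM)
   also have "... <= (\<integral>\<^sup>+kp. ennreal e * emeasure (mw v) (E (fst kp) (snd kp)) \<partial>count_space (T N l m))"
    unfolding e_def by (intro nn_integral_mono step1) auto
   also have "... = ennreal e * (\<integral>\<^sup>+kp. emeasure (mw v) (E (fst kp) (snd kp)) \<partial>count_space (T N l m))"
    by (rule nn_integral_cmult) simp
   also have "(\<integral>\<^sup>+kp. emeasure (mw v) (E (fst kp) (snd kp)) \<partial>count_space (T N l m)) = emeasure (mw v) (\<Union>kp\<in>T N l m. E (fst kp) (snd kp))"
    using cT disjE by (intro emeasure_UN_countable[symmetric]) auto
   also have "... <= emeasure (mw v) (Z N l m)" by (intro emeasure_mono) (auto simp: Z_def E_def)
   also have "... <= ennreal (c2 * B powr real_of_int l) * emeasure \<nu> (Z N l m)" by (rule step2)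
   finally have "emeasure M (\<Union>kp\<in>T N l m. Ek (fst kp) \<inter> G.tri (snd kp)) <= ennreal e * (ennreal (c2 * B powr real_of_int l) * emeasure \<nu> (Z N l m))"
    by (simp add: mult_left_mono)
   also have "... = ennreal (e * (c2 * B powr real_of_int l)) * emeasure \<nu> (Z N l m)"
    using e c2 by (simp add: ennreal_mult mult.assoc)
   also have "e * (c2 * B powr real_of_int l) = c1 * c2 * B powr (- \<kappa> * \<bar>real_of_int l\<bar>) * 2 powr real_of_int m"
   proof -
    have "B powr (- real_of_int l) * B powr real_of_int l = 1" using B by (simp flip: powr_add)
    then show ?thesis unfolding e_def by (simp add: mult_ac)
   qed
   finally show ?thesis using c1 c2 by (simp add: ennreal_mult mult.assoc)
  qed
  have step4: "emeasure M (\<Union>k\<in>{- int N..}. Ek k) <= ennreal D * (\<integral>\<^sup>+x. g x * ennreal (u x) \<partial>lebesgue)" for N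
  proof -
   define Y where "Y l m = (\<Union>kp\<in>T N l m. Ek (fst kp) \<inter> G.tri (snd kp))" for l m
   have Ys: "Y l m \<in> sets M" for l m using cT by (auto simp: Y_def setsM intro!: sets.countable_UN')
   have "(\<Union>k\<in>{- int N..}. Ek k) \<subseteq> (\<Union>l\<in>UNIV. \<Union>m\<in>UNIV. Y l m)"
   proof
    fix x assume "x \<in> (\<Union>k\<in>{- int N..}. Ek k)"
    then obtain k where k: "- int N <= k" "x \<in> Ek k" by auto
    then obtain p where p: "p \<in> G.maxi (S k)" "x \<in> G.tri p" using Ekcov by blast
    obtain l0 :: int where l0: "B powr real_of_int l0 <= vt p" "vt p < B powr (real_of_int l0 + 1)"
     using powr_level_le[OF B tpos(1)] by blast
    obtain m :: int where m: "2 powr real_of_int m <= ut p" "ut p < 2 powr (real_of_int m + 1)"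
     using powr_level_le[of 2 "ut p"] tpos(2)[of p] by auto
    have "(k, p) \<in> T N (l0 - k) m" using k p l0 m by (simp add: T_def)
    then have "x \<in> Y (l0 - k) m" using k p unfolding Y_def by (intro UN_I[of "(k, p)"]) auto
    then show "x \<in> (\<Union>l\<in>UNIV. \<Union>m\<in>UNIV. Y l m)" by blast
   qed
   then have "emeasure M (\<Union>k\<in>{- int N..}. Ek k) <= emeasure M (\<Union>l\<in>UNIV. \<Union>m\<in>UNIV. Y l m)"
    using Ys by (intro emeasure_mono) (auto intro!: sets.countable_UN')
   also have "... <= (\<integral>\<^sup>+l. emeasure M (\<Union>m\<in>UNIV. Y l m) \<partial>count_space UNIV)"
    using Ys by (intro emeasure_UN_le) (auto intro!: sets.countable_UN')
   also have "... <= (\<integral>\<^sup>+l. (\<integral>\<^sup>+m. emeasure M (Y l m) \<partial>count_space UNIV) \<partial>count_space UNIV)"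
    using Ys by (intro nn_integral_mono emeasure_UN_le) auto
   also have "... <= (\<integral>\<^sup>+l. ennreal (c1 * c2 * B powr (- \<kappa> * \<bar>real_of_int l\<bar>)) * (ennreal (2 * A) * (\<integral>\<^sup>+x. g x * ennreal (u x) \<partial>lebesgue)) \<partial>count_space UNIV)"
   proof (rule nn_integral_mono)
    fix l :: int
    have "(\<integral>\<^sup>+m. emeasure M (Y l m) \<partial>count_space UNIV)
     <= (\<integral>\<^sup>+m. ennreal (c1 * c2 * B powr (- \<kappa> * \<bar>real_of_int l\<bar>)) * (ennreal (2 powr real_of_int m) * emeasure \<nu> (Z N l m)) \<partial>count_space UNIV)"
     unfolding Y_def by (intro nn_integral_mono step3)
    also have "... = ennreal (c1 * c2 * B powr (- \<kappa> * \<bar>real_of_int l\<bar>)) * (\<integral>\<^sup>+m. ennreal (2 powr real_of_int m) * emeasure \<nu> (Z N l m) \<partial>count_space UNIV)"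
     by (rule nn_integral_cmult) simp
    also have "(\<integral>\<^sup>+m. ennreal (2 powr real_of_int m) * emeasure \<nu> (Z N l m) \<partial>count_space UNIV) =
      (\<integral>\<^sup>+m. (\<integral>\<^sup>+x. ennreal (2 powr real_of_int m) * (g x * indicator (Z N l m) x) \<partial>lebesgue) \<partial>count_space UNIV)"
     by (intro nn_integral_cong) (simp add: \<nu>E nn_integral_cmult)
    also have "... = (\<integral>\<^sup>+x. (\<integral>\<^sup>+m. ennreal (2 powr real_of_int m) * (g x * indicator (Z N l m) x) \<partial>count_space UNIV) \<partial>lebesgue)"
     by (intro nn_integral_count_space_nn_integral[symmetric]) auto
    also have "... <= (\<integral>\<^sup>+x. ennreal (2 * A) * (g x * ennreal (u x)) \<partial>lebesgue)"
    proof (intro nn_integral_mono_AE)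
     have Age: "A >= 0" using A by simp
     show "AE x in lebesgue. (\<integral>\<^sup>+m. ennreal (2 powr real_of_int m) * (g x * indicator (Z N l m) x) \<partial>count_space UNIV) <= ennreal (2 * A) * (g x * ennreal (u x))"
      using A1w_cube[OF u(1) Age]
     proof (rule eventually_mono)
      fix x assume good: "\<forall>c s. s > 0 --> x \<in> cub c s --> measure (mw u) (cub c s) <= A * u x * s ^ CARD('n)"
      \<comment> \<open>By A_1 at x only those m contribute for which 2^m is at most A u(x). The
        geometric sum over m then replaces the averages of u by the pointwise value u(x).\<close>
      have le: "2 powr real_of_int m <= A * u x" if xZ: "x \<in> Z N l m" for m
      proof -
       obtain kp where kp: "kp \<in> T N l m" "x \<in> G.dq (snd kp)" using xZ unfolding Z_def by blast
       have "2 powr real_of_int m <= ut (snd kp)" using kp by (auto simp: T_def)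
       moreover have "measure (mw u) (G.tri (snd kp)) <= A * u x * measure lebesgue (G.tri (snd kp))"
        using good[rule_format, of "3 * G.sd (fst (snd kp))" "G.cn (snd kp) - (\<chi> i. G.sd (fst (snd kp)))"]
         subsetD[OF G.dq_subset_tri kp(2)] unfolding mtri by (simp add: G.tri_def n_def power_mult_distrib)
       then have "ut (snd kp) <= A * u x" unfolding ut_def using tripos(1)[of "snd kp"] by (simp add: pos_divide_le_eq)
       ultimately show ?thesis by linarith
      qed
      have "(\<integral>\<^sup>+m. ennreal (2 powr real_of_int m) * (g x * indicator (Z N l m) x) \<partial>count_space UNIV)
       <= (\<integral>\<^sup>+m. g x * (if 2 powr real_of_int m <= A * u x then ennreal (2 powr (real_of_int m * 1)) else 0) \<partial>count_space UNIV)"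
       using le by (intro nn_integral_mono) (auto simp: indicator_def mult.commute)
      also have "... = g x * (\<integral>\<^sup>+m. (if 2 powr real_of_int m <= A * u x then ennreal (2 powr (real_of_int m * 1)) else 0) \<partial>count_space UNIV)"
       by (rule nn_integral_cmult) simp
      also have "... <= g x * ennreal ((A * u x) powr 1 / (1 - 2 powr (- 1)))"
       using A u0 by (intro mult_left_mono geometric_sum_le) auto
      also have "(A * u x) powr 1 / (1 - 2 powr (- 1)) = 2 * A * u x" using A u0[of x] by (simp add: powr_minus)
      also have "g x * ennreal (2 * A * u x) = ennreal (2 * A) * (g x * ennreal (u x))"
       using A u0 by (simp add: ennreal_mult mult_ac)
      finally show "(\<integral>\<^sup>+m. ennreal (2 powr real_of_int m) * (g x * indicator (Z N l m) x) \<partial>count_space UNIV) <= ennreal (2 * A) * (g x * ennreal (u x))" .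
     qed
    qed
    also have "... = ennreal (2 * A) * (\<integral>\<^sup>+x. g x * ennreal (u x) \<partial>lebesgue)" by (rule nn_integral_cmult) measurable
    finally show "(\<integral>\<^sup>+m. emeasure M (Y l m) \<partial>count_space UNIV) <= ennreal (c1 * c2 * B powr (- \<kappa> * \<bar>real_of_int l\<bar>)) * (ennreal (2 * A) * (\<integral>\<^sup>+x. g x * ennreal (u x) \<partial>lebesgue))"
     by (simp add: mult_left_mono)
   qed
   also have "... = (\<integral>\<^sup>+l. ennreal (B powr (- \<kappa> * \<bar>real_of_int l\<bar>)) * (ennreal (c1 * c2 * (2 * A)) * (\<integral>\<^sup>+x. g x * ennreal (u x) \<partial>lebesgue)) \<partial>count_space UNIV)"
    using c1 c2 A by (intro nn_integral_cong) (simp add: ennreal_mult mult_ac)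
   also have "... = (\<integral>\<^sup>+l. ennreal (B powr (- \<kappa> * \<bar>real_of_int l\<bar>)) \<partial>count_space UNIV) * (ennreal (c1 * c2 * (2 * A)) * (\<integral>\<^sup>+x. g x * ennreal (u x) \<partial>lebesgue))"
    by (rule nn_integral_multc) simp
   also have "... <= ennreal (2 / (1 - B powr (- \<kappa>))) * (ennreal (c1 * c2 * (2 * A)) * (\<integral>\<^sup>+x. g x * ennreal (u x) \<partial>lebesgue))"
    by (intro mult_right_mono geometric_sum_abs B kap) auto
   also have "... = ennreal D * (\<integral>\<^sup>+x. g x * ennreal (u x) \<partial>lebesgue)"
   proof -
    have "ennreal D = ennreal (2 / (1 - B powr (- \<kappa>))) * ennreal (c1 * c2 * (2 * A))"
     unfolding D_def using c1 c2 A q by (subst ennreal_mult[symmetric]) (auto simp: mult_ac)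
    then show ?thesis by (simp add: mult.assoc)
   qed
   finally show ?thesis .
  qed
  have "AE x in lebesgue. 0 < v x" by (rule ainf_imp_pos[OF v])
  then have "AE x in M. 0 < v x" unfolding M_def by (rule AE_mw[OF uvm])
  then have "AE x in M. x \<in> {x. ennreal (v x) < HL g x} --> x \<in> (\<Union>N. \<Union>k\<in>{- int N..}. Ek k)"
  proof (rule eventually_mono, intro impI)
   fix x assume x: "0 < v x" "x \<in> {x. ennreal (v x) < HL g x}"
   then obtain k :: int where "x \<in> Ek k" using powr_level_lt[OF B, of "v x"] by (auto simp: Ek_def)
   moreover have "- int (nat (- k)) <= k" by simp
   ultimately show "x \<in> (\<Union>N. \<Union>k\<in>{- int N..}. Ek k)" by blast
  qed
  then have "emeasure M {x. ennreal (v x) < HL g x} <= emeasure M (\<Union>N. \<Union>k\<in>{- int N..}. Ek k)"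
   by (intro emeasure_mono_AE) (auto simp: setsM intro!: sets.countable_UN')
  also have "... = (SUP N. emeasure M (\<Union>k\<in>{- int N..}. Ek k))"
  proof (rule SUP_emeasure_incseq[symmetric])
   show "range (\<lambda>N. \<Union>k\<in>{- int N..}. Ek k) \<subseteq> sets M" by (auto simp: setsM intro!: sets.countable_UN')
   show "incseq (\<lambda>N. \<Union>k\<in>{- int N..}. Ek k)" by (force simp: incseq_def)
  qed
  also have "... <= ennreal D * (\<integral>\<^sup>+x. g x * ennreal (u x) \<partial>lebesgue)" by (intro SUP_least step4)
  finally show ?thesis by (simp add: M_def)
 qed
 then show ?thesis using D by blast
qed

text \<open>Truncation to bounded functions supported in \<open>big N\<close>, divided by t, reduces
  the claim to the integrable case at height 1. By monotone convergence, a cube whose average of g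
  exceeds t v(x) already shows this for some truncation, so the level sets increase to one that
  covers the set in question.\<close>

lemma mixed_weak_type:
 assumes A: "A >= 1" and C: "C >= 1" "0 < d" "d < 1"
 shows "\<exists>D>0. \<forall>(u :: real ^ 'n => real) v g t. A1w A u --> ainf C d (\<lambda>_. 1) u --> wt v --> ainf C d v (\<lambda>_. 1) -->
  lmeas g --> (\<forall>x. 0 <= g x) --> t > 0 -->
  ennreal t * emeasure (mw (\<lambda>x. u x * v x)) {x. ennreal (t * v x) < HL (\<lambda>y. ennreal (g y)) x}
   <= ennreal D * (\<integral>\<^sup>+x. ennreal (g x * u x) \<partial>lebesgue)"
proof -
 obtain D where D: "D > 0" and core: "\<forall>(u :: real ^ 'n => real) v g. A1w A u --> ainf C d (\<lambda>_. 1) u --> wt v --> ainf C d v (\<lambda>_. 1) -->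
  lmeas g --> (\<integral>\<^sup>+x. g x \<partial>lebesgue) < \<infinity> -->
  emeasure (mw (\<lambda>x. u x * v x)) {x. ennreal (v x) < HL g x} <= ennreal D * (\<integral>\<^sup>+x. g x * ennreal (u x) \<partial>lebesgue)"
  using mixed_weak_type_integrable[OF A C, where 'n = 'n] by blast
 have main: "ennreal t * emeasure (mw (\<lambda>x. u x * v x)) {x. ennreal (t * v x) < HL (\<lambda>y. ennreal (g y)) x}
   <= ennreal D * (\<integral>\<^sup>+x. ennreal (g x * u x) \<partial>lebesgue)"
  if u: "A1w A u" "ainf C d (\<lambda>_. 1) u" and v: "wt v" "ainf C d v (\<lambda>_. 1)" and gm[measurable]: "lmeas g"
   and g0: "\<And>x. 0 <= g x" and t: "t > 0" for u v g :: "real ^ 'n => real" and t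
 proof -
  have wu: "wt u" using u by (simp add: A1w_def)
  have um[measurable]: "lmeas u" and u0: "\<And>x. 0 <= u x" using wtD wu by auto
  have vm[measurable]: "lmeas v" and v0: "\<And>x. 0 <= v x" using wtD v by auto
  have bk[measurable]: "big N \<in> sets lebesgue" for N by (simp add: big_def)
  define h where "h N x = (if x \<in> big N \<and> g x <= real N then g x / t else 0)" for N x
  have h0: "0 <= h N x" for N x using g0 t by (simp add: h_def)
  have hm[measurable]: "h N \<in> borel_measurable lebesgue" for N unfolding h_def[abs_def] by measurable
  have hle: "h N x <= g x / t" for N x using g0 t by (simp add: h_def)
  have hinc: "h N x <= h N' x" if "N <= N'" for N N' x
   using that big_mono[OF that] g0[of x] t by (auto simp: h_def)
  have hfin: "(\<integral>\<^sup>+x. ennreal (h N x) \<partial>lebesgue) < \<infinity>" for N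
  proof -
   have "(\<integral>\<^sup>+x. ennreal (h N x) \<partial>lebesgue) <= (\<integral>\<^sup>+x\<in>(big N :: (real ^ 'n) set). ennreal (real N / t) \<partial>lebesgue)"
    using t by (intro nn_integral_mono) (auto simp: h_def indicator_def intro!: ennreal_leI divide_right_mono)
   also have "... = ennreal (real N / t) * emeasure lebesgue (big N :: (real ^ 'n) set)" by (simp add: nn_integral_cmult_indicator)
   also have "... < \<infinity>" using wt_finite[OF wt_one, of "big N :: (real ^ 'n) set"] by (simp add: mw_one big_def ennreal_mult_less_top)
   finally show ?thesis .
  qed
  have hlim: "(SUP N. ennreal (h N x)) = ennreal (g x / t)" for x
  proof (rule antisym)
   show "(SUP N. ennreal (h N x)) <= ennreal (g x / t)" by (intro SUP_least ennreal_leI hle)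
   obtain k where "x \<in> big k" using UN_big by blast
   obtain l where "g x <= real l" using real_arch_simple by blast
   have "x \<in> big (max k l)" "g x <= real (max k l)" using \<open>x \<in> big k\<close> big_mono[of k "max k l"] \<open>g x <= real l\<close> by auto
   then have "h (max k l) x = g x / t" by (simp add: h_def)
   then show "ennreal (g x / t) <= (SUP N. ennreal (h N x))" by (metis SUP_upper UNIV_I)
  qed
  define X where "X N = {x. ennreal (v x) < HL (\<lambda>y. ennreal (h N y)) x}" for N
  have MX[measurable]: "HL (\<lambda>y. ennreal (h N y)) \<in> borel_measurable lebesgue" for N by (rule Mx_measurable[OF wt_one])
  have Xs[measurable]: "X N \<in> sets lebesgue" for N unfolding X_def by (intro lebesgue_Collect) measurable
  have Xinc: "incseq X"
   unfolding incseq_def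
  proof (intro allI impI subsetI)
   fix N N' x assume "N <= (N' :: nat)" "x \<in> X N"
   have "HL (\<lambda>y. ennreal (h N y)) x <= HL (\<lambda>y. ennreal (h N' y)) x"
    using hinc[OF \<open>N <= N'\<close>] by (intro Mx_mono_AE AE_I2 ennreal_leI)
   then show "x \<in> X N'" using \<open>x \<in> X N\<close> by (auto simp: X_def)
  qed
  have sub: "{x. ennreal (t * v x) < HL (\<lambda>y. ennreal (g y)) x} \<subseteq> (\<Union>N. X N)"
  proof
   fix x assume "x \<in> {x. ennreal (t * v x) < HL (\<lambda>y. ennreal (g y)) x}"
   then obtain c s where cs: "s > 0" "x \<in> cub c s" "ennreal (t * v x) < avg (\<lambda>_. 1) (cub c s) (\<lambda>y. ennreal (g y))"
    unfolding mem_Collect_eq Mx_greater by blast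
   let ?Q = "cub c s"
   have "\<not> (\<integral>\<^sup>+y\<in>?Q. ennreal (g y) \<partial>lebesgue) <= ennreal (t * v x) * emeasure lebesgue ?Q"
    using cs(3) avg_le_iff[OF wt_one cs(1), of c "\<lambda>y. ennreal (g y)" "ennreal (t * v x)"] by (auto simp: mw_one not_le)
   moreover have "(\<integral>\<^sup>+y\<in>?Q. ennreal (g y) \<partial>lebesgue) = ennreal t * (SUP N. \<integral>\<^sup>+y\<in>?Q. ennreal (h N y) \<partial>lebesgue)"
   proof -
    have "(\<integral>\<^sup>+y\<in>?Q. ennreal (g y) \<partial>lebesgue) = (\<integral>\<^sup>+y. ennreal t * ((SUP N. ennreal (h N y)) * indicator ?Q y) \<partial>lebesgue)"
     using t g0 by (intro nn_integral_cong) (simp add: hlim mult.assoc[symmetric] flip: ennreal_mult)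
    also have "... = ennreal t * (\<integral>\<^sup>+y. (SUP N. ennreal (h N y) * indicator ?Q y) \<partial>lebesgue)"
     by (subst nn_integral_cmult) (auto simp: SUP_mult_right_ennreal)
    also have "(\<integral>\<^sup>+y. (SUP N. ennreal (h N y) * indicator ?Q y) \<partial>lebesgue) = (SUP N. \<integral>\<^sup>+y\<in>?Q. ennreal (h N y) \<partial>lebesgue)"
     using hinc by (intro nn_integral_monotone_convergence_SUP) (auto simp: incseq_def le_fun_def intro!: mult_right_mono ennreal_leI)
    finally show ?thesis .
   qed
   moreover have "ennreal (t * v x) * emeasure lebesgue ?Q = ennreal t * (ennreal (v x) * emeasure lebesgue ?Q)"
    using t v0 by (simp add: ennreal_mult mult.assoc)
   ultimately have "\<not> (SUP N. \<integral>\<^sup>+y\<in>?Q. ennreal (h N y) \<partial>lebesgue) <= ennreal (v x) * emeasure lebesgue ?Q"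
    using mult_left_mono[of "SUP N. \<integral>\<^sup>+y\<in>?Q. ennreal (h N y) \<partial>lebesgue" "ennreal (v x) * emeasure lebesgue ?Q" "ennreal t"] by auto
   then obtain N where "\<not> (\<integral>\<^sup>+y\<in>?Q. ennreal (h N y) \<partial>lebesgue) <= ennreal (v x) * emeasure lebesgue ?Q"
    using SUP_least[of UNIV "\<lambda>N. \<integral>\<^sup>+y\<in>?Q. ennreal (h N y) \<partial>lebesgue"] by blast
   then have "ennreal (v x) < avg (\<lambda>_. 1) ?Q (\<lambda>y. ennreal (h N y))"
    using avg_le_iff[OF wt_one cs(1), of c "\<lambda>y. ennreal (h N y)" "ennreal (v x)"] by (auto simp: mw_one not_le)
   also have "... <= HL (\<lambda>y. ennreal (h N y)) x" using cs by (intro avg_le_Mx)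
   finally show "x \<in> (\<Union>N. X N)" by (auto simp: X_def)
  qed
  have XN: "emeasure (mw (\<lambda>x. u x * v x)) (X N) <= ennreal D * (\<integral>\<^sup>+x. ennreal (g x * u x / t) \<partial>lebesgue)" for N
  proof -
   have "emeasure (mw (\<lambda>x. u x * v x)) (X N) <= ennreal D * (\<integral>\<^sup>+x. ennreal (h N x) * ennreal (u x) \<partial>lebesgue)"
    unfolding X_def using core[rule_format, OF u v _ hfin[of N]] by simp
   also have "... <= ennreal D * (\<integral>\<^sup>+x. ennreal (g x * u x / t) \<partial>lebesgue)"
   proof (intro mult_left_mono nn_integral_mono)
    fix x
    have "h N x * u x <= g x / t * u x" using hle u0 by (intro mult_right_mono)
    then show "ennreal (h N x) * ennreal (u x) <= ennreal (g x * u x / t)"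
     using h0 u0 by (simp add: ennreal_leI flip: ennreal_mult)
   qed auto
   finally show ?thesis .
  qed
  have "emeasure (mw (\<lambda>x. u x * v x)) {x. ennreal (t * v x) < HL (\<lambda>y. ennreal (g y)) x}
    <= emeasure (mw (\<lambda>x. u x * v x)) (\<Union>N. X N)"
   using sub by (intro emeasure_mono) auto
  also have "... = (SUP N. emeasure (mw (\<lambda>x. u x * v x)) (X N))"
   using Xinc by (intro SUP_emeasure_incseq[symmetric]) auto
  also have "... <= ennreal D * (\<integral>\<^sup>+x. ennreal (g x * u x / t) \<partial>lebesgue)" by (intro SUP_least XN)
  finally have "ennreal t * emeasure (mw (\<lambda>x. u x * v x)) {x. ennreal (t * v x) < HL (\<lambda>y. ennreal (g y)) x}
    <= ennreal t * (ennreal D * (\<integral>\<^sup>+x. ennreal (g x * u x / t) \<partial>lebesgue))" by (rule mult_left_mono) simp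
  also have "... = ennreal D * (\<integral>\<^sup>+x. ennreal t * ennreal (g x * u x / t) \<partial>lebesgue)"
   by (subst nn_integral_cmult) (auto simp: mult_ac)
  also have "... = ennreal D * (\<integral>\<^sup>+x. ennreal (g x * u x) \<partial>lebesgue)"
   using t g0 u0 by (simp flip: ennreal_mult)
  finally show ?thesis .
 qed
 show ?thesis using D main by blast
qed

text \<open>Young's inequality separates the two factors, at the price of slightly larger exponents.\<close>

lemma ainf_Mx_powr_mult:
 assumes th: "0 < \<theta>" "\<theta> < 1" and C: "C >= 1" "0 < d" "d < 1"
 shows "\<exists>\<sigma>0>0. \<exists>C'\<ge>1. \<exists>d'. 0 < d' \<and> d' < 1 \<and> (\<forall>\<sigma> (v :: real ^ 'n => real) g. 0 < \<sigma> --> \<sigma> <= \<sigma>0 --> wt v --> ainf C d v (\<lambda>_. 1) -->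
  lmeas g --> (\<forall>x. 0 < HL g x) --> (AE x in lebesgue. HL g x < top) -->
  wt (\<lambda>x. enn2real (HL g x) powr \<theta> * v x powr \<sigma>) \<and>
  ainf C' d' (\<lambda>_. 1) (\<lambda>x. enn2real (HL g x) powr \<theta> * v x powr \<sigma>))"
proof -
 define \<delta> where "\<delta> = (1 + \<theta>) / 2"
 have \<delta>: "0 < \<delta>" "\<delta> < 1" "\<theta> < \<delta>" using th by (auto simp: \<delta>_def)
 have K1: "(16::real) ^ CARD('n) >= 1" by simp
 obtain C1 where C1: "C1 >= 1" and CL: "\<forall>(a :: real ^ 'n => real) g c s. wt a --> dbl (16 ^ CARD('n)) a --> lmeas g -->
  (\<forall>x. 0 < Mx a g x) --> (AE x in mw a. Mx a g x < top) --> s > 0 -->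
  (\<exists>j>0. (AE y in mw a. y \<in> cub c s --> j / 2 <= enn2real (Mx a g y)) \<and>
   (\<integral>\<^sup>+y\<in>cub c s. ennreal (enn2real (Mx a g y) powr \<delta>) \<partial>mw a) <= ennreal (C1 * j powr \<delta> * measure (mw a) (cub c s)))"
  using Mx_cube_level[OF \<delta>(1,2) K1, where 'n = 'n] by blast
 \<comment> \<open>The midpoint between 1 and \<delta> / \<theta>: Young's inequality with exponent
   p leaves the power p \<theta> of the maximal function, still below \<delta>, and so with room for
   a gain.\<close>
 define p where "p = (\<delta> / \<theta> + 1) / 2"
 have dt: "\<delta> / \<theta> > 1" using th \<delta> by simp
 have p: "p > 1" "p < \<delta> / \<theta>"
  using less_half_sum[OF dt] gt_half_sum[OF dt] by (simp_all add: p_def add.commute)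
 have pth: "p * \<theta> < \<delta>" "p * \<theta> > 0" using p th by (simp_all add: field_simps)
 define p' where "p' = p / (p - 1)"
 have p': "p' > 0" using p by (simp add: p'_def)
 have conj: "1 + p / p' = p" "1 + p' / p = p'" using p by (simp_all add: p'_def field_simps)
 define \<epsilon> where "\<epsilon> = (\<delta> - p * \<theta>) / (p * \<theta>)"
 have eps: "\<epsilon> > 0" using pth by (simp add: \<epsilon>_def)
 define \<eta> where "\<eta> = d / (1 - d)"
 have eta: "\<eta> > 0" using C by (auto simp: \<eta>_def)
 define C0 where "C0 = C powr (1 / (1 - d))"
 have C0: "C0 >= 1" using C by (simp add: C0_def ge_one_powr_ge_zero)
 \<comment> \<open>Chosen so that v is at most l V on at most half of the cube, V being its average;
   the other half gives the lower bound for the mass of the product.\<close>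
 define l where "l = (1 / (2 * C0)) powr (1 / \<eta>)"
 have l: "0 < l" "l <= 1" using C0 eta by (auto simp: l_def intro!: powr_le1)
 have l\<eta>: "C0 * l powr \<eta> = 1 / 2" using C0 eta by (simp add: l_def powr_powr)
 \<comment> \<open>Ensures \<sigma> p' \<le> 1/2, so that
   \<open>(v / V) powr (\<sigma> * p')\<close> is at most 1 plus the square root of v / V, which the
   average of v controls with room to spare.\<close>
 define \<sigma>0 where "\<sigma>0 = min (1 / (2 * p')) 1"
 have s0: "\<sigma>0 > 0" "\<sigma>0 <= 1" using p' by (auto simp: \<sigma>0_def)
 define d' where "d' = min (1/2) (\<epsilon> / 2)"
 have d': "0 < d'" "d' < 1" "d' <= 1/2" "d' <= \<epsilon> / 2" using eps by (auto simp: d'_def)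
 define C' where "C' = (4 + C1) * 2 powr \<theta> * 2 / l"
 have C': "C' >= 1"
 proof -
  have "1 * 1 * 1 <= (4 + C1) * 2 powr \<theta> * 2" using C1 th by (intro mult_mono ge_one_powr_ge_zero) auto
  then have "l <= (4 + C1) * 2 powr \<theta> * 2" using l by linarith
  then show ?thesis using l by (simp add: C'_def)
 qed
 have main: "wt (\<lambda>x. enn2real (HL g x) powr \<theta> * v x powr \<sigma>) \<and>
  ainf C' d' (\<lambda>_. 1) (\<lambda>x. enn2real (HL g x) powr \<theta> * v x powr \<sigma>)"
  if sig: "0 < \<sigma>" "\<sigma> <= \<sigma>0" and v: "wt v" "ainf C d v (\<lambda>_. 1)" and g: "lmeas g" and pos: "\<And>x. 0 < HL g x" and fin: "AE x in lebesgue. HL g x < top"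
  for \<sigma> and v :: "real ^ 'n => real" and g
 proof -
  have vm[measurable]: "lmeas v" and v0: "\<And>x. 0 <= v x" using wtD v by auto
  define \<beta> where "\<beta> x = enn2real (HL g x)" for x
  have bm[measurable]: "lmeas \<beta>" unfolding \<beta>_def[abs_def] using Mx_measurable[OF wt_one] by measurable
  have b0: "\<beta> x >= 0" for x by (simp add: \<beta>_def)
  define w where "w x = \<beta> x powr \<theta> * v x powr \<sigma>" for x
  have wm[measurable]: "lmeas w" unfolding w_def[abs_def] by measurable
  have cube: "\<exists>L>0. ennreal L <= emeasure (mw w) (cub c s) \<and>
   (\<forall>E. E \<in> sets lebesgue --> E \<subseteq> cub c s --> emeasure (mw w) E <= ennreal (C' * (measure lebesgue E / measure lebesgue (cub c s)) powr d' * L))"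
   if s: "s > 0" for c s
  proof -
   define Q where "Q = cub c s"
   have Qs[measurable]: "Q \<in> sets lebesgue" by (simp add: Q_def)
   define Y where "Y = s ^ CARD('n)"
   have Y: "Y > 0" "measure lebesgue Q = Y" "emeasure lebesgue Q = ennreal Y" using s by (simp_all add: Y_def Q_def measure_cub emeasure_cub)
   obtain j where j: "j > 0" and lo: "AE y in lebesgue. y \<in> Q --> j / 2 <= \<beta> y"
    and up: "(\<integral>\<^sup>+y\<in>Q. ennreal (\<beta> y powr \<delta>) \<partial>lebesgue) <= ennreal (C1 * j powr \<delta> * Y)"
    using CL[rule_format, OF wt_one dbl_one g pos _ s, of c] fin unfolding Q_def[symmetric] mw_one Y(2) \<beta>_def by blast
   define W where "W = measure (mw v) Q"
   have W: "W > 0" "emeasure (mw v) Q = ennreal W"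
    unfolding W_def Q_def using wt_measure_pos[OF v(1) s] wt_emeasure_eq[OF v(1)] by simp_all
   define V where "V = W / Y"
   have V: "V > 0" "V * Y = W" using W Y by (simp_all add: V_def)
   define L where "L = (j / 2) powr \<theta> * (l * V powr \<sigma>) * (Y / 2)"
   have L: "L > 0" using j l V Y by (simp add: L_def)
   have lower: "ennreal L <= emeasure (mw w) Q"
   proof -
    define G where "G = {x \<in> Q. v x <= l * V}"
    have "G \<in> sets lebesgue" unfolding G_def by (intro lebesgue_Collect) measurable
    moreover have "G \<subseteq> Q" by (auto simp: G_def)
    ultimately have G: "G \<in> sets lebesgue" "G \<subseteq> Q" by auto
    have "measure lebesgue G <= C0 * Y * (l * V * Y / W) powr \<eta>"
     unfolding G_def Q_def W_def Y_def C0_def \<eta>_def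
     by (intro tail_lower v C s) (use C l V in auto)
    also have "l * V * Y / W = l" using V W by (simp add: mult.assoc)
    also have "C0 * Y * l powr \<eta> = Y / 2" using l\<eta> by (simp add: mult_ac)
    finally have G2: "measure lebesgue G <= Y / 2" .
    have bQ: "bounded Q" by (simp add: Q_def)
    have "measure lebesgue (Q - G) = Y - measure lebesgue G"
     using wt_measure_Diff[OF wt_one G(2) bQ Qs G(1)] Y by (simp add: mw_one)
    then have "Y / 2 <= measure lebesgue (Q - G)" using G2 by simp
    then have "ennreal (Y / 2) <= emeasure lebesgue (Q - G)"
     using wt_emeasure_eq[OF wt_one, of "Q - G"] bQ by (simp add: mw_one bounded_diff ennreal_leI)
    then have "ennreal L <= ennreal ((j / 2) powr \<theta> * (l * V powr \<sigma>)) * emeasure lebesgue (Q - G)"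
     unfolding L_def using Y j l V by (subst ennreal_mult) (auto intro!: mult_left_mono)
    also have "... = (\<integral>\<^sup>+x\<in>Q - G. ennreal ((j / 2) powr \<theta> * (l * V powr \<sigma>)) \<partial>lebesgue)"
     using G by (simp add: nn_integral_cmult_indicator)
    also have "... <= (\<integral>\<^sup>+x\<in>Q. ennreal (w x) \<partial>lebesgue)"
     using lo
    proof (intro nn_integral_mono_AE, elim eventually_mono)
     fix x assume x: "x \<in> Q --> j / 2 <= \<beta> x"
     show "ennreal ((j / 2) powr \<theta> * (l * V powr \<sigma>)) * indicator (Q - G) x <= ennreal (w x) * indicator Q x"
     proof (cases "x \<in> Q - G")
      case True
      have "(j / 2) powr \<theta> <= \<beta> x powr \<theta>" using x True j th by (intro powr_mono2) auto
      moreover have "l * V powr \<sigma> <= v x powr \<sigma>"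
      proof -
       have "l powr 1 <= l powr \<sigma>" using sig s0 l by (intro powr_mono') auto
       then have "l * V powr \<sigma> <= l powr \<sigma> * V powr \<sigma>" using l by (intro mult_right_mono) auto
       also have "... = (l * V) powr \<sigma>" using l V by (simp add: powr_mult)
       also have "... <= v x powr \<sigma>" using True sig l V by (intro powr_mono2) (auto simp: G_def)
       finally show ?thesis .
      qed
      ultimately have "(j / 2) powr \<theta> * (l * V powr \<sigma>) <= w x" unfolding w_def using l by (intro mult_mono) auto
      then show ?thesis using True by (simp add: ennreal_leI)
     qed simp
    qed
    also have "... = emeasure (mw w) Q" by (rule emeasure_mw[symmetric]) auto
    finally show ?thesis .
   qed
   have upper: "emeasure (mw w) E <= ennreal (C' * (measure lebesgue E / Y) powr d' * L)" if E: "E \<in> sets lebesgue" "E \<subseteq> Q" for E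
   proof -
    define e where "e = measure lebesgue E / Y"
    have bE: "bounded E" using E bounded_subset[OF bounded_cub] unfolding Q_def by blast
    have mE: "emeasure lebesgue E = ennreal (e * Y)" using wt_emeasure_eq[OF wt_one bE] Y by (simp add: mw_one e_def)
    have "measure lebesgue E <= measure lebesgue Q" using wt_measure_mono[OF wt_one E(2) _ Qs] by (simp add: mw_one Q_def)
    then have e1: "e <= 1" "e >= 0" using Y by (simp_all add: e_def)
    show ?thesis
    proof (cases "e = 0")
     case True
     then have "E \<in> null_sets lebesgue" using mE E by (auto simp: null_sets_def)
     then have "emeasure (mw w) E = 0" using mw_ac[OF wm] unfolding absolutely_continuous_def by blast
     then show ?thesis by simp
    next
     case False
     then have e: "e > 0" using e1 by simp
     \<comment> \<open>The cut depends on the relative volume e of E: below it the contribution is T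
       e = \<open>e powr (1/2)\<close>, above it the integrability gains contribute 1 / T and
       \<open>T powr (- \<epsilon>)\<close>. All are powers of e with exponent at least d'.\<close>
     define T where "T = e powr (- (1/2))"
     have T: "T > 0" "T * e = e powr (1/2)" using e by (simp_all add: T_def powr_mult_base flip: powr_add) (simp_all add: mult.commute powr_mult_base)
     have T1: "1 / T = e powr (1/2)" "T powr (- \<epsilon>) = e powr (\<epsilon> / 2)"
      unfolding T_def using e by (simp_all only: powr_powr) (simp_all add: powr_minus_divide)
     have pw: "w x <= j powr \<theta> * V powr \<sigma> * (2 * T + 1 + v x / V / T + T powr (- \<epsilon>) * (\<beta> x powr \<delta> / j powr \<delta>))" for x
     proof -
      define a where "a = (\<beta> x / j) powr \<theta>"
      define b where "b = (v x / V) powr \<sigma>"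
      have ab: "a >= 0" "b >= 0" by (simp_all add: a_def b_def)
      have young: "a * b <= a powr p + b powr p'"
      proof (cases "b <= a powr (p / p')")
       case True
       have "a * b <= a * a powr (p / p')" using True ab by (intro mult_left_mono)
       also have "... = a powr (1 + p / p')" using ab by (simp add: powr_mult_base)
       finally show ?thesis using conj by (simp add: add_increasing2)
      next
       case False
       then have "a powr (p / p') <= b" by simp
       then have "(a powr (p / p')) powr (p' / p) <= b powr (p' / p)" using p p' by (intro powr_mono2) auto
       then have "a <= b powr (p' / p)" using p p' ab by (simp add: powr_powr)
       then have "a * b <= b powr (p' / p) * b" using ab by (intro mult_right_mono)
       also have "... = b powr (1 + p' / p)" using ab by (simp add: powr_mult_base mult.commute)
       finally show ?thesis using conj by (simp add: add_increasing)
      qed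
      define z where "z = \<beta> x / j"
      have z: "z >= 0" using b0 j by (simp add: z_def)
      have ap: "a powr p = z powr (p * \<theta>)" by (simp add: a_def z_def powr_powr mult.commute)
      have "z powr (p * \<theta>) <= T + T powr (- \<epsilon>) * z powr \<delta>"
      proof (cases "z powr (p * \<theta>) <= T")
       case False
       then have zp: "z powr (p * \<theta>) > T" by simp
       have "T powr \<epsilon> <= (z powr (p * \<theta>)) powr \<epsilon>" using zp T eps by (intro powr_mono2) auto
       then have "1 <= T powr (- \<epsilon>) * (z powr (p * \<theta>)) powr \<epsilon>" using T by (simp add: powr_minus field_simps)
       then have "z powr (p * \<theta>) * 1 <= z powr (p * \<theta>) * (T powr (- \<epsilon>) * (z powr (p * \<theta>)) powr \<epsilon>)" by (intro mult_left_mono) auto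
       also have "... = T powr (- \<epsilon>) * z powr (p * \<theta> + p * \<theta> * \<epsilon>)" by (simp add: powr_powr powr_add)
       also have "p * \<theta> + p * \<theta> * \<epsilon> = \<delta>" using p th by (simp add: \<epsilon>_def)
       finally show ?thesis using T by simp
      qed (simp add: add_increasing2)
      then have 1: "a powr p <= T + T powr (- \<epsilon>) * (\<beta> x powr \<delta> / j powr \<delta>)"
       unfolding ap using b0 j by (simp add: z_def powr_divide)
      define r where "r = v x / V"
      have r: "r >= 0" using v0 V by (simp add: r_def)
      have sp: "\<sigma> * p' <= 1/2" "\<sigma> * p' >= 0" using sig p' by (auto simp: \<sigma>0_def field_simps)
      have "b powr p' = r powr (\<sigma> * p')" by (simp add: b_def r_def powr_powr)
      also have "... <= 1 + r powr (1/2)"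
      proof (cases "r <= 1")
       case True
       then have "r powr (\<sigma> * p') <= 1" using r sp by (intro powr_le1) auto
       then show ?thesis by (simp add: add_increasing2)
      next
       case False
       then have "r powr (\<sigma> * p') <= r powr (1/2)" using sp by (intro powr_mono) auto
       then show ?thesis by simp
      qed
      also have "r powr (1/2) <= T + r / T"
      proof (cases "r powr (1/2) <= T")
       case True then show ?thesis using r T by (simp add: add_increasing2)
      next
       case False
       have "r powr (1/2) * r powr (1/2) = r" using r by (cases "r = 0") (simp_all flip: powr_add)
       moreover have "T * r powr (1/2) <= r powr (1/2) * r powr (1/2)" using False by (intro mult_right_mono) auto
       ultimately have "r powr (1/2) <= r / T" using T by (simp add: field_simps)
       then show ?thesis using T by simp
      qed
      finally have 2: "b powr p' <= 1 + (T + v x / V / T)" by (simp add: r_def)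
      have "w x = j powr \<theta> * V powr \<sigma> * (a * b)"
       using j V b0 v0 by (simp add: w_def a_def b_def powr_divide)
      also have "... <= j powr \<theta> * V powr \<sigma> * (2 * T + 1 + v x / V / T + T powr (- \<epsilon>) * (\<beta> x powr \<delta> / j powr \<delta>))"
       using young 1 2 by (intro mult_left_mono) auto
      finally show ?thesis .
     qed
     note [measurable] = E(1)
     have "emeasure (mw w) E = (\<integral>\<^sup>+x\<in>E. ennreal (w x) \<partial>lebesgue)" by (rule emeasure_mw) auto
     also have "... <= (\<integral>\<^sup>+x. ennreal (j powr \<theta> * V powr \<sigma>) * (ennreal (2 * T + 1) * indicator E x + (ennreal (1 / (V * T)) * (ennreal (v x) * indicator Q x) + ennreal (T powr (- \<epsilon>) / j powr \<delta>) * (ennreal (\<beta> x powr \<delta>) * indicator Q x))) \<partial>lebesgue)"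
     proof (rule nn_integral_mono)
      fix x
      show "ennreal (w x) * indicator E x <= ennreal (j powr \<theta> * V powr \<sigma>) * (ennreal (2 * T + 1) * indicator E x + (ennreal (1 / (V * T)) * (ennreal (v x) * indicator Q x) + ennreal (T powr (- \<epsilon>) / j powr \<delta>) * (ennreal (\<beta> x powr \<delta>) * indicator Q x)))"
      proof (cases "x \<in> E")
       case True
       then have xQ: "x \<in> Q" using E by blast
       have "ennreal (w x) <= ennreal (j powr \<theta> * V powr \<sigma> * (2 * T + 1 + (1 / (V * T) * v x + T powr (- \<epsilon>) / j powr \<delta> * \<beta> x powr \<delta>)))"
        using pw[of x] by (intro ennreal_leI) (simp add: mult_ac add.assoc)
       then show ?thesis using True xQ T V j v0 by (simp flip: ennreal_mult ennreal_plus)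
      qed simp
     qed
     also have "... = ennreal (j powr \<theta> * V powr \<sigma>) * (ennreal (2 * T + 1) * emeasure lebesgue E + (ennreal (1 / (V * T)) * emeasure (mw v) Q + ennreal (T powr (- \<epsilon>) / j powr \<delta>) * (\<integral>\<^sup>+x\<in>Q. ennreal (\<beta> x powr \<delta>) \<partial>lebesgue)))"
      by (simp add: nn_integral_cmult nn_integral_add emeasure_mw nn_integral_cmult_indicator)
     also have "... <= ennreal (j powr \<theta> * V powr \<sigma>) * (ennreal (2 * T + 1) * ennreal (e * Y) + (ennreal (1 / (V * T)) * ennreal W + ennreal (T powr (- \<epsilon>) / j powr \<delta>) * ennreal (C1 * j powr \<delta> * Y)))"
      using mE W up by (intro mult_left_mono add_mono) auto
     also have "... = ennreal (j powr \<theta> * V powr \<sigma> * ((2 * T + 1) * (e * Y) + (1 / (V * T) * W + T powr (- \<epsilon>) / j powr \<delta> * (C1 * j powr \<delta> * Y))))"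
      using T V W Y e C1 j by (simp flip: ennreal_mult ennreal_plus)
     also have "... <= ennreal (j powr \<theta> * V powr \<sigma> * ((4 + C1) * e powr d' * Y))"
     proof (intro ennreal_leI mult_left_mono)
      have q1: "e powr (1/2) <= e powr d'" "e powr (\<epsilon> / 2) <= e powr d'" "e powr 1 <= e powr d'"
       using e e1 d' by (intro powr_mono'; simp)+
      have "(2 * T + 1) * (e * Y) = (2 * e powr (1/2) + e) * Y" using T(2) by (simp add: algebra_simps)
      also have "... <= (3 * e powr d') * Y" using q1 e Y by (intro mult_right_mono) auto
      finally have r1: "(2 * T + 1) * (e * Y) <= 3 * e powr d' * Y" .
      have "1 / (V * T) * W = (1 / T) * Y" using V T by (simp add: V(2)[symmetric])
      also have "... <= e powr d' * Y" using q1 Y unfolding T1 by (intro mult_right_mono) auto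
      finally have r2: "1 / (V * T) * W <= e powr d' * Y" .
      have "T powr (- \<epsilon>) / j powr \<delta> * (C1 * j powr \<delta> * Y) = C1 * e powr (\<epsilon> / 2) * Y" using j by (simp add: T1)
      also have "... <= C1 * e powr d' * Y" using q1 C1 Y by (intro mult_right_mono mult_left_mono) auto
      finally have r3: "T powr (- \<epsilon>) / j powr \<delta> * (C1 * j powr \<delta> * Y) <= C1 * e powr d' * Y" .
      show "(2 * T + 1) * (e * Y) + (1 / (V * T) * W + T powr (- \<epsilon>) / j powr \<delta> * (C1 * j powr \<delta> * Y)) <= (4 + C1) * e powr d' * Y"
       using r1 r2 r3 by (simp add: algebra_simps)
     qed auto
     also have "j powr \<theta> * V powr \<sigma> * ((4 + C1) * e powr d' * Y) = C' * e powr d' * L"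
     proof -
      have "j powr \<theta> = 2 powr \<theta> * (j / 2) powr \<theta>" using j by (simp flip: powr_mult)
      then show ?thesis using l by (simp add: C'_def L_def)
     qed
     finally show ?thesis by (simp add: e_def)
    qed
   qed
   show ?thesis using L lower upper unfolding Y(2)[symmetric] Q_def by blast
  qed
  have "wt w"
   unfolding wt_def
  proof (intro conjI allI impI)
   fix c :: "real ^ 'n" and s :: real assume s: "s > 0"
   from cube[OF s, of c] obtain L where L: "L > 0" "ennreal L <= emeasure (mw w) (cub c s)"
    "\<And>E. E \<in> sets lebesgue ==> E \<subseteq> cub c s ==> emeasure (mw w) E <= ennreal (C' * (measure lebesgue E / measure lebesgue (cub c s)) powr d' * L)" by blast
   show "0 < emeasure (mw w) (cub c s)" using L(1,2) by (meson ennreal_less_zero_iff order_less_le_trans)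
   show "emeasure (mw w) (cub c s) < \<infinity>" using L(3)[of "cub c s"] by (simp add: order_le_less_trans[OF _ ennreal_less_top])
  qed (use wm in \<open>auto simp: w_def\<close>)
  moreover have "ainf C' d' (\<lambda>_. 1) w"
   unfolding ainf_def mw_one
  proof (intro allI impI)
   fix c :: "real ^ 'n" and s :: real and E assume s: "s > 0" and E: "E \<in> sets lebesgue" "E \<subseteq> cub c s"
   from cube[OF s, of c] obtain L where L: "L > 0" "ennreal L <= emeasure (mw w) (cub c s)"
    "\<And>E. E \<in> sets lebesgue ==> E \<subseteq> cub c s ==> emeasure (mw w) E <= ennreal (C' * (measure lebesgue E / measure lebesgue (cub c s)) powr d' * L)" by blast
   have "measure (mw w) E <= C' * (measure lebesgue E / measure lebesgue (cub c s)) powr d' * L"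
    using L(3)[OF E] C' L by (intro measure_leI) auto
   also have "... <= C' * (measure lebesgue E / measure lebesgue (cub c s)) powr d' * measure (mw w) (cub c s)"
    using L(2) wt_emeasure_eq[OF \<open>wt w\<close>, of "cub c s"] C' by (intro mult_left_mono) auto
   finally show "measure (mw w) E <= C' * (measure lebesgue E / measure lebesgue (cub c s)) powr d' * measure (mw w) (cub c s)" .
  qed
  ultimately show ?thesis unfolding w_def \<beta>_def by blast
 qed
 show ?thesis using s0 C' d' main by blast
qed

section \<open>Comparable weights with a prescribed A_inf constant\<close>

lemma Mx_cmult_le:
 assumes "lmeas g"
 shows "Mx a (\<lambda>y. k * g y) x <= k * Mx a g x"
proof (rule Mx_le)
 fix c s assume s: "(s :: real) > 0" "x \<in> cub c s"
 have "avg a (cub c s) (\<lambda>y. k * g y) = k * avg a (cub c s) g"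
  using assms unfolding avg_def by (simp add: nn_integral_cmult mult.assoc ennreal_times_divide)
 also have "... <= k * Mx a g x" using s by (intro mult_left_mono avg_le_Mx) auto
 finally show "avg a (cub c s) (\<lambda>y. k * g y) <= k * Mx a g x" .
qed

lemma emeasure_mw_comparable:
 assumes "wt w" "lmeas w'" "\<And>x. w x <= w' x" "\<And>x. w' x <= K * w x" "K >= 1" "E \<in> sets lebesgue"
 shows "emeasure (mw w) E <= emeasure (mw w') E" "emeasure (mw w') E <= ennreal K * emeasure (mw w) E"
proof -
 have wm: "lmeas w" using assms wtD by auto
 show "emeasure (mw w) E <= emeasure (mw w') E"
  unfolding emeasure_mw[OF wm assms(6)] emeasure_mw[OF assms(2,6)]
  by (intro nn_integral_mono mult_right_mono ennreal_leI assms) auto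
 have "emeasure (mw w') E <= emeasure (mw (\<lambda>x. K * w x)) E"
  using assms wm by (subst (1 2) emeasure_mw) (auto intro!: nn_integral_mono mult_right_mono ennreal_leI)
 also have "... = ennreal K * emeasure (mw w) E" using assms wm by (intro emeasure_mw_cmult) auto
 finally show "emeasure (mw w') E <= ennreal K * emeasure (mw w) E" .
qed

lemma wt_comparable:
 assumes "wt w" "lmeas w'" "\<And>x. w x <= w' x" "\<And>x. w' x <= K * w x" "K >= 1"
 shows "wt w'"
 unfolding wt_def
proof (intro conjI allI impI)
 fix a s assume s: "(s :: real) > 0"
 have c: "emeasure (mw w) (cub a s) <= emeasure (mw w') (cub a s)" "emeasure (mw w') (cub a s) <= ennreal K * emeasure (mw w) (cub a s)"
  using emeasure_mw_comparable[OF assms] by auto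
 show "0 < emeasure (mw w') (cub a s)" using c wtD(3)[OF assms(1) s, of a] by (auto intro: order_less_le_trans)
 have "ennreal K * emeasure (mw w) (cub a s) < \<infinity>" using wtD(4)[OF assms(1) s, of a] by (simp add: ennreal_mult_less_top)
 then show "emeasure (mw w') (cub a s) < \<infinity>" using c by (auto intro: order_le_less_trans)
next
 fix x show "0 <= w' x" using wtD(2)[OF assms(1), of x] assms(3)[of x] by simp
qed (use assms in auto)

text \<open>The factor lost in the Fujii-Wilson constant is the factor K of comparability itself, in
  both directions. With K close to 1 this yields continuity of the constant along a family of
  weights.\<close>

lemma fw_comparable:
 fixes w :: "real ^ 'n => real"
 assumes "wt w" "lmeas w'" "\<And>x. w x <= w' x" "\<And>x. w' x <= K * w x" "K >= 1" "b >= 0"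
 shows "fw b w ==> fw (K * b) w'" "fw b w' ==> fw (K * b) w"
proof -
 note em = emeasure_mw_comparable[OF assms(1-5)]
 have wm[measurable]: "lmeas w" "lmeas w'" using assms wtD by auto
 have w0: "0 <= w x" for x using assms wtD by auto
 show "fw (K * b) w'" if f: "fw b w"
  unfolding fw_def
 proof (intro allI impI)
  fix c :: "real ^ 'n" and s :: real assume s: "s > 0"
  let ?Q = "cub c s"
  have "(\<integral>\<^sup>+x\<in>?Q. HL (\<lambda>y. ennreal (w' y) * indicator ?Q y) x \<partial>lebesgue) \<le>
    (\<integral>\<^sup>+x. ennreal K * (HL (\<lambda>y. ennreal (w y) * indicator ?Q y) x * indicator ?Q x) \<partial>lebesgue)"
  proof (intro nn_integral_mono)
   fix x
   have "HL (\<lambda>y. ennreal (w' y) * indicator ?Q y) x <= HL (\<lambda>y. ennreal K * (ennreal (w y) * indicator ?Q y)) x"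
    using assms w0 by (intro Mx_mono_AE AE_I2) (auto simp: mult.assoc[symmetric] ennreal_leI simp flip: ennreal_mult intro!: mult_right_mono)
   also have "... <= ennreal K * HL (\<lambda>y. ennreal (w y) * indicator ?Q y) x"
    by (intro Mx_cmult_le) measurable
   finally show "HL (\<lambda>y. ennreal (w' y) * indicator ?Q y) x * indicator ?Q x <= ennreal K * (HL (\<lambda>y. ennreal (w y) * indicator ?Q y) x * indicator ?Q x)"
    by (simp add: mult.assoc[symmetric] mult_right_mono)
  qed
  also have "... = ennreal K * (\<integral>\<^sup>+x\<in>?Q. HL (\<lambda>y. ennreal (w y) * indicator ?Q y) x \<partial>lebesgue)"
   using Mx_measurable[OF wt_one, of "\<lambda>y. ennreal (w y) * indicator ?Q y"] by (intro nn_integral_cmult borel_measurable_times_ennreal) auto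
  also have "... <= ennreal K * (ennreal b * emeasure (mw w) ?Q)" using f s by (intro mult_left_mono) (auto simp: fw_def)
  also have "... <= ennreal K * (ennreal b * emeasure (mw w') ?Q)" by (intro mult_left_mono em(1)) auto
  also have "... = ennreal (K * b) * emeasure (mw w') ?Q" using assms by (simp add: ennreal_mult mult.assoc)
  finally show "(\<integral>\<^sup>+x\<in>?Q. HL (\<lambda>y. ennreal (w' y) * indicator ?Q y) x \<partial>lebesgue) <= ennreal (K * b) * emeasure (mw w') ?Q" .
 qed
 show "fw (K * b) w" if f: "fw b w'"
  unfolding fw_def
 proof (intro allI impI)
  fix c :: "real ^ 'n" and s :: real assume s: "s > 0"
  let ?Q = "cub c s"
  have "(\<integral>\<^sup>+x\<in>?Q. HL (\<lambda>y. ennreal (w y) * indicator ?Q y) x \<partial>lebesgue) <= (\<integral>\<^sup>+x\<in>?Q. HL (\<lambda>y. ennreal (w' y) * indicator ?Q y) x \<partial>lebesgue)"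
   by (intro nn_integral_mono mult_right_mono Mx_mono_AE AE_I2 ennreal_leI assms) auto
  also have "... <= ennreal b * emeasure (mw w') ?Q" using f s by (auto simp: fw_def)
  also have "... <= ennreal b * (ennreal K * emeasure (mw w) ?Q)" by (intro mult_left_mono em(2)) auto
  also have "... = ennreal (K * b) * emeasure (mw w) ?Q" using assms by (simp add: ennreal_mult mult_ac)
  finally show "(\<integral>\<^sup>+x\<in>?Q. HL (\<lambda>y. ennreal (w y) * indicator ?Q y) x \<partial>lebesgue) <= ennreal (K * b) * emeasure (mw w) ?Q" .
 qed
qed

text \<open>Since the constant in the hypothesis on the operator is an arbitrary, possibly non-monotone, function of the \<open>A\<^sub>\<infinity>\<close>
 constant, weights are replaced by comparable ones whose \<open>A\<^sub>\<infinity>\<close> constant has a prescribed value. The constant is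
 raised continuously by increasing the weight on a small subcube in the corner of a cube.\<close>

lemma Ainf_const_prescribed:
 assumes b: "b >= 0"
 shows "\<exists>t0\<ge>0. \<exists>K\<ge>1. \<forall>w :: real ^ 'n => real. wt w --> fw b w -->
  (\<exists>w'. w' \<in> borel_measurable lebesgue \<and> (\<forall>x. w x <= w' x \<and> w' x <= K * w x) \<and> Ainf w' \<and> Ainf_const w' = ennreal t0)"
proof -
 obtain c where c: "0 < c" "c < 1" "\<forall>w :: real ^ 'n => real. wt w --> fw b w --> weak_ainf c (\<lambda>_. 1) w"
  using fw_imp_weak[of b, where 'n = 'n] by blast
 obtain C d Kd where Kd: "Kd >= 1" "\<forall>w :: real ^ 'n => real. wt w --> weak_ainf c (\<lambda>_. 1) w --> ainf C d (\<lambda>_. 1) w \<and> ainf C d w (\<lambda>_. 1) \<and> dbl Kd w"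
  using weak_one_imp_ainf[OF c(1,2), where 'n = 'n] by blast
 \<comment> \<open>The number of nested cubes around the subcube. Each of the m shells will
   contribute q / 2 to the integral of the maximal function, against a total mass 2 q, so the
   constant reaches at least m / 4 \<ge> b.\<close>
 obtain m :: nat where m: "real m >= 4 * b" using real_arch_simple by blast
 have main: "\<exists>w'. w' \<in> borel_measurable lebesgue \<and> (\<forall>x. w x <= w' x \<and> w' x <= (1 + Kd ^ m) * w x) \<and> Ainf w' \<and> Ainf_const w' = ennreal b"
  if w: "wt w" "fw b w" for w :: "real ^ 'n => real"
 proof -
  have wm[measurable]: "lmeas w" and w0: "\<And>x. 0 <= w x" using wtD w by auto
  have dbw: "dbl Kd w" using c(3) Kd(2) w by blast
  define Q where "Q i = cub (0 :: real ^ 'n) ((1/2) ^ i)" for i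
  have Qs[measurable]: "Q i \<in> sets lebesgue" for i by (simp add: Q_def)
  have Qm: "Q (Suc i) \<subseteq> Q i" for i by (simp add: Q_def cub_subset_iff)
  have Q0: "Q i \<subseteq> Q 0" for i by (induction i) (use Qm in blast)+
  have wQ: "measure (mw w) (Q i) > 0" for i unfolding Q_def by (intro wt_measure_pos w) simp
  have "measure (mw w) (Q 0) <= Kd ^ i * measure (mw w) (Q i)" for i
  proof (induction i)
   case (Suc i)
   have "measure (mw w) (Q i) <= Kd * measure (mw w) (Q (Suc i))"
    unfolding Q_def using Qm[of i] by (intro dblD[OF dbw]) (simp_all add: Q_def)
   then have "Kd ^ i * measure (mw w) (Q i) <= Kd ^ i * (Kd * measure (mw w) (Q (Suc i)))" using Kd by (intro mult_left_mono) auto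
   then show ?case using Suc.IH by (simp add: mult_ac)
  qed simp
  note Qd = this[of m]
  \<comment> \<open>At l = \<Lambda> the mass added on Q m equals the original mass of Q 0. Doubling
    along the m generations bounds \<Lambda> by Kd^m, independently of w.\<close>
  define \<Lambda> where "\<Lambda> = measure (mw w) (Q 0) / measure (mw w) (Q m)"
  have L: "\<Lambda> >= 0" "\<Lambda> <= Kd ^ m" "\<Lambda> * measure (mw w) (Q m) = measure (mw w) (Q 0)"
   using wQ[of m] wQ[of 0] Qd by (simp_all add: \<Lambda>_def field_simps)
  define W where "W l x = w x * (1 + l * indicator (Q m) x)" for l x
  have Wm[measurable]: "W l \<in> borel_measurable lebesgue" for l unfolding W_def[abs_def] by measurable
  have W0: "W 0 = w" by (simp add: W_def fun_eq_iff)
  have comp: "W l x <= W l' x \<and> W l' x <= (1 + (l' - l)) * W l x" if "0 <= l" "l <= l'" for l l' x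
  proof (cases "x \<in> Q m")
   case True
   have "0 <= w x * (l * (l' - l))" using w0 that by simp
   moreover have "w x * l <= w x * l'" using w0 that by (intro mult_left_mono)
   ultimately show ?thesis using True by (simp add: W_def algebra_simps)
  next
   case False
   have "1 * w x <= (1 + (l' - l)) * w x" using w0[of x] that by (intro mult_right_mono) auto
   then show ?thesis using False by (simp add: W_def)
  qed
  have wtW: "wt (W l)" if "0 <= l" for l
   by (rule wt_comparable[OF w(1), of _ "1 + l"]) (use comp[of 0 l] W0 that in auto)
  have fwW: "fw ((1 + l) * b) (W l)" if "0 <= l" for l
   by (rule fw_comparable(1)[OF w(1)]) (use comp[of 0 l] W0 that w b in auto)
  define \<phi> where "\<phi> l = enn2real (Ainf_const (W l))" for l
  have AW: "Ainf_const (W l) = ennreal (\<phi> l)" "\<phi> l <= (1 + l) * b" "\<phi> l >= 0" "fw (\<phi> l) (W l)" if "0 <= l" for l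
  proof -
   have le: "Ainf_const (W l) <= ennreal ((1 + l) * b)" using fwW[OF that] Ainf_const_le_iff_fw[OF wtW[OF that], of "(1 + l) * b"] that b by simp
   then have "Ainf_const (W l) < top" using ennreal_less_top order_le_less_trans by blast
   then show 1: "Ainf_const (W l) = ennreal (\<phi> l)" by (simp add: \<phi>_def)
   show 2: "\<phi> l >= 0" by (simp add: \<phi>_def)
   show "\<phi> l <= (1 + l) * b" using le 1 that b by (simp add: ennreal_le_iff)
   show "fw (\<phi> l) (W l)" using Ainf_const_le_iff_fw[OF wtW[OF that] 2] 1 by simp
  qed
  have up: "\<phi> l <= (1 + (l' - l)) * \<phi> l'" "\<phi> l' <= (1 + (l' - l)) * \<phi> l" if l: "0 <= l" "l <= l'" for l l'
  proof -
   have l': "0 <= l'" using l by simp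
   have cp: "\<And>x. W l x <= W l' x" "\<And>x. W l' x <= (1 + (l' - l)) * W l x" "1 + (l' - l) >= 1" using comp[OF l] l by auto
   have "fw ((1 + (l' - l)) * \<phi> l') (W l)" "fw ((1 + (l' - l)) * \<phi> l) (W l')"
    using fw_comparable(2)[OF wtW[OF l(1)] Wm cp AW(3)[OF l'] AW(4)[OF l']] fw_comparable(1)[OF wtW[OF l(1)] Wm cp AW(3)[OF l(1)] AW(4)[OF l(1)]] by auto
   then have "Ainf_const (W l) <= ennreal ((1 + (l' - l)) * \<phi> l')" "Ainf_const (W l') <= ennreal ((1 + (l' - l)) * \<phi> l)"
    using Ainf_const_le_iff_fw[OF wtW[OF l(1)], of "(1 + (l' - l)) * \<phi> l'"] Ainf_const_le_iff_fw[OF wtW[OF l'], of "(1 + (l' - l)) * \<phi> l"]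
     AW(3)[OF l'] AW(3)[OF l(1)] l by auto
   then show "\<phi> l <= (1 + (l' - l)) * \<phi> l'" "\<phi> l' <= (1 + (l' - l)) * \<phi> l"
    using AW(1)[OF l'] AW(1)[OF l(1)] AW(3)[OF l'] AW(3)[OF l(1)] l by (auto simp: ennreal_le_iff)
  qed
  define B where "B = (1 + \<Lambda>) * b"
  have B: "B >= 0" using L b by (simp add: B_def)
  have pB: "\<phi> l <= B" if "0 <= l" "l <= \<Lambda>" for l
   using AW(2)[OF that(1)] mult_right_mono[of "1 + l" "1 + \<Lambda>" b] that b by (simp add: B_def)
  \<comment> \<open>Raising l to l' multiplies the weight by at most 1 + (l' - l), hence also
    changes \<phi> by at most this factor; as \<phi> is bounded on the interval, it is
    Lipschitz.\<close>
  have lip: "\<bar>\<phi> l - \<phi> l'\<bar> <= B * (l' - l)" if l: "0 <= l" "l <= l'" "l' <= \<Lambda>" for l l'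
  proof -
   have "(l' - l) * \<phi> l' <= (l' - l) * B" "(l' - l) * \<phi> l <= (l' - l) * B" using l pB[of l] pB[of l'] by (auto intro!: mult_left_mono)
   then show ?thesis using up[OF l(1,2)] by (simp add: abs_le_iff algebra_simps)
  qed
  have "B-lipschitz_on {0..\<Lambda>} \<phi>"
  proof (rule lipschitz_onI)
   fix l l' assume "l \<in> {0..\<Lambda>}" "l' \<in> {0..\<Lambda>}"
   then show "dist (\<phi> l) (\<phi> l') <= B * dist l l'"
    using lip[of l l'] lip[of l' l] by (cases "l <= l'") (auto simp: dist_real_def abs_minus_commute)
  qed (rule B)
  then have cont: "continuous_on {0..\<Lambda>} \<phi>" by (rule lipschitz_on_continuous_on)
  have high: "b <= \<phi> \<Lambda>"
  proof -
   define q where "q = measure (mw w) (Q 0)"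
   have q: "q > 0" using wQ by (simp add: q_def)
   let ?M = "HL (\<lambda>y. ennreal (W \<Lambda> y) * indicator (Q 0) y)"
   have Mm[measurable]: "?M \<in> borel_measurable lebesgue" by (rule Mx_measurable[OF wt_one])
   have sub: "ennreal q <= emeasure (mw (W \<Lambda>)) (Q m)"
   proof -
    have "ennreal q = ennreal \<Lambda> * emeasure (mw w) (Q m)"
     using wt_emeasure_eq[OF w(1), of "Q m"] L q by (simp add: q_def Q_def flip: ennreal_mult)
    also have "... = emeasure (mw (\<lambda>x. \<Lambda> * w x)) (Q m)" using L by (intro emeasure_mw_cmult[symmetric]) auto
    also have "... <= emeasure (mw (W \<Lambda>)) (Q m)"
     using w0 by (subst (1 2) emeasure_mw) (auto simp: W_def indicator_def algebra_simps intro!: nn_integral_mono ennreal_leI)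
    finally show ?thesis .
   qed
   have tot: "emeasure (mw (W \<Lambda>)) (Q 0) = ennreal (2 * q)"
   proof -
    have "emeasure (mw (W \<Lambda>)) (Q 0) = (\<integral>\<^sup>+x. ennreal (w x) * indicator (Q 0) x + ennreal \<Lambda> * (ennreal (w x) * indicator (Q m) x) \<partial>lebesgue)"
     unfolding emeasure_mw[OF Wm Qs]
    proof (intro nn_integral_cong)
     fix x
     show "ennreal (W \<Lambda> x) * indicator (Q 0) x = ennreal (w x) * indicator (Q 0) x + ennreal \<Lambda> * (ennreal (w x) * indicator (Q m) x)"
      using Q0[of m] w0[of x] L(1) by (cases "x \<in> Q m"; cases "x \<in> Q 0") (auto simp: W_def algebra_simps simp flip: ennreal_mult ennreal_plus)
    qed
    also have "... = emeasure (mw w) (Q 0) + ennreal \<Lambda> * emeasure (mw w) (Q m)"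
     by (simp add: nn_integral_add nn_integral_cmult emeasure_mw)
    also have "... = ennreal q + ennreal (\<Lambda> * measure (mw w) (Q m))"
     using wt_emeasure_eq[OF w(1), of "Q m"] wt_emeasure_eq[OF w(1), of "Q 0"] L(1) by (simp add: q_def Q_def flip: ennreal_mult)
    also have "... = ennreal (2 * q)" unfolding L q_def[symmetric] using q by (simp flip: ennreal_plus)
    finally show ?thesis .
   qed
   \<comment> \<open>Each Q k contains Q m and so has mass at least q for the raised weight. The
     maximal function is therefore at least q / |Q k| on the shell between Q k and Q (k + 1), which
     fills at least half of Q k.\<close>
   have lower: "ennreal (real k / 2 * q) <= (\<integral>\<^sup>+x\<in>Q 0 - Q k. ?M x \<partial>lebesgue)" if "k <= m" for k
    using that
   proof (induction k)
    case (Suc k)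
    define y where "y = ((1/2::real) ^ k) ^ CARD('n)"
    have y: "y > 0" by (simp add: y_def)
    have mQ: "emeasure lebesgue (Q k) = ennreal y" unfolding Q_def y_def by (intro emeasure_cub) simp
    have QmQk: "Q m \<subseteq> Q k" using Suc.prems by (auto simp: Q_def cub_subset_iff intro!: power_decreasing)
    have Mk: "ennreal (q / y) <= ?M x" if "x \<in> Q k" for x
    proof -
     have "ennreal q <= emeasure (mw (W \<Lambda>)) (Q k)" using sub QmQk by (intro order_trans[OF sub] emeasure_mono) auto
     also have "... = (\<integral>\<^sup>+x\<in>Q k. (ennreal (W \<Lambda> x) * indicator (Q 0) x) \<partial>lebesgue)"
      using Q0[of k] by (subst emeasure_mw) (auto intro!: nn_integral_cong simp: indicator_def)
     finally have "ennreal q / ennreal y <= avg (\<lambda>_. 1) (Q k) (\<lambda>y. ennreal (W \<Lambda> y) * indicator (Q 0) y)"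
      unfolding avg_def mw_one mQ by (rule divide_right_mono_ennreal)
     also have "... <= ?M x" using that unfolding Q_def by (intro avg_le_Mx) auto
     finally show ?thesis using y q by (simp add: divide_ennreal)
    qed
    have "(1/2::real) ^ CARD('n) <= (1/2) ^ 1" by (intro power_decreasing) (auto simp: Suc_le_eq)
    then have h: "(1/2::real) ^ CARD('n) * y <= 1/2 * y" using y by (intro mult_right_mono) auto
    have "measure lebesgue (Q k - Q (Suc k)) = measure lebesgue (Q k) - measure lebesgue (Q (Suc k))"
     using wt_measure_Diff[OF wt_one Qm[of k]] by (simp add: mw_one Q_def)
    also have "... = y - (1/2) ^ CARD('n) * y" by (simp add: Q_def measure_cub y_def power_divide)
    finally have dm: "y / 2 <= measure lebesgue (Q k - Q (Suc k))" using h by simp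
    have "ennreal (q / 2) = ennreal (q / y) * ennreal (y / 2)" using y q by (simp flip: ennreal_mult)
    also have "... <= ennreal (q / y) * emeasure lebesgue (Q k - Q (Suc k))"
     using wt_emeasure_eq[OF wt_one, of "Q k - Q (Suc k)"] dm by (intro mult_left_mono) (auto simp: mw_one Q_def bounded_diff ennreal_leI)
    also have "... = (\<integral>\<^sup>+x\<in>Q k - Q (Suc k). ennreal (q / y) \<partial>lebesgue)" by (simp add: nn_integral_cmult_indicator)
    also have "... <= (\<integral>\<^sup>+x\<in>Q k - Q (Suc k). ?M x \<partial>lebesgue)" using Mk by (intro nn_integral_mono) (auto simp: indicator_def)
    finally have 1: "ennreal (q / 2) <= (\<integral>\<^sup>+x\<in>Q k - Q (Suc k). ?M x \<partial>lebesgue)" .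
    have "ennreal (real (Suc k) / 2 * q) = ennreal (real k / 2 * q) + ennreal (q / 2)" using q by (subst ennreal_plus[symmetric]) (auto simp: field_simps)
    also have "... <= (\<integral>\<^sup>+x\<in>Q 0 - Q k. ?M x \<partial>lebesgue) + (\<integral>\<^sup>+x\<in>Q k - Q (Suc k). ?M x \<partial>lebesgue)"
     using Suc.IH Suc.prems 1 by (intro add_mono) auto
    also have "... = (\<integral>\<^sup>+x\<in>(Q 0 - Q k) \<union> (Q k - Q (Suc k)). ?M x \<partial>lebesgue)"
     by (intro nn_integral_disjoint_pair[symmetric]) auto
    also have "(Q 0 - Q k) \<union> (Q k - Q (Suc k)) = Q 0 - Q (Suc k)" using Q0[of k] Qm[of k] by auto
    finally show ?case .
   qed simp
   have "ennreal (real m / 2 * q) <= (\<integral>\<^sup>+x\<in>Q 0 - Q m. ?M x \<partial>lebesgue)" by (rule lower) simp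
   also have "... <= (\<integral>\<^sup>+x\<in>Q 0. ?M x \<partial>lebesgue)" by (intro nn_integral_mono) (auto simp: indicator_def)
   also have "... <= ennreal (\<phi> \<Lambda>) * emeasure (mw (W \<Lambda>)) (Q 0)" using AW(4)[OF L(1)] unfolding fw_def Q_def by simp
   also have "... = ennreal (\<phi> \<Lambda> * (2 * q))" unfolding tot using AW(3)[OF L(1)] q by (simp add: ennreal_mult)
   finally have "real m / 2 * q <= \<phi> \<Lambda> * (2 * q)" using AW(3)[OF L(1)] q by (simp add: ennreal_le_iff)
   then have "q * (real m / 2) <= q * (\<phi> \<Lambda> * 2)" by (simp add: mult_ac)
   then have "real m / 2 <= \<phi> \<Lambda> * 2" using q by (subst (asm) mult_le_cancel_left_pos) auto
   then show ?thesis using m by simp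
  qed
  \<comment> \<open>The value to be attained is b itself: \<phi> starts at most at b and ends at
    least at b, so the intermediate value theorem applies.\<close>
  have "\<phi> 0 <= b" using AW(2)[of 0] by simp
  then obtain l where l: "0 <= l" "l <= \<Lambda>" "\<phi> l = b" using IVT'[of \<phi> 0 b \<Lambda>] high L cont by auto
  have "Ainf (W l)"
  proof -
   obtain c' where c': "0 < c'" "c' < 1" "\<forall>w :: real ^ 'n => real. wt w --> fw ((1 + l) * b) w --> weak_ainf c' (\<lambda>_. 1) w"
    using fw_imp_weak[of "(1 + l) * b", where 'n = 'n] by blast
   obtain C' d' where "C' >= 1" "0 < d'" "d' < 1" "\<forall>w :: real ^ 'n => real. wt w --> weak_ainf c' (\<lambda>_. 1) w --> ainf C' d' w (\<lambda>_. 1)"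
    using weak_one_imp_ainf[OF c'(1,2), where 'n = 'n] by blast
   then show ?thesis using c'(3) wtW[OF l(1)] fwW[OF l(1)] by (intro ainf_imp_Ainf[of _ C' d']) auto
  qed
  moreover have "w x <= W l x" "W l x <= (1 + Kd ^ m) * w x" for x
  proof -
   show "w x <= W l x" using comp[of 0 l x] l W0 by simp
   have "W l x <= (1 + l) * w x" using comp[of 0 l x] l W0 by simp
   also have "... <= (1 + Kd ^ m) * w x" using l L w0 by (intro mult_right_mono) auto
   finally show "W l x <= (1 + Kd ^ m) * w x" .
  qed
  ultimately show ?thesis using AW(1)[OF l(1)] l(3) Wm by blast
 qed
 have "1 + Kd ^ m >= 1" using Kd by simp
 then show ?thesis using b main by blast
qed

section \<open>Positivity of maximal functions and self-improvement of A_1\<close>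

lemma Mx_pos:
 fixes a :: "real ^ 'n => real"
 assumes a: "wt a" and g[measurable]: "lmeas g" and nz: "\<not> (AE x in mw a. g x = 0)"
 shows "0 < Mx a g x"
proof (rule ccontr)
 assume "\<not> 0 < Mx a g x"
 then have M0: "Mx a g x = 0" by simp
 have bk[measurable]: "big k \<in> sets lebesgue" for k by (simp add: big_def)
 obtain k0 where k0: "x \<in> big k0" using UN_big by blast
 have "AE y in mw a. y \<in> big k --> g y = 0" for k
 proof -
  define l where "l = max k k0"
  have x: "x \<in> big l" "big k \<subseteq> (big l :: (real ^ 'n) set)" using k0 big_mono[of k0 l] big_mono[of k l] by (auto simp: l_def)
  have "avg a (big l) g <= 0"
   using avg_le_Mx[where s = "2 * real l + 2" and x = x and a = a and g = g and c = "\<chi> i. - real l - 1"] x(1) M0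
   unfolding big_def by simp
  then have "(\<integral>\<^sup>+y\<in>big l. g y \<partial>mw a) = 0" using avg_le_iff[OF a, of "2 * real l + 2" "\<chi> i. - real l - 1" g 0] unfolding big_def by simp
  then have "AE y in mw a. g y * indicator (big l) y = 0" by (subst (asm) nn_integral_0_iff_AE) auto
  then show ?thesis by eventually_elim (use x in \<open>auto simp: indicator_def split: if_splits\<close>)
 qed
 then have "AE y in mw a. \<forall>k. y \<in> big k --> g y = 0" by (subst AE_all_countable) blast
 then have "AE y in mw a. g y = 0"
 proof eventually_elim
  fix y assume "\<forall>k. y \<in> big k --> g y = 0"
  moreover obtain k where "y \<in> big k" using UN_big by blast
  ultimately show "g y = 0" by blast
 qed
 then show False using nz by blast
qed

lemma fw_imp_ainf:
 "\<exists>C\<ge>1. \<exists>d. 0 < d \<and> d < 1 \<and> (\<exists>K\<ge>1. \<forall>w :: real ^ 'n => real. wt w --> fw b w --> ainf C d (\<lambda>_. 1) w \<and> ainf C d w (\<lambda>_. 1) \<and> dbl K w)"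
proof -
 obtain c where c: "0 < c" "c < 1" "\<forall>w :: real ^ 'n => real. wt w --> fw b w --> weak_ainf c (\<lambda>_. 1) w"
  using fw_imp_weak[of b, where 'n = 'n] by blast
 show ?thesis using weak_one_imp_ainf[OF c(1,2), where 'n = 'n] c(3) by blast
qed

lemma A1w_mono: "A1w A u ==> A <= A' ==> A1w A' u"
 unfolding A1w_def
proof (elim conjE, intro conjI)
 assume "wt u" "AE x in lebesgue. HL (\<lambda>y. ennreal (u y)) x <= ennreal (A * u x)" "A <= A'"
 then show "AE x in lebesgue. HL (\<lambda>y. ennreal (u y)) x <= ennreal (A' * u x)"
  using wtD(2)[OF \<open>wt u\<close>] by (auto elim!: eventually_mono intro: order_trans[OF _ ennreal_leI[OF mult_right_mono]])
qed

text \<open>The reverse Hoelder inequality bounds the average of u^\<rho> by the power \<rho> of the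
  average of u, and A_1 bounds that average pointwise. The exponent \<rho> and all constants depend
  only on A and the dimension.\<close>

lemma A1w_powr:
 assumes A: "A >= 1"
 shows "\<exists>\<rho>>1. \<exists>A'\<ge>1. \<exists>C\<ge>1. \<exists>d. 0 < d \<and> d < 1 \<and> (\<forall>u :: real ^ 'n => real. A1w A u -->
  ainf C d (\<lambda>_. 1) u \<and> A1w A' (\<lambda>x. u x powr \<rho>) \<and> ainf C d (\<lambda>_. 1) (\<lambda>x. u x powr \<rho>))"
proof -
 have A0: "A >= 0" using A by simp
 obtain C1 d1 where C1: "C1 >= 1" "0 < d1" "d1 < 1" and c1: "\<forall>w :: real ^ 'n => real. wt w --> fw A w --> ainf C1 d1 (\<lambda>_. 1) w"
  using fw_imp_ainf[of A, where 'n = 'n] by blast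
 have C1': "C1 > 0" using C1 by simp
 define \<rho> where "\<rho> = 1 + d1 / (1 - d1) / 2"
 have rho: "\<rho> > 1" using C1 by (simp add: \<rho>_def)
 obtain C' where C': "C' >= 0" and rh: "\<forall>(w :: real ^ 'n => real) c s. wt w --> ainf C1 d1 (\<lambda>_. 1) w --> s > 0 -->
   (\<integral>\<^sup>+x\<in>cub c s. ennreal (w x powr \<rho>) \<partial>lebesgue) <= ennreal (C' * s ^ CARD('n) * (measure (mw w) (cub c s) / s ^ CARD('n)) powr \<rho>)"
  using reverse_holder[OF C1' C1(2,3), where 'n = 'n] unfolding \<rho>_def by blast
 define A' where "A' = max 1 (C' * A powr \<rho>)"
 have A': "A' >= 1" "A' >= 0" "C' * A powr \<rho> <= A'" by (auto simp: A'_def)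
 obtain C2 d2 where C2: "C2 >= 1" "0 < d2" "d2 < 1" and c2: "\<forall>w :: real ^ 'n => real. wt w --> fw A' w --> ainf C2 d2 (\<lambda>_. 1) w"
  using fw_imp_ainf[of A', where 'n = 'n] by blast
 define C where "C = max C1 C2"
 define d where "d = min d1 d2"
 have Cd: "C >= 1" "0 < d" "d < 1" "C1 <= C" "C2 <= C" "d <= d1" "d <= d2" using C1 C2 by (auto simp: C_def d_def)
 have main: "ainf C d (\<lambda>_. 1) u \<and> A1w A' (\<lambda>x. u x powr \<rho>) \<and> ainf C d (\<lambda>_. 1) (\<lambda>x. u x powr \<rho>)" if u: "A1w A u" for u :: "real ^ 'n => real"
 proof -
  have wu: "wt u" using u by (simp add: A1w_def)
  have um[measurable]: "lmeas u" and u0: "\<And>x. 0 <= u x" using wtD wu by auto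
  have au: "ainf C1 d1 (\<lambda>_. 1) u" using c1 wu A1w_imp_fw[OF u A0] by blast
  define u' where "u' x = u x powr \<rho>" for x
  have u'm[measurable]: "lmeas u'" unfolding u'_def[abs_def] by measurable
  have em: "emeasure (mw u') (cub c s) <= ennreal (C' * s ^ CARD('n) * (measure (mw u) (cub c s) / s ^ CARD('n)) powr \<rho>)" if "s > 0" for c s
   using rh[rule_format, OF wu au that, of c] unfolding u'_def[symmetric] by (simp add: emeasure_mw)
  have wu': "wt u'"
   unfolding wt_def
  proof (intro conjI allI impI)
   fix c :: "real ^ 'n" and s :: real assume s: "s > 0"
   show "emeasure (mw u') (cub c s) < \<infinity>" using em[OF s, of c] by (simp add: order_le_less_trans[OF _ ennreal_less_top])
   show "0 < emeasure (mw u') (cub c s)"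
   proof (rule ccontr)
    assume "\<not> 0 < emeasure (mw u') (cub c s)"
    then have "(\<integral>\<^sup>+x\<in>cub c s. ennreal (u' x) \<partial>lebesgue) = 0" by (simp add: emeasure_mw)
    then have "AE x in lebesgue. ennreal (u' x) * indicator (cub c s) x = 0" by (subst (asm) nn_integral_0_iff_AE) auto
    then have "AE x in lebesgue. x \<notin> cub c s"
     using A1w_pos[OF u A0] by eventually_elim (auto simp: u'_def indicator_def split: if_splits)
    then have "emeasure lebesgue (cub c s) = 0" by (subst (asm) AE_iff_measurable[OF _ refl]) auto
    then show False using s by (simp add: emeasure_cub)
   qed
  qed (auto simp: u'_def)
  have "A1w A' u'"
   unfolding A1w_def
  proof (intro conjI wu')
   show "AE x in lebesgue. HL (\<lambda>y. ennreal (u' y)) x <= ennreal (A' * u' x)"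
    using A1w_cube[OF u A0]
   proof (rule eventually_mono)
    fix x assume x: "\<forall>c s. s > 0 --> x \<in> cub c s --> measure (mw u) (cub c s) <= A * u x * s ^ CARD('n)"
    show "HL (\<lambda>y. ennreal (u' y)) x <= ennreal (A' * u' x)"
    proof (rule Mx_le)
     fix c and s :: real assume s: "s > 0" "x \<in> cub c s"
     have sn: "s ^ CARD('n) > 0" using s by simp
     have "measure (mw u) (cub c s) / s ^ CARD('n) <= A * u x" using x s sn by (simp add: field_simps)
     then have "(measure (mw u) (cub c s) / s ^ CARD('n)) powr \<rho> <= (A * u x) powr \<rho>" using rho sn by (intro powr_mono2) auto
     also have "... = A powr \<rho> * u' x" using A0 u0 by (simp add: u'_def powr_mult)
     finally have "C' * s ^ CARD('n) * (measure (mw u) (cub c s) / s ^ CARD('n)) powr \<rho> <= C' * s ^ CARD('n) * (A powr \<rho> * u' x)"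
      using C' sn by (intro mult_left_mono) auto
     also have "... = C' * A powr \<rho> * (u' x * s ^ CARD('n))" by (simp add: mult_ac)
     also have "... <= A' * (u' x * s ^ CARD('n))" using A' sn by (intro mult_right_mono) (auto simp: u'_def)
     finally have le: "C' * s ^ CARD('n) * (measure (mw u) (cub c s) / s ^ CARD('n)) powr \<rho> <= A' * u' x * s ^ CARD('n)" by (simp add: mult_ac)
     have "(\<integral>\<^sup>+y\<in>cub c s. ennreal (u' y) \<partial>lebesgue) <= ennreal (A' * u' x * s ^ CARD('n))"
      using em[OF s(1), of c] le by (simp add: emeasure_mw) (meson order_trans ennreal_leI)
     also have "... = ennreal (A' * u' x) * emeasure lebesgue (cub c s)"
      using s A' by (simp add: emeasure_cub ennreal_mult u'_def)
     finally show "avg (\<lambda>_. 1) (cub c s) (\<lambda>y. ennreal (u' y)) <= ennreal (A' * u' x)"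
      unfolding avg_le_iff[OF wt_one s(1)] mw_one .
    qed
   qed
  qed
  moreover have "ainf C d (\<lambda>_. 1) u" using ainf_mono[OF wt_one au Cd(4,6,2) C1'] .
  moreover have "ainf C d (\<lambda>_. 1) u'"
  proof -
   have "ainf C2 d2 (\<lambda>_. 1) u'" using c2 wu' A1w_imp_fw[OF \<open>A1w A' u'\<close> A'(2)] by blast
   then show ?thesis using ainf_mono[OF wt_one _ Cd(5,7,2)] C2 by simp
  qed
  ultimately show ?thesis unfolding u'_def by blast
 qed
 then show ?thesis using rho A' Cd by blast
qed

section \<open>Kolmogorov's inequality against a bounded factor, and extrapolation from a single
  weight\<close>

definition kolW :: "real => real => real => real => real" where
 "kolW c0 D r \<sigma> = c0 * kolC (1 - \<sigma>) * (D * (c0 / 2) powr (- r)) powr \<sigma> / (1 - 2 powr (r * \<sigma>) / 2)"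

text \<open>On the layer where k is about c0 / 2^i the factor contributes 2^(-i). Kolmogorov's
  inequality on {k > c0 / 2^(i + 1)}, whose measure may grow like 2^(i r), contributes that measure
  to the power \<sigma>. The ratio of the series is therefore 2^(r \<sigma>) / 2, which is below 1
  exactly because r \<sigma> < 1.\<close>

lemma kolmogorov_weighted:
 fixes h :: "'a => ennreal" and k :: "'a => real"
 assumes sig: "0 < \<sigma>" "\<sigma> < 1" "r * \<sigma> < 1" and c0: "c0 > 0" and D: "D >= 0" and m: "m >= 0" and L: "L >= 0"
  and h[measurable]: "h \<in> borel_measurable M" and k[measurable]: "k \<in> borel_measurable M" and k0: "AE x in M. 0 <= k x \<and> k x <= c0"
  and dec: "\<And>l. l > 0 ==> emeasure M {x \<in> space M. l < k x} <= ennreal (D * l powr (- r) * m)"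
  and wk: "\<And>t. t > 0 ==> ennreal t * emeasure M {x \<in> space M. ennreal t < h x} <= ennreal L"
 shows "(\<integral>\<^sup>+x. ennreal_powr (h x) (1 - \<sigma>) * ennreal (k x) \<partial>M) <= ennreal (kolW c0 D r \<sigma> * m powr \<sigma> * L powr (1 - \<sigma>))"
proof -
 define s where "s = 1 - \<sigma>"
 have s: "0 < s" "s < 1" using sig by (auto simp: s_def)
 define S where "S i = {x \<in> space M. c0 / 2 / 2 ^ i < k x}" for i :: nat
 have Ss[measurable]: "S i \<in> sets M" for i unfolding S_def by measurable
 define q where "q = 2 powr (r * \<sigma>) / 2"
 have "2 powr (r * \<sigma>) < 2 powr 1" using sig by (intro powr_less_mono) auto
 then have q: "0 <= q" "q < 1" by (simp_all add: q_def)
 define c where "c = c0 * kolC s * (D * (c0 / 2) powr (- r) * m) powr \<sigma> * L powr s"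
 have c: "c >= 0" using c0 kolC_ge1[OF s(2)] by (simp add: c_def)
 have piece: "ennreal (c0 / 2 ^ i) * (\<integral>\<^sup>+x\<in>S i. ennreal_powr (h x) s \<partial>M) <= ennreal (c * q ^ i)" for i
 proof -
  define mi where "mi = D * (c0 / 2 / 2 ^ i) powr (- r) * m"
  have "(\<integral>\<^sup>+x\<in>S i. ennreal_powr (h x) s \<partial>M) <= ennreal (kolC s * mi powr (1 - s) * L powr s)"
  proof (rule kolmogorov[OF s h Ss])
   show "0 <= mi" using D m by (simp add: mi_def)
   show "emeasure M (S i) <= ennreal mi" unfolding S_def mi_def by (rule dec) (use c0 in simp)
   fix t :: real assume t: "t > 0"
   have "ennreal t * emeasure M {x \<in> S i. ennreal t < h x} <= ennreal t * emeasure M {x \<in> space M. ennreal t < h x}"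
    by (intro mult_left_mono emeasure_mono) (auto simp: S_def)
   then show "ennreal t * emeasure M {x \<in> S i. ennreal t < h x} <= ennreal L" using wk[OF t] by (rule order_trans)
  qed (rule L)
  then have "ennreal (c0 / 2 ^ i) * (\<integral>\<^sup>+x\<in>S i. ennreal_powr (h x) s \<partial>M) <= ennreal (c0 / 2 ^ i) * ennreal (kolC s * mi powr (1 - s) * L powr s)"
   by (rule mult_left_mono) simp
  also have "... = ennreal (c0 / 2 ^ i * (kolC s * mi powr (1 - s) * L powr s))"
   using c0 kolC_ge1[OF s(2)] by (simp flip: ennreal_mult)
  also have "c0 / 2 ^ i * (kolC s * mi powr (1 - s) * L powr s) = c * q ^ i"
  proof -
   have e: "(c0 / 2 / 2 ^ i) powr (- r) = (c0 / 2) powr (- r) * (2 ^ i) powr r"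
    unfolding powr_divide[of "c0 / 2" "2 ^ i"] powr_minus[of "2 ^ i" r] by (simp only: divide_inverse inverse_inverse_eq)
   have mi: "mi = D * (c0 / 2) powr (- r) * m * (2 ^ i) powr r" unfolding mi_def e by (simp only: mult_ac)
   have "mi powr \<sigma> = (D * (c0 / 2) powr (- r) * m) powr \<sigma> * ((2 ^ i) powr r) powr \<sigma>"
    unfolding mi by (rule powr_mult)
   also have "(((2::real) ^ i) powr r) powr \<sigma> = (2 powr (r * \<sigma>)) ^ i"
    by (simp only: powr_powr powr_power zero_less_numeral flip: powr_realpow) (simp add: mult_ac)
   finally have "mi powr (1 - s) = (D * (c0 / 2) powr (- r) * m) powr \<sigma> * (2 powr (r * \<sigma>)) ^ i" by (simp add: s_def)
   then show ?thesis by (simp add: c_def q_def power_divide)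
  qed
  finally show ?thesis .
 qed
 have "(\<integral>\<^sup>+x. ennreal_powr (h x) s * ennreal (k x) \<partial>M) <= (\<integral>\<^sup>+x. (\<Sum>i. ennreal (c0 / 2 ^ i) * (ennreal_powr (h x) s * indicator (S i) x)) \<partial>M)"
  using AE_space k0
 proof (intro nn_integral_mono_AE, eventually_elim)
  fix x assume x: "x \<in> space M" "0 <= k x \<and> k x <= c0"
  show "ennreal_powr (h x) s * ennreal (k x) <= (\<Sum>i. ennreal (c0 / 2 ^ i) * (ennreal_powr (h x) s * indicator (S i) x))"
  proof (cases "k x = 0")
   case False
   then have kp: "k x > 0" using x by simp
   obtain n where "(1/2) ^ n < k x / (c0 / 2)" using real_arch_pow_inv[of "k x / (c0 / 2)" "1/2"] kp c0 by auto
   then have ex: "c0 / 2 / 2 ^ n < k x" using c0 by (simp add: field_simps)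
   define i where "i = (LEAST n. c0 / 2 / 2 ^ n < k x)"
   have i1: "c0 / 2 / 2 ^ i < k x" unfolding i_def by (rule LeastI[of _ n]) (rule ex)
   have i2: "k x <= c0 / 2 ^ i"
   proof (cases i)
    case (Suc j)
    then have "\<not> c0 / 2 / 2 ^ j < k x" using not_less_Least[of j "\<lambda>n. c0 / 2 / 2 ^ n < k x"] by (simp add: i_def)
    then show ?thesis using Suc by simp
   qed (use x in simp)
   have "ennreal_powr (h x) s * ennreal (k x) <= ennreal (c0 / 2 ^ i) * (ennreal_powr (h x) s * indicator (S i) x)"
    using i1 mult_left_mono[OF ennreal_leI[OF i2], of "ennreal_powr (h x) s"] x by (simp add: S_def mult.commute)
   also have "... <= (\<Sum>i. ennreal (c0 / 2 ^ i) * (ennreal_powr (h x) s * indicator (S i) x))"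
    using sum_le_suminf[of "\<lambda>i. ennreal (c0 / 2 ^ i) * (ennreal_powr (h x) s * indicator (S i) x)" "{i}"] by simp
   finally show ?thesis .
  qed simp
 qed
 also have "... = (\<Sum>i. ennreal (c0 / 2 ^ i) * (\<integral>\<^sup>+x\<in>S i. ennreal_powr (h x) s \<partial>M))"
  by (subst nn_integral_suminf) (auto simp: nn_integral_cmult)
 also have "... <= (\<Sum>i. ennreal (c * q ^ i))" by (intro suminf_le piece) auto
 also have "... = ennreal (c / (1 - q))" using nn_integral_geometric_nat[OF c q] by (simp add: nn_integral_count_space_nat)
 also have "c / (1 - q) = kolW c0 D r \<sigma> * m powr \<sigma> * L powr (1 - \<sigma>)"
  using D m by (simp add: c_def q_def kolW_def s_def powr_mult)
 finally show ?thesis unfolding s_def .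
qed

text \<open>Here b stands for a value of the maximal function that dominates \<epsilon> f^\<gamma> +
  g^\<gamma>. The first two bounds make the integrals in the operator hypothesis finite and
  controlled by a power of the maximal function; the third recovers f^s. If \<theta> < 0, the third
  needs no power of \<epsilon>: either f^\<gamma> \<le> b, or the negative power of b dominates that
  of f^\<gamma>. Hence the maximum in the exponent.\<close>

lemma powr_interpolation:
 fixes f g b :: real
 assumes f: "f >= 0" and g: "g >= 0" and b: "b > 0" and eps: "0 < \<epsilon>" "\<epsilon> <= 1" and \<gamma>: "\<gamma> > 0" and p0: "p0 > 0" and s: "s > 0"
  and le: "\<epsilon> * f powr \<gamma> + g powr \<gamma> <= b" and \<theta>: "\<theta> = (s - p0) / \<gamma>"
 shows "f powr p0 * b powr \<theta> <= \<epsilon> powr (- (p0 / \<gamma>)) * b powr (s / \<gamma>)"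
  and "g powr p0 * b powr \<theta> <= b powr (s / \<gamma>)"
  and "f powr s <= b powr (s / \<gamma>) + \<epsilon> powr (- max \<theta> 0) * (f powr p0 * b powr \<theta>)"
proof -
 have eq: "p0 / \<gamma> + \<theta> = s / \<gamma>" using \<gamma> by (simp add: \<theta> field_simps)
 have fb: "f powr \<gamma> <= b / \<epsilon>" using le eps g by (simp add: field_simps) (smt (verit) powr_ge_zero)
 have gb: "g powr \<gamma> <= b" using le eps by (smt (verit) mult_nonneg_nonneg powr_ge_zero)
 have fe: "f powr (\<gamma> * t) = (f powr \<gamma>) powr t" "g powr (\<gamma> * t) = (g powr \<gamma>) powr t" for t by (simp_all add: powr_powr)
 have "f powr p0 = (f powr \<gamma>) powr (p0 / \<gamma>)" using \<gamma> by (simp add: powr_powr)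
 also have "... <= (b / \<epsilon>) powr (p0 / \<gamma>)" using fb \<gamma> p0 by (intro powr_mono2) auto
 also have "... = \<epsilon> powr (- (p0 / \<gamma>)) * b powr (p0 / \<gamma>)" using b eps by (simp add: powr_divide powr_minus field_simps)
 finally have "f powr p0 * b powr \<theta> <= \<epsilon> powr (- (p0 / \<gamma>)) * b powr (p0 / \<gamma>) * b powr \<theta>" by (intro mult_right_mono) auto
 also have "... = \<epsilon> powr (- (p0 / \<gamma>)) * b powr (s / \<gamma>)" by (simp add: mult.assoc flip: powr_add eq)
 finally show "f powr p0 * b powr \<theta> <= \<epsilon> powr (- (p0 / \<gamma>)) * b powr (s / \<gamma>)" .
 have "g powr p0 = (g powr \<gamma>) powr (p0 / \<gamma>)" using \<gamma> by (simp add: powr_powr)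
 also have "... <= b powr (p0 / \<gamma>)" using gb \<gamma> p0 by (intro powr_mono2) auto
 finally have "g powr p0 * b powr \<theta> <= b powr (p0 / \<gamma>) * b powr \<theta>" by (intro mult_right_mono) auto
 then show "g powr p0 * b powr \<theta> <= b powr (s / \<gamma>)" by (simp flip: powr_add eq)
 have fs: "f powr s = f powr p0 * (f powr \<gamma>) powr \<theta>" using \<gamma> by (simp add: powr_powr \<theta> flip: powr_add)
 show "f powr s <= b powr (s / \<gamma>) + \<epsilon> powr (- max \<theta> 0) * (f powr p0 * b powr \<theta>)"
 proof (cases "\<theta> >= 0")
  case True
  have "(f powr \<gamma>) powr \<theta> <= (b / \<epsilon>) powr \<theta>" using fb True by (intro powr_mono2) auto
  also have "... = \<epsilon> powr (- \<theta>) * b powr \<theta>" using b eps by (simp add: powr_divide powr_minus field_simps)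
  finally have "f powr s <= f powr p0 * (\<epsilon> powr (- \<theta>) * b powr \<theta>)" unfolding fs by (intro mult_left_mono) auto
  then show ?thesis using True by (simp add: max_absorb1 mult_ac add_increasing)
 next
  case False
  show ?thesis
  proof (cases "f powr \<gamma> <= b")
   case le: True
   have "f powr s <= b powr (s / \<gamma>)"
    using le \<gamma> s powr_mono2[of "s / \<gamma>" "f powr \<gamma>" b] by (simp add: powr_powr)
   then show ?thesis by (simp add: add_increasing2)
  next
   case gt: False
   then have "(f powr \<gamma>) powr \<theta> <= b powr \<theta>" using False b by (intro powr_mono2') auto
   then have "f powr s <= f powr p0 * b powr \<theta>" unfolding fs by (intro mult_left_mono) auto
   then show ?thesis using False eps by (simp add: max_def add_increasing)
  qed
 qed
qed

text \<open>The hypothesis on the operator is applied to the single weight \<open>a (M\<^sub>a (\<epsilon> F\<^sup>\<gamma> + G\<^sup>\<gamma>))\<^sup>\<theta>\<close>, which dominates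
 both \<open>F\<close> and \<open>G\<close>; the term with \<open>F\<close> is absorbed for small \<open>\<epsilon>\<close>.\<close>

lemma extrapolation:
 fixes c :: "ennreal => real"
 assumes p0: "p0 > 0" and s: "0 < s" and C: "C > 0" "0 < d"
 shows "\<exists>D>0. \<forall>(a :: real ^ 'n => real) F G. wt a --> ainf C d (\<lambda>_. 1) a -->
  lmeas F --> (\<forall>x. 0 <= F x) --> lmeas G --> (\<forall>x. 0 <= G x) -->
  (\<integral>\<^sup>+x. ennreal (F x powr s) \<partial>mw a) < \<infinity> --> (\<integral>\<^sup>+x. ennreal (G x powr s) \<partial>mw a) < \<infinity> -->
  (\<forall>w. Ainf w --> (\<integral>\<^sup>+x. ennreal (F x powr p0 * w x) \<partial>lebesgue) < \<infinity> -->
   (\<integral>\<^sup>+x. ennreal (F x powr p0 * w x) \<partial>lebesgue) <= ennreal (c (Ainf_const w)) * (\<integral>\<^sup>+x. ennreal (G x powr p0 * w x) \<partial>lebesgue)) -->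
  (\<integral>\<^sup>+x. ennreal (F x powr s) \<partial>mw a) <= ennreal D * (\<integral>\<^sup>+x. ennreal (G x powr s) \<partial>mw a)"
proof -
 \<comment> \<open>Strictly between max 0 (s - p0) and s, so that p = s / \<gamma> > 1 for the
   maximal theorem and \<theta> = (s - p0) / \<gamma> < 1 for the A_inf property of the constructed
   weight.\<close>
 define \<gamma> where "\<gamma> = (max 0 (s - p0) + s) / 2"
 have gam: "\<gamma> > 0" "\<gamma> < s" "s - p0 < \<gamma>" using p0 s by (auto simp: \<gamma>_def)
 define p where "p = s / \<gamma>"
 have p: "p > 1" using gam by (simp add: p_def)
 define \<theta> where "\<theta> = (s - p0) / \<gamma>"
 have th: "\<theta> < 1" using gam by (simp add: \<theta>_def)
 define \<tau> where "\<tau> = max \<theta> 0"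
 have tau: "0 <= \<tau>" "\<tau> < p" using th p by (auto simp: \<tau>_def)
 obtain c1 where c1: "0 < c1" "c1 < 1" "\<forall>w :: real ^ 'n => real. wt w --> ainf C d (\<lambda>_. 1) w --> weak_ainf c1 (\<lambda>_. 1) w"
  using ainf_imp_weak_one[OF C, where 'n = 'n] by blast
 obtain K where K: "K >= 1" "\<forall>w :: real ^ 'n => real. wt w --> weak_ainf c1 (\<lambda>_. 1) w --> dbl K w"
  using weak_one_imp_ainf[OF c1(1,2), where 'n = 'n] by blast
 obtain C1 where C1: "C1 >= 0" and strong: "\<forall>(a :: real ^ 'n => real) g. wt a --> dbl K a --> lmeas g --> (\<forall>x. 0 <= g x) -->
   (\<integral>\<^sup>+x. ennreal_powr (Mx a (\<lambda>x. ennreal (g x)) x) p \<partial>mw a) <= ennreal C1 * (\<integral>\<^sup>+x. ennreal (g x powr p) \<partial>mw a)"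
  using Mx_strong_type[OF p K(1), where 'n = 'n] by blast
 obtain C3 d3 where C3: "C3 > 0" "d3 > 0" and pw: "\<forall>(a :: real ^ 'n => real) g. wt a --> dbl K a --> lmeas g -->
   (\<forall>x. 0 < Mx a g x) --> (AE x in mw a. Mx a g x < top) -->
   wt (\<lambda>x. a x * enn2real (Mx a g x) powr \<theta>) \<and> ainf C3 d3 a (\<lambda>x. a x * enn2real (Mx a g x) powr \<theta>)"
  using ainf_Mx_powr[OF th K(1), where 'n = 'n] by blast
 define C4 where "C4 = C3 * C powr d3"
 define d4 where "d4 = min (d * d3) (1 / 2)"
 have C4: "C4 > 0" "0 < d4" "d4 < 1" "d4 <= d * d3" using C C3 by (auto simp: C4_def d4_def)
 obtain b where b: "b >= 0" and fwb: "\<forall>w :: real ^ 'n => real. wt w --> ainf C4 d4 (\<lambda>_. 1) w --> fw b w"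
  using ainf_imp_fw[OF C4(1,2,3), where 'n = 'n] by blast
 obtain t0 K1 where t0: "t0 >= 0" and K1: "K1 >= 1" and presc: "\<forall>w :: real ^ 'n => real. wt w --> fw b w -->
  (\<exists>w'. w' \<in> borel_measurable lebesgue \<and> (\<forall>x. w x <= w' x \<and> w' x <= K1 * w x) \<and> Ainf w' \<and> Ainf_const w' = ennreal t0)"
  using Ainf_const_prescribed[OF b, where 'n = 'n] by blast
 define C2 where "C2 = K1 * max 0 (c (ennreal t0))"
 have C2: "C2 >= 0" using K1 by (simp add: C2_def)
 define B where "B = (1 + C2) * C1 * 2 powr p + 1"
 have B: "B >= 1" "(1 + C2) * C1 * 2 powr p <= B" using C2 C1 by (auto simp: B_def)
 define e where "e = p - \<tau>"
 have e: "e > 0" using tau by (simp add: e_def)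
 \<comment> \<open>In the maximal bound F carries the factor \<open>\<epsilon> powr p\<close>, while
   recovering F^s costs \<open>\<epsilon> powr (- \<tau>)\<close>. Since \<tau> < p, the net power
   is positive, and this \<epsilon> makes the coefficient of the F-integral equal to 1/2.\<close>
 define \<epsilon> where "\<epsilon> = (1 / (2 * B)) powr (1 / e)"
 have eps: "0 < \<epsilon>" "\<epsilon> <= 1" using B e by (auto simp: \<epsilon>_def intro!: powr_le1)
 have epse: "B * \<epsilon> powr e = 1 / 2" using B e by (simp add: \<epsilon>_def powr_powr)
 have epsr: "\<epsilon> powr (- \<tau>) >= 1" using powr_mono'[of "- \<tau>" 0 \<epsilon>] eps tau by simp
 define D where "D = 2 * B * \<epsilon> powr (- \<tau>)"
 have D: "D > 0" using B eps by (simp add: D_def)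
 have main: "(\<integral>\<^sup>+x. ennreal (F x powr s) \<partial>mw a) <= ennreal D * (\<integral>\<^sup>+x. ennreal (G x powr s) \<partial>mw a)"
  if a: "wt a" "ainf C d (\<lambda>_. 1) a" and F[measurable]: "lmeas F" and F0: "\<And>x. 0 <= F x"
   and G[measurable]: "lmeas G" and G0: "\<And>x. 0 <= G x"
   and Xf: "(\<integral>\<^sup>+x. ennreal (F x powr s) \<partial>mw a) < \<infinity>" and Yf: "(\<integral>\<^sup>+x. ennreal (G x powr s) \<partial>mw a) < \<infinity>"
   and hyp: "\<And>w. Ainf w ==> (\<integral>\<^sup>+x. ennreal (F x powr p0 * w x) \<partial>lebesgue) < \<infinity> ==>
    (\<integral>\<^sup>+x. ennreal (F x powr p0 * w x) \<partial>lebesgue) <= ennreal (c (Ainf_const w)) * (\<integral>\<^sup>+x. ennreal (G x powr p0 * w x) \<partial>lebesgue)"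
  for a F G :: "real ^ 'n => real"
 proof -
  have am[measurable]: "lmeas a" and a0: "\<And>x. 0 <= a x" using wtD a by auto
  have dba: "dbl K a" using a c1(3) K(2) by blast
  define X where "X = enn2real (\<integral>\<^sup>+x. ennreal (F x powr s) \<partial>mw a)"
  define Y where "Y = enn2real (\<integral>\<^sup>+x. ennreal (G x powr s) \<partial>mw a)"
  have X: "(\<integral>\<^sup>+x. ennreal (F x powr s) \<partial>mw a) = ennreal X" "X >= 0" and Y: "(\<integral>\<^sup>+x. ennreal (G x powr s) \<partial>mw a) = ennreal Y" "Y >= 0"
   using Xf Yf by (simp_all add: X_def Y_def)
  define \<phi> where "\<phi> x = \<epsilon> * F x powr \<gamma> + G x powr \<gamma>" for x
  have \<phi>m[measurable]: "lmeas \<phi>" unfolding \<phi>_def[abs_def] by measurable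
  have \<phi>0: "\<phi> x >= 0" for x using eps by (simp add: \<phi>_def)
  show ?thesis
  \<comment> \<open>If \<phi> vanishes almost everywhere, so does F. Otherwise the maximal function
    is positive everywhere, as a possibly negative power of it requires.\<close>
  proof (cases "AE x in mw a. ennreal (\<phi> x) = 0")
   case True
   then have "AE x in mw a. ennreal (F x powr s) = 0"
   proof eventually_elim
    fix x assume "ennreal (\<phi> x) = 0"
    then have "\<epsilon> * F x powr \<gamma> + G x powr \<gamma> = 0" using \<phi>0[of x] by (simp add: \<phi>_def)
    moreover have "0 <= \<epsilon> * F x powr \<gamma>" using eps by simp
    ultimately have "\<epsilon> * F x powr \<gamma> = 0" by (smt (verit) powr_ge_zero)
    then show "ennreal (F x powr s) = 0" using eps by simp
   qed
   then have "(\<integral>\<^sup>+x. ennreal (F x powr s) \<partial>mw a) = (\<integral>\<^sup>+x. 0 \<partial>mw a)" by (intro nn_integral_cong_AE)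
   then show ?thesis by simp
  next
   case False
   let ?M = "Mx a (\<lambda>x. ennreal (\<phi> x))"
   have Mm[measurable]: "?M \<in> borel_measurable lebesgue" by (rule Mx_measurable[OF a(1)])
   have Mp: "0 < ?M x" for x by (rule Mx_pos[OF a(1) _ False]) measurable
   have "(\<integral>\<^sup>+x. ennreal_powr (?M x) p \<partial>mw a) <= ennreal C1 * (\<integral>\<^sup>+x. ennreal (\<phi> x powr p) \<partial>mw a)"
    using strong[rule_format, OF a(1) dba \<phi>m \<phi>0] .
   also have "... <= ennreal C1 * (\<integral>\<^sup>+x. ennreal (2 powr p) * (ennreal (\<epsilon> powr p) * ennreal (F x powr s) + ennreal (G x powr s)) \<partial>mw a)"
   proof (intro mult_left_mono nn_integral_mono)
    fix x
    have gp: "(z powr \<gamma>) powr p = z powr s" for z :: real using gam by (simp add: powr_powr p_def)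
    have "ennreal (\<phi> x powr p) = ennreal_powr (ennreal (\<epsilon> * F x powr \<gamma>) + ennreal (G x powr \<gamma>)) p"
     using eps \<phi>0[of x] by (simp add: \<phi>_def ennreal_powr_ennreal flip: ennreal_plus)
    also have "... <= ennreal (2 powr p) * (ennreal_powr (ennreal (\<epsilon> * F x powr \<gamma>)) p + ennreal_powr (ennreal (G x powr \<gamma>)) p)"
     using p by (intro ennreal_powr_add_le) auto
    also have "... = ennreal (2 powr p) * (ennreal (\<epsilon> powr p) * ennreal (F x powr s) + ennreal (G x powr s))"
     using eps by (subst (1 2) ennreal_powr_ennreal) (simp_all add: powr_mult gp flip: ennreal_mult)
    finally show "ennreal (\<phi> x powr p) <= ennreal (2 powr p) * (ennreal (\<epsilon> powr p) * ennreal (F x powr s) + ennreal (G x powr s))" .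
   qed auto
   also have "... = ennreal C1 * (ennreal (2 powr p) * (ennreal (\<epsilon> powr p) * ennreal X + ennreal Y))"
    by (simp add: nn_integral_cmult nn_integral_add X Y)
   also have "... = ennreal (C1 * (2 powr p * (\<epsilon> powr p * X + Y)))"
    using C1 X Y by (simp flip: ennreal_mult ennreal_plus)
   finally have Jp: "(\<integral>\<^sup>+x. ennreal_powr (?M x) p \<partial>mw a) <= ennreal (C1 * (2 powr p * (\<epsilon> powr p * X + Y)))" .
   then have "(\<integral>\<^sup>+x. ennreal_powr (?M x) p \<partial>mw a) \<noteq> \<infinity>" using order_le_less_trans[OF Jp ennreal_less_top] by (simp add: less_top)
   then have "AE x in mw a. ennreal_powr (?M x) p \<noteq> \<infinity>" by (intro nn_integral_PInf_AE) auto
   then have Mf: "AE x in mw a. ?M x < top"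
    by eventually_elim (auto simp: ennreal_powr_def less_top split: if_splits)
   define \<beta> where "\<beta> x = enn2real (?M x)" for x
   have bm[measurable]: "lmeas \<beta>" unfolding \<beta>_def[abs_def] by measurable
   have dom: "AE x in mw a. \<beta> x > 0 \<and> \<epsilon> * F x powr \<gamma> + G x powr \<gamma> <= \<beta> x"
    using Mf Mx_ge_AE[OF a(1) measurable_compose[OF \<phi>m measurable_ennreal]]
   proof eventually_elim
    fix x assume x: "?M x < top" "ennreal (\<phi> x) <= ?M x"
    then have M: "?M x = ennreal (\<beta> x)" by (simp add: \<beta>_def)
     have "0 < \<beta> x" using Mp[of x] unfolding M by simp
     moreover have "\<phi> x <= \<beta> x" using x(2) unfolding M using \<open>0 < \<beta> x\<close> by (simp add: ennreal_le_iff)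
     ultimately show "\<beta> x > 0 \<and> \<epsilon> * F x powr \<gamma> + G x powr \<gamma> <= \<beta> x" by (simp add: \<phi>_def)
   qed
   define J where "J = (\<integral>\<^sup>+x. ennreal (\<beta> x powr p) \<partial>mw a)"
   have J: "J <= ennreal (C1 * (2 powr p * (\<epsilon> powr p * X + Y)))"
   proof -
    have "J = (\<integral>\<^sup>+x. ennreal_powr (?M x) p \<partial>mw a)"
     unfolding J_def using Mf
     by (intro nn_integral_cong_AE, elim eventually_mono) (auto simp: ennreal_powr_def \<beta>_def)
    then show ?thesis using Jp by simp
   qed
   then have Jf: "J < \<infinity>" using order_le_less_trans[OF J ennreal_less_top] by simp
   define w where "w x = a x * \<beta> x powr \<theta>" for x
   have w: "wt w" "ainf C3 d3 a w"
    using pw[rule_format, OF a(1) dba _ Mp Mf] unfolding w_def[abs_def] \<beta>_def by simp_all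
   have wm[measurable]: "lmeas w" and w0: "\<And>x. 0 <= w x" using wtD w by auto
   have "ainf C4 (d * d3) (\<lambda>_. 1) w" unfolding C4_def
    by (rule ainf_trans[OF wt_one a(1) w(1) a(2) w(2) C C3])
   then have "ainf C4 d4 (\<lambda>_. 1) w" using ainf_mono[OF wt_one _ order_refl C4(4,2,1)] by blast
   then have "fw b w" using fwb w(1) by blast
   \<comment> \<open>The comparable weight has A_inf constant exactly t0, a number fixed before the
     weights; so the arbitrary function c is evaluated at one point only.\<close>
   then obtain w' where w'm[measurable]: "lmeas w'" and w': "\<And>x. w x <= w' x" "\<And>x. w' x <= K1 * w x" and Aw': "Ainf w'" "Ainf_const w' = ennreal t0"
    using presc w(1) by blast
   have int_w: "(\<integral>\<^sup>+x. ennreal (H x powr p0 * w x) \<partial>lebesgue) = (\<integral>\<^sup>+x. ennreal (H x powr p0 * \<beta> x powr \<theta>) \<partial>mw a)"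
    if [measurable]: "lmeas H" for H :: "real ^ 'n => real"
    using a0 by (subst nn_integral_mw) (auto intro!: nn_integral_cong simp: w_def mult_ac simp flip: ennreal_mult)
   have int_w': "(\<integral>\<^sup>+x. ennreal (H x powr p0 * w' x) \<partial>lebesgue) <= ennreal K1 * (\<integral>\<^sup>+x. ennreal (H x powr p0 * w x) \<partial>lebesgue)"
    if [measurable]: "lmeas H" for H :: "real ^ 'n => real"
   proof -
    have "(\<integral>\<^sup>+x. ennreal (H x powr p0 * w' x) \<partial>lebesgue) <= (\<integral>\<^sup>+x. ennreal K1 * ennreal (H x powr p0 * w x) \<partial>lebesgue)"
    proof (intro nn_integral_mono)
     fix x
     have "H x powr p0 * w' x <= H x powr p0 * (K1 * w x)" using w'(2) by (intro mult_left_mono) auto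
     then show "ennreal (H x powr p0 * w' x) <= ennreal K1 * ennreal (H x powr p0 * w x)"
      using K1 w0 by (simp add: mult_ac ennreal_leI flip: ennreal_mult)
    qed
    also have "... = ennreal K1 * (\<integral>\<^sup>+x. ennreal (H x powr p0 * w x) \<partial>lebesgue)" by (rule nn_integral_cmult) measurable
    finally show ?thesis .
   qed
   define Z where "Z = (\<integral>\<^sup>+x. ennreal (F x powr p0 * \<beta> x powr \<theta>) \<partial>mw a)"
   have interp: "F x powr p0 * \<beta> x powr \<theta> <= \<epsilon> powr (- (p0 / \<gamma>)) * \<beta> x powr p"
    "G x powr p0 * \<beta> x powr \<theta> <= \<beta> x powr p"
    "F x powr s <= \<beta> x powr p + \<epsilon> powr (- \<tau>) * (F x powr p0 * \<beta> x powr \<theta>)"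
    if "\<beta> x > 0 \<and> \<epsilon> * F x powr \<gamma> + G x powr \<gamma> <= \<beta> x" for x
    using powr_interpolation[OF F0 G0 _ eps gam(1) p0 s _ \<theta>_def] that unfolding p_def \<tau>_def by blast+
   \<comment> \<open>The operator hypothesis speaks only of finite left-hand sides. The finiteness
     of Z comes from the pointwise bound by the maximal function, whose p-th power is
     integrable.\<close>
   have "Z <= (\<integral>\<^sup>+x. ennreal (\<epsilon> powr (- (p0 / \<gamma>))) * ennreal (\<beta> x powr p) \<partial>mw a)"
    unfolding Z_def using dom by (intro nn_integral_mono_AE, elim eventually_mono) (auto intro!: ennreal_leI interp simp flip: ennreal_mult)
   also have "... = ennreal (\<epsilon> powr (- (p0 / \<gamma>))) * J" unfolding J_def by (rule nn_integral_cmult) measurable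
   finally have Zf: "Z < \<infinity>" using Jf by (simp add: ennreal_mult_less_top order_le_less_trans)
   have GJ: "(\<integral>\<^sup>+x. ennreal (G x powr p0 * w x) \<partial>lebesgue) <= J"
    unfolding int_w[OF G] J_def using dom by (intro nn_integral_mono_AE, elim eventually_mono) (auto intro!: ennreal_leI interp)
   have "Z = (\<integral>\<^sup>+x. ennreal (F x powr p0 * w x) \<partial>lebesgue)" unfolding Z_def int_w[OF F] ..
   also have "... <= (\<integral>\<^sup>+x. ennreal (F x powr p0 * w' x) \<partial>lebesgue)"
    using w'(1) by (intro nn_integral_mono ennreal_leI mult_left_mono) auto
   also have "... <= ennreal (c (ennreal t0)) * (\<integral>\<^sup>+x. ennreal (G x powr p0 * w' x) \<partial>lebesgue)"
   proof (rule hyp[OF Aw'(1), unfolded Aw'(2)])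
    have "(\<integral>\<^sup>+x. ennreal (F x powr p0 * w' x) \<partial>lebesgue) <= ennreal K1 * Z"
     using int_w'[OF F] unfolding Z_def int_w[OF F] .
    then show "(\<integral>\<^sup>+x. ennreal (F x powr p0 * w' x) \<partial>lebesgue) < \<infinity>" using Zf by (simp add: ennreal_mult_less_top order_le_less_trans)
   qed
   also have "... <= ennreal (c (ennreal t0)) * (ennreal K1 * J)"
    using int_w'[OF G] GJ by (intro mult_left_mono order_trans[OF int_w'[OF G]]) auto
   also have "ennreal (c (ennreal t0)) = ennreal (max 0 (c (ennreal t0)))" by (simp add: max_def ennreal_neg)
   also have "ennreal (max 0 (c (ennreal t0))) * (ennreal K1 * J) = ennreal C2 * J"
    using K1 by (simp add: C2_def ennreal_mult mult_ac)
   finally have ZJ: "Z <= ennreal C2 * J" .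
   have "ennreal X <= (\<integral>\<^sup>+x. ennreal (\<beta> x powr p) + ennreal (\<epsilon> powr (- \<tau>)) * ennreal (F x powr p0 * \<beta> x powr \<theta>) \<partial>mw a)"
    unfolding X(1)[symmetric] using dom
    by (intro nn_integral_mono_AE, elim eventually_mono) (auto intro!: ennreal_leI interp simp flip: ennreal_mult ennreal_plus)
   also have "... = J + ennreal (\<epsilon> powr (- \<tau>)) * Z"
    unfolding J_def Z_def by (simp add: nn_integral_add nn_integral_cmult)
   also have "... <= J + ennreal (\<epsilon> powr (- \<tau>)) * (ennreal C2 * J)" using ZJ by (intro add_left_mono mult_left_mono) auto
   also have "... = ennreal (1 + \<epsilon> powr (- \<tau>) * C2) * J" using C2 by (simp add: ennreal_mult distrib_right mult.assoc)
   also have "... <= ennreal (1 + \<epsilon> powr (- \<tau>) * C2) * ennreal (C1 * (2 powr p * (\<epsilon> powr p * X + Y)))" using J by (rule mult_left_mono) simp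
   also have "... = ennreal ((1 + \<epsilon> powr (- \<tau>) * C2) * (C1 * (2 powr p * (\<epsilon> powr p * X + Y))))"
    using C1 C2 X Y by (intro ennreal_mult[symmetric]) auto
   finally have "X <= (1 + \<epsilon> powr (- \<tau>) * C2) * (C1 * (2 powr p * (\<epsilon> powr p * X + Y)))"
    using C1 C2 X Y by (subst (asm) ennreal_le_iff) auto
   also have "... <= (\<epsilon> powr (- \<tau>) * (1 + C2)) * (C1 * (2 powr p * (\<epsilon> powr p * X + Y)))"
    using C1 C2 X Y epsr by (intro mult_right_mono) (auto simp: algebra_simps)
   also have "... = (1 + C2) * C1 * 2 powr p * (\<epsilon> powr (- \<tau>) * (\<epsilon> powr p * X + Y))" by (simp add: mult_ac)
   also have "... <= B * (\<epsilon> powr (- \<tau>) * (\<epsilon> powr p * X + Y))" using B X Y by (intro mult_right_mono) auto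
   also have "\<epsilon> powr (- \<tau>) * (\<epsilon> powr p * X + Y) = \<epsilon> powr e * X + \<epsilon> powr (- \<tau>) * Y"
    by (simp add: e_def distrib_left mult.assoc[symmetric] flip: powr_add)
   also have "B * (\<epsilon> powr e * X + \<epsilon> powr (- \<tau>) * Y) = 1 / 2 * X + D / 2 * Y"
    unfolding epse[symmetric] D_def by (simp add: algebra_simps)
   finally have "X <= D * Y" by simp
   then show ?thesis unfolding X Y using D Y by (simp add: ennreal_leI flip: ennreal_mult)
  qed
 qed
 show ?thesis using D main by blast
qed

text \<open>The operator is replaced by a pair of functions: F stands for |T(fv)| and \<phi> for
  |f|. The bound L expresses only the a priori finiteness of the weak norm; it does not enter D,
  which is chosen before u and v.\<close>

lemma weak_type_extrapolation:
 fixes c :: "ennreal => real"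
 assumes p0: "p0 > 0" and A: "A >= 1"
 shows "\<exists>D>0. \<forall>(u :: real ^ 'n => real) v F \<phi> L t. A1w A u --> wt v --> fw b v -->
  lmeas F --> (\<forall>x. 0 <= F x) --> lmeas \<phi> --> (\<forall>x. 0 <= \<phi> x) -->
  (\<forall>w. Ainf w --> (\<integral>\<^sup>+x. ennreal (F x powr p0 * w x) \<partial>lebesgue) < \<infinity> -->
   (\<integral>\<^sup>+x. ennreal (F x powr p0 * w x) \<partial>lebesgue) <= ennreal (c (Ainf_const w)) *
    (\<integral>\<^sup>+x. ennreal_powr (HL (\<lambda>y. ennreal (\<phi> y * v y)) x) p0 * ennreal (w x) \<partial>lebesgue)) -->
  L < \<infinity> --> (\<forall>t>0. ennreal t * emeasure (mw (\<lambda>x. u x * v x)) {x. t * v x < F x} <= L) --> t > 0 -->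
  ennreal t * emeasure (mw (\<lambda>x. u x * v x)) {x. t * v x < F x} <= ennreal D * (\<integral>\<^sup>+x. ennreal (\<phi> x * v x * u x) \<partial>lebesgue)"
proof -
 have A0: "A >= 0" using A by simp
 obtain \<rho> A' Cu du where rho: "\<rho> > 1" and A': "A' >= 1" and Cu: "Cu >= 1" "0 < du" "du < 1"
  and cu: "\<forall>u :: real ^ 'n => real. A1w A u --> ainf Cu du (\<lambda>_. 1) u \<and> A1w A' (\<lambda>x. u x powr \<rho>) \<and> ainf Cu du (\<lambda>_. 1) (\<lambda>x. u x powr \<rho>)"
  using A1w_powr[OF A, where 'n = 'n] by blast
 obtain Cv dv K where Cv: "Cv >= 1" "0 < dv" "dv < 1" and K: "K >= 1"
  and cv: "\<forall>w :: real ^ 'n => real. wt w --> fw b w --> ainf Cv dv (\<lambda>_. 1) w \<and> ainf Cv dv w (\<lambda>_. 1) \<and> dbl K w"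
  using fw_imp_ainf[of b, where 'n = 'n] by blast
 define C where "C = max Cu Cv"
 define d where "d = min du dv"
 have Cd: "C >= 1" "0 < d" "d < 1" "Cu <= C" "Cv <= C" "d <= du" "d <= dv" using Cu Cv by (auto simp: C_def d_def)
 have Cuv: "Cu > 0" "Cv > 0" using Cu Cv by auto
 define \<theta> where "\<theta> = 1 / \<rho>"
 have th: "0 < \<theta>" "\<theta> < 1" "\<rho> * \<theta> = 1" using rho by (simp_all add: \<theta>_def)
 obtain Dm where Dm: "Dm > 0" and mix: "\<forall>(u :: real ^ 'n => real) v g t. A1w A u --> ainf C d (\<lambda>_. 1) u --> wt v --> ainf C d v (\<lambda>_. 1) -->
  lmeas g --> (\<forall>x. 0 <= g x) --> t > 0 -->
  ennreal t * emeasure (mw (\<lambda>x. u x * v x)) {x. ennreal (t * v x) < HL (\<lambda>y. ennreal (g y)) x}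
   <= ennreal Dm * (\<integral>\<^sup>+x. ennreal (g x * u x) \<partial>lebesgue)"
  using mixed_weak_type[OF A Cd(1-3), where 'n = 'n] by blast
 obtain Dr \<kappa> where Dr: "Dr > 0" and kap: "\<kappa> > 0" and decay: "\<forall>(u :: real ^ 'n => real) v E \<Lambda>. A1w A' u --> ainf C d (\<lambda>_. 1) u --> wt v -->
  ainf C d v (\<lambda>_. 1) --> dbl K v --> E \<in> sets lebesgue --> \<Lambda> > 0 -->
  emeasure (mw (\<lambda>x. u x powr \<theta> * v x)) {x. ennreal (\<Lambda> * u x) < HL (\<lambda>y. ennreal (u y) * indicator E y) x}
   <= ennreal (Dr * \<Lambda> powr (- \<kappa>)) * emeasure (mw (\<lambda>x. u x powr \<theta> * v x)) E"
  using restricted_decay[OF A' Cd(1-3) K th(1), where 'n = 'n] by blast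
 obtain \<sigma>0 C5 d5 where sig0: "\<sigma>0 > 0" and C5: "C5 >= 1" "0 < d5" and prod: "\<forall>\<sigma> (v :: real ^ 'n => real) g. 0 < \<sigma> --> \<sigma> <= \<sigma>0 --> wt v -->
  ainf C d v (\<lambda>_. 1) --> lmeas g --> (\<forall>x. 0 < HL g x) --> (AE x in lebesgue. HL g x < top) -->
  wt (\<lambda>x. enn2real (HL g x) powr \<theta> * v x powr \<sigma>) \<and>
  ainf C5 d5 (\<lambda>_. 1) (\<lambda>x. enn2real (HL g x) powr \<theta> * v x powr \<sigma>)"
  using ainf_Mx_powr_mult[OF th(1,2) Cd(1-3), where 'n = 'n] by blast
 \<comment> \<open>The inequality \<open>l < \<beta> powr \<theta> / u\<close> means \<beta> >
   l^\<rho> u^\<rho>, so the decay exponent \<kappa> for the maximal function of u^\<rho> \<chi>_E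
   is multiplied by \<rho>.\<close>
 define r where "r = \<rho> * \<kappa>"
 have r: "r > 0" using rho kap by (simp add: r_def)
 \<comment> \<open>Three constraints: \<sigma> \<le> \<sigma>0 for the A_inf property of the product
   weight, \<sigma> < 1 so that s = 1 - \<sigma> is positive, and r \<sigma> \<le> 1/2 for the
   summation of the layers of k.\<close>
 define \<sigma> where "\<sigma> = min (min \<sigma>0 (1/2)) (1 / (2 * r))"
 have sig: "0 < \<sigma>" "\<sigma> < 1" "\<sigma> <= \<sigma>0" "\<sigma> <= 1 / (2 * r)" using sig0 r by (auto simp: \<sigma>_def)
 have rsig: "r * \<sigma> < 1" using sig(4) r by (simp add: field_simps)
 define s where "s = 1 - \<sigma>"
 have s: "0 < s" "s < 1" using sig by (auto simp: s_def)
 define c0 where "c0 = A' powr \<theta>"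
 have c0: "c0 > 0" using A' by (simp add: c0_def)
 define W where "W = max 1 (kolW c0 Dr r \<sigma>)"
 have W: "W >= 1" "kolW c0 Dr r \<sigma> <= W" by (auto simp: W_def)
 have C5': "C5 > 0" using C5 by simp
 obtain D6 where D6: "D6 > 0" and ext: "\<forall>(a :: real ^ 'n => real) F G. wt a --> ainf C5 d5 (\<lambda>_. 1) a -->
  lmeas F --> (\<forall>x. 0 <= F x) --> lmeas G --> (\<forall>x. 0 <= G x) -->
  (\<integral>\<^sup>+x. ennreal (F x powr s) \<partial>mw a) < \<infinity> --> (\<integral>\<^sup>+x. ennreal (G x powr s) \<partial>mw a) < \<infinity> -->
  (\<forall>w. Ainf w --> (\<integral>\<^sup>+x. ennreal (F x powr p0 * w x) \<partial>lebesgue) < \<infinity> -->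
   (\<integral>\<^sup>+x. ennreal (F x powr p0 * w x) \<partial>lebesgue) <= ennreal (c (Ainf_const w)) * (\<integral>\<^sup>+x. ennreal (G x powr p0 * w x) \<partial>lebesgue)) -->
  (\<integral>\<^sup>+x. ennreal (F x powr s) \<partial>mw a) <= ennreal D6 * (\<integral>\<^sup>+x. ennreal (G x powr s) \<partial>mw a)"
  using extrapolation[OF p0 s(1) C5' C5(2), where 'n = 'n] by blast
 define D where "D = (D6 * W) powr (1 / s) * Dm"
 have D: "D > 0" using D6 W Dm by (simp add: D_def)
 have main: "ennreal t * emeasure (mw (\<lambda>x. u x * v x)) {x. t * v x < F x} <= ennreal D * (\<integral>\<^sup>+x. ennreal (\<phi> x * v x * u x) \<partial>lebesgue)"
  if u: "A1w A u" and v: "wt v" "fw b v" and F[measurable]: "lmeas F" and F0: "\<And>x. 0 <= F x"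
   and \<phi>[measurable]: "lmeas \<phi>" and \<phi>0: "\<And>x. 0 <= \<phi> x"
   and hyp: "\<And>w. Ainf w ==> (\<integral>\<^sup>+x. ennreal (F x powr p0 * w x) \<partial>lebesgue) < \<infinity> ==>
    (\<integral>\<^sup>+x. ennreal (F x powr p0 * w x) \<partial>lebesgue) <= ennreal (c (Ainf_const w)) *
    (\<integral>\<^sup>+x. ennreal_powr (HL (\<lambda>y. ennreal (\<phi> y * v y)) x) p0 * ennreal (w x) \<partial>lebesgue)"
   and Lf: "L < \<infinity>" and weak: "\<And>t. t > 0 ==> ennreal t * emeasure (mw (\<lambda>x. u x * v x)) {x. t * v x < F x} <= L" and t: "t > 0"
  for u v F \<phi> :: "real ^ 'n => real" and L t
 proof -
  define \<mu> where "\<mu> = mw (\<lambda>x. u x * v x)"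
  have [simp, measurable_cong]: "sets \<mu> = sets lebesgue" and [simp]: "space \<mu> = UNIV" by (simp_all add: \<mu>_def)
  have wu: "wt u" using u by (simp add: A1w_def)
  have um[measurable]: "lmeas u" and u0: "\<And>x. 0 <= u x" using wtD wu by auto
  have vm[measurable]: "lmeas v" and v0: "\<And>x. 0 <= v x" using wtD v by auto
  define u' where "u' x = u x powr \<rho>" for x
  have u'm[measurable]: "lmeas u'" unfolding u'_def[abs_def] by measurable
  have u'th: "u' x powr \<theta> = u x" for x using th u0[of x] by (simp add: u'_def powr_powr)
  have cv': "ainf Cv dv v (\<lambda>_. 1)" "dbl K v" using cv v by blast+
  have av: "ainf C d v (\<lambda>_. 1)" by (rule ainf_mono[OF v(1) cv'(1) Cd(5,7,2) Cuv(2)])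
  have cu': "ainf Cu du (\<lambda>_. 1) u" "A1w A' u'" "ainf Cu du (\<lambda>_. 1) u'" using cu u unfolding u'_def[abs_def] by blast+
  have au: "ainf C d (\<lambda>_. 1) u" "ainf C d (\<lambda>_. 1) u'"
   using ainf_mono[OF wt_one cu'(1) Cd(4,6,2) Cuv(1)] ainf_mono[OF wt_one cu'(3) Cd(4,6,2) Cuv(1)] by auto
  have upos: "AE x in lebesgue. 0 < u x" by (rule A1w_pos[OF u A0])
  have vpos: "AE x in lebesgue. 0 < v x" by (rule ainf_imp_pos[OF v(1) av])
  have \<mu>0: "emeasure lebesgue E = 0" if E: "E \<in> sets lebesgue" "emeasure \<mu> E = 0" for E
  proof -
   have "(\<integral>\<^sup>+x\<in>E. ennreal (u x * v x) \<partial>lebesgue) = 0" using E by (simp add: \<mu>_def emeasure_mw)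
   then have "AE x in lebesgue. ennreal (u x * v x) * indicator E x = 0" using E by (subst (asm) nn_integral_0_iff_AE) auto
   then have "AE x in lebesgue. x \<notin> E"
    using upos vpos
   proof eventually_elim
    fix x assume "ennreal (u x * v x) * indicator E x = 0" "0 < u x" "0 < v x"
    moreover then have "u x * v x > 0" by simp
    ultimately show "x \<notin> E" by (auto simp: indicator_def split: if_splits)
   qed
   then show ?thesis using E by (subst (asm) AE_iff_measurable[OF _ refl]) auto
  qed
  define E where "E = {x. t * v x < F x}"
  have Es[measurable]: "E \<in> sets lebesgue" unfolding E_def by (intro lebesgue_Collect) measurable
  have "emeasure \<mu> E \<noteq> \<infinity>"
   using weak[OF t] Lf t unfolding \<mu>_def[symmetric] E_def[symmetric] by (auto simp: ennreal_mult_top top_unique)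
  then obtain m where m: "emeasure \<mu> E = ennreal m" "m >= 0" by (cases "emeasure \<mu> E") auto
  let ?I = "\<integral>\<^sup>+x. ennreal (\<phi> x * v x * u x) \<partial>lebesgue"
  show ?thesis
  proof (cases "m = 0 \<or> ?I = \<infinity>")
   case True
   then show ?thesis using m D unfolding \<mu>_def[symmetric] E_def[symmetric] by (auto simp: ennreal_mult_top)
  next
   case False
   then have mp: "m > 0" using m by simp
   obtain N where N: "?I = ennreal N" "N >= 0" using False by (cases ?I) auto
   obtain l where l: "L = ennreal l" "l >= 0" using Lf by (cases L) auto
   define g where "g y = ennreal (u' y) * indicator E y" for y
   have gm[measurable]: "lmeas g" unfolding g_def[abs_def] by measurable
   let ?M = "HL g"
   have Mm[measurable]: "?M \<in> borel_measurable lebesgue" by (rule Mx_measurable[OF wt_one])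
   have pos: "0 < ?M x" for x
   proof (rule Mx_pos[OF wt_one gm], unfold mw_one, rule notI)
    assume "AE x in lebesgue. g x = 0"
    then have "AE x in lebesgue. x \<notin> E" using upos by eventually_elim (auto simp: g_def u'_def indicator_def split: if_splits)
    then have "E \<in> null_sets lebesgue" using Es by (subst (asm) AE_iff_measurable[OF _ refl]) auto
    then have "emeasure \<mu> E = 0" using mw_ac[of "\<lambda>x. u x * v x"] unfolding absolutely_continuous_def \<mu>_def by auto
    then show False using mp m by simp
   qed
   have up: "AE x in lebesgue. ?M x <= ennreal (A' * u' x)"
    using cu'(2) unfolding A1w_def
   proof (elim conjE eventually_mono)
    fix x assume x: "HL (\<lambda>y. ennreal (u' y)) x <= ennreal (A' * u' x)"
    have "?M x <= HL (\<lambda>y. ennreal (u' y)) x" by (intro Mx_mono_AE AE_I2) (simp add: g_def indicator_def)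
    then show "?M x <= ennreal (A' * u' x)" using x by simp
   qed
   have fin: "AE x in lebesgue. ?M x < top" using up by eventually_elim (simp add: order_le_less_trans)
   define \<beta> where "\<beta> x = enn2real (?M x)" for x
   have bm[measurable]: "lmeas \<beta>" unfolding \<beta>_def[abs_def] by measurable
   have b0: "\<beta> x >= 0" for x by (simp add: \<beta>_def)
   have low: "AE x in lebesgue. x \<in> E --> u x <= \<beta> x powr \<theta>"
    using fin Mx_ge_AE[OF wt_one gm, unfolded mw_one]
   proof eventually_elim
    fix x assume x: "?M x < top" "g x <= ?M x"
    then have M: "?M x = ennreal (\<beta> x)" by (simp add: \<beta>_def)
    show "x \<in> E --> u x <= \<beta> x powr \<theta>"
    proof
     assume "x \<in> E"
     then have "u' x <= \<beta> x" using x(2) b0[of x] unfolding M by (simp add: g_def)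
     then have "u' x powr \<theta> <= \<beta> x powr \<theta>" using th by (intro powr_mono2) (auto simp: u'_def)
     then show "u x <= \<beta> x powr \<theta>" by (simp add: u'th)
    qed
   qed
   define a where "a x = \<beta> x powr \<theta> * v x powr \<sigma>" for x
   have a: "wt a" "ainf C5 d5 (\<lambda>_. 1) a"
    using prod[rule_format, OF sig(1,3) v(1) av gm pos fin] unfolding a_def[abs_def] \<beta>_def by simp_all
   have am[measurable]: "lmeas a" using wtD a by auto
   define k where "k x = \<beta> x powr \<theta> / u x" for x
   have km[measurable]: "lmeas k" unfolding k_def[abs_def] by measurable
   have uvm: "(\<lambda>x. u x * v x) \<in> borel_measurable lebesgue" by measurable
   have k1: "AE x in \<mu>. 0 <= k x \<and> k x <= c0"
    unfolding \<mu>_def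
   proof (rule AE_mw[OF uvm], use up fin upos in eventually_elim)
    fix x assume x: "?M x <= ennreal (A' * u' x)" "?M x < top" "0 < u x"
    then have M: "?M x = ennreal (\<beta> x)" by (simp add: \<beta>_def)
    have "\<beta> x <= A' * u' x" using x(1) A' unfolding M by (subst (asm) ennreal_le_iff) (auto simp: u'_def)
    then have "\<beta> x powr \<theta> <= (A' * u' x) powr \<theta>" using th b0 by (intro powr_mono2) auto
    also have "... = c0 * u x" using A' by (simp add: powr_mult u'th c0_def)
    finally show "0 <= k x \<and> k x <= c0" using x(3) by (simp add: k_def field_simps)
   qed
   have k2: "emeasure \<mu> {x \<in> space \<mu>. l < k x} <= ennreal (Dr * l powr (- r) * m)" if l: "l > 0" for l
   proof -
    have \<mu>eq: "mw (\<lambda>x. u' x powr \<theta> * v x) = \<mu>" by (simp add: \<mu>_def u'th)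
    have geq: "(\<lambda>y. ennreal (u' y) * indicator E y) = g" by (simp add: g_def fun_eq_iff)
    have "{x \<in> space \<mu>. l < k x} \<subseteq> {x. ennreal (l powr \<rho> * u' x) < ?M x}"
    proof
     fix x assume "x \<in> {x \<in> space \<mu>. l < k x}"
     then have x: "l < \<beta> x powr \<theta> / u x" by (simp add: k_def)
     then have ux: "u x > 0" using l u0[of x] by (cases "u x = 0") auto
     then have "l * u x < \<beta> x powr \<theta>" using x by (simp add: field_simps)
     then have "(l * u x) powr \<rho> < (\<beta> x powr \<theta>) powr \<rho>" using l ux rho by (intro powr_less_mono2) auto
     then have "l powr \<rho> * u' x < \<beta> x" using l ux th b0[of x] by (simp add: powr_mult u'_def powr_powr mult.commute)
     then have "ennreal (l powr \<rho> * u' x) < ennreal (\<beta> x)" by (subst ennreal_less_iff) (auto simp: u'_def)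
     also have "... <= ?M x" by (simp add: \<beta>_def ennreal_enn2real_if)
     finally show "x \<in> {x. ennreal (l powr \<rho> * u' x) < ?M x}"
      by simp
    qed
    moreover have "{x. ennreal (l powr \<rho> * u' x) < ?M x} \<in> sets \<mu>"
     unfolding \<mu>_def sets_mw by (intro lebesgue_Collect) measurable
    ultimately have "emeasure \<mu> {x \<in> space \<mu>. l < k x} <= emeasure \<mu> {x. ennreal (l powr \<rho> * u' x) < ?M x}"
     by (rule emeasure_mono)
    also have "... <= ennreal (Dr * (l powr \<rho>) powr (- \<kappa>)) * emeasure \<mu> E"
     using decay[rule_format, OF cu'(2) au(2) v(1) av cv'(2) Es, of "l powr \<rho>"] l unfolding \<mu>eq geq by simp
    also have "... = ennreal (Dr * l powr (- r) * m)"
     unfolding m using Dr m(2) by (simp add: powr_powr r_def flip: ennreal_mult)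
    finally show ?thesis .
   qed
   \<comment> \<open>Used for two functions: for F with the a priori bound, where only the resulting
     finiteness counts, and for the maximal function with the mixed weak-type bound, whose constant
     survives.\<close>
   have conv: "(\<integral>\<^sup>+x. ennreal (H x powr s) \<partial>mw a) <= ennreal (W * m powr \<sigma> * l powr s)"
    if H[measurable]: "lmeas H" and H0: "\<And>x. 0 <= H x" and l: "l >= 0"
     and wk: "\<And>t. t > 0 ==> ennreal t * emeasure \<mu> {x. t * v x < H x} <= ennreal l" for H l
   proof -
    have "(\<integral>\<^sup>+x. ennreal (H x powr s) \<partial>mw a) = (\<integral>\<^sup>+x. ennreal (a x) * ennreal (H x powr s) \<partial>lebesgue)"
     by (rule nn_integral_mw) measurable
    also have "... = (\<integral>\<^sup>+x. ennreal (u x * v x) * (ennreal_powr (ennreal (H x / v x)) (1 - \<sigma>) * ennreal (k x)) \<partial>lebesgue)"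
    proof (rule nn_integral_cong_AE, use upos vpos in eventually_elim)
     fix x assume x: "0 < u x" "0 < v x"
     have "v x powr 1 = v x powr \<sigma> * v x powr s" by (simp only: s_def flip: powr_add) simp
     then have "v x powr \<sigma> = v x / v x powr s" using x by (simp add: field_simps)
     then have "a x * H x powr s = u x * v x * ((H x / v x) powr s * k x)"
      using x H0 by (simp add: a_def k_def powr_divide)
     then show "ennreal (a x) * ennreal (H x powr s) = ennreal (u x * v x) * (ennreal_powr (ennreal (H x / v x)) (1 - \<sigma>) * ennreal (k x))"
      using x H0[of x] wtD(2)[OF a(1), of x] by (simp add: ennreal_powr_ennreal s_def k_def flip: ennreal_mult)
    qed
    also have "... = (\<integral>\<^sup>+x. ennreal_powr (ennreal (H x / v x)) (1 - \<sigma>) * ennreal (k x) \<partial>\<mu>)"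
     unfolding \<mu>_def by (rule nn_integral_mw[symmetric]) measurable
    also have "... <= ennreal (kolW c0 Dr r \<sigma> * m powr \<sigma> * l powr (1 - \<sigma>))"
    proof (rule kolmogorov_weighted[OF sig(1,2) rsig c0 _ m(2) l _ _ k1 k2])
     fix t :: real assume t: "t > 0"
     have "{x \<in> space \<mu>. ennreal t < ennreal (H x / v x)} \<subseteq> {x. t * v x < H x}"
     proof
      fix x assume "x \<in> {x \<in> space \<mu>. ennreal t < ennreal (H x / v x)}"
      then have x: "t < H x / v x" using t by (simp add: ennreal_less_iff)
      then have "v x > 0" using t v0[of x] by (cases "v x = 0") auto
      then show "x \<in> {x. t * v x < H x}" using x by (simp add: field_simps)
     qed
     then have "ennreal t * emeasure \<mu> {x \<in> space \<mu>. ennreal t < ennreal (H x / v x)} <= ennreal t * emeasure \<mu> {x. t * v x < H x}"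
      by (intro mult_left_mono emeasure_mono) (auto intro!: lebesgue_Collect)
     then show "ennreal t * emeasure \<mu> {x \<in> space \<mu>. ennreal t < ennreal (H x / v x)} <= ennreal l" using wk[OF t] by simp
    qed (use Dr in auto)
    also have "... <= ennreal (W * m powr \<sigma> * l powr s)"
     using W by (intro ennreal_leI) (auto simp: s_def intro!: mult_right_mono)
    finally show ?thesis .
   qed
   have Fs: "(\<integral>\<^sup>+x. ennreal (F x powr s) \<partial>mw a) <= ennreal (W * m powr \<sigma> * l powr s)"
    using weak unfolding l \<mu>_def[symmetric] by (intro conv F F0 l)
   let ?G = "HL (\<lambda>y. ennreal (\<phi> y * v y))"
   have Gm[measurable]: "?G \<in> borel_measurable lebesgue" by (rule Mx_measurable[OF wt_one])
   have mixG: "ennreal t * emeasure \<mu> {x. ennreal (t * v x) < ?G x} <= ennreal (Dm * N)" if "t > 0" for t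
    using mix[rule_format, OF u au(1) v(1) av, of "\<lambda>y. \<phi> y * v y" t] that \<phi>0 v0 Dm N
    unfolding \<mu>_def by (simp add: ennreal_mult)
   \<comment> \<open>The weak-type bound at all heights makes the set of infinite values null for
     uv, hence for Lebesgue measure; the maximal function can then be replaced by a real-valued
     G.\<close>
   have Gfin: "AE x in lebesgue. ?G x < top"
   proof -
    define P where "P = {x. ?G x = top}"
    have P: "P \<in> sets lebesgue" unfolding P_def by (intro lebesgue_Collect) measurable
    have le: "ennreal t * emeasure \<mu> P <= ennreal (Dm * N)" if "t > 0" for t
    proof -
     have "emeasure \<mu> P <= emeasure \<mu> {x. ennreal (t * v x) < ?G x}"
      by (intro emeasure_mono) (auto simp: P_def intro!: lebesgue_Collect)
     then show ?thesis using mixG[OF that] by (meson mult_left_mono order_trans zero_le)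
    qed
    have "emeasure \<mu> P = 0"
    proof (cases "emeasure \<mu> P")
     case (real z)
     show ?thesis
     proof (rule ccontr)
      assume "emeasure \<mu> P \<noteq> 0"
      then have z: "z > 0" using real by auto
      have DN: "Dm * N >= 0" using Dm N by simp
      have "ennreal ((Dm * N + 1) / z) * ennreal z <= ennreal (Dm * N)" using le[of "(Dm * N + 1) / z"] z DN real by simp
      then show False using z DN by (simp add: ennreal_le_iff flip: ennreal_mult)
     qed
    next
     case top
     then show ?thesis using le[of 1] by (simp add: top_unique)
    qed
    then have "P \<in> null_sets lebesgue" using \<mu>0[OF P] P by (simp add: null_sets_def)
    then show ?thesis by (rule AE_I') (auto simp: P_def simp flip: top.not_eq_extremum)
   qed
   define G where "G x = enn2real (?G x)" for x
   have GM[measurable]: "lmeas G" unfolding G_def[abs_def] by measurable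
   have G0: "G x >= 0" for x by (simp add: G_def)
   have Gs: "(\<integral>\<^sup>+x. ennreal (G x powr s) \<partial>mw a) <= ennreal (W * m powr \<sigma> * (Dm * N) powr s)"
   proof (rule conv[OF GM G0])
    show "Dm * N >= 0" using Dm N by simp
    fix t :: real assume t: "t > 0"
    have "{x. t * v x < G x} \<subseteq> {x. ennreal (t * v x) < ?G x}"
    proof
     fix x assume "x \<in> {x. t * v x < G x}"
     then have "ennreal (t * v x) < ennreal (G x)" using t v0[of x] by (simp add: ennreal_less_iff)
     also have "... <= ?G x" by (simp add: G_def ennreal_enn2real_if)
     finally show "x \<in> {x. ennreal (t * v x) < ?G x}" by simp
    qed
    then have "ennreal t * emeasure \<mu> {x. t * v x < G x} <= ennreal t * emeasure \<mu> {x. ennreal (t * v x) < ?G x}"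
     by (intro mult_left_mono emeasure_mono) (auto intro!: lebesgue_Collect)
    then show "ennreal t * emeasure \<mu> {x. t * v x < G x} <= ennreal (Dm * N)" using mixG[OF t] by simp
   qed
   have hyp': "(\<integral>\<^sup>+x. ennreal (F x powr p0 * w x) \<partial>lebesgue) <= ennreal (c (Ainf_const w)) * (\<integral>\<^sup>+x. ennreal (G x powr p0 * w x) \<partial>lebesgue)"
    if w: "Ainf w" "(\<integral>\<^sup>+x. ennreal (F x powr p0 * w x) \<partial>lebesgue) < \<infinity>" for w
   proof -
    have w0: "0 <= w x" for x using w(1) by (auto simp: Ainf_def Ap_def weight_def)
    have "(\<integral>\<^sup>+x. ennreal_powr (?G x) p0 * ennreal (w x) \<partial>lebesgue) = (\<integral>\<^sup>+x. ennreal (G x powr p0 * w x) \<partial>lebesgue)"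
    proof (rule nn_integral_cong_AE, use Gfin in eventually_elim)
     fix x assume "?G x < top"
     then show "ennreal_powr (?G x) p0 * ennreal (w x) = ennreal (G x powr p0 * w x)"
      using w0[of x] by (simp add: ennreal_powr_def G_def less_top flip: ennreal_mult)
    qed
    then show ?thesis using hyp[OF w] by simp
   qed
   have "(\<integral>\<^sup>+x. ennreal (F x powr s) \<partial>mw a) <= ennreal D6 * (\<integral>\<^sup>+x. ennreal (G x powr s) \<partial>mw a)"
    using order_le_less_trans[OF Fs ennreal_less_top] order_le_less_trans[OF Gs ennreal_less_top] hyp'
    by (intro ext[rule_format] a F F0 GM G0) auto
   also have "... <= ennreal D6 * ennreal (W * m powr \<sigma> * (Dm * N) powr s)" by (intro mult_left_mono Gs) auto
   also have "... = ennreal (D6 * W * m powr \<sigma> * (Dm * N) powr s)" using D6 W by (simp add: mult.assoc flip: ennreal_mult)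
   finally have upF: "(\<integral>\<^sup>+x. ennreal (F x powr s) \<partial>mw a) <= ennreal (D6 * W * m powr \<sigma> * (Dm * N) powr s)" .
   have "ennreal (t powr s * m) = ennreal (t powr s) * (\<integral>\<^sup>+x\<in>E. ennreal (u x * v x) \<partial>lebesgue)"
    using m by (simp add: ennreal_mult \<mu>_def emeasure_mw)
   also have "... = (\<integral>\<^sup>+x. ennreal (t powr s) * (ennreal (u x * v x) * indicator E x) \<partial>lebesgue)"
    by (rule nn_integral_cmult[symmetric]) measurable
   also have "... <= (\<integral>\<^sup>+x. ennreal (a x) * ennreal (F x powr s) \<partial>lebesgue)"
   proof (rule nn_integral_mono_AE, use low in eventually_elim)
    fix x assume x: "x \<in> E --> u x <= \<beta> x powr \<theta>"
    show "ennreal (t powr s) * (ennreal (u x * v x) * indicator E x) <= ennreal (a x) * ennreal (F x powr s)"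
    proof (cases "x \<in> E")
     case True
     have "(t * v x) powr s <= F x powr s" using True t v0[of x] s by (intro powr_mono2) (auto simp: E_def)
     then have "u x * (v x powr \<sigma> * (t * v x) powr s) <= \<beta> x powr \<theta> * (v x powr \<sigma> * F x powr s)"
      using x True u0 by (intro mult_mono) auto
     moreover have "v x powr \<sigma> * (t * v x) powr s = t powr s * v x"
      using t v0[of x] by (simp add: powr_mult s_def mult.left_commute flip: powr_add)
     ultimately have "t powr s * (u x * v x) <= a x * F x powr s" by (simp add: a_def mult_ac)
     then show ?thesis using True u0 v0 wtD(2)[OF a(1), of x] by (simp add: ennreal_leI flip: ennreal_mult)
    qed simp
   qed
   also have "... = (\<integral>\<^sup>+x. ennreal (F x powr s) \<partial>mw a)" by (rule nn_integral_mw[symmetric]) measurable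
   also note upF
   finally have "t powr s * m <= D6 * W * m powr \<sigma> * (Dm * N) powr s"
    using D6 W by (subst (asm) ennreal_le_iff) auto
   \<comment> \<open>Splits off the factor \<open>m powr \<sigma>\<close> common to both sides; it
     may be cancelled because m is positive and finite.\<close>
   moreover have "m powr \<sigma> * m powr s = m" using mp by (simp add: s_def flip: powr_add)
   then have "m powr \<sigma> * (t powr s * m powr s) = t powr s * m" by (metis mult.left_commute)
   ultimately have "m powr \<sigma> * (t powr s * m powr s) <= D6 * W * m powr \<sigma> * (Dm * N) powr s" by linarith
   then have "m powr \<sigma> * (t powr s * m powr s) <= m powr \<sigma> * (D6 * W * (Dm * N) powr s)" by (simp only: mult_ac)
   then have "t powr s * m powr s <= D6 * W * (Dm * N) powr s" using mp by (subst (asm) mult_le_cancel_left_pos) auto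
   then have "(t * m) powr s <= D6 * W * (Dm * N) powr s" using t mp by (simp add: powr_mult)
   then have "((t * m) powr s) powr (1 / s) <= (D6 * W * (Dm * N) powr s) powr (1 / s)" using s by (intro powr_mono2) auto
   also have "((t * m) powr s) powr (1 / s) = t * m" using s t mp by (simp add: powr_powr)
   also have "(D6 * W * (Dm * N) powr s) powr (1 / s) = D * N"
    using D6 W Dm N s by (simp add: powr_mult[of "D6 * W"] powr_powr D_def)
   finally have "ennreal (t * m) <= ennreal (D * N)" by (rule ennreal_leI)
   then show ?thesis
    unfolding \<mu>_def[symmetric] E_def[symmetric] m N using t mp D N by (simp add: ennreal_mult)
  qed
 qed
 show ?thesis using D main by blast
qed

theorem corollary1p7:
  fixes p0 :: real and C :: "ennreal \<Rightarrow> real"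
  assumes "0 < p0"
  shows "\<exists>D :: ennreal \<Rightarrow> ennreal \<Rightarrow> real.
    \<forall>T :: (real ^ 'n \<Rightarrow> complex) \<Rightarrow> (real ^ 'n \<Rightarrow> complex).
      (\<forall>f \<in> borel_measurable lebesgue. T f \<in> borel_measurable lebesgue) \<longrightarrow>
      (\<forall>w. Ainf w \<longrightarrow>
        (\<forall>f \<in> borel_measurable lebesgue.
          (\<integral>\<^sup>+x. ennreal (norm (T f x) powr p0 * w x) \<partial>lebesgue) < top \<longrightarrow>
          (\<integral>\<^sup>+x. ennreal (norm (T f x) powr p0 * w x) \<partial>lebesgue)
            \<le> ennreal (C (Ainf_const w))
              * (\<integral>\<^sup>+x. ennreal_powr (maximal_fun f x) p0 * ennreal (w x) \<partial>lebesgue))) \<longrightarrow>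
      (\<forall>u v. A1 u \<and> Ainf v \<longrightarrow>
        (\<forall>f \<in> borel_measurable lebesgue.
          weak_L1_norm (uv_measure u v) (\<lambda>x. T (\<lambda>y. f y * complex_of_real (v y)) x
              / complex_of_real (v x)) < top \<longrightarrow>
          weak_L1_norm (uv_measure u v) (\<lambda>x. T (\<lambda>y. f y * complex_of_real (v y)) x
              / complex_of_real (v x))
            \<le> ennreal (D (A1_const u) (Ainf_const v)) * L1_norm (uv_measure u v) f))"
proof -
 \<comment> \<open>Collects the conclusion for fixed values of the two constants, so that a choice
   yields D as a function of them alone. The maximum with 1 meets the normalization A >= 1.\<close>
 define \<Phi> where "\<Phi> D \<alpha> \<beta> \<longleftrightarrow> (\<forall>(u :: real ^ 'n => real) v F \<phi> L t. A1w (max 1 (enn2real \<alpha>)) u --> wt v --> fw (enn2real \<beta>) v -->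
  lmeas F --> (\<forall>x. 0 <= F x) --> lmeas \<phi> --> (\<forall>x. 0 <= \<phi> x) -->
  (\<forall>w. Ainf w --> (\<integral>\<^sup>+x. ennreal (F x powr p0 * w x) \<partial>lebesgue) < \<infinity> -->
   (\<integral>\<^sup>+x. ennreal (F x powr p0 * w x) \<partial>lebesgue) <= ennreal (C (Ainf_const w)) *
    (\<integral>\<^sup>+x. ennreal_powr (HL (\<lambda>y. ennreal (\<phi> y * v y)) x) p0 * ennreal (w x) \<partial>lebesgue)) -->
  L < \<infinity> --> (\<forall>t>0. ennreal t * emeasure (mw (\<lambda>x. u x * v x)) {x. t * v x < F x} <= L) --> t > 0 -->
  ennreal t * emeasure (mw (\<lambda>x. u x * v x)) {x. t * v x < F x} <= ennreal D * (\<integral>\<^sup>+x. ennreal (\<phi> x * v x * u x) \<partial>lebesgue))"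
  for D :: real and \<alpha> \<beta> :: ennreal
 have "\<exists>D. \<Phi> D \<alpha> \<beta>" for \<alpha> \<beta>
  using weak_type_extrapolation[OF assms, of "max 1 (enn2real \<alpha>)" "enn2real \<beta>" C, where 'n = 'n] unfolding \<Phi>_def by auto
 then obtain D where D: "\<Phi> (D \<alpha> \<beta>) \<alpha> \<beta>" for \<alpha> \<beta> by metis
 show ?thesis
 proof (intro exI[of _ D] allI impI ballI, elim conjE)
  fix T :: "(real ^ 'n => complex) => (real ^ 'n => complex)" and u v f
  assume Tm: "\<forall>f \<in> borel_measurable lebesgue. T f \<in> borel_measurable lebesgue"
   and hyp: "\<forall>w. Ainf w --> (\<forall>f \<in> borel_measurable lebesgue.
     (\<integral>\<^sup>+x. ennreal (norm (T f x) powr p0 * w x) \<partial>lebesgue) < top -->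
     (\<integral>\<^sup>+x. ennreal (norm (T f x) powr p0 * w x) \<partial>lebesgue)
      <= ennreal (C (Ainf_const w)) * (\<integral>\<^sup>+x. ennreal_powr (maximal_fun f x) p0 * ennreal (w x) \<partial>lebesgue))"
   and f[measurable]: "lmeas f"
   and fin: "weak_L1_norm (uv_measure u v) (\<lambda>x. T (\<lambda>y. f y * complex_of_real (v y)) x / complex_of_real (v x)) < top"
   and u: "A1 u" and v: "Ainf v"
  obtain A where A: "A >= 0" "A1_const u = ennreal A" "A1w A u" using A1_imp_A1w[OF u] by blast
  obtain b where b: "b >= 0" "Ainf_const v = ennreal b" "wt v" "fw b v" using Ainf_const_finite[OF v] by blast
  have Au: "A1w (max 1 (enn2real (A1_const u))) u" using A by (auto intro: A1w_mono)
  have bv: "fw (enn2real (Ainf_const v)) v" using b by simp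
  have um[measurable]: "lmeas u" and u0: "\<And>x. 0 <= u x" using wtD A(3) by (auto simp: A1w_def)
  have vm[measurable]: "lmeas v" and v0: "\<And>x. 0 <= v x" using wtD b(3) by auto
  define h where "h y = f y * complex_of_real (v y)" for y
  have hm[measurable]: "lmeas h" unfolding h_def[abs_def] by measurable
  have Th[measurable]: "T h \<in> borel_measurable lebesgue" using Tm hm by blast
  define \<mu> where "\<mu> = uv_measure u v"
  have \<mu>: "\<mu> = mw (\<lambda>x. u x * v x)" by (simp add: \<mu>_def uv_measure_def mw_def)
  have sp[simp]: "space \<mu> = UNIV" "sets \<mu> = sets lebesgue" by (simp_all add: \<mu>)
  define N where "N = weak_L1_norm \<mu> (\<lambda>x. T h x / complex_of_real (v x))"
  have Nf: "N < \<infinity>" using fin by (simp add: N_def \<mu>_def h_def[abs_def])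
  \<comment> \<open>Division by zero yields 0, so the two sets can differ only where v vanishes,
    which is a null set.\<close>
  have set_eq: "emeasure \<mu> {x \<in> space \<mu>. t < norm (T h x / complex_of_real (v x))} = emeasure \<mu> {x. t * v x < norm (T h x)}" if t: "t > 0" for t
  proof (rule emeasure_eq_AE)
   have "AE x in lebesgue. 0 < v x" using weight_imp_wt(2) v by (auto simp: Ainf_def Ap_def)
   then have "AE x in \<mu>. 0 < v x" unfolding \<mu> by (rule AE_mw[rotated]) measurable
   then show "AE x in \<mu>. (x \<in> {x \<in> space \<mu>. t < norm (T h x / complex_of_real (v x))}) = (x \<in> {x. t * v x < norm (T h x)})"
    by eventually_elim (simp add: norm_divide field_simps)
  qed (auto intro!: lebesgue_Collect)
  have weak: "ennreal t * emeasure \<mu> {x. t * v x < norm (T h x)} <= N" if "t > 0" for t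
   unfolding N_def weak_L1_norm_def set_eq[OF that, symmetric] using that by (intro SUP_upper) simp
  have hyp': "(\<integral>\<^sup>+x. ennreal (norm (T h x) powr p0 * w x) \<partial>lebesgue) <= ennreal (C (Ainf_const w)) *
    (\<integral>\<^sup>+x. ennreal_powr (HL (\<lambda>y. ennreal (norm (f y) * v y)) x) p0 * ennreal (w x) \<partial>lebesgue)"
   if "Ainf w" "(\<integral>\<^sup>+x. ennreal (norm (T h x) powr p0 * w x) \<partial>lebesgue) < \<infinity>" for w
   using hyp[rule_format, OF that(1) hm] that(2) v0 by (simp add: maximal_fun_eq_Mx h_def norm_mult)
  have "ennreal t * emeasure \<mu> {x. t * v x < norm (T h x)} \<le>
    ennreal (D (A1_const u) (Ainf_const v)) * (\<integral>\<^sup>+x. ennreal (norm (f x) * v x * u x) \<partial>lebesgue)" if t: "t > 0" for t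
   using D[unfolded \<Phi>_def, rule_format, OF Au b(3) bv _ _ _ _ _ Nf _ t, of "\<lambda>x. norm (T h x)" "\<lambda>x. norm (f x)"] weak hyp'
   unfolding \<mu> by simp
  moreover have "(\<integral>\<^sup>+x. ennreal (norm (f x) * v x * u x) \<partial>lebesgue) = L1_norm \<mu> f"
   unfolding L1_norm_def \<mu> using u0 v0
   by (subst nn_integral_mw) (auto intro!: nn_integral_cong simp: mult_ac simp flip: ennreal_mult)
  ultimately have "N <= ennreal (D (A1_const u) (Ainf_const v)) * L1_norm \<mu> f"
   unfolding N_def weak_L1_norm_def using set_eq by (intro SUP_least) simp
  then show "weak_L1_norm (uv_measure u v) (\<lambda>x. T (\<lambda>y. f y * complex_of_real (v y)) x / complex_of_real (v x))
    <= ennreal (D (A1_const u) (Ainf_const v)) * L1_norm (uv_measure u v) f"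
   unfolding N_def \<mu>_def h_def[abs_def] .
 qed
qed

end
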